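(* Let $T:\mathbb{S}^1\to\mathbb{S}^1$ be a $\mathcal{C}^\infty$ expanding map of the circle, with transfer operator $\mathcal{L}$ and dynamical determinant $d$. Then there exist a Hilbert space $\mathcal{H}$, continuously contained in $\mathcal{C}^\infty(\mathbb{S}^1)$ and containing the trigonometric polynomials as a dense subspace, on which $\mathcal{L}$ defines a compact operator from $\mathcal{H}$ to itself, and two compact operators $\mathcal{L}_c$ and $\mathcal{L}_b$ from $\mathcal{H}$ to itself such that: (i) $\mathcal{L}_c$ is nuclear of order $0$; (ii) the spectral radius of $\mathcal{L}_b$ is $0$; (iii) $\mathcal{L}=\mathcal{L}_b+\mathcal{L}_c$ on $\mathcal{H}$; (iv) $d$ extends to an entire function, still denoted $d$, and for all $z\in\mathbb{C}$ $$d(z)=\det\big(I-z(I-z\mathcal{L}_b)^{-1}\mathcal{L}_c\big).$$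
   Context: $\mathbb{S}^1=\mathbb{R}/\mathbb{Z}$, and $T':\mathbb{S}^1\to\mathbb{R}$ is taken with respect to the usual parallelization. $T$ is expanding if there is $\lambda>1$ with $|T'(x)|\ge\lambda$ for all $x\in\mathbb{S}^1$. The transfer operator is $\mathcal{L}\varphi(x)=\sum_{y:\,Ty=x}\frac{1}{|T'(y)|}\varphi(y)$. For $n\ge1$ set $\mathrm{tr}^\flat(\mathcal{L}^n)=\sum_{x:\,T^nx=x}\frac{1}{|1-(T^n)'(x)|}$. The dynamical determinant is defined for $|z|$ small by $d(z)=\exp\big(-\sum_{n=1}^{+\infty}\frac1n\mathrm{tr}^\flat(\mathcal{L}^n)z^n\big)$, and $d$ also denotes its entire continuation. "$\mathcal{H}$ is continuously contained in $\mathcal{C}^\infty(\mathbb{S}^1)$" means that $\mathcal{H}$ is a linear subspace with continuous inclusion (usual Fréchet topology on $\mathcal{C}^\infty(\mathbb{S}^1)$). Trigonometric polynomials are the finite linear combinations of $x\mapsto e^{2i\pi nx}$, $n\in\mathbb{Z}$. An operator on a Hilbert space is nuclear of order $0$ if it is compact and its singular values are $p$-summable for every $p>0$. $\det$ is the Fredholm determinant of the identity plus a trace class operator. *)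

theory Defs
  imports
    "HOL-Analysis.Analysis"
    "HOL-Library.Function_Algebras"
begin

section \<open>The circle\<close>

quotient_type circle = real / "\<lambda>s t :: real. s - t \<in> \<int>"
  morphisms rep_circle to_circle
proof (rule equivpI)
  show "reflp (\<lambda>s t :: real. s - t \<in> \<int>)"
    by (simp add: reflp_def)
  show "symp (\<lambda>s t :: real. s - t \<in> \<int>)"
    by (rule sympI) (metis Ints_minus minus_diff_eq)
  show "transp (\<lambda>s t :: real. s - t \<in> \<int>)"
  proof (rule transpI)
    fix r s t :: real
    assume "r - s \<in> \<int>" and "s - t \<in> \<int>"
    then have "(r - s) + (s - t) \<in> \<int>"
      by (rule Ints_add)
    then show "r - t \<in> \<int>"
      by simp
  qed
qed

definition vderiv :: "(real \<Rightarrow> 'a::real_normed_vector) \<Rightarrow> real \<Rightarrow> 'a" where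
  "vderiv f t = vector_derivative f (at t)"

text \<open>Infinite differentiability on an open set of reals.\<close>

definition smooth_on :: "real set \<Rightarrow> (real \<Rightarrow> 'a::real_normed_vector) \<Rightarrow> bool" where
  "smooth_on S f \<longleftrightarrow> (\<forall>k. \<forall>t\<in>S. (vderiv ^^ k) f differentiable (at t))"

text \<open>The charts of the circle are the local inverses of \<^const>\<open>to_circle\<close>, so smoothness and the
  derivative of a circle map are those of its local expressions \<open>F\<close> in these charts.\<close>

definition smooth_circle_map :: "(circle \<Rightarrow> circle) \<Rightarrow> bool" where
  "smooth_circle_map T \<longleftrightarrow>
     (\<forall>t. \<exists>U F. open U \<and> t \<in> U \<and> smooth_on U F \<and> (\<forall>s\<in>U. T (to_circle s) = to_circle (F s)))"

definition circle_deriv :: "(circle \<Rightarrow> circle) \<Rightarrow> circle \<Rightarrow> real" where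
  "circle_deriv T x =
     (THE D. \<exists>t F. to_circle t = x \<and> (\<forall>\<^sub>F s in nhds t. T (to_circle s) = to_circle (F s)) \<and>
                   (F has_real_derivative D) (at t))"

definition expanding :: "(circle \<Rightarrow> circle) \<Rightarrow> bool" where
  "expanding T \<longleftrightarrow> (\<exists>c>1. \<forall>x. \<bar>circle_deriv T x\<bar> \<ge> c)"


section \<open>Transfer operator and dynamical determinant\<close>

text \<open>For a smooth expanding map, the fibres of \<open>T\<close> and the fixed point sets of its positive
  iterates are finite, so the sums below are genuine.\<close>

definition transfer :: "(circle \<Rightarrow> circle) \<Rightarrow> (circle \<Rightarrow> complex) \<Rightarrow> circle \<Rightarrow> complex" where
  "transfer T \<phi> x = (\<Sum>y | T y = x. complex_of_real (1 / \<bar>circle_deriv T y\<bar>) * \<phi> y)"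

definition flat_trace :: "(circle \<Rightarrow> circle) \<Rightarrow> nat \<Rightarrow> real" where
  "flat_trace T n = (\<Sum>x | (T ^^ n) x = x. 1 / \<bar>1 - circle_deriv (T ^^ n) x\<bar>)"

text \<open>The term of index \<open>n\<close> is the one of order \<open>n + 1\<close> in \<open>z\<close>, as the series starts at order 1.\<close>

definition dyn_det_term :: "(circle \<Rightarrow> circle) \<Rightarrow> complex \<Rightarrow> nat \<Rightarrow> complex" where
  "dyn_det_term T z n = 1 / of_nat (Suc n) * complex_of_real (flat_trace T (Suc n)) * z ^ Suc n"

definition dyn_det :: "(circle \<Rightarrow> circle) \<Rightarrow> complex \<Rightarrow> complex" where
  "dyn_det T z = exp (- (\<Sum>n. dyn_det_term T z n))"


section \<open>Complex-valued functions\<close>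

text \<open>Addition, subtraction and zero of functions are the pointwise ones.\<close>

definition cscale :: "complex \<Rightarrow> ('x \<Rightarrow> complex) \<Rightarrow> 'x \<Rightarrow> complex" where
  "cscale c f = (\<lambda>x. c * f x)"

global_interpretation cfun: vector_space "cscale :: complex \<Rightarrow> ('x \<Rightarrow> complex) \<Rightarrow> 'x \<Rightarrow> complex"
  by unfold_locales (auto simp: cscale_def fun_eq_iff algebra_simps)

lift_definition fourier_mode :: "int \<Rightarrow> circle \<Rightarrow> complex"
  is "\<lambda>n t. exp (2 * of_real pi * \<i> * of_int n * of_real t)"
proof -
  fix n :: int and s t :: real
  assume "s - t \<in> \<int>"
  then obtain m where "s - t = of_int m"
    by (elim Ints_cases)
  then have "s = t + of_int m"
    by simp
  then have "2 * of_real pi * \<i> * of_int n * complex_of_real s =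
      2 * of_real pi * \<i> * of_int n * complex_of_real t + (2 * of_int (n * m) * of_real pi) * \<i>"
    by (simp add: algebra_simps)
  moreover have "exp ((2 * of_int (n * m) * of_real pi) * \<i>) = 1"
    using exp_integer_2pi[OF Ints_of_int, of "n * m"] by simp
  ultimately show "exp (2 * of_real pi * \<i> * of_int n * complex_of_real s) =
      exp (2 * of_real pi * \<i> * of_int n * complex_of_real t)"
    by (simp only: exp_add mult_1_right)
qed

definition trig_polys :: "(circle \<Rightarrow> complex) set" where
  "trig_polys = cfun.span (range fourier_mode)"

definition Cinf :: "(circle \<Rightarrow> complex) set" where
  "Cinf = {\<phi>. smooth_on UNIV (\<phi> \<circ> to_circle)}"

definition Cinf_seminorm :: "nat \<Rightarrow> (circle \<Rightarrow> complex) \<Rightarrow> real" where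
  "Cinf_seminorm k \<phi> = (SUP t. cmod ((vderiv ^^ k) (\<phi> \<circ> to_circle) t))"

text \<open>The Frechet topology: the seminorm balls form a subbasis.\<close>

definition Cinf_topology :: "(circle \<Rightarrow> complex) topology" where
  "Cinf_topology = topology_generated_by
     {{\<psi> \<in> Cinf. Cinf_seminorm k (\<psi> - \<phi>) < \<epsilon>} | k \<phi> \<epsilon>. \<phi> \<in> Cinf \<and> \<epsilon> > 0}"


section \<open>Hilbert spaces of functions\<close>

text \<open>A Hilbert space is given by its carrier \<open>H\<close> and its inner product \<open>ip\<close>, linear in the first
  variable; the values of \<open>ip\<close> and of operators outside \<open>H\<close> are irrelevant.\<close>

definition hnorm :: "(('x \<Rightarrow> complex) \<Rightarrow> ('x \<Rightarrow> complex) \<Rightarrow> complex) \<Rightarrow> ('x \<Rightarrow> complex) \<Rightarrow> real" where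
  "hnorm ip f = sqrt (Re (ip f f))"

text \<open>The locale \<^locale>\<open>Metric_space\<close> wants nonnegativity and symmetry on the whole type,
  whence the value 0 off the carrier.\<close>

definition hdist ::
  "('x \<Rightarrow> complex) set \<Rightarrow> (('x \<Rightarrow> complex) \<Rightarrow> ('x \<Rightarrow> complex) \<Rightarrow> complex) \<Rightarrow>
   ('x \<Rightarrow> complex) \<Rightarrow> ('x \<Rightarrow> complex) \<Rightarrow> real" where
  "hdist H ip f g = (if f \<in> H \<and> g \<in> H then hnorm ip (f - g) else 0)"

abbreviation htop where "htop H ip \<equiv> Metric_space.mtopology H (hdist H ip)"

locale hilbert_function_space =
  fixes H :: "('x \<Rightarrow> complex) set"
    and ip :: "('x \<Rightarrow> complex) \<Rightarrow> ('x \<Rightarrow> complex) \<Rightarrow> complex"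
  assumes subspace: "cfun.subspace H"
    and ip_add: "\<lbrakk>f \<in> H; g \<in> H; h \<in> H\<rbrakk> \<Longrightarrow> ip (f + g) h = ip f h + ip g h"
    and ip_scale: "\<lbrakk>f \<in> H; g \<in> H\<rbrakk> \<Longrightarrow> ip (cscale c f) g = c * ip f g"
    and ip_cnj: "\<lbrakk>f \<in> H; g \<in> H\<rbrakk> \<Longrightarrow> ip f g = cnj (ip g f)"
    and ip_pos: "\<lbrakk>f \<in> H; f \<noteq> 0\<rbrakk> \<Longrightarrow> Re (ip f f) > 0"
    and complete: "Metric_space.mcomplete H (hdist H ip)"

lemma (in hilbert_function_space) Metric_space_hdist: "Metric_space H (hdist H ip)"
proof -
  have addH: "f + g \<in> H" if "f \<in> H" "g \<in> H" for f g
    using that subspace by (rule_tac cfun.subspace_add)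
  have diffH: "f - g \<in> H" if "f \<in> H" "g \<in> H" for f g
    using that subspace by (rule_tac cfun.subspace_diff)
  have scaleH: "cscale c f \<in> H" if "f \<in> H" for c f
    using that subspace by (rule_tac cfun.subspace_scale)
  have ip0: "ip 0 0 = 0"
    using ip_add[of 0 0 0] cfun.subspace_0[OF subspace] by simp
  have nonneg: "Re (ip f f) \<ge> 0" if "f \<in> H" for f
    using ip_pos[OF that] ip0 by (cases "f = 0") auto
  have zero: "hnorm ip f = 0 \<longleftrightarrow> f = 0" if "f \<in> H" for f
    using ip_pos[OF that] ip0 by (cases "f = 0") (auto simp: hnorm_def)
  have ip_add_right: "ip h (f + g) = ip h f + ip h g" if "f \<in> H" "g \<in> H" "h \<in> H" for f g h
    using that by (metis addH complex_cnj_add ip_add ip_cnj)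
  have ip_scale_right: "ip g (cscale c f) = cnj c * ip g f" if "f \<in> H" "g \<in> H" for f g c
    using that by (metis scaleH complex_cnj_mult ip_scale ip_cnj)
  have Re_sym: "Re (ip f g) = Re (ip g f)" if "f \<in> H" "g \<in> H" for f g
    using ip_cnj[OF that] by simp
  have expand: "Re (ip (f + cscale (of_real t) g) (f + cscale (of_real t) g)) =
      Re (ip f f) + 2 * t * Re (ip f g) + t\<^sup>2 * Re (ip g g)" if "f \<in> H" "g \<in> H" for f g t
    using that Re_sym[OF that]
    by (simp add: ip_add ip_add_right ip_scale ip_scale_right addH scaleH algebra_simps
        power2_eq_square)
  have norm_add: "hnorm ip (f + g) \<le> hnorm ip f + hnorm ip g" if fg: "f \<in> H" "g \<in> H" for f g
  proof -
    have cs: "Re (ip f g) \<le> sqrt (Re (ip f f)) * sqrt (Re (ip g g))"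
    proof (cases "g = 0")
      case True
      have "ip f 0 = 0"
        using ip_add_right[of 0 0 f] fg True by simp
      then show ?thesis
        using True ip0 by simp
    next
      case False
      define a b c where "a = Re (ip f f)" and "b = Re (ip f g)" and "c = Re (ip g g)"
      have c: "c > 0"
        using ip_pos fg False by (simp add: c_def)
      have "0 \<le> a + 2 * (- b / c) * b + (- b / c)\<^sup>2 * c"
        using expand[OF fg, of "- b / c"] nonneg[OF addH[OF fg(1) scaleH[OF fg(2)]]]
        unfolding a_def b_def c_def by metis
      also have "\<dots> = a - b\<^sup>2 / c"
        using c by (simp add: field_simps power2_eq_square)
      finally have "b\<^sup>2 \<le> a * c"
        using c by (simp add: field_simps)
      then have "b \<le> sqrt (a * c)"
        by (rule real_le_rsqrt)
      then show ?thesis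
        by (simp add: a_def b_def c_def real_sqrt_mult)
    qed
    have "Re (ip (f + g) (f + g)) = Re (ip f f) + 2 * Re (ip f g) + Re (ip g g)"
      using expand[OF fg, of 1] by simp
    also have "\<dots> \<le> (hnorm ip f + hnorm ip g)\<^sup>2"
      using cs nonneg fg by (simp add: hnorm_def power2_sum)
    finally show ?thesis
      unfolding hnorm_def[of ip "f + g"] using nonneg fg
      by (intro real_le_lsqrt) (auto simp: hnorm_def)
  qed
  have norm_minus: "hnorm ip (f - g) = hnorm ip (g - f)" if "f \<in> H" "g \<in> H" for f g
  proof -
    have eq: "f - g = cscale (- 1) (g - f)"
      by (simp add: cscale_def fun_eq_iff)
    have "ip (f - g) (f - g) = ip (g - f) (g - f)"
      unfolding eq ip_scale[OF diffH[OF that(2,1)] scaleH[OF diffH[OF that(2,1)]]]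
        ip_scale_right[OF diffH[OF that(2,1)] diffH[OF that(2,1)]] by simp
    then show ?thesis
      by (simp add: hnorm_def)
  qed
  show ?thesis
  proof
    show "0 \<le> hdist H ip f g" for f g
      using nonneg diffH by (simp add: hdist_def hnorm_def)
    show "hdist H ip f g = hdist H ip g f" for f g
      using norm_minus by (simp add: hdist_def)
    show "hdist H ip f g = 0 \<longleftrightarrow> f = g" if "f \<in> H" "g \<in> H" for f g
      using zero[OF diffH[OF that]] that by (simp add: hdist_def)
    show "hdist H ip f h \<le> hdist H ip f g + hdist H ip g h" if "f \<in> H" "g \<in> H" "h \<in> H" for f g h
      using norm_add[OF diffH[OF that(1,2)] diffH[OF that(2,3)]] that by (simp add: hdist_def)
  qed
qed

definition linear_op ::
  "('x \<Rightarrow> complex) set \<Rightarrow> (('x \<Rightarrow> complex) \<Rightarrow> 'x \<Rightarrow> complex) \<Rightarrow> bool" where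
  "linear_op H A \<longleftrightarrow> A ` H \<subseteq> H \<and> (\<forall>f\<in>H. \<forall>g\<in>H. A (f + g) = A f + A g) \<and>
     (\<forall>c. \<forall>f\<in>H. A (cscale c f) = cscale c (A f))"

definition bounded_op where
  "bounded_op H ip A \<longleftrightarrow> linear_op H A \<and> (\<exists>C. \<forall>f\<in>H. hnorm ip (A f) \<le> C * hnorm ip f)"

definition compact_op where
  "compact_op H ip A \<longleftrightarrow> linear_op H A \<and>
     compactin (htop H ip) (htop H ip closure_of (A ` Metric_space.mcball H (hdist H ip) 0 1))"

definition op_spectrum where
  "op_spectrum H ip A = {\<mu>. \<not> (bij_betw (\<lambda>f. cscale \<mu> f - A f) H H \<and>
                               bounded_op H ip (inv_into H (\<lambda>f. cscale \<mu> f - A f)))}"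

definition op_spectral_radius :: "_ \<Rightarrow> _ \<Rightarrow> _ \<Rightarrow> real" where
  "op_spectral_radius H ip A = (SUP \<mu> \<in> op_spectrum H ip A. cmod \<mu>)"

definition hadjoint where
  "hadjoint H ip A g = (THE h. h \<in> H \<and> (\<forall>f\<in>H. ip (A f) g = ip f h))"

text \<open>The singular values of \<open>A\<close> are the square roots \<open>s\<close> of the eigenvalues of \<open>A\<^sup>*A\<close>. Every
  \<open>s > 0\<close> gets a multiplicity, which is 0 when \<open>s\<close> is not a singular value. For compact \<open>A\<close> these
  eigenspaces are finite-dimensional, so the convention of \<open>cfun.dim\<close> for infinite dimension
  plays no role.\<close>

definition sing_mult ::
  "('x \<Rightarrow> complex) set \<Rightarrow> (('x \<Rightarrow> complex) \<Rightarrow> ('x \<Rightarrow> complex) \<Rightarrow> complex) \<Rightarrow>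
   (('x \<Rightarrow> complex) \<Rightarrow> 'x \<Rightarrow> complex) \<Rightarrow> real \<Rightarrow> nat" where
  "sing_mult H ip A s =
     cfun.dim {f \<in> H. hadjoint H ip A (A f) = cscale (complex_of_real (s\<^sup>2)) f}"

definition sing_values_summable where
  "sing_values_summable H ip A p \<longleftrightarrow>
     (\<lambda>s. real (sing_mult H ip A s) * s powr p) summable_on {s. s > 0}"

definition nuclear_order_0 where
  "nuclear_order_0 H ip A \<longleftrightarrow> compact_op H ip A \<and> (\<forall>p>0. sing_values_summable H ip A p)"

definition orthonormal_basis where
  "orthonormal_basis H ip B \<longleftrightarrow> B \<subseteq> H \<and> (\<forall>e\<in>B. \<forall>f\<in>B. ip e f = (if e = f then 1 else 0)) \<and>
     htop H ip closure_of (cfun.span B) = H"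

text \<open>The determinant of the matrix \<open>\<langle>A e, f\<rangle>\<close> indexed by \<open>e, f \<in> F\<close>. For orthonormal
  \<open>F = {e\<^sub>1, ..., e\<^sub>k}\<close> it is the diagonal coefficient of \<open>\<Lambda>\<^sup>k A\<close> at the unit vector
  \<open>e\<^sub>1 \<and> ... \<and> e\<^sub>k\<close>.\<close>

definition principal_minor ::
  "(('x \<Rightarrow> complex) \<Rightarrow> ('x \<Rightarrow> complex) \<Rightarrow> complex) \<Rightarrow>
   (('x \<Rightarrow> complex) \<Rightarrow> 'x \<Rightarrow> complex) \<Rightarrow> ('x \<Rightarrow> complex) set \<Rightarrow> complex" where
  "principal_minor ip A F = (\<Sum>p | p permutes F. of_int (sign p) * (\<Prod>e\<in>F. ip (A e) (p e)))"

text \<open>The Fredholm determinant \<open>det (I + A)\<close> of a trace class operator \<open>A\<close> is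
  \<open>\<Sum>\<^sub>k tr (\<Lambda>\<^sup>k A)\<close>. Each trace is computed in the basis of \<open>k\<close>-fold wedge products of an
  orthonormal basis \<open>B\<close>; these are indexed by the \<open>k\<close>-element subsets of \<open>B\<close>. The double sum
  converges absolutely, and its value does not depend on \<open>B\<close>.\<close>

definition fredholm_det ::
  "('x \<Rightarrow> complex) set \<Rightarrow> (('x \<Rightarrow> complex) \<Rightarrow> ('x \<Rightarrow> complex) \<Rightarrow> complex) \<Rightarrow>
   (('x \<Rightarrow> complex) \<Rightarrow> 'x \<Rightarrow> complex) \<Rightarrow> complex" where
  "fredholm_det H ip A =
     (THE D. \<forall>B. orthonormal_basis H ip B \<longrightarrow>
                 (principal_minor ip A has_sum D) {F. finite F \<and> F \<subseteq> B})"

end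

theory Submission
  imports
    Defs
    "HOL-Complex_Analysis.Complex_Analysis"
    "Jordan_Normal_Form.Schur_Decomposition"
    "HOL-Combinatorics.Permutations"
    "HOL-Library.Nat_Bijection"
begin

text \<open>Let \<open>M m n\<close> be the Fourier matrix of the transfer operator, the integral of
  \<open>exp (2 i \<pi> (n t - m F t))\<close> for a lift \<open>F\<close> of \<open>T\<close>. As \<open>\<bar>F'\<bar> \<ge> c > 1\<close>, integration by parts makes it decay
  rapidly in \<open>m\<close> where \<open>\<bar>n\<bar> \<le> \<kappa> \<bar>m\<bar>\<close>, with \<open>\<kappa> = (1 + c) / 2\<close>. Frequencies get levels by powers of \<open>\<kappa>\<close>. The part of \<open>M\<close>
  that strictly decreases the level is \<open>Lb\<close>, the rest is \<open>Lc\<close>. The space \<open>H\<close> consists of Fourier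
  series with square summable weighted coefficients. Its weights grow superexponentially in the
  level, so that \<open>Lb\<close> is contracted by arbitrarily small factors, but slowly enough for the decay of
  the entries of \<open>Lc\<close> to survive.

  On the frequencies up to a level, \<open>Lb\<close> is strictly triangular, so the finite sections of the
  Fredholm determinant are the determinants of the sections of \<open>1 - z M\<close>, whose logarithms are
  power series in the traces of powers. These converge to the traces of the powers of \<open>M\<close>, which
  are the flat traces, by Fourier inversion of the sum of \<open>1 / S'\<close> over the zeros modulo 1 of
  \<open>S = F\<^sup>n - id\<close>.\<close>

section \<open>Principal minors\<close>

text \<open>No trace class bound is available for \<open>Lb\<close>, so det(1 - z L) is not directly
  at hand on \<open>H\<close>. The factor 1 - z \<open>Lb\<close> has determinant 1 on every
  section, and only the remaining factor needs a determinant. The phase n t - m F t is stationary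
  where n = m F', so the transfer operator carries mode n mainly to frequencies in the range of n /
  F', below n. No smoothness makes this part small; only the ratio of the weights does.

  Two demands on the weights compete: growth by a fixed factor per level would contract
  \<open>Lb\<close> by a fixed factor only, while too fast a growth would destroy the decay of
  \<open>Lc\<close>. Since that decay is merely faster than every power, with no explicit rate, the
  weights are built from the constants of the decay estimates themselves.

  In coordinates the weights conjugate the matrices by a diagonal one, which leaves principal minors
  alone; hence \<open>fdet\<close> does not mention them. The definition of
  \<open>fredholm_det\<close> asks for one value in all orthonormal bases, and this is where
  Sylvester's identity for sums of rank one operators enters.\<close>

no_notation Infinite_Set_Sum.abs_summable_on (infix \<open>abs'_summable'_on\<close> 50)

text \<open>Bounded below by 1, so that decay estimates can divide by its powers at frequency 0
  too.\<close>

abbreviation brk :: "int \<Rightarrow> real" where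
  "brk n \<equiv> 1 + \<bar>real_of_int n\<bar>"

text \<open>The sum in \<open>principal_minor\<close>, for a matrix over any index type.
  Permutations of the index set itself avoid choosing an order on it.\<close>

definition pminor :: "('a \<Rightarrow> 'a \<Rightarrow> complex) \<Rightarrow> 'a set \<Rightarrow> complex" where
  "pminor M F = (\<Sum>p | p permutes F. of_int (sign p) * (\<Prod>i\<in>F. M i (p i)))"

lemma pminor_cong:
  assumes "\<And>i j. i \<in> F \<Longrightarrow> j \<in> F \<Longrightarrow> M i j = N i j"
  shows "pminor M F = pminor N F"
  unfolding pminor_def
  by (intro sum.cong prod.cong arg_cong2[where f = "(*)"] refl assms)
     (auto simp: permutes_in_image)

lemma bij_betw_map_permutation:
  assumes h: "bij_betw h A B"
  shows "bij_betw (map_permutation A h) {p. p permutes A} {p. p permutes B}"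
proof (rule bij_betw_byWitness[where f' = "map_permutation B (inv_into A h)"])
  have h': "bij_betw (inv_into A h) B A"
    by (rule bij_betw_inv_into[OF h])
  show "\<forall>p\<in>{p. p permutes A}. map_permutation B (inv_into A h) (map_permutation A h p) = p"
    using map_permutation_compose_inv[OF h] bij_betw_inv_into_left[OF h] by auto
  show "\<forall>p\<in>{p. p permutes B}. map_permutation A h (map_permutation B (inv_into A h) p) = p"
    using map_permutation_compose_inv[OF h'] bij_betw_inv_into_right[OF h] by auto
  show "map_permutation A h ` {p. p permutes A} \<subseteq> {p. p permutes B}"
    using map_permutation_permutes[OF h] by auto
  show "map_permutation B (inv_into A h) ` {p. p permutes B} \<subseteq> {p. p permutes A}"
    using map_permutation_permutes[OF h'] by auto
qed

text \<open>Transports minors to the sets \<open>{0..<n}\<close>, where they are determinants of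
  matrices.\<close>

lemma pminor_reindex:
  assumes h: "bij_betw h A B" and fin: "finite A"
  shows "pminor (\<lambda>i j. M (h i) (h j)) A = pminor M B"
proof -
  have inj: "inj_on h A"
    using h by (simp add: bij_betw_def)
  have "pminor M B = (\<Sum>p | p permutes A. of_int (sign (map_permutation A h p)) *
      (\<Prod>i\<in>B. M i (map_permutation A h p i)))"
    unfolding pminor_def by (rule sum.reindex_bij_betw[OF bij_betw_map_permutation[OF h], symmetric])
  also have "\<dots> = (\<Sum>p | p permutes A. of_int (sign p) * (\<Prod>i\<in>A. M (h i) (h (p i))))"
  proof (intro sum.cong arg_cong2[where f = "(*)"] refl)
    fix p assume "p \<in> {p. p permutes A}"
    then have p: "p permutes A" by simp
    show "of_int (sign (map_permutation A h p)) = of_int (sign p)"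
      using sign_map_permutation[OF inj p fin] by simp
    have "(\<Prod>i\<in>B. M i (map_permutation A h p i)) = (\<Prod>i\<in>A. M (h i) (map_permutation A h p (h i)))"
      by (rule prod.reindex_bij_betw[OF h, symmetric])
    also have "\<dots> = (\<Prod>i\<in>A. M (h i) (h (p i)))"
      by (intro prod.cong refl) (simp add: map_permutation_apply[OF inj])
    finally show "(\<Prod>i\<in>B. M i (map_permutation A h p i)) = (\<Prod>i\<in>A. M (h i) (h (p i)))" .
  qed
  finally show ?thesis
    by (simp add: pminor_def)
qed

text \<open>Along a permutation every weight occurs once in the numerator and once in the
  denominator. This is how the weights of the Hilbert space drop out of its determinants.\<close>

lemma pminor_conj:
  assumes w: "\<And>i. i \<in> F \<Longrightarrow> w i \<noteq> 0"
  shows "pminor (\<lambda>i j. M i j * w j / w i) F = pminor M F"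
  unfolding pminor_def
proof (intro sum.cong arg_cong2[where f = "(*)"] refl)
  fix p assume "p \<in> {p. p permutes F}"
  then have p: "p permutes F" by simp
  have "(\<Prod>i\<in>F. w (p i)) = (\<Prod>i\<in>F. w i)"
    using prod.permute[OF p, of w] by (simp add: o_def)
  then show "(\<Prod>i\<in>F. M i (p i) * w (p i) / w i) = (\<Prod>i\<in>F. M i (p i))"
  proof (cases "finite F")
    case True
    then have "(\<Prod>i\<in>F. w i) \<noteq> 0"
      using w by simp
    then show ?thesis
      using \<open>(\<Prod>i\<in>F. w (p i)) = (\<Prod>i\<in>F. w i)\<close> by (simp add: prod_dividef prod.distrib)
  qed simp
qed

lemma pminor_transpose:
  assumes fin: "finite F"
  shows "pminor (\<lambda>i j. M j i) F = pminor M F"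
proof -
  have "pminor M F = (\<Sum>p | p permutes F. of_int (sign (inv_into UNIV p)) * (\<Prod>i\<in>F. M i (inv_into UNIV p i)))"
    unfolding pminor_def by (rule sum_permutations_inverse)
  also have "\<dots> = (\<Sum>p | p permutes F. of_int (sign p) * (\<Prod>i\<in>F. M (p i) i))"
  proof (intro sum.cong refl)
    fix p assume "p \<in> {p. p permutes F}"
    then have p: "p permutes F" by simp
    have "(\<Prod>i\<in>F. M i (inv_into UNIV p i)) = (\<Prod>i\<in>F. M (p i) (inv_into UNIV p (p i)))"
      using prod.permute[OF p, of "\<lambda>i. M i (inv_into UNIV p i)"] by (simp add: o_def)
    moreover have "sign (inv_into UNIV p) = sign p"
      using permutes_imp_permutation[OF fin p] by (rule sign_inverse)
    ultimately show "of_int (sign (inv_into UNIV p)) * (\<Prod>i\<in>F. M i (inv_into UNIV p i)) =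
        of_int (sign p) * (\<Prod>i\<in>F. M (p i) i)"
      using permutes_inverses[OF p] by simp
  qed
  finally show ?thesis
    by (simp add: pminor_def)
qed

text \<open>Expand each factor over the set F of indices that take the entry of \<open>M\<close>;
  the identity entries on the complement of F kill every permutation that moves a point there. The
  right side is the finite form of the series in \<open>fredholm_det\<close>.\<close>

lemma pminor_add_id:
  assumes fin: "finite S"
  shows "pminor (\<lambda>i j. (if i = j then 1 else 0) + M i j) S = (\<Sum>F\<in>Pow S. pminor M F)"
proof -
  have "pminor (\<lambda>i j. (if i = j then 1 else 0) + M i j) S =
    (\<Sum>p | p permutes S. \<Sum>F\<in>Pow S.
        of_int (sign p) * ((\<Prod>i\<in>F. M i (p i)) * (\<Prod>i\<in>S - F. (if i = p i then 1 else 0))))"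
    unfolding pminor_def
    by (subst add.commute, subst prod_add[OF fin]) (simp add: sum_distrib_left)
  also have "\<dots> = (\<Sum>F\<in>Pow S. \<Sum>p | p permutes S.
        of_int (sign p) * ((\<Prod>i\<in>F. M i (p i)) * (\<Prod>i\<in>S - F. (if i = p i then 1 else 0))))"
    by (rule sum.swap)
  also have "\<dots> = (\<Sum>F\<in>Pow S. \<Sum>p | p permutes F. of_int (sign p) * (\<Prod>i\<in>F. M i (p i)))"
  proof (rule sum.cong[OF refl])
    fix F assume "F \<in> Pow S"
    then have F: "F \<subseteq> S" by simp
    have iff: "p permutes F \<longleftrightarrow> (\<forall>i\<in>S - F. p i = i)" if "p permutes S" for p
      using that F by (metis Diff_iff permutes_not_in permutes_superset)
    show "(\<Sum>p | p permutes S. of_int (sign p) * ((\<Prod>i\<in>F. M i (p i)) *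
            (\<Prod>i\<in>S - F. (if i = p i then 1 else 0)))) =
          (\<Sum>p | p permutes F. of_int (sign p) * (\<Prod>i\<in>F. M i (p i)))"
    proof (rule sum.mono_neutral_cong_right)
      show "finite {p. p permutes S}" using fin by (rule finite_permutations)
      show "{p. p permutes F} \<subseteq> {p. p permutes S}" using F permutes_subset by blast
      show "\<forall>p\<in>{p. p permutes S} - {p. p permutes F}. of_int (sign p) * ((\<Prod>i\<in>F. M i (p i)) *
            (\<Prod>i\<in>S - F. (if i = p i then 1 else 0))) = 0"
      proof
        fix p assume p: "p \<in> {p. p permutes S} - {p. p permutes F}"
        then obtain i where "i \<in> S - F" "p i \<noteq> i" using iff by auto
        then have "(\<Prod>i\<in>S - F. (if i = p i then 1 else 0 :: complex)) = 0"
          using fin by (intro prod_zero bexI[of _ i]) auto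
        then show "of_int (sign p) * ((\<Prod>i\<in>F. M i (p i)) *
            (\<Prod>i\<in>S - F. (if i = p i then 1 else 0))) = 0" by simp
      qed
      fix p assume "p \<in> {p. p permutes F}"
      then have "\<forall>i\<in>S - F. p i = i" using permutes_not_in by auto
      then have "(\<Prod>i\<in>S - F. (if i = p i then 1 else 0 :: complex)) = 1"
        by (intro prod.neutral) auto
      then show "of_int (sign p) * ((\<Prod>i\<in>F. M i (p i)) *
            (\<Prod>i\<in>S - F. (if i = p i then 1 else 0))) = of_int (sign p) * (\<Prod>i\<in>F. M i (p i))"
        by simp
    qed
  qed
  finally show ?thesis
    by (simp add: pminor_def)
qed

text \<open>A nonzero product along a permutation of a nonempty set would increase \<open>b\<close>
  at every index, although the permutation preserves the sum of the \<open>b i\<close>. So only the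
  empty minor survives.\<close>

lemma pminor_triangular:
  fixes b :: "'a \<Rightarrow> nat"
  assumes fin: "finite S" and tri: "\<And>i j. i \<in> S \<Longrightarrow> j \<in> S \<Longrightarrow> N i j \<noteq> 0 \<Longrightarrow> b i < b j"
  shows "pminor (\<lambda>i j. (if i = j then 1 else 0) + N i j) S = 1"
proof -
  have "pminor N F = (if F = {} then 1 else 0)" if F: "F \<subseteq> S" for F
  proof (cases "F = {}")
    case True
    then show ?thesis by (simp add: pminor_def)
  next
    case False
    have finF: "finite F" using F fin finite_subset by blast
    have "(\<Prod>i\<in>F. N i (p i)) = 0" if p: "p permutes F" for p
    proof (rule ccontr)
      assume "(\<Prod>i\<in>F. N i (p i)) \<noteq> 0"
      then have "\<And>i. i \<in> F \<Longrightarrow> b i < b (p i)"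
        using tri F finF p by (metis (no_types, lifting) prod_zero_iff permutes_in_image subsetD)
      then have "(\<Sum>i\<in>F. b i) < (\<Sum>i\<in>F. b (p i))"
        using finF False by (intro sum_strict_mono) auto
      moreover have "(\<Sum>i\<in>F. b (p i)) = (\<Sum>i\<in>F. b i)"
        using sum.permute[OF p, of b] by (simp add: o_def)
      ultimately show False by simp
    qed
    then show ?thesis using False by (simp add: pminor_def)
  qed
  then have "(\<Sum>F\<in>Pow S. pminor N F) = (\<Sum>F\<in>Pow S. if F = {} then 1 else 0)"
    by (intro sum.cong) auto
  also have "\<dots> = 1" using fin by simp
  finally show ?thesis by (simp add: pminor_add_id[OF fin])
qed

lemma pminor_lessThan: "pminor M {0..<n} = Determinant.det (Matrix.mat n n (\<lambda>(i, j). M i j))"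
  unfolding pminor_def Determinant.det_def
  by (auto intro!: sum.cong prod.cong simp: permutes_in_image)

lemma pminor_mult:
  assumes fin: "finite S"
  shows "pminor (\<lambda>i j. \<Sum>k\<in>S. A i k * B k j) S = pminor A S * pminor B S"
proof -
  obtain h where h: "bij_betw h {0..<card S} S"
    using ex_bij_betw_nat_finite[OF fin] by blast
  let ?n = "card S"
  let ?m = "\<lambda>A. Matrix.mat ?n ?n (\<lambda>(i, j). A (h i) (h j))"
  have "pminor (\<lambda>i j. \<Sum>k\<in>S. A i k * B k j) S
      = pminor (\<lambda>i j. \<Sum>k\<in>{0..<?n}. A (h i) (h k) * B (h k) (h j)) {0..<?n}"
    by (subst pminor_reindex[OF h, symmetric]) (auto simp: sum.reindex_bij_betw[OF h, symmetric])
  also have "\<dots> = Determinant.det (?m A * ?m B)"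
    unfolding pminor_lessThan
    by (intro arg_cong[where f = Determinant.det] eq_matI) (auto simp: scalar_prod_def)
  also have "\<dots> = Determinant.det (?m A) * Determinant.det (?m B)"
    by (rule det_mult) auto
  also have "\<dots> = pminor A S * pminor B S"
    by (simp add: pminor_lessThan[symmetric] pminor_reindex[OF h])
  finally show ?thesis .
qed

section \<open>Traces of powers and the characteristic polynomial\<close>

fun mpow :: "'a set \<Rightarrow> ('a \<Rightarrow> 'a \<Rightarrow> complex) \<Rightarrow> nat \<Rightarrow> 'a \<Rightarrow> 'a \<Rightarrow> complex" where
  "mpow S A 0 i j = (if i = j then 1 else 0)"
| "mpow S A (Suc n) i j = (\<Sum>k\<in>S. A i k * mpow S A n k j)"

text \<open>Traces and determinants are invariant under similarity, and a Schur form of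
  \<open>A\<close> shows the eigenvalues \<open>e i\<close> with multiplicity on its
  diagonal.\<close>

lemma trace_powers_char_poly:
  fixes A :: "complex mat"
  assumes A: "A \<in> carrier_mat n n"
  shows "\<exists>e :: nat \<Rightarrow> complex.
    (\<forall>k. (\<Sum>i<n. (((*) A ^^ k) (1\<^sub>m n)) $$ (i, i)) = (\<Sum>i<n. e i ^ k)) \<and>
    (\<forall>z. Determinant.det (1\<^sub>m n + (- z) \<cdot>\<^sub>m A) = (\<Prod>i<n. 1 - z * e i))"
proof -
  obtain as where cp: "char_poly A = (\<Prod>a\<leftarrow>as. [:- a, 1:])"
    using char_poly_factorized[OF A] by blast
  obtain B P Q where BPQ: "schur_decomposition A as = (B, P, Q)"
    by (metis prod_cases3)
  have wit: "similar_mat_wit A B P Q" and ut: "upper_triangular B"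
    using schur_decomposition[OF A cp BPQ] by auto
  note w = similar_mat_witD2[OF A wit]
  define e where "e i = B $$ (i, i)" for i
  have Bk: "((*) B ^^ k) (1\<^sub>m n) \<in> carrier_mat n n" for k
    by (induction k) (use w in auto)
  have Ak: "((*) A ^^ k) (1\<^sub>m n) \<in> carrier_mat n n" for k
    by (induction k) (use w in auto)
  have pow: "((*) A ^^ k) (1\<^sub>m n) = P * ((*) B ^^ k) (1\<^sub>m n) * Q" for k
  proof (induction k)
    case 0
    then show ?case using w by simp
  next
    case (Suc k)
    let ?X = "((*) B ^^ k) (1\<^sub>m n)"
    have "((*) A ^^ Suc k) (1\<^sub>m n) = (P * B * Q) * (P * ?X * Q)"
      using Suc w by simp
    also have "\<dots> = P * B * (Q * P) * ?X * Q"
      using w Bk[of k] by (smt (verit) assoc_mult_mat mult_carrier_mat)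
    also have "\<dots> = P * (B * ?X) * Q"
      using w Bk[of k] by (simp add: assoc_mult_mat[of _ n n _ n _ n])
    finally show ?case by simp
  qed
  \<comment> \<open>Triangularity is carried along in the induction because it is what makes
    diagonals multiply: in the product only the index \<open>l = i\<close> avoids a zero of one of
    the factors.\<close>
  have upow: "upper_triangular (((*) B ^^ k) (1\<^sub>m n)) \<and> (\<forall>i<n. ((*) B ^^ k) (1\<^sub>m n) $$ (i, i) = e i ^ k)" for k
  proof (induction k)
    case 0
    then show ?case by simp
  next
    case (Suc k)
    let ?X = "((*) B ^^ k) (1\<^sub>m n)"
    have X: "?X \<in> carrier_mat n n" by (rule Bk)
    have zB: "B $$ (i, l) = 0" if "l < i" "i < n" for i l
      using ut that w by (auto dest: upper_triangularD)
    have zX: "?X $$ (i, l) = 0" if "l < i" "i < n" for i l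
      using Suc that X by (auto dest: upper_triangularD)
    have ent: "(B * ?X) $$ (i, j) = (\<Sum>l<n. B $$ (i, l) * ?X $$ (l, j))" if "i < n" "j < n" for i j
      using that w X by (simp add: scalar_prod_def atLeast0LessThan)
    have "(B * ?X) $$ (i, j) = 0" if "j < i" "i < n" for i j
    proof -
      have "B $$ (i, l) * ?X $$ (l, j) = 0" if "l < n" for l
        using zB[of l i] zX[of j l] \<open>j < i\<close> \<open>i < n\<close> that by (cases "l < i") auto
      then show ?thesis unfolding ent[OF that(2) less_trans[OF that]] by (intro sum.neutral) auto
    qed
    moreover have "(B * ?X) $$ (i, i) = e i ^ Suc k" if "i < n" for i
    proof -
      have "(B * ?X) $$ (i, i) = (\<Sum>l<n. if l = i then e i * e i ^ k else 0)"
        unfolding ent[OF that that]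
      proof (intro sum.cong refl)
        fix l assume "l \<in> {..<n}"
        then show "B $$ (i, l) * ?X $$ (l, i) = (if l = i then e i * e i ^ k else 0)"
          using zB[of l i] zX[of i l] that Suc e_def by (cases l i rule: linorder_cases) auto
      qed
      then show ?thesis using that by simp
    qed
    ultimately show ?case
      using w X by (auto intro!: upper_triangularI)
  qed
  have trc: "(\<Sum>i<n. (P * X * Q) $$ (i, i)) = (\<Sum>i<n. X $$ (i, i))" if X: "X \<in> carrier_mat n n" for X
  proof -
    have comm: "(\<Sum>i<n. (Y * Z) $$ (i, i)) = (\<Sum>i<n. (Z * Y) $$ (i, i))"
      if "Y \<in> carrier_mat n n" "Z \<in> carrier_mat n n" for Y Z :: "complex mat"
    proof -
      have "(\<Sum>i<n. (Y * Z) $$ (i, i)) = (\<Sum>i<n. \<Sum>l<n. Y $$ (i, l) * Z $$ (l, i))"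
        using that by (intro sum.cong) (auto simp: scalar_prod_def atLeast0LessThan)
      also have "\<dots> = (\<Sum>l<n. \<Sum>i<n. Y $$ (i, l) * Z $$ (l, i))" by (rule sum.swap)
      also have "\<dots> = (\<Sum>i<n. (Z * Y) $$ (i, i))"
        using that by (intro sum.cong) (auto simp: scalar_prod_def atLeast0LessThan mult.commute)
      finally show ?thesis .
    qed
    have "(\<Sum>i<n. (P * X * Q) $$ (i, i)) = (\<Sum>i<n. (Q * (P * X)) $$ (i, i))"
      using w X by (intro comm) auto
    also have "Q * (P * X) = X"
      using w X by (simp add: assoc_mult_mat[of Q n n P n X n, symmetric])
    finally show ?thesis .
  qed
  show ?thesis
  proof (intro exI[of _ e] conjI allI)
    show "(\<Sum>i<n. (((*) A ^^ k) (1\<^sub>m n)) $$ (i, i)) = (\<Sum>i<n. e i ^ k)" for k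
      unfolding pow trc[OF Bk] using upow by simp
    show "Determinant.det (1\<^sub>m n + (- z) \<cdot>\<^sub>m A) = (\<Prod>i<n. 1 - z * e i)" for z
    proof -
      let ?B = "1\<^sub>m n + (- z) \<cdot>\<^sub>m B"
      have B': "?B \<in> carrier_mat n n" using w by auto
      have "P * ?B * Q = (P * 1\<^sub>m n + P * ((- z) \<cdot>\<^sub>m B)) * Q"
        using w by (subst mult_add_distrib_mat[of P n n]) auto
      also have "\<dots> = P * 1\<^sub>m n * Q + P * ((- z) \<cdot>\<^sub>m B) * Q"
        using w by (subst add_mult_distrib_mat[of _ n n]) auto
      also have "\<dots> = 1\<^sub>m n + (- z) \<cdot>\<^sub>m A"
        using w by (simp add: mult_smult_distrib[of P n n B n] mult_smult_assoc_mat[of _ n n Q n])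
      finally have "Determinant.det (1\<^sub>m n + (- z) \<cdot>\<^sub>m A) = Determinant.det (P * ?B * Q)" by simp
      also have "\<dots> = Determinant.det (P * Q) * Determinant.det ?B"
      proof -
        have "Determinant.det (P * ?B * Q) = Determinant.det P * Determinant.det ?B * Determinant.det Q"
          using w(4-) B' by (subst det_mult[of _ n], simp, simp, subst det_mult[of _ n]) auto
        moreover have "Determinant.det (P * Q) = Determinant.det P * Determinant.det Q"
          using w(4-) by (subst det_mult[of _ n]) auto
        ultimately show ?thesis by simp
      qed
      also have "\<dots> = Determinant.det ?B" using w by simp
      also have "\<dots> = prod_list (diag_mat ?B)"
        using ut w B' by (intro det_upper_triangular) (auto intro!: upper_triangularI dest: upper_triangularD)
      also have "\<dots> = (\<Prod>i<n. 1 - z * e i)"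
        using w by (simp add: diag_mat_def prod.list_conv_set_nth atLeast0LessThan e_def)
      finally show ?thesis .
    qed
  qed
qed

text \<open>In terms of the eigenvalues, the determinant is a product of factors 1 - z e, and the
  series collects the power series of their logarithms. The radius depends on the section;
  \<open>log_series_limit\<close> is stated so as to allow this.\<close>

lemma pminor_exp_trace:
  assumes fin: "finite S"
  obtains r where "r > 0"
    "\<And>z. cmod z < r \<Longrightarrow> summable (\<lambda>n. z ^ Suc n / of_nat (Suc n) * (\<Sum>i\<in>S. mpow S A (Suc n) i i))"
    "\<And>z. cmod z < r \<Longrightarrow> pminor (\<lambda>i j. (if i = j then 1 else 0) + (- z * A i j)) S =
        exp (- (\<Sum>n. z ^ Suc n / of_nat (Suc n) * (\<Sum>i\<in>S. mpow S A (Suc n) i i)))"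
proof -
  obtain h where h: "bij_betw h {0..<card S} S"
    using ex_bij_betw_nat_finite[OF fin] by blast
  let ?n = "card S"
  define Am where "Am = Matrix.mat ?n ?n (\<lambda>(i, j). A (h i) (h j))"
  have Am: "Am \<in> carrier_mat ?n ?n" by (simp add: Am_def)
  have inj: "h i = h j \<longleftrightarrow> i = j" if "i < ?n" "j < ?n" for i j
    using h that by (auto simp: bij_betw_def inj_on_def)
  have pw: "((*) Am ^^ k) (1\<^sub>m ?n) \<in> carrier_mat ?n ?n \<and>
      (\<forall>i<?n. \<forall>j<?n. ((*) Am ^^ k) (1\<^sub>m ?n) $$ (i, j) = mpow S A k (h i) (h j))" for k
  proof (induction k)
    case 0
    then show ?case by (auto simp: inj)
  next
    case (Suc k)
    let ?X = "((*) Am ^^ k) (1\<^sub>m ?n)"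
    have "(Am * ?X) $$ (i, j) = mpow S A (Suc k) (h i) (h j)" if "i < ?n" "j < ?n" for i j
    proof -
      have "(Am * ?X) $$ (i, j) = (\<Sum>l\<in>{0..<?n}. A (h i) (h l) * mpow S A k (h l) (h j))"
      proof -
        have "(Am * ?X) $$ (i, j) = (\<Sum>l\<in>{0..<?n}. Am $$ (i, l) * ?X $$ (l, j))"
          using Suc Am that by (auto simp: scalar_prod_def)
        also have "\<dots> = (\<Sum>l\<in>{0..<?n}. A (h i) (h l) * mpow S A k (h l) (h j))"
          using Suc that by (intro sum.cong) (auto simp: Am_def)
        finally show ?thesis .
      qed
      also have "\<dots> = (\<Sum>l\<in>S. A (h i) l * mpow S A k l (h j))"
        by (rule sum.reindex_bij_betw[OF h, where g = "\<lambda>l. A (h i) l * mpow S A k l (h j)"])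
      finally show ?thesis by simp
    qed
    moreover have "Am * ?X \<in> carrier_mat ?n ?n" using Suc Am by (intro mult_carrier_mat) auto
    ultimately show ?case by simp
  qed
  obtain e where e1: "\<And>k. (\<Sum>i<?n. (((*) Am ^^ k) (1\<^sub>m ?n)) $$ (i, i)) = (\<Sum>i<?n. e i ^ k)"
    and e2: "\<And>z. Determinant.det (1\<^sub>m ?n + (- z) \<cdot>\<^sub>m Am) = (\<Prod>i<?n. 1 - z * e i)"
    using trace_powers_char_poly[OF Am] by blast
  have tr: "(\<Sum>i\<in>S. mpow S A k i i) = (\<Sum>i<?n. e i ^ k)" for k
  proof -
    have "(\<Sum>i\<in>S. mpow S A k i i) = (\<Sum>i\<in>{0..<?n}. mpow S A k (h i) (h i))"
      by (rule sum.reindex_bij_betw[OF h, symmetric])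
    also have "\<dots> = (\<Sum>i<?n. (((*) Am ^^ k) (1\<^sub>m ?n)) $$ (i, i))"
      using pw[of k] by (auto simp: atLeast0LessThan)
    finally show ?thesis by (simp add: e1)
  qed
  have dt: "pminor (\<lambda>i j. (if i = j then 1 else 0) + (- z * A i j)) S = (\<Prod>i<?n. 1 - z * e i)" for z
  proof -
    have "pminor (\<lambda>i j. (if i = j then 1 else 0) + (- z * A i j)) S =
        pminor (\<lambda>i j. (if h i = h j then 1 else 0) + (- z * A (h i) (h j))) {0..<?n}"
      using pminor_reindex[OF h, of "\<lambda>i j. (if i = j then 1 else 0) + (- z * A i j)"] by simp
    also have "\<dots> = Determinant.det (1\<^sub>m ?n + (- z) \<cdot>\<^sub>m Am)"
      unfolding pminor_lessThan
      by (intro arg_cong[where f = Determinant.det] eq_matI) (auto simp: Am_def inj)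
    finally show ?thesis by (simp add: e2)
  qed
  \<comment> \<open>Strictly larger than every \<open>cmod (e i)\<close>, and positive even if all
    eigenvalues vanish, thanks to the added 1.\<close>
  define R where "R = (\<Sum>i<?n. cmod (e i)) + 1"
  have R: "cmod (e i) < R" if "i < ?n" for i
    using member_le_sum[of i "{..<?n}" "\<lambda>i. cmod (e i)"] that by (simp add: R_def)
  have Rpos: "R > 0" unfolding R_def by (intro add_nonneg_pos sum_nonneg) auto
  have main: "(\<lambda>n. z ^ Suc n / of_nat (Suc n) * (\<Sum>i\<in>S. mpow S A (Suc n) i i)) sums
      (\<Sum>i<?n. - Ln (1 - z * e i)) \<and> (\<Prod>i<?n. 1 - z * e i) = exp (- (\<Sum>i<?n. - Ln (1 - z * e i)))"
    if z: "cmod z < 1 / R" for z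
  proof -
    have ze: "cmod (z * e i) < 1" if "i < ?n" for i
    proof -
      have "cmod (z * e i) \<le> (1 / R) * cmod (e i)"
        using z unfolding norm_mult by (intro mult_right_mono) auto
      also have "\<dots> < (1 / R) * R" using R[OF that] Rpos by (intro mult_strict_left_mono) auto
      finally show ?thesis using Rpos by simp
    qed
    have one: "(\<lambda>n. z ^ Suc n / of_nat (Suc n) * e i ^ Suc n) sums (- Ln (1 - z * e i))" if "i < ?n" for i
    proof -
      have "(\<lambda>n. (-1) ^ Suc n / of_nat n * (- (z * e i)) ^ n) sums Ln (1 + (- (z * e i)))"
        using ze[OF that] by (intro Ln_series) simp
      then have "(\<lambda>n. (-1) ^ Suc (Suc n) / of_nat (Suc n) * (- (z * e i)) ^ Suc n) sums Ln (1 - z * e i)"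
        by (subst sums_Suc_iff) simp
      then have "(\<lambda>n. - ((-1) ^ Suc (Suc n) / of_nat (Suc n) * (- (z * e i)) ^ Suc n)) sums - Ln (1 - z * e i)"
        by (rule sums_minus)
      moreover have "- ((-1) ^ Suc (Suc n) / of_nat (Suc n) * (- (z * e i)) ^ Suc n) =
          z ^ Suc n / of_nat (Suc n) * e i ^ Suc n" for n
        by (subst power_minus) (simp add: power_mult_distrib)
      ultimately show ?thesis by (simp only:)
    qed
    have "(\<lambda>n. \<Sum>i<?n. z ^ Suc n / of_nat (Suc n) * e i ^ Suc n) sums (\<Sum>i<?n. - Ln (1 - z * e i))"
      by (rule sums_sum) (use one in auto)
    moreover have "(\<Prod>i<?n. 1 - z * e i) = exp (- (\<Sum>i<?n. - Ln (1 - z * e i)))"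
    proof -
      have "1 - z * e i \<noteq> 0" if "i < ?n" for i
        using ze[OF that] by auto
      then show ?thesis
        by (simp add: sum_negf exp_sum)
    qed
    ultimately show ?thesis
      unfolding tr sum_distrib_left by blast
  qed
  show ?thesis
  proof (rule that[of "1 / R"])
    show "1 / R > 0" using Rpos by simp
  qed (use main dt in \<open>auto simp: sums_iff\<close>)
qed

section \<open>Sums over finite sets of indices\<close>

lemma has_sum_sum:
  fixes f :: "'i \<Rightarrow> 'a \<Rightarrow> 'b::topological_comm_monoid_add"
  assumes "finite P" "\<And>p. p \<in> P \<Longrightarrow> (f p has_sum s p) A"
  shows "((\<lambda>x. \<Sum>p\<in>P. f p x) has_sum (\<Sum>p\<in>P. s p)) A"
  using assms by (induction P) (auto intro!: has_sum_add)

lemma abs_summable_prod_PiE: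
  fixes f :: "'a \<Rightarrow> 'b \<Rightarrow> complex"
  assumes fin: "finite A" and f: "\<And>x. x \<in> A \<Longrightarrow> f x abs_summable_on B x"
  shows "(\<lambda>g. \<Prod>x\<in>A. f x (g x)) abs_summable_on PiE A B"
    and "(\<Sum>\<^sub>\<infinity>g\<in>PiE A B. cmod (\<Prod>x\<in>A. f x (g x))) = (\<Prod>x\<in>A. \<Sum>\<^sub>\<infinity>y\<in>B x. cmod (f x y))"
proof -
  have eq: "(\<Sum>\<^sub>\<infinity>g\<in>PiE A B. \<Prod>x\<in>A. cmod (f x (g x))) = (\<Prod>x\<in>A. \<Sum>\<^sub>\<infinity>y\<in>B x. cmod (f x y))"
    by (rule infsum_prod_PiE_abs[OF fin]) (use f in auto)
  then show "(\<Sum>\<^sub>\<infinity>g\<in>PiE A B. cmod (\<Prod>x\<in>A. f x (g x))) = (\<Prod>x\<in>A. \<Sum>\<^sub>\<infinity>y\<in>B x. cmod (f x y))"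
    by (simp add: prod_norm)
  have "(\<lambda>g. \<Prod>x\<in>A. cmod (f x (g x))) summable_on PiE A B"
  \<comment> \<open>An \<open>infsum\<close> over a family that is not summable is 0, so a nonzero
    value in \<open>eq\<close> proves summability. If some factor on the right vanishes, all
    products on the left do.\<close>
  proof (cases "\<exists>x\<in>A. (\<Sum>\<^sub>\<infinity>y\<in>B x. cmod (f x y)) = 0")
    case True
    then obtain x where x: "x \<in> A" "(\<Sum>\<^sub>\<infinity>y\<in>B x. cmod (f x y)) = 0" by blast
    have "f x y = 0" if "y \<in> B x" for y
      using nonneg_infsum_le_0D[of "\<lambda>y. cmod (f x y)" "B x" y] f[OF x(1)] x(2) that by simp
    then have "(\<Prod>x\<in>A. cmod (f x (g x))) = 0" if "g \<in> PiE A B" for g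
      using that x fin by (intro prod_zero bexI[of _ x]) (auto simp: PiE_mem)
    then have "(\<lambda>g. \<Prod>x\<in>A. cmod (f x (g x))) summable_on PiE A B \<longleftrightarrow> (\<lambda>_. 0 :: real) summable_on PiE A B"
      by (intro summable_on_cong)
    then show ?thesis by simp
  next
    case False
    then have "(\<Sum>\<^sub>\<infinity>g\<in>PiE A B. \<Prod>x\<in>A. cmod (f x (g x))) \<noteq> 0"
      unfolding eq using fin by auto
    then show ?thesis using infsum_not_exists by blast
  qed
  then show "(\<lambda>g. \<Prod>x\<in>A. f x (g x)) abs_summable_on PiE A B"
    by (simp add: prod_norm)
qed

section \<open>Cauchy-Binet expansions and Sylvester's identity\<close>

lemma pminor_eq_rows:
  assumes fin: "finite F" and ij: "i \<in> F" "j \<in> F" "i \<noteq> j" and eq: "\<And>l. M i l = M j l"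
  shows "pminor M F = 0"
proof -
  define \<tau> where "\<tau> = Transposition.transpose i j"
  have \<tau>: "\<tau> permutes F" unfolding \<tau>_def using ij by (intro permutes_swap_id) auto
  have M\<tau>: "M (\<tau> e) l = M e l" for e l
    using eq by (auto simp: \<tau>_def Transposition.transpose_def)
  have "pminor M F = (\<Sum>p | p permutes F. of_int (sign (p \<circ> \<tau>)) * (\<Prod>e\<in>F. M e ((p \<circ> \<tau>) e)))"
    unfolding pminor_def by (rule sum_permutations_compose_right[OF \<tau>])
  also have "\<dots> = (\<Sum>p | p permutes F. - (of_int (sign p) * (\<Prod>e\<in>F. M e (p e))))"
  proof (intro sum.cong refl)
    fix p assume "p \<in> {p. p permutes F}"
    then have p: "p permutes F" by simp
    have "(\<Prod>e\<in>F. M e ((p \<circ> \<tau>) e)) = (\<Prod>e\<in>F. M (\<tau> e) (p (\<tau> e)))"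
      by (simp add: M\<tau>)
    also have "\<dots> = (\<Prod>e\<in>F. M e (p e))"
      using prod.permute[OF \<tau>, of "\<lambda>e. M e (p e)"] by (simp add: o_def)
    finally have "(\<Prod>e\<in>F. M e ((p \<circ> \<tau>) e)) = (\<Prod>e\<in>F. M e (p e))" .
    moreover have "sign (p \<circ> \<tau>) = - sign p"
      using sign_compose[OF permutes_imp_permutation[OF fin p] permutes_imp_permutation[OF fin \<tau>]] ij
      by (simp add: \<tau>_def sign_swap_id)
    ultimately show "of_int (sign (p \<circ> \<tau>)) * (\<Prod>e\<in>F. M e ((p \<circ> \<tau>) e)) =
        - (of_int (sign p) * (\<Prod>e\<in>F. M e (p e)))" by simp
  qed
  finally have "pminor M F = - pminor M F"
    by (simp add: pminor_def sum_negf)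
  then show ?thesis by simp
qed

abbreviation inj_maps :: "'a set \<Rightarrow> 'b set \<Rightarrow> ('a \<Rightarrow> 'b) set" where
  "inj_maps F Y \<equiv> {k \<in> F \<rightarrow>\<^sub>E Y. inj_on k F}"

text \<open>A Cauchy-Binet expansion for an infinite intermediate index set: the product of the sums
  over \<open>Y\<close> is multiplied out into a sum over maps k from \<open>F\<close> to
  \<open>Y\<close>. The maps that are not injective cancel, since they produce minors with two equal
  rows.\<close>

lemma pminor_inj_has_sum:
  fixes a :: "'a \<Rightarrow> 'b \<Rightarrow> complex" and b :: "'b \<Rightarrow> 'a \<Rightarrow> complex"
  assumes fin: "finite F"
    and ab: "\<And>e f. e \<in> F \<Longrightarrow> f \<in> F \<Longrightarrow> (\<lambda>k. a e k * b k f) abs_summable_on Y"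
  defines "t \<equiv> \<lambda>(k, p). of_int (sign p) * (\<Prod>e\<in>F. a e (k e) * b (k e) (p e))"
  shows "(t has_sum pminor (\<lambda>e f. \<Sum>\<^sub>\<infinity>k\<in>Y. a e k * b k f) F) (inj_maps F Y \<times> {p. p permutes F})"
    and "t abs_summable_on inj_maps F Y \<times> {p. p permutes F}"
    and "(\<Sum>\<^sub>\<infinity>x\<in>inj_maps F Y \<times> {p. p permutes F}. cmod (t x))
           \<le> (\<Sum>p | p permutes F. \<Prod>e\<in>F. \<Sum>\<^sub>\<infinity>k\<in>Y. cmod (a e k * b k (p e)))"
proof -
  let ?P = "{p. p permutes F}"
  have finP: "finite ?P" using fin by (rule finite_permutations)
  define m where "m p k = (\<Prod>e\<in>F. a e (k e) * b (k e) (p e))" for p k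
  have m: "m p abs_summable_on (F \<rightarrow>\<^sub>E Y)"
      "(\<Sum>\<^sub>\<infinity>k\<in>F \<rightarrow>\<^sub>E Y. cmod (m p k)) = (\<Prod>e\<in>F. \<Sum>\<^sub>\<infinity>k\<in>Y. cmod (a e k * b k (p e)))"
      "(\<Sum>\<^sub>\<infinity>k\<in>F \<rightarrow>\<^sub>E Y. m p k) = (\<Prod>e\<in>F. \<Sum>\<^sub>\<infinity>k\<in>Y. a e k * b k (p e))"
    if "p \<in> ?P" for p
  proof -
    have *: "(\<lambda>k. a e k * b k (p e)) abs_summable_on Y" if "e \<in> F" for e
      using ab[OF that, of "p e"] \<open>p \<in> ?P\<close> that by (simp add: permutes_in_image)
    show "m p abs_summable_on (F \<rightarrow>\<^sub>E Y)"
      "(\<Sum>\<^sub>\<infinity>k\<in>F \<rightarrow>\<^sub>E Y. cmod (m p k)) = (\<Prod>e\<in>F. \<Sum>\<^sub>\<infinity>k\<in>Y. cmod (a e k * b k (p e)))"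
      unfolding m_def
      using abs_summable_prod_PiE[OF fin, of "\<lambda>e k. a e k * b k (p e)" "\<lambda>_. Y"] * by auto
    show "(\<Sum>\<^sub>\<infinity>k\<in>F \<rightarrow>\<^sub>E Y. m p k) = (\<Prod>e\<in>F. \<Sum>\<^sub>\<infinity>k\<in>Y. a e k * b k (p e))"
      unfolding m_def by (rule infsum_prod_PiE_abs[OF fin]) (use * in auto)
  qed
  have minj: "m p abs_summable_on inj_maps F Y" if "p \<in> ?P" for p
    using m(1)[OF that] by (rule summable_on_subset) auto
  have cm: "cmod (t (k, p)) = cmod (m p k)" for k p
    by (simp add: t_def m_def norm_mult sign_def)
  have sw: "(\<lambda>(p, k). cmod (m p k)) summable_on ?P \<times> inj_maps F Y"
    using minj by (intro summable_on_SigmaI[where g = "\<lambda>p. \<Sum>\<^sub>\<infinity>k\<in>inj_maps F Y. cmod (m p k)"])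
      (auto intro!: summable_on_finite finP)
  have sw': "(\<lambda>(k, p). cmod (m p k)) summable_on inj_maps F Y \<times> ?P"
    using sw by (subst summable_on_swap) simp
  show abs: "t abs_summable_on inj_maps F Y \<times> ?P"
    using sw' by (rule summable_on_cong[THEN iffD1, rotated]) (auto simp: cm)
  have "(\<Sum>\<^sub>\<infinity>x\<in>inj_maps F Y \<times> ?P. cmod (t x)) = (\<Sum>\<^sub>\<infinity>(k, p)\<in>inj_maps F Y \<times> ?P. cmod (m p k))"
    by (rule infsum_cong) (auto simp: cm)
  also have "\<dots> = (\<Sum>\<^sub>\<infinity>p\<in>?P. \<Sum>\<^sub>\<infinity>k\<in>inj_maps F Y. cmod (m p k))"
    using sw' by (subst infsum_Sigma'_banach[symmetric]) (auto simp: infsum_swap_banach)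
  also have "\<dots> = (\<Sum>p\<in>?P. \<Sum>\<^sub>\<infinity>k\<in>inj_maps F Y. cmod (m p k))"
    by (simp add: finP)
  also have "\<dots> \<le> (\<Sum>p\<in>?P. \<Sum>\<^sub>\<infinity>k\<in>F \<rightarrow>\<^sub>E Y. cmod (m p k))"
    using m(1) minj by (intro sum_mono infsum_mono_neutral) auto
  also have "\<dots> = (\<Sum>p\<in>?P. \<Prod>e\<in>F. \<Sum>\<^sub>\<infinity>k\<in>Y. cmod (a e k * b k (p e)))"
    by (intro sum.cong m(2)) auto
  finally show "(\<Sum>\<^sub>\<infinity>x\<in>inj_maps F Y \<times> ?P. cmod (t x))
           \<le> (\<Sum>p | p permutes F. \<Prod>e\<in>F. \<Sum>\<^sub>\<infinity>k\<in>Y. cmod (a e k * b k (p e)))" .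
  \<comment> \<open>The cancellation takes place only after summation over the permutations, so it
    is used before the two sums are merged into one.\<close>
  have zero: "(\<Sum>p\<in>?P. of_int (sign p) * m p k) = 0" if ninj: "\<not> inj_on k F" for k
  proof -
    obtain i j where ij: "i \<in> F" "j \<in> F" "i \<noteq> j" "k i = k j"
      using ninj by (auto simp: inj_on_def)
    have "pminor (\<lambda>i. b (k i)) F = 0"
      by (rule pminor_eq_rows[OF fin ij(1-3)]) (simp add: ij)
    moreover have "(\<Sum>p\<in>?P. of_int (sign p) * m p k) = (\<Prod>e\<in>F. a e (k e)) * pminor (\<lambda>i. b (k i)) F"
      by (simp add: pminor_def m_def prod.distrib sum_distrib_left mult_ac)
    ultimately show ?thesis by simp
  qed
  have summ: "(\<lambda>k. of_int (sign p) * m p k) summable_on F \<rightarrow>\<^sub>E Y" if "p \<in> ?P" for p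
    using abs_summable_summable[OF m(1)[OF that]] by (rule summable_on_cmult_right)
  have "pminor (\<lambda>e f. \<Sum>\<^sub>\<infinity>k\<in>Y. a e k * b k f) F = (\<Sum>p\<in>?P. \<Sum>\<^sub>\<infinity>k\<in>F \<rightarrow>\<^sub>E Y. of_int (sign p) * m p k)"
    unfolding pminor_def
    by (intro sum.cong refl) (simp only: m(3)[symmetric] infsum_cmult_right')
  also have "\<dots> = (\<Sum>\<^sub>\<infinity>k\<in>F \<rightarrow>\<^sub>E Y. \<Sum>p\<in>?P. of_int (sign p) * m p k)"
    by (intro infsumI[symmetric] has_sum_sum finP has_sum_infsum summ)
  also have "\<dots> = (\<Sum>\<^sub>\<infinity>k\<in>inj_maps F Y. \<Sum>p\<in>?P. of_int (sign p) * m p k)"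
    using zero by (intro infsum_cong_neutral) auto
  also have "\<dots> = (\<Sum>\<^sub>\<infinity>k\<in>inj_maps F Y. \<Sum>\<^sub>\<infinity>p\<in>?P. t (k, p))"
    by (simp add: finP t_def m_def)
  also have "\<dots> = infsum t (inj_maps F Y \<times> ?P)"
    using abs_summable_summable[OF abs] by (subst infsum_Sigma'_banach) auto
  finally show "(t has_sum pminor (\<lambda>e f. \<Sum>\<^sub>\<infinity>k\<in>Y. a e k * b k f) F) (inj_maps F Y \<times> ?P)"
    using abs_summable_summable[OF abs] by (simp add: has_sum_infsum)
qed

abbreviation fin_subsets :: "'a set \<Rightarrow> 'a set set" where
  "fin_subsets X \<equiv> {F. finite F \<and> F \<subseteq> X}"

abbreviation inj_perms :: "'a set \<Rightarrow> 'b set \<Rightarrow> ('a set \<times> ('a \<Rightarrow> 'b) \<times> ('a \<Rightarrow> 'a)) set" where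
  "inj_perms X Y \<equiv> (SIGMA F:fin_subsets X. inj_maps F Y \<times> {p. p permutes F})"

text \<open>A triple describes closed chains alternating between the two index sets:
  \<open>e\<close> goes to \<open>k e\<close>, which goes to \<open>p e\<close>. The image reads the
  same chains from the other side: \<open>k e\<close> goes to \<open>p e\<close>, which goes to
  \<open>k (p e)\<close>.\<close>

definition swap_inj :: "'a set \<times> ('a \<Rightarrow> 'b) \<times> ('a \<Rightarrow> 'a) \<Rightarrow> 'b set \<times> ('b \<Rightarrow> 'a) \<times> ('b \<Rightarrow> 'b)" where
  "swap_inj = (\<lambda>(F, k, p). (k ` F, restrict (p \<circ> inv_into F k) (k ` F), map_permutation F k p))"

lemma swap_inj_in: "x \<in> inj_perms X Y \<Longrightarrow> swap_inj x \<in> inj_perms Y X"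
proof -
  assume "x \<in> inj_perms X Y"
  then obtain F k p where x: "x = (F, k, p)" "finite F" "F \<subseteq> X" "k \<in> F \<rightarrow>\<^sub>E Y" "inj_on k F" "p permutes F"
    by auto
  have "map_permutation F k p permutes k ` F"
    using x by (intro map_permutation_permutes inj_on_imp_bij_betw)
  moreover have "inj_on (restrict (p \<circ> inv_into F k) (k ` F)) (k ` F)"
    using permutes_inj[OF x(6)] x(5) by (auto simp: inj_on_def dest: injD)
  moreover have "p (inv_into F k (k e)) \<in> X" if "e \<in> F" for e
    using x that by (auto simp: permutes_in_image subset_iff)
  ultimately show ?thesis
    using x by (auto simp: swap_inj_def PiE_mem)
qed

text \<open>Moving the starting points of the chains twice is one step of \<open>p\<close>, which
  only permutes the starting points within \<open>F\<close>.\<close>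

lemma swap_inj_swap_inj:
  assumes "x \<in> inj_perms X Y"
  shows "swap_inj (swap_inj x) = x"
proof -
  obtain F k p where x: "x = (F, k, p)" "finite F" "F \<subseteq> X" "k \<in> F \<rightarrow>\<^sub>E Y" "inj_on k F" "p permutes F"
    using assms by auto
  define K where "K = k ` F"
  define i where "i = restrict (p \<circ> inv_into F k) K"
  define q where "q = map_permutation F k p"
  have ik: "i (k e) = p e" if "e \<in> F" for e
    using x that by (simp add: i_def K_def)
  have qk: "q (k e) = k (p e)" if "e \<in> F" for e
    using x that by (simp add: q_def map_permutation_apply)
  have pF: "p e \<in> F \<longleftrightarrow> e \<in> F" for e using x by (simp add: permutes_in_image)
  define r where "r = inv_into UNIV p"
  have r: "p (r e) = e" "r (p e) = e" for e using x by (simp_all add: r_def permutes_inverses)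
  have rF: "r e \<in> F \<longleftrightarrow> e \<in> F" for e using pF[of "r e"] r by simp
  have iK: "i ` K = F"
  proof -
    have "i ` K = p ` F" unfolding K_def image_image by (rule image_cong) (simp_all add: ik)
    then show ?thesis using x by (simp add: permutes_image)
  qed
  have inji: "inj_on i K"
    unfolding K_def inj_on_def using ik r x(5) by (auto) (metis r(2))
  have invi: "inv_into K i e = k (r e)" if "e \<in> F" for e
    using inv_into_f_f[OF inji, of "k (r e)"] that rF by (simp add: ik r K_def)
  have "swap_inj x = (K, i, q)"
    by (simp add: x(1) swap_inj_def K_def i_def q_def)
  moreover have "restrict (q \<circ> inv_into K i) F = k"
  proof
    fix e
    show "restrict (q \<circ> inv_into K i) F e = k e"
      using x(4) by (cases "e \<in> F") (auto simp: invi qk rF r PiE_def extensional_def)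
  qed
  moreover have "map_permutation K i q = p"
  proof
    fix e
    show "map_permutation K i q e = p e"
    proof (cases "e \<in> F")
      case True
      have "map_permutation K i q (i (k (r e))) = i (q (k (r e)))"
        using map_permutation_apply[OF inji, of "k (r e)" q] True rF by (simp add: K_def)
      then show ?thesis using True by (simp add: ik qk rF r)
    next
      case False
      then show ?thesis using x(6) iK
        by (simp add: map_permutation_def restrict_id_def permutes_not_in)
    qed
  qed
  ultimately have "swap_inj (K, i, q) = (F, k, p)"
    by (simp only: swap_inj_def prod.case iK)
  then show ?thesis
    using \<open>swap_inj x = (K, i, q)\<close> x(1) by metis
qed

lemma bij_betw_swap_inj: "bij_betw swap_inj (inj_perms X Y) (inj_perms Y X)"
proof (rule bij_betw_byWitness[where f' = swap_inj])
  show "\<forall>a\<in>inj_perms X Y. swap_inj (swap_inj a) = a" using swap_inj_swap_inj[where X = X and Y = Y] by blast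
  show "\<forall>a\<in>inj_perms Y X. swap_inj (swap_inj a) = a" using swap_inj_swap_inj[where X = Y and Y = X] by blast
  show "swap_inj ` inj_perms X Y \<subseteq> inj_perms Y X" using swap_inj_in[where X = X and Y = Y] by blast
  show "swap_inj ` inj_perms Y X \<subseteq> inj_perms X Y" using swap_inj_in[where X = Y and Y = X] by blast
qed

text \<open>Sylvester's identity $\det(1 + VP) = \det(1 + PV)$ for infinite matrices. Both sides are sums
  over pairs of injections between finite sets of indices of the two kinds.\<close>

lemma sylvester_pminor:
  fixes P :: "'b \<Rightarrow> 'a \<Rightarrow> complex" and V :: "'a \<Rightarrow> 'b \<Rightarrow> complex" and p q :: "'b \<Rightarrow> real"
  assumes PV: "\<And>k l. k \<in> Y \<Longrightarrow> l \<in> Y \<Longrightarrow> (\<lambda>e. P k e * V e l) abs_summable_on X"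
    and PV_le: "\<And>k l. k \<in> Y \<Longrightarrow> l \<in> Y \<Longrightarrow> (\<Sum>\<^sub>\<infinity>e\<in>X. cmod (P k e * V e l)) \<le> p k * q l"
    and VP: "\<And>e f. e \<in> X \<Longrightarrow> f \<in> X \<Longrightarrow> (\<lambda>k. V e k * P k f) abs_summable_on Y"
    and sum: "(\<lambda>K. fact (card K) * (\<Prod>k\<in>K. p k * q k)) summable_on fin_subsets Y"
  shows "(pminor (\<lambda>e f. \<Sum>\<^sub>\<infinity>k\<in>Y. V e k * P k f) has_sum
     (\<Sum>\<^sub>\<infinity>K\<in>fin_subsets Y. pminor (\<lambda>k l. \<Sum>\<^sub>\<infinity>e\<in>X. P k e * V e l) K)) (fin_subsets X)"
    and "pminor (\<lambda>k l. \<Sum>\<^sub>\<infinity>e\<in>X. P k e * V e l) summable_on fin_subsets Y"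
    and "\<And>K. K \<in> fin_subsets Y \<Longrightarrow>
       cmod (pminor (\<lambda>k l. \<Sum>\<^sub>\<infinity>e\<in>X. P k e * V e l) K) \<le> fact (card K) * (\<Prod>k\<in>K. p k * q k)"
proof -
  define t1 where "t1 = (\<lambda>(F, k, r). of_int (sign r) * (\<Prod>e\<in>F. V e (k e) * P (k e) (r e)))"
  define t2 where "t2 = (\<lambda>(K, i, r). of_int (sign r) * (\<Prod>k\<in>K. P k (i k) * V (i k) (r k)))"
  let ?MX = "\<lambda>e f. \<Sum>\<^sub>\<infinity>k\<in>Y. V e k * P k f"
  let ?MY = "\<lambda>k l. \<Sum>\<^sub>\<infinity>e\<in>X. P k e * V e l"
  have t2: "((\<lambda>x. t2 (K, x)) has_sum pminor ?MY K) (inj_maps K X \<times> {p. p permutes K})"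
    "(\<lambda>x. t2 (K, x)) abs_summable_on inj_maps K X \<times> {p. p permutes K}"
    "(\<Sum>\<^sub>\<infinity>x\<in>inj_maps K X \<times> {p. p permutes K}. cmod (t2 (K, x)))
        \<le> fact (card K) * (\<Prod>k\<in>K. p k * q k)"
    if K: "K \<in> fin_subsets Y" for K
  proof -
    have fin: "finite K" and *: "\<And>k l. k \<in> K \<Longrightarrow> l \<in> K \<Longrightarrow> (\<lambda>e. P k e * V e l) abs_summable_on X"
      using K PV by auto
    note h = pminor_inj_has_sum[OF fin *]
    have eq: "t2 (K, x) = (\<lambda>(i, r). of_int (sign r) * (\<Prod>k\<in>K. P k (i k) * V (i k) (r k))) x" for x
      by (simp add: t2_def case_prod_unfold)
    show "((\<lambda>x. t2 (K, x)) has_sum pminor ?MY K) (inj_maps K X \<times> {p. p permutes K})"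
      unfolding eq by (rule h(1))
    show "(\<lambda>x. t2 (K, x)) abs_summable_on inj_maps K X \<times> {p. p permutes K}"
      unfolding eq by (rule h(2))
    have "(\<Sum>\<^sub>\<infinity>x\<in>inj_maps K X \<times> {p. p permutes K}. cmod (t2 (K, x)))
        \<le> (\<Sum>r | r permutes K. \<Prod>k\<in>K. \<Sum>\<^sub>\<infinity>e\<in>X. cmod (P k e * V e (r k)))"
      unfolding eq by (rule h(3))
    also have "\<dots> \<le> (\<Sum>r | r permutes K. \<Prod>k\<in>K. p k * q k)"
    proof (rule sum_mono)
      fix r assume "r \<in> {r. r permutes K}"
      then have r: "r permutes K" by simp
      have "(\<Prod>k\<in>K. \<Sum>\<^sub>\<infinity>e\<in>X. cmod (P k e * V e (r k))) \<le> (\<Prod>k\<in>K. p k * q (r k))"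
        using K r by (intro prod_mono conjI infsum_nonneg PV_le) (auto simp: permutes_in_image)
      also have "\<dots> = (\<Prod>k\<in>K. p k * q k)"
        using prod.permute[OF r, of q] by (simp add: prod.distrib o_def)
      finally show "(\<Prod>k\<in>K. \<Sum>\<^sub>\<infinity>e\<in>X. cmod (P k e * V e (r k))) \<le> (\<Prod>k\<in>K. p k * q k)" .
    qed
    also have "\<dots> = fact (card K) * (\<Prod>k\<in>K. p k * q k)"
      using fin by (simp add: card_permutations)
    finally show "(\<Sum>\<^sub>\<infinity>x\<in>inj_maps K X \<times> {p. p permutes K}. cmod (t2 (K, x)))
        \<le> fact (card K) * (\<Prod>k\<in>K. p k * q k)" .
  qed
  have "(\<lambda>K. \<Sum>\<^sub>\<infinity>y\<in>inj_maps K X \<times> {p. p permutes K}. cmod (t2 (K, y))) abs_summable_on fin_subsets Y"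
  proof (rule Infinite_Sum.abs_summable_on_comparison_test'[OF sum])
    fix K assume "K \<in> fin_subsets Y"
    then show "norm (\<Sum>\<^sub>\<infinity>y\<in>inj_maps K X \<times> {p. p permutes K}. cmod (t2 (K, y)))
        \<le> fact (card K) * (\<Prod>k\<in>K. p k * q k)"
      using t2(3)[of K] by (simp add: infsum_nonneg)
  qed
  then have t2_abs: "t2 abs_summable_on inj_perms Y X"
    using t2(2) Infinite_Sum.abs_summable_on_Sigma_iff[of t2 "fin_subsets Y" "\<lambda>K. inj_maps K X \<times> {p. p permutes K}"]
    by blast
  have t2_sum: "(t2 has_sum infsum t2 (inj_perms Y X)) (inj_perms Y X)"
    using abs_summable_summable[OF t2_abs] by simp
  have MY: "(pminor ?MY has_sum infsum t2 (inj_perms Y X)) (fin_subsets Y)"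
    by (rule has_sum_SigmaD[OF t2_sum]) (rule t2)
  show "pminor ?MY summable_on fin_subsets Y" using MY by (rule has_sum_imp_summable)
  have D: "(\<Sum>\<^sub>\<infinity>K\<in>fin_subsets Y. pminor ?MY K) = infsum t2 (inj_perms Y X)"
    using MY by (rule infsumI)
  \<comment> \<open>The total over all triples exists absolutely, so it can be grouped by finite
    subsets of \<open>Y\<close> or, after \<open>swap_inj\<close>, by finite subsets of
    \<open>X\<close>. The two groupings are the two sides of the identity.\<close>
  have "((\<lambda>x. t2 (swap_inj x)) has_sum infsum t2 (inj_perms Y X)) (inj_perms X Y)"
    using t2_sum has_sum_reindex_bij_betw[OF bij_betw_swap_inj, of t2] by blast
  moreover have "t2 (swap_inj x) = t1 x" if "x \<in> inj_perms X Y" for x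
  proof -
    obtain F k r where x: "x = (F, k, r)" "finite F" "inj_on k F" "r permutes F"
      using \<open>x \<in> inj_perms X Y\<close> by auto
    let ?i = "restrict (r \<circ> inv_into F k) (k ` F)" and ?q = "map_permutation F k r"
    have "(\<Prod>l\<in>k ` F. P l (?i l) * V (?i l) (?q l)) = (\<Prod>e\<in>F. P (k e) (?i (k e)) * V (?i (k e)) (?q (k e)))"
      using x(3) by (simp add: prod.reindex)
    also have "\<dots> = (\<Prod>e\<in>F. P (k e) (r e) * V (r e) (k (r e)))"
      using x(3) by (intro prod.cong refl) (simp add: map_permutation_apply)
    also have "\<dots> = (\<Prod>e\<in>F. P (k e) (r e)) * (\<Prod>e\<in>F. V e (k e))"
      using prod.permute[OF x(4), of "\<lambda>e. V e (k e)"] by (simp add: prod.distrib o_def)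
    also have "\<dots> = (\<Prod>e\<in>F. V e (k e) * P (k e) (r e))"
      by (simp add: prod.distrib mult.commute)
    finally show ?thesis
      using sign_map_permutation[OF x(3,4,2)] by (simp add: x(1) t2_def t1_def swap_inj_def)
  qed
  ultimately have t1_sum: "(t1 has_sum infsum t2 (inj_perms Y X)) (inj_perms X Y)"
    by (subst (asm) has_sum_cong[where g = t1]) auto
  show "(pminor ?MX has_sum (\<Sum>\<^sub>\<infinity>K\<in>fin_subsets Y. pminor ?MY K)) (fin_subsets X)"
    unfolding D
  proof (rule has_sum_SigmaD[OF t1_sum])
    fix F assume F: "F \<in> fin_subsets X"
    have fin: "finite F" and *: "\<And>e f. e \<in> F \<Longrightarrow> f \<in> F \<Longrightarrow> (\<lambda>k. V e k * P k f) abs_summable_on Y"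
      using F VP by auto
    have eq: "t1 (F, x) = (\<lambda>(k, r). of_int (sign r) * (\<Prod>e\<in>F. V e (k e) * P (k e) (r e))) x" for x
      by (simp add: t1_def case_prod_unfold)
    show "((\<lambda>x. t1 (F, x)) has_sum pminor ?MX F) (inj_maps F Y \<times> {p. p permutes F})"
      unfolding eq by (rule pminor_inj_has_sum(1)[OF fin *])
  qed
  fix K assume K: "K \<in> fin_subsets Y"
  have "cmod (pminor ?MY K) \<le> (\<Sum>\<^sub>\<infinity>x\<in>inj_maps K X \<times> {p. p permutes K}. cmod (t2 (K, x)))"
    using norm_has_sum_bound[OF _ t2(1)[OF K]] t2(2)[OF K] has_sum_infsum by blast
  then show "cmod (pminor ?MY K) \<le> fact (card K) * (\<Prod>k\<in>K. p k * q k)"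
    using t2(3)[OF K] by linarith
qed

text \<open>The j-th smallest of finitely many distinct positive integers is at least j.\<close>

lemma fact_card_le_prod:
  assumes "finite K" "\<And>k. k \<in> K \<Longrightarrow> h k > (0 :: nat)" "inj_on h K"
  shows "fact (card K) \<le> (\<Prod>k\<in>K. h k)"
proof -
  have "fact (card A) \<le> \<Prod>A" if "finite A" "0 \<notin> A" for A :: "nat set"
    using that
  proof (induction A rule: finite_linorder_max_induct)
    case empty
    then show ?case by simp
  next
    case (insert b A)
    have "A \<subseteq> {1..<b}" using insert by (auto simp: Suc_le_eq intro: gr0I)
    then have "card A \<le> b - 1" using card_mono[of "{1..<b}" A] by simp
    then have "Suc (card A) \<le> b" using insert by (cases b) auto
    moreover have "b \<notin> A" using insert by auto
    moreover have "Suc (card A) * fact (card A) \<le> b * \<Prod>A"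
      using insert \<open>Suc (card A) \<le> b\<close> by (intro mult_mono) auto
    ultimately show ?case using insert(1) by simp
  qed
  from this[of "h ` K"] show ?thesis
    using assms by (fastforce simp: card_image prod.reindex)
qed

text \<open>The extra factor \<open>brk k\<close> pays for the number of permutations in a minor:
  indices in \<open>K\<close> have distinct codes, so the factorial is at most the product of the 2
  \<open>brk k\<close>. What is left is a sum of products over subsets, bounded by the product of
  the 1 + t k and hence by the exponential of the sum of the t k.\<close>

lemma summable_on_fact_prod:
  fixes s :: "int \<Rightarrow> real"
  assumes s: "\<And>k. s k \<ge> 0" and sum: "(\<lambda>k. brk k * s k) summable_on UNIV"
  shows "(\<lambda>K. fact (card K) * (\<Prod>k\<in>K. s k)) summable_on fin_subsets UNIV"
proof -
  define t where "t k = 2 * (brk k * s k)" for k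
  have t0: "t k \<ge> 0" for k using s by (simp add: t_def)
  have ts: "t summable_on UNIV" unfolding t_def using sum by (rule summable_on_cmult_right)
  have le: "fact (card K) * (\<Prod>k\<in>K. s k) \<le> (\<Prod>k\<in>K. t k)" if "finite K" for K
  proof -
    \<comment> \<open>Codes of integers are at most twice the absolute value; \<open>Suc\<close>
      makes them positive.\<close>
    let ?h = "\<lambda>k. Suc (int_encode k)"
    have "fact (card K) \<le> (\<Prod>k\<in>K. ?h k)"
      using that by (intro fact_card_le_prod) (auto simp: inj_on_def int_encode_eq)
    then have "fact (card K) \<le> (\<Prod>k\<in>K. real (?h k))"
      by (metis of_nat_fact of_nat_mono of_nat_prod)
    also have "\<dots> \<le> (\<Prod>k\<in>K. 2 * brk k)"
      by (intro prod_mono) (auto simp: int_encode_def sum_encode_def)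
    finally have "fact (card K) * (\<Prod>k\<in>K. s k) \<le> (\<Prod>k\<in>K. 2 * brk k) * (\<Prod>k\<in>K. s k)"
      using s by (intro mult_right_mono prod_nonneg) auto
    then show ?thesis by (simp add: t_def prod.distrib mult_ac)
  qed
  show ?thesis
  proof (rule nonneg_bdd_above_summable_on)
    show "0 \<le> fact (card K) * (\<Prod>k\<in>K. s k)" for K using s by (intro mult_nonneg_nonneg prod_nonneg) auto
    show "bdd_above (sum (\<lambda>K. fact (card K) * (\<Prod>k\<in>K. s k)) ` {\<F>. \<F> \<subseteq> fin_subsets UNIV \<and> finite \<F>})"
    proof (rule bdd_aboveI2)
      fix \<F> :: "int set set" assume \<F>: "\<F> \<in> {\<F>. \<F> \<subseteq> fin_subsets UNIV \<and> finite \<F>}"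
      define W where "W = \<Union>\<F>"
      have W: "finite W" "\<F> \<subseteq> Pow W" using \<F> by (auto simp: W_def)
      have "(\<Sum>K\<in>\<F>. fact (card K) * (\<Prod>k\<in>K. s k)) \<le> (\<Sum>K\<in>\<F>. \<Prod>k\<in>K. t k)"
        using \<F> by (intro sum_mono le) auto
      also have "\<dots> \<le> (\<Sum>K\<in>Pow W. \<Prod>k\<in>K. t k)"
        using W t0 by (intro sum_mono2) (auto intro: prod_nonneg)
      also have "\<dots> = (\<Prod>k\<in>W. t k + 1)"
        using prod_add[OF W(1), of t "\<lambda>_. 1"] by simp
      also have "\<dots> \<le> (\<Prod>k\<in>W. exp (t k))"
        using t0 by (intro prod_mono conjI) (auto simp: add.commute exp_ge_add_one_self)
      also have "\<dots> = exp (\<Sum>k\<in>W. t k)" using W by (simp add: exp_sum)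
      also have "\<dots> \<le> exp (infsum t UNIV)"
        using finite_sum_le_infsum[OF ts W(1)] t0 by simp
      finally show "(\<Sum>K\<in>\<F>. fact (card K) * (\<Prod>k\<in>K. s k)) \<le> exp (infsum t UNIV)" .
    qed
  qed
qed

section \<open>Fredholm determinants on Hilbert function spaces\<close>

context hilbert_function_space
begin

lemma addH [simp]: "f \<in> H \<Longrightarrow> g \<in> H \<Longrightarrow> f + g \<in> H"
  using subspace by (rule cfun.subspace_add)

lemma diffH [simp]: "f \<in> H \<Longrightarrow> g \<in> H \<Longrightarrow> f - g \<in> H"
  using subspace by (rule cfun.subspace_diff)

lemma scaleH [simp]: "f \<in> H \<Longrightarrow> cscale c f \<in> H"
  using subspace by (rule cfun.subspace_scale)

lemma zeroH [simp]: "0 \<in> H"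
  using subspace by (rule cfun.subspace_0)

lemma sumH [simp]: "(\<And>i. i \<in> A \<Longrightarrow> f i \<in> H) \<Longrightarrow> sum f A \<in> H"
  using subspace by (rule cfun.subspace_sum)

lemma ip_zero_left [simp]: "g \<in> H \<Longrightarrow> ip 0 g = 0"
  using ip_add[of 0 0 g] by simp

lemma ip_zero_right [simp]: "g \<in> H \<Longrightarrow> ip g 0 = 0"
  using ip_cnj[of g 0] by simp

lemma ip_add_right: "f \<in> H \<Longrightarrow> g \<in> H \<Longrightarrow> h \<in> H \<Longrightarrow> ip h (f + g) = ip h f + ip h g"
  using ip_cnj[of h "f + g"] ip_cnj[of f h] ip_cnj[of g h] by (simp add: ip_add)

lemma ip_scale_right: "f \<in> H \<Longrightarrow> g \<in> H \<Longrightarrow> ip g (cscale c f) = cnj c * ip g f"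
  using ip_cnj[of g "cscale c f"] ip_cnj[of f g] by (simp add: ip_scale)

lemma uminusH [simp]: "f \<in> H \<Longrightarrow> - f \<in> H"
  using subspace by (rule cfun.subspace_neg)

lemma ip_minus_left [simp]: "f \<in> H \<Longrightarrow> g \<in> H \<Longrightarrow> ip (- f) g = - ip f g"
  using ip_scale[of f g "- 1"] by simp

lemma ip_minus_right [simp]: "f \<in> H \<Longrightarrow> g \<in> H \<Longrightarrow> ip g (- f) = - ip g f"
  using ip_scale_right[of f g "- 1"] by simp

lemma ip_diff_left: "f \<in> H \<Longrightarrow> g \<in> H \<Longrightarrow> h \<in> H \<Longrightarrow> ip (f - g) h = ip f h - ip g h"
  using ip_add[of f "- g" h] by simp

lemma ip_diff_right: "f \<in> H \<Longrightarrow> g \<in> H \<Longrightarrow> h \<in> H \<Longrightarrow> ip h (f - g) = ip h f - ip h g"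
  using ip_add_right[of f "- g" h] by simp

lemma ip_sum_left: "(\<And>i. i \<in> A \<Longrightarrow> f i \<in> H) \<Longrightarrow> g \<in> H \<Longrightarrow> ip (sum f A) g = (\<Sum>i\<in>A. ip (f i) g)"
  by (induction A rule: infinite_finite_induct) (simp_all add: ip_add)

lemma ip_sum_right: "(\<And>i. i \<in> A \<Longrightarrow> f i \<in> H) \<Longrightarrow> g \<in> H \<Longrightarrow> ip g (sum f A) = (\<Sum>i\<in>A. ip g (f i))"
  by (induction A rule: infinite_finite_induct) (simp_all add: ip_add_right)

lemma ip_self_nonneg: "f \<in> H \<Longrightarrow> Re (ip f f) \<ge> 0"
  using ip_pos[of f] by (cases "f = 0") auto

lemma hnorm_nonneg [simp]: "f \<in> H \<Longrightarrow> hnorm ip f \<ge> 0"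
  by (simp add: hnorm_def ip_self_nonneg)

lemma hnorm_sq: "f \<in> H \<Longrightarrow> (hnorm ip f)\<^sup>2 = Re (ip f f)"
  by (simp add: hnorm_def ip_self_nonneg)

lemma ip_self: "f \<in> H \<Longrightarrow> ip f f = of_real ((hnorm ip f)\<^sup>2)"
  using arg_cong[OF ip_cnj[of f f], of Im] by (simp add: hnorm_sq complex_eq_iff)

lemma hnorm_zero [simp]: "hnorm ip 0 = 0"
  by (simp add: hnorm_def)

lemma hnorm_eq_0 [simp]: "f \<in> H \<Longrightarrow> hnorm ip f = 0 \<longleftrightarrow> f = 0"
  using ip_pos[of f] by (cases "f = 0") (auto simp: hnorm_def)

lemma hnorm_scale: "f \<in> H \<Longrightarrow> hnorm ip (cscale c f) = cmod c * hnorm ip f"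
proof -
  assume f: "f \<in> H"
  have "ip (cscale c f) (cscale c f) = of_real ((cmod c)\<^sup>2) * ip f f"
    using f by (simp only: ip_scale ip_scale_right scaleH complex_norm_square mult_ac)
  then show ?thesis
    by (simp add: hnorm_def real_sqrt_mult)
qed

lemma hdist_eq: "f \<in> H \<Longrightarrow> g \<in> H \<Longrightarrow> hdist H ip f g = hnorm ip (f - g)"
  by (simp add: hdist_def)

sublocale M: Metric_space H "hdist H ip"
  by (rule Metric_space_hdist)

lemma hnorm_minus_commute: "f \<in> H \<Longrightarrow> g \<in> H \<Longrightarrow> hnorm ip (f - g) = hnorm ip (g - f)"
  using M.commute[of f g] by (simp add: hdist_eq)

lemma hnorm_triangle: "f \<in> H \<Longrightarrow> g \<in> H \<Longrightarrow> hnorm ip (f + g) \<le> hnorm ip f + hnorm ip g"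
  using M.triangle[of "f + g" g 0] by (simp add: hdist_eq)

lemma hnorm_triangle_diff: "f \<in> H \<Longrightarrow> g \<in> H \<Longrightarrow> hnorm ip (f - g) \<le> hnorm ip f + hnorm ip g"
  using hnorm_triangle[of f "- g"] by (simp add: hnorm_def)

lemma hnorm_sum: "(\<And>i. i \<in> A \<Longrightarrow> f i \<in> H) \<Longrightarrow> hnorm ip (sum f A) \<le> (\<Sum>i\<in>A. hnorm ip (f i))"
proof (induction A rule: infinite_finite_induct)
  case (insert i A)
  then have "hnorm ip (f i + sum f A) \<le> hnorm ip (f i) + hnorm ip (sum f A)"
    by (intro hnorm_triangle) auto
  also have "\<dots> \<le> hnorm ip (f i) + (\<Sum>i\<in>A. hnorm ip (f i))"
    using insert by auto
  finally show ?case
    unfolding sum.insert[OF insert(1,2)] .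
qed auto

lemma cauchy_schwarz:
  assumes "f \<in> H" "g \<in> H"
  shows "cmod (ip f g) \<le> hnorm ip f * hnorm ip g"
proof (cases "g = 0")
  case False
  define c where "c = ip f g / ip g g"
  have gg: "ip g g = of_real ((hnorm ip g)\<^sup>2)" "hnorm ip g > 0"
    using assms False ip_self hnorm_nonneg[of g] hnorm_eq_0[of g] by (auto simp: less_le)
  have "0 \<le> Re (ip (f - cscale c g) (f - cscale c g))"
    using assms by (intro ip_self_nonneg) auto
  also have "ip (f - cscale c g) (f - cscale c g) =
      ip f f - cnj c * ip f g - c * ip g f + c * cnj c * ip g g"
    using assms by (simp add: ip_diff_left ip_diff_right ip_scale ip_scale_right algebra_simps)
  also have "\<dots> = ip f f - cnj (ip f g) * ip f g / ip g g"
    using gg ip_cnj[OF assms(2,1)] by (simp add: c_def field_simps)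
  also have "cnj (ip f g) * ip f g = of_real ((cmod (ip f g))\<^sup>2)"
    by (metis complex_norm_square mult.commute)
  finally have "0 \<le> (hnorm ip f)\<^sup>2 - (cmod (ip f g))\<^sup>2 / (hnorm ip g)\<^sup>2"
    using gg assms by (simp add: ip_self flip: of_real_power of_real_divide of_real_diff del: of_real_power)
  then have "(cmod (ip f g))\<^sup>2 \<le> (hnorm ip f * hnorm ip g)\<^sup>2"
    using gg by (simp add: field_simps power_mult_distrib)
  then show ?thesis
    using assms by (simp add: power2_le_iff_abs_le)
qed (use assms in auto)

lemma closure_of_iff:
  assumes "S \<subseteq> H"
  shows "f \<in> htop H ip closure_of S \<longleftrightarrow> f \<in> H \<and> (\<forall>\<epsilon>>0. \<exists>g\<in>S. hnorm ip (f - g) < \<epsilon>)"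
  using assms by (auto simp: M.metric_closure_of hdist_def) fast+


end

section \<open>Bessel's inequality and Parseval's identity\<close>

context hilbert_function_space
begin

text \<open>Completing the square serves two purposes: Bessel's inequality, and the fact that the
  coefficients \<open>ip u e\<close> give the best approximation along F.\<close>

lemma orthonormal_expand:
  assumes B: "F \<subseteq> H" "\<forall>e\<in>F. \<forall>f\<in>F. ip e f = (if e = f then 1 else 0)" and fin: "finite F" and u: "u \<in> H"
  shows "(hnorm ip (u - (\<Sum>e\<in>F. cscale (c e) e)))\<^sup>2 =
    (hnorm ip u)\<^sup>2 - (\<Sum>e\<in>F. (cmod (ip u e))\<^sup>2) + (\<Sum>e\<in>F. (cmod (ip u e - c e))\<^sup>2)"
proof -
  let ?g = "\<Sum>e\<in>F. cscale (c e) e"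
  have FH: "e \<in> F \<Longrightarrow> e \<in> H" for e using B(1) by blast
  have g: "?g \<in> H" using FH by auto
  have ug: "ip u ?g = (\<Sum>e\<in>F. cnj (c e) * ip u e)"
    using u FH by (simp add: ip_sum_right ip_scale_right)
  have gu: "ip ?g u = (\<Sum>e\<in>F. c e * cnj (ip u e))"
    unfolding ip_cnj[OF g u] ug by (simp add: cnj_sum)
  have eg: "ip e ?g = cnj (c e)" if "e \<in> F" for e
  proof -
    have "ip e ?g = (\<Sum>f\<in>F. cnj (c f) * ip e f)"
      using that FH by (simp add: ip_sum_right ip_scale_right)
    also have "\<dots> = (\<Sum>f\<in>F. if f = e then cnj (c f) else 0)"
      using that B(2) by (intro sum.cong) auto
    finally show ?thesis using fin that by simp
  qed
  have gg: "ip ?g ?g = (\<Sum>e\<in>F. c e * cnj (c e))"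
    using g FH by (simp add: ip_sum_left ip_scale eg)
  have "ip (u - ?g) (u - ?g) = ip u u - (\<Sum>e\<in>F. ip u e * cnj (ip u e))
      + (\<Sum>e\<in>F. (ip u e - c e) * cnj (ip u e - c e))"
    using u g by (simp add: ip_diff_left ip_diff_right ug gu gg algebra_simps sum_subtractf sum.distrib)
  then have "complex_of_real ((hnorm ip (u - ?g))\<^sup>2) = of_real ((hnorm ip u)\<^sup>2 - (\<Sum>e\<in>F. (cmod (ip u e))\<^sup>2)
      + (\<Sum>e\<in>F. (cmod (ip u e - c e))\<^sup>2))"
    unfolding ip_self[OF u] ip_self[OF diffH[OF u g]] complex_norm_square[symmetric]
    by (simp only: of_real_sum of_real_diff of_real_add)
  then show ?thesis
    using of_real_eq_iff by blast
qed

lemma bessel: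
  assumes B: "F \<subseteq> H" "\<forall>e\<in>F. \<forall>f\<in>F. ip e f = (if e = f then 1 else 0)" and fin: "finite F" and u: "u \<in> H"
  shows "(\<Sum>e\<in>F. (cmod (ip u e))\<^sup>2) \<le> (hnorm ip u)\<^sup>2"
proof -
  have "0 \<le> (hnorm ip u)\<^sup>2 - (\<Sum>e\<in>F. (cmod (ip u e))\<^sup>2) + (\<Sum>e\<in>F. (cmod (ip u e - ip u e))\<^sup>2)"
    unfolding orthonormal_expand[OF assms, of "ip u", symmetric] by (rule zero_le_power2)
  then show ?thesis by simp
qed

context
  fixes B assumes B: "orthonormal_basis H ip B"
begin

lemma basis_sub: "F \<subseteq> B \<Longrightarrow> F \<subseteq> H" "F \<subseteq> B \<Longrightarrow> \<forall>e\<in>F. \<forall>f\<in>F. ip e f = (if e = f then 1 else 0)"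
  using B unfolding orthonormal_basis_def by (blast, meson subsetD)

lemma basis_span: "cfun.span B \<subseteq> H" "htop H ip closure_of (cfun.span B) = H"
  using B subspace unfolding orthonormal_basis_def by (meson cfun.span_minimal, blast)

text \<open>A vector of the span that is close to \<open>u\<close> involves a finite set
  \<open>F0\<close> only, and for every larger F the best approximation along F is at least as
  close.\<close>

lemma basis_approx:
  assumes u: "u \<in> H" and \<epsilon>: "\<epsilon> > 0"
  shows "\<forall>\<^sub>F F in finite_subsets_at_top B. hnorm ip (u - (\<Sum>e\<in>F. cscale (ip u e) e)) < \<epsilon>"
proof -
  obtain g where g: "g \<in> cfun.span B" "hnorm ip (u - g) < \<epsilon>"
    using closure_of_iff[OF basis_span(1), of u] basis_span(2) u \<epsilon> by blast
  then have gH: "g \<in> H" using basis_span(1) by blast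
  from g(1) obtain F0 c0 where F0: "finite F0" "F0 \<subseteq> B" "g = (\<Sum>e\<in>F0. cscale (c0 e) e)"
    unfolding cfun.span_explicit by auto
  have "hnorm ip (u - (\<Sum>e\<in>F. cscale (ip u e) e)) < \<epsilon>" if F: "finite F" "F0 \<subseteq> F" "F \<subseteq> B" for F
  proof -
    define c where "c e = (if e \<in> F0 then c0 e else 0)" for e
    have "g = (\<Sum>e\<in>F. cscale (c e) e)"
      unfolding F0(3) using F by (intro sum.mono_neutral_cong_left) (auto simp: c_def cscale_def fun_eq_iff)
    moreover note ex = orthonormal_expand[OF basis_sub[OF F(3)] F(1) u]
    ultimately have "(hnorm ip (u - (\<Sum>e\<in>F. cscale (ip u e) e)))\<^sup>2 \<le> (hnorm ip (u - g))\<^sup>2"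
      using ex[of "ip u"] ex[of c] by (simp add: sum_nonneg)
    then have "hnorm ip (u - (\<Sum>e\<in>F. cscale (ip u e) e)) \<le> hnorm ip (u - g)"
      by (rule power2_le_imp_le) (intro hnorm_nonneg diffH u gH)
    then show ?thesis using g(2) by simp
  qed
  then show ?thesis
    unfolding eventually_finite_subsets_at_top using F0 by blast
qed

lemma parseval:
  assumes u: "u \<in> H" and v: "v \<in> H"
  shows "((\<lambda>e. ip u e * ip e v) has_sum ip u v) B"
  unfolding has_sum_def tendsto_iff
proof (intro allI impI)
  fix \<epsilon> :: real assume \<epsilon>: "\<epsilon> > 0"
  have pos: "hnorm ip v + 1 > 0" using v by (simp add: add_nonneg_pos)
  have "\<forall>\<^sub>F F in finite_subsets_at_top B. hnorm ip (u - (\<Sum>e\<in>F. cscale (ip u e) e)) < \<epsilon> / (hnorm ip v + 1)"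
    using \<epsilon> pos by (intro basis_approx[OF u]) auto
  moreover have "\<forall>\<^sub>F F in finite_subsets_at_top B. finite F \<and> F \<subseteq> B"
    by (simp add: eventually_finite_subsets_at_top) blast
  ultimately show "\<forall>\<^sub>F F in finite_subsets_at_top B. dist (\<Sum>e\<in>F. ip u e * ip e v) (ip u v) < \<epsilon>"
  proof eventually_elim
    case (elim F)
    have FH: "e \<in> F \<Longrightarrow> e \<in> H" for e using basis_sub(1)[of F] elim(2) by blast
    let ?P = "\<Sum>e\<in>F. cscale (ip u e) e"
    have P: "?P \<in> H" using FH by auto
    have "ip (u - ?P) v = ip u v - (\<Sum>e\<in>F. ip u e * ip e v)"
      using u v P FH by (simp add: ip_diff_left ip_sum_left ip_scale)
    then have "cmod (ip u v - (\<Sum>e\<in>F. ip u e * ip e v)) \<le> hnorm ip (u - ?P) * hnorm ip v"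
      using cauchy_schwarz[of "u - ?P" v] u v P by simp
    also have "\<dots> \<le> hnorm ip (u - ?P) * (hnorm ip v + 1)"
      using u P by (intro mult_left_mono) auto
    also have "\<dots> < \<epsilon>" using elim pos by (simp add: field_simps)
    finally show ?case by (simp add: dist_norm norm_minus_commute)
  qed
qed

lemma parseval_abs:
  assumes u: "u \<in> H" and v: "v \<in> H"
  shows "(\<lambda>e. ip u e * ip e v) abs_summable_on B"
    and "(\<Sum>\<^sub>\<infinity>e\<in>B. cmod (ip u e * ip e v)) \<le> hnorm ip u * hnorm ip v"
proof -
  show s: "(\<lambda>e. ip u e * ip e v) abs_summable_on B"
    by (rule summable_on_iff_abs_summable_on_complex[THEN iffD1, OF has_sum_imp_summable[OF parseval[OF u v]]])
  show "(\<Sum>\<^sub>\<infinity>e\<in>B. cmod (ip u e * ip e v)) \<le> hnorm ip u * hnorm ip v"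
  proof (rule infsum_le_finite_sums[OF s])
    fix F assume F: "finite F" "F \<subseteq> B"
    have FH: "e \<in> F \<Longrightarrow> e \<in> H" for e using basis_sub(1)[of F] F(2) by blast
    have l2: "L2_set (\<lambda>e. cmod (ip w e)) F \<le> hnorm ip w" if "w \<in> H" for w
      unfolding L2_set_def using bessel[OF basis_sub[OF F(2)] F(1) that] that
      by (intro real_le_lsqrt) (auto intro: sum_nonneg)
    have "(\<Sum>e\<in>F. cmod (ip u e * ip e v)) = (\<Sum>e\<in>F. \<bar>cmod (ip u e)\<bar> * \<bar>cmod (ip v e)\<bar>)"
    proof (intro sum.cong refl)
      fix e assume "e \<in> F"
      then show "cmod (ip u e * ip e v) = \<bar>cmod (ip u e)\<bar> * \<bar>cmod (ip v e)\<bar>"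
        using ip_cnj[OF FH v, of e] by (simp add: norm_mult)
    qed
    also have "\<dots> \<le> L2_set (\<lambda>e. cmod (ip u e)) F * L2_set (\<lambda>e. cmod (ip v e)) F"
      by (rule L2_set_mult_ineq)
    also have "\<dots> \<le> hnorm ip u * hnorm ip v"
      using l2 u v by (intro mult_mono) auto
    finally show "(\<Sum>e\<in>F. cmod (ip u e * ip e v)) \<le> hnorm ip u * hnorm ip v" .
  qed
qed

end

text \<open>\<open>A\<close> is the sum of the rank one operators mapping \<open>f\<close> to
  \<open>ip f (v k)\<close> times \<open>u k\<close>. In an orthonormal basis its matrix is a
  product V P with intermediate index k, and Sylvester's identity replaces it by P V. By Parseval
  the entries of P V are the \<open>ip (u k) (v l)\<close>, which no longer mention the
  basis.\<close>

lemma fredholm_det_nuclear: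
  fixes u v :: "int \<Rightarrow> 'x \<Rightarrow> complex"
  assumes basis: "orthonormal_basis H ip B0"
    and u: "\<And>k. u k \<in> H" and v: "\<And>k. v k \<in> H"
    and A: "\<And>f g. f \<in> H \<Longrightarrow> g \<in> H \<Longrightarrow> ((\<lambda>k. ip f (v k) * ip (u k) g) has_sum ip (A f) g) UNIV"
    and sum: "(\<lambda>k. brk k * (hnorm ip (u k) * hnorm ip (v k))) summable_on UNIV"
  shows "fredholm_det H ip A = (\<Sum>\<^sub>\<infinity>K\<in>fin_subsets UNIV. pminor (\<lambda>k l. ip (u k) (v l)) K)"
proof -
  let ?D = "\<Sum>\<^sub>\<infinity>K\<in>fin_subsets UNIV. pminor (\<lambda>k l. ip (u k) (v l)) K"
  have "(principal_minor ip A has_sum ?D) {F. finite F \<and> F \<subseteq> B}" if B: "orthonormal_basis H ip B" for B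
  proof -
    have BH: "e \<in> B \<Longrightarrow> e \<in> H" for e using B by (auto simp: orthonormal_basis_def)
    have "(pminor (\<lambda>e f. \<Sum>\<^sub>\<infinity>k\<in>UNIV. ip e (v k) * ip (u k) f) has_sum
       (\<Sum>\<^sub>\<infinity>K\<in>fin_subsets UNIV. pminor (\<lambda>k l. \<Sum>\<^sub>\<infinity>e\<in>B. ip (u k) e * ip e (v l)) K)) (fin_subsets B)"
    proof (rule sylvester_pminor(1))
      show "(\<lambda>e. ip (u k) e * ip e (v l)) abs_summable_on B" for k l
        by (rule parseval_abs[OF B u v])
      show "(\<Sum>\<^sub>\<infinity>e\<in>B. cmod (ip (u k) e * ip e (v l))) \<le> hnorm ip (u k) * hnorm ip (v l)" for k l
        by (rule parseval_abs[OF B u v])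
      show "(\<lambda>k. ip e (v k) * ip (u k) f) abs_summable_on UNIV" if "e \<in> B" "f \<in> B" for e f
        by (rule summable_on_iff_abs_summable_on_complex[THEN iffD1, OF has_sum_imp_summable[OF A[OF BH BH, OF that]]])
      show "(\<lambda>K. fact (card K) * (\<Prod>k\<in>K. hnorm ip (u k) * hnorm ip (v k))) summable_on fin_subsets UNIV"
        using u v by (intro summable_on_fact_prod sum) auto
    qed
    moreover have "pminor (\<lambda>e f. \<Sum>\<^sub>\<infinity>k\<in>UNIV. ip e (v k) * ip (u k) f) F = principal_minor ip A F"
      if "F \<in> fin_subsets B" for F
    proof -
      have "pminor (\<lambda>e f. \<Sum>\<^sub>\<infinity>k\<in>UNIV. ip e (v k) * ip (u k) f) F = pminor (\<lambda>e f. ip (A e) f) F"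
        using that BH by (intro pminor_cong infsumI A) auto
      then show ?thesis by (simp add: pminor_def principal_minor_def)
    qed
    moreover have "(\<Sum>\<^sub>\<infinity>e\<in>B. ip (u k) e * ip e (v l)) = ip (u k) (v l)" for k l
      by (rule infsumI[OF parseval[OF B u v]])
    ultimately show ?thesis
      by (subst (asm) has_sum_cong[where g = "principal_minor ip A"]) auto
  qed
  \<comment> \<open>The basis \<open>B0\<close> ensures uniqueness in \<open>THE\<close>: without
    any orthonormal basis the condition on the value would be vacuous.\<close>
  then show ?thesis
    unfolding fredholm_det_def using basis has_sum_unique by (intro the_equality) blast+
qed

end

section \<open>Spaces with orthonormal coordinates\<close>

text \<open>A copy of the sequence space l2 over the integers inside a space of functions. The inner
  product \<open>cip\<close> is transported from l2, so that the coordinates become orthonormal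
  ones.\<close>

locale coord_space =
  fixes H :: "('x \<Rightarrow> complex) set" and crd :: "('x \<Rightarrow> complex) \<Rightarrow> int \<Rightarrow> complex"
  assumes sub: "cfun.subspace H"
    and crd_add: "f \<in> H \<Longrightarrow> g \<in> H \<Longrightarrow> crd (f + g) n = crd f n + crd g n"
    and crd_scale: "f \<in> H \<Longrightarrow> crd (cscale c f) n = c * crd f n"
    and crd_inj: "f \<in> H \<Longrightarrow> (\<And>n. crd f n = 0) \<Longrightarrow> f = 0"
    and crd_sq: "f \<in> H \<Longrightarrow> (\<lambda>n. (cmod (crd f n))\<^sup>2) summable_on UNIV"
    and crd_surj: "(\<lambda>n. (cmod (x n))\<^sup>2) summable_on UNIV \<Longrightarrow> \<exists>f\<in>H. \<forall>n. crd f n = x n"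
begin

definition cip :: "('x \<Rightarrow> complex) \<Rightarrow> ('x \<Rightarrow> complex) \<Rightarrow> complex" where
  "cip f g = (\<Sum>\<^sub>\<infinity>n. crd f n * cnj (crd g n))"

lemma add_in: "f \<in> H \<Longrightarrow> g \<in> H \<Longrightarrow> f + g \<in> H"
  using sub by (rule cfun.subspace_add)

lemma diff_in: "f \<in> H \<Longrightarrow> g \<in> H \<Longrightarrow> f - g \<in> H"
  using sub by (rule cfun.subspace_diff)

lemma crd_zero [simp]: "crd 0 n = 0"
  using crd_scale[of 0 0 n] cfun.subspace_0[OF sub] by simp

lemma crd_minus: "f \<in> H \<Longrightarrow> crd (- f) n = - crd f n"
  using crd_scale[of f "- 1" n] by simp

lemma crd_diff: "f \<in> H \<Longrightarrow> g \<in> H \<Longrightarrow> crd (f - g) n = crd f n - crd g n"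
  using crd_add[of f "- g" n] crd_minus[of g n] cfun.subspace_neg[OF sub, of g] by simp

lemma crd_sum: "(\<And>i. i \<in> A \<Longrightarrow> f i \<in> H) \<Longrightarrow> crd (sum f A) n = (\<Sum>i\<in>A. crd (f i) n)"
  by (induction A rule: infinite_finite_induct) (simp_all add: crd_add cfun.subspace_sum[OF sub])

lemma crd_prod_abs:
  assumes "f \<in> H" "g \<in> H"
  shows "(\<lambda>n. crd f n * cnj (crd g n)) abs_summable_on UNIV"
proof (rule Infinite_Sum.abs_summable_on_comparison_test')
  show "(\<lambda>n. (cmod (crd f n))\<^sup>2 + (cmod (crd g n))\<^sup>2) summable_on UNIV"
    using assms by (intro summable_on_add crd_sq)
  fix n
  have "2 * (cmod (crd f n) * cmod (crd g n)) \<le> (cmod (crd f n))\<^sup>2 + (cmod (crd g n))\<^sup>2"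
    using sum_squares_bound[of "cmod (crd f n)" "cmod (crd g n)"] by simp
  moreover have "0 \<le> cmod (crd f n) * cmod (crd g n)" by simp
  ultimately show "norm (crd f n * cnj (crd g n)) \<le> (cmod (crd f n))\<^sup>2 + (cmod (crd g n))\<^sup>2"
    unfolding norm_mult complex_mod_cnj by linarith
qed

lemma crd_prod: "f \<in> H \<Longrightarrow> g \<in> H \<Longrightarrow> (\<lambda>n. crd f n * cnj (crd g n)) summable_on UNIV"
  by (rule abs_summable_summable[OF crd_prod_abs])

lemma cip_self: "f \<in> H \<Longrightarrow> cip f f = of_real (\<Sum>\<^sub>\<infinity>n. (cmod (crd f n))\<^sup>2)"
  unfolding cip_def complex_norm_square[symmetric]
  by (intro infsumI has_sum_of_real has_sum_infsum crd_sq)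

lemma cnorm: "f \<in> H \<Longrightarrow> hnorm cip f = sqrt (\<Sum>\<^sub>\<infinity>n. (cmod (crd f n))\<^sup>2)"
  by (simp add: hnorm_def cip_self)

lemma L2_crd_le: "f \<in> H \<Longrightarrow> finite F \<Longrightarrow> L2_set (\<lambda>n. cmod (crd f n)) F \<le> hnorm cip f"
  unfolding cnorm L2_set_def by (intro real_sqrt_le_mono finite_sum_le_infsum crd_sq) auto

lemma crd_le: "f \<in> H \<Longrightarrow> cmod (crd f n) \<le> hnorm cip f"
  using L2_crd_le[of f "{n}"] by simp

lemma cnorm_leI:
  assumes "f \<in> H" "C \<ge> 0" "\<And>F. finite F \<Longrightarrow> L2_set (\<lambda>n. cmod (crd f n)) F \<le> C"
  shows "hnorm cip f \<le> C"
proof -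
  have "(\<Sum>\<^sub>\<infinity>n. (cmod (crd f n))\<^sup>2) \<le> C\<^sup>2"
  proof (rule infsum_le_finite_sums[OF crd_sq[OF assms(1)]])
    fix F :: "int set" assume "finite F"
    then have "(L2_set (\<lambda>n. cmod (crd f n)) F)\<^sup>2 \<le> C\<^sup>2"
      using assms by (intro power_mono) auto
    then show "(\<Sum>n\<in>F. (cmod (crd f n))\<^sup>2) \<le> C\<^sup>2"
      by (simp add: L2_set_def sum_nonneg)
  qed
  then show ?thesis
    using assms by (simp add: cnorm real_sqrt_le_iff real_le_lsqrt infsum_nonneg)
qed

lemma cnorm_triangle:
  assumes "f \<in> H" "g \<in> H"
  shows "hnorm cip (f + g) \<le> hnorm cip f + hnorm cip g"
proof (rule cnorm_leI)
  show "0 \<le> hnorm cip f + hnorm cip g"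
    using assms by (simp add: cnorm infsum_nonneg)
  fix F :: "int set" assume F: "finite F"
  have "L2_set (\<lambda>n. cmod (crd (f + g) n)) F \<le> L2_set (\<lambda>n. cmod (crd f n) + cmod (crd g n)) F"
    using assms by (intro L2_set_mono) (auto simp: crd_add norm_triangle_ineq)
  also have "\<dots> \<le> L2_set (\<lambda>n. cmod (crd f n)) F + L2_set (\<lambda>n. cmod (crd g n)) F"
    by (rule L2_set_triangle_ineq)
  also have "\<dots> \<le> hnorm cip f + hnorm cip g"
    using assms F by (intro add_mono L2_crd_le)
  finally show "L2_set (\<lambda>n. cmod (crd (f + g) n)) F \<le> hnorm cip f + hnorm cip g" .
qed (use assms add_in in auto)

lemma cnorm_eq_0: "f \<in> H \<Longrightarrow> hnorm cip f = 0 \<longleftrightarrow> f = 0"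
proof
  assume f: "f \<in> H" "hnorm cip f = 0"
  then have "crd f n = 0" for n using crd_le[of f n] by simp
  with f(1) show "f = 0" by (rule crd_inj)
qed (simp add: hnorm_def cip_def)

lemma cmetric: "Metric_space H (hdist H cip)"
proof
  show "0 \<le> hdist H cip f g" for f g
    using diff_in[of f g] by (auto simp: hdist_def cnorm infsum_nonneg)
  show "hdist H cip f g = hdist H cip g f" for f g
    using diff_in[of f g] diff_in[of g f]
    by (auto simp: hdist_def cnorm crd_diff norm_minus_commute)
  show "hdist H cip f g = 0 \<longleftrightarrow> f = g" if "f \<in> H" "g \<in> H" for f g
    using that cnorm_eq_0[OF diff_in[OF that]] by (simp add: hdist_def)
  show "hdist H cip f h \<le> hdist H cip f g + hdist H cip g h" if "f \<in> H" "g \<in> H" "h \<in> H" for f g h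
    using that cnorm_triangle[OF diff_in[OF that(1,2)] diff_in[OF that(2,3)]]
    by (simp add: hdist_def)
qed

lemma ccomplete: "Metric_space.mcomplete H (hdist H cip)"
proof -
  interpret Metric_space H "hdist H cip" by (rule cmetric)
  have "\<exists>f. limitin mtopology \<sigma> f sequentially" if \<sigma>: "MCauchy \<sigma>" for \<sigma>
  proof -
    have \<sigma>H: "\<sigma> k \<in> H" for k using \<sigma> by (auto simp: MCauchy_def)
    have Cau: "\<exists>N. \<forall>k l. N \<le> k \<longrightarrow> N \<le> l \<longrightarrow> hnorm cip (\<sigma> k - \<sigma> l) < \<epsilon>" if "\<epsilon> > 0" for \<epsilon>
      using \<sigma> that \<sigma>H by (auto simp: MCauchy_def hdist_def)
    have "Cauchy (\<lambda>k. crd (\<sigma> k) n)" for n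
    proof (rule metric_CauchyI)
      fix \<epsilon> :: real assume "\<epsilon> > 0"
      then obtain N where N: "\<forall>k l. N \<le> k \<longrightarrow> N \<le> l \<longrightarrow> hnorm cip (\<sigma> k - \<sigma> l) < \<epsilon>" using Cau by blast
      have "dist (crd (\<sigma> k) n) (crd (\<sigma> l) n) < \<epsilon>" if "N \<le> k" "N \<le> l" for k l
        using crd_le[OF diff_in[OF \<sigma>H[of k] \<sigma>H[of l]], of n] N that
        by (fastforce simp: dist_norm crd_diff \<sigma>H)
      then show "\<exists>N. \<forall>k\<ge>N. \<forall>l\<ge>N. dist (crd (\<sigma> k) n) (crd (\<sigma> l) n) < \<epsilon>" by blast
    qed
    then have "convergent (\<lambda>k. crd (\<sigma> k) n)" for n by (simp add: Cauchy_convergent_iff)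
    then have "\<exists>x. \<forall>n. (\<lambda>k. crd (\<sigma> k) n) \<longlonglongrightarrow> x n"
      by (intro choice) (auto simp: convergent_def)
    then obtain x where x: "\<And>n. (\<lambda>k. crd (\<sigma> k) n) \<longlonglongrightarrow> x n" by blast
    \<comment> \<open>Fatou's argument: the Cauchy bound holds on every finite set of coordinates,
      where the coordinatewise limit may be taken, and it is uniform in this set.\<close>
    have fatou: "L2_set (\<lambda>n. cmod (crd (\<sigma> k) n - x n)) F \<le> \<epsilon>"
      if N: "\<forall>k l. N \<le> k \<longrightarrow> N \<le> l \<longrightarrow> hnorm cip (\<sigma> k - \<sigma> l) < \<epsilon>" and k: "N \<le> k" and F: "finite F"
      for N k \<epsilon> F
    proof (rule tendsto_upperbound)
      show "(\<lambda>l. L2_set (\<lambda>n. cmod (crd (\<sigma> k) n - crd (\<sigma> l) n)) F) \<longlonglongrightarrow> L2_set (\<lambda>n. cmod (crd (\<sigma> k) n - x n)) F"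
        unfolding L2_set_def by (intro tendsto_intros x)
      show "\<forall>\<^sub>F l in sequentially. L2_set (\<lambda>n. cmod (crd (\<sigma> k) n - crd (\<sigma> l) n)) F \<le> \<epsilon>"
        using eventually_ge_at_top[of N]
      proof eventually_elim
        case (elim l)
        have "L2_set (\<lambda>n. cmod (crd (\<sigma> k) n - crd (\<sigma> l) n)) F \<le> hnorm cip (\<sigma> k - \<sigma> l)"
          using L2_crd_le[OF diff_in[OF \<sigma>H[of k] \<sigma>H[of l]] F] by (simp add: crd_diff \<sigma>H)
        then show ?case using N k elim by force
      qed
    qed simp
    obtain N1 where N1: "\<forall>k l. N1 \<le> k \<longrightarrow> N1 \<le> l \<longrightarrow> hnorm cip (\<sigma> k - \<sigma> l) < 1"
      using Cau[of 1] by auto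
    have "(\<lambda>n. (cmod (x n))\<^sup>2) summable_on UNIV"
    proof (rule nonneg_bdd_above_summable_on)
      have "(\<Sum>n\<in>F. (cmod (x n))\<^sup>2) \<le> (hnorm cip (\<sigma> N1) + 1)\<^sup>2" if F: "finite F" for F
      proof -
        have "L2_set (\<lambda>n. cmod (x n)) F \<le> L2_set (\<lambda>n. cmod (crd (\<sigma> N1) n) + cmod (crd (\<sigma> N1) n - x n)) F"
        proof (intro L2_set_mono)
          show "cmod (x n) \<le> cmod (crd (\<sigma> N1) n) + cmod (crd (\<sigma> N1) n - x n)" for n
            using norm_triangle_ineq4[of "crd (\<sigma> N1) n" "crd (\<sigma> N1) n - x n"] by simp
        qed auto
        also have "\<dots> \<le> L2_set (\<lambda>n. cmod (crd (\<sigma> N1) n)) F + L2_set (\<lambda>n. cmod (crd (\<sigma> N1) n - x n)) F"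
          by (rule L2_set_triangle_ineq)
        also have "\<dots> \<le> hnorm cip (\<sigma> N1) + 1"
          using F by (intro add_mono L2_crd_le \<sigma>H fatou[OF N1]) auto
        finally have "(L2_set (\<lambda>n. cmod (x n)) F)\<^sup>2 \<le> (hnorm cip (\<sigma> N1) + 1)\<^sup>2"
          by (intro power_mono) auto
        then show ?thesis by (simp add: L2_set_def sum_nonneg)
      qed
      then show "bdd_above (sum (\<lambda>n. (cmod (x n))\<^sup>2) ` {F. F \<subseteq> UNIV \<and> finite F})"
        by (intro bdd_aboveI2[where M = "(hnorm cip (\<sigma> N1) + 1)\<^sup>2"]) auto
    qed auto
    then obtain f where f: "f \<in> H" "\<And>n. crd f n = x n" using crd_surj by blast
    have "limitin mtopology \<sigma> f sequentially"
      unfolding limitin_metric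
    proof (intro conjI allI impI f)
      fix \<epsilon> :: real assume "\<epsilon> > 0"
      then obtain N where N: "\<forall>k l. N \<le> k \<longrightarrow> N \<le> l \<longrightarrow> hnorm cip (\<sigma> k - \<sigma> l) < \<epsilon> / 2"
        using Cau[of "\<epsilon> / 2"] by auto
      show "\<forall>\<^sub>F k in sequentially. \<sigma> k \<in> H \<and> hdist H cip (\<sigma> k) f < \<epsilon>"
        using eventually_ge_at_top[of N]
      proof eventually_elim
        case (elim k)
        have "hnorm cip (\<sigma> k - f) \<le> \<epsilon> / 2"
        proof (rule cnorm_leI)
          show "L2_set (\<lambda>n. cmod (crd (\<sigma> k - f) n)) F \<le> \<epsilon> / 2" if "finite F" for F
            using fatou[OF N elim that] by (simp add: crd_diff \<sigma>H f)
        qed (use \<open>\<epsilon> > 0\<close> diff_in \<sigma>H f in auto)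
        then show ?case using \<sigma>H f \<open>\<epsilon> > 0\<close> by (simp add: hdist_def)
      qed
    qed
    then show ?thesis by blast
  qed
  then show ?thesis by (simp add: mcomplete_def)
qed

sublocale hilbert_function_space H cip
proof
  show "cfun.subspace H" by (rule sub)
  show "cip (f + g) h = cip f h + cip g h" if "f \<in> H" "g \<in> H" "h \<in> H" for f g h
    using that by (simp add: cip_def crd_add distrib_right infsum_add crd_prod)
  show "cip (cscale c f) g = c * cip f g" if "f \<in> H" "g \<in> H" for c f g
    using that by (simp add: cip_def crd_scale mult.assoc infsum_cmult_right')
  show "cip f g = cnj (cip g f)" if "f \<in> H" "g \<in> H" for f g
    by (simp add: cip_def infsum_cnj[symmetric] mult.commute del: infsum_cnj)
  show "Re (cip f f) > 0" if "f \<in> H" "f \<noteq> 0" for f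
  proof -
    have "(\<Sum>\<^sub>\<infinity>n. (cmod (crd f n))\<^sup>2) \<ge> 0" by (rule infsum_nonneg) simp
    then show ?thesis
      using cnorm_eq_0[OF that(1)] that by (auto simp: cip_self cnorm less_le)
  qed
  show "Metric_space.mcomplete H (hdist H cip)" by (rule ccomplete)
qed

definition bas :: "int \<Rightarrow> 'x \<Rightarrow> complex" where
  "bas m = (SOME f. f \<in> H \<and> (\<forall>n. crd f n = (if n = m then 1 else 0)))"

lemma bas: "bas m \<in> H" "crd (bas m) n = (if n = m then 1 else 0)"
proof -
  have "(\<lambda>n. (cmod (if n = m then 1 else 0))\<^sup>2) summable_on UNIV"
    by (rule finite_nonzero_values_imp_summable_on) (rule finite_subset[of _ "{m}"], auto)
  from crd_surj[OF this] have "\<exists>f. f \<in> H \<and> (\<forall>n. crd f n = (if n = m then 1 else 0))" by blast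
  from someI_ex[OF this] show "bas m \<in> H" "crd (bas m) n = (if n = m then 1 else 0)"
    by (simp_all add: bas_def)
qed

lemma cip_bas: "f \<in> H \<Longrightarrow> cip f (bas m) = crd f m"
proof -
  have "cip f (bas m) = (\<Sum>\<^sub>\<infinity>n\<in>{m}. crd f n)"
    unfolding cip_def by (rule infsum_cong_neutral) (auto simp: bas)
  then show ?thesis by simp
qed

lemma cip_bas_left: "f \<in> H \<Longrightarrow> cip (bas m) f = cnj (crd f m)"
  using ip_cnj[of "bas m" f] by (simp add: bas cip_bas)

lemma inj_bas: "inj bas"
proof (rule injI)
  fix m n assume "bas m = bas n"
  then have "crd (bas m) n = 1" by (simp add: bas)
  then show "m = n" by (simp add: bas split: if_splits)
qed

definition trunc :: "int set \<Rightarrow> ('x \<Rightarrow> complex) \<Rightarrow> 'x \<Rightarrow> complex" where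
  "trunc F f = (\<Sum>n\<in>F. cscale (crd f n) (bas n))"

lemma trunc: "trunc F f \<in> H" "finite F \<Longrightarrow> crd (trunc F f) n = (if n \<in> F then crd f n else 0)"
proof -
  show "trunc F f \<in> H" by (simp add: trunc_def bas)
  show "crd (trunc F f) n = (if n \<in> F then crd f n else 0)" if "finite F"
    using that by (simp add: trunc_def crd_sum crd_scale bas if_distrib[of "\<lambda>x. _ * x"] cong: if_cong)
qed

lemma trunc_approx:
  assumes f: "f \<in> H" and \<epsilon>: "\<epsilon> > 0"
  shows "\<forall>\<^sub>F F in finite_subsets_at_top UNIV. hnorm cip (f - trunc F f) < \<epsilon>"
proof -
  let ?s = "\<lambda>n. (cmod (crd f n))\<^sup>2"
  have "\<forall>\<^sub>F F in finite_subsets_at_top UNIV. dist (sum ?s F) (infsum ?s UNIV) < \<epsilon>\<^sup>2"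
    using infsum_tendsto[OF crd_sq[OF f]] \<epsilon> unfolding tendsto_iff by (meson zero_less_power)
  moreover have "\<forall>\<^sub>F F in finite_subsets_at_top (UNIV :: int set). finite F"
    by (rule eventually_finite_subsets_at_top_weakI) simp
  ultimately show ?thesis
  proof eventually_elim
    case (elim F)
    have d: "f - trunc F f \<in> H" using f trunc by (intro diffH)
    have "(\<Sum>\<^sub>\<infinity>n. (cmod (crd (f - trunc F f) n))\<^sup>2) = (\<Sum>\<^sub>\<infinity>n\<in>- F. ?s n)"
      using elim by (intro infsum_cong_neutral) (auto simp: crd_diff f trunc)
    also have "\<dots> = infsum ?s UNIV - sum ?s F"
    proof -
      have "infsum ?s (F \<union> - F) = infsum ?s F + infsum ?s (- F)"
        using elim by (intro infsum_Un_disjoint summable_on_subset[OF crd_sq[OF f]]) auto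
      then show ?thesis using elim by simp
    qed
    also have "\<dots> < \<epsilon>\<^sup>2" using elim(1) by (simp add: dist_real_def)
    finally have "sqrt (\<Sum>\<^sub>\<infinity>n. (cmod (crd (f - trunc F f) n))\<^sup>2) < \<epsilon>"
      using \<epsilon> by (simp add: real_less_lsqrt infsum_nonneg)
    then show ?case by (simp add: cnorm[OF d])
  qed
qed

lemma orthonormal_bas: "orthonormal_basis H cip (range bas)"
  unfolding orthonormal_basis_def
proof (intro conjI)
  show "range bas \<subseteq> H" using bas by auto
  show "\<forall>e\<in>range bas. \<forall>f\<in>range bas. cip e f = (if e = f then 1 else 0)"
    using inj_bas by (auto simp: cip_bas bas inj_eq)
  have sp: "cfun.span (range bas) \<subseteq> H"
    using \<open>range bas \<subseteq> H\<close> sub by (rule cfun.span_minimal)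
  show "htop H cip closure_of cfun.span (range bas) = H"
  proof (intro subset_antisym subsetI)
    fix f assume f: "f \<in> H"
    have "\<exists>g\<in>cfun.span (range bas). hnorm cip (f - g) < \<epsilon>" if \<epsilon>: "\<epsilon> > 0" for \<epsilon>
    proof -
      obtain F where "hnorm cip (f - trunc F f) < \<epsilon>"
        using eventually_happens'[OF finite_subsets_at_top_neq_bot trunc_approx[OF f \<epsilon>]] by blast
      moreover have "trunc F f \<in> cfun.span (range bas)"
        unfolding trunc_def by (intro cfun.span_sum cfun.span_scale cfun.span_base) auto
      ultimately show ?thesis by blast
    qed
    then show "f \<in> htop H cip closure_of cfun.span (range bas)"
      using closure_of_iff[OF sp] f by blast
  qed (use closure_of_iff[OF sp] in blast)
qed

text \<open>The representing vector must have the coordinates \<open>cnj (l (bas n))\<close>.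
  Testing \<open>l\<close> on their finite sections y gives \<open>l y\<close> equal to the square
  of the norm of y, whence the l2 bound by C. The bound on the norm of h is needed later for the
  convergence of determinants.\<close>

lemma riesz:
  fixes l :: "('x \<Rightarrow> complex) \<Rightarrow> complex"
  assumes add: "\<And>f g. f \<in> H \<Longrightarrow> g \<in> H \<Longrightarrow> l (f + g) = l f + l g"
    and scale: "\<And>c f. f \<in> H \<Longrightarrow> l (cscale c f) = c * l f"
    and bound: "\<And>f. f \<in> H \<Longrightarrow> cmod (l f) \<le> C * hnorm cip f" and C: "C \<ge> 0"
  shows "\<exists>h\<in>H. hnorm cip h \<le> C \<and> (\<forall>f\<in>H. l f = cip f h)"
proof -
  define x where "x n = cnj (l (bas n))" for n
  have l0: "l 0 = 0" using scale[of 0 0] by simp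
  have lsum: "l (sum f A) = (\<Sum>i\<in>A. l (f i))" if "\<And>i. i \<in> A \<Longrightarrow> f i \<in> H" for f and A :: "int set"
    using that by (induction A rule: infinite_finite_induct) (simp_all add: l0 add)
  have fin: "L2_set (\<lambda>n. cmod (x n)) F \<le> C" if F: "finite F" for F
  proof -
    define y where "y = (\<Sum>n\<in>F. cscale (x n) (bas n))"
    have y: "y \<in> H" by (simp add: y_def bas)
    have cy: "crd y n = (if n \<in> F then x n else 0)" for n
      using F by (simp add: y_def crd_sum crd_scale bas if_distrib[of "\<lambda>x. _ * x"] cong: if_cong)
    have "l y = (\<Sum>n\<in>F. x n * cnj (x n))"
      by (simp add: y_def lsum bas scale x_def)
    also have "\<dots> = of_real ((L2_set (\<lambda>n. cmod (x n)) F)\<^sup>2)"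
      by (simp only: complex_norm_square[symmetric] of_real_sum[symmetric] L2_set_def sum_nonneg real_sqrt_pow2 zero_le_power2)
    finally have ly: "l y = of_real ((L2_set (\<lambda>n. cmod (x n)) F)\<^sup>2)" .
    have ny: "hnorm cip y = L2_set (\<lambda>n. cmod (x n)) F"
    proof -
      have "(\<Sum>\<^sub>\<infinity>n. (cmod (crd y n))\<^sup>2) = (\<Sum>\<^sub>\<infinity>n\<in>F. (cmod (x n))\<^sup>2)"
        by (rule infsum_cong_neutral) (auto simp: cy)
      then show ?thesis using F y by (simp add: cnorm L2_set_def)
    qed
    have "(L2_set (\<lambda>n. cmod (x n)) F)\<^sup>2 \<le> C * L2_set (\<lambda>n. cmod (x n)) F"
      using bound[OF y] unfolding ly ny by (simp add: norm_power)
    then show ?thesis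
      using C by (cases "L2_set (\<lambda>n. cmod (x n)) F = 0") (auto simp: power2_eq_square mult_le_cancel_right)
  qed
  have sq: "(\<Sum>n\<in>F. (cmod (x n))\<^sup>2) \<le> C\<^sup>2" if "finite F" for F
    using power_mono[OF fin[OF that], of 2] by (simp add: L2_set_def sum_nonneg)
  have "(\<lambda>n. (cmod (x n))\<^sup>2) summable_on UNIV"
    by (rule nonneg_bdd_above_summable_on) (use sq in \<open>auto intro!: bdd_aboveI2[where M = "C\<^sup>2"]\<close>)
  then obtain h where h: "h \<in> H" "\<And>n. crd h n = x n" using crd_surj by blast
  show ?thesis
  proof (intro bexI[OF _ h(1)] conjI ballI)
    show "hnorm cip h \<le> C" using h(1) C by (rule cnorm_leI) (simp add: h fin)
    fix f assume f: "f \<in> H"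
    have "((\<lambda>F. \<Sum>n\<in>F. crd f n * cnj (crd h n)) \<longlongrightarrow> cip f h) (finite_subsets_at_top UNIV)"
      unfolding cip_def by (rule infsum_tendsto[OF crd_prod[OF f h(1)]])
    moreover have "((\<lambda>F. \<Sum>n\<in>F. crd f n * cnj (crd h n)) \<longlongrightarrow> l f) (finite_subsets_at_top UNIV)"
      unfolding tendsto_iff
    proof (intro allI impI)
      fix \<epsilon> :: real assume \<epsilon>: "\<epsilon> > 0"
      have "\<forall>\<^sub>F F in finite_subsets_at_top UNIV. hnorm cip (f - trunc F f) < \<epsilon> / (C + 1)"
        using \<epsilon> C by (intro trunc_approx[OF f]) simp
      then show "\<forall>\<^sub>F F in finite_subsets_at_top UNIV. dist (\<Sum>n\<in>F. crd f n * cnj (crd h n)) (l f) < \<epsilon>"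
      proof eventually_elim
        case (elim F)
        have d: "f - trunc F f \<in> H" using f trunc by (intro diffH)
        have "l f = l (f - trunc F f) + l (trunc F f)"
          using add[OF d trunc(1)[of F f]] by simp
        moreover have "l (trunc F f) = (\<Sum>n\<in>F. crd f n * cnj (crd h n))"
          by (simp add: trunc_def lsum bas scale h x_def)
        ultimately have "dist (\<Sum>n\<in>F. crd f n * cnj (crd h n)) (l f) = cmod (l (f - trunc F f))"
          by (simp add: dist_norm norm_minus_commute)
        also have "\<dots> \<le> C * hnorm cip (f - trunc F f)" by (rule bound[OF d])
        also have "\<dots> \<le> (C + 1) * hnorm cip (f - trunc F f)"
          using d by (intro mult_right_mono) auto
        also have "\<dots> < \<epsilon>" using elim C by (simp add: field_simps)
        finally show ?case .
      qed
    qed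
    ultimately show "l f = cip f h"
      using tendsto_unique finite_subsets_at_top_neq_bot by blast
  qed
qed

lemma adjoint_ex:
  assumes A: "bounded_op H cip A" and g: "g \<in> H"
  shows "\<exists>h\<in>H. \<forall>f\<in>H. cip (A f) g = cip f h"
proof -
  have lin: "linear_op H A" using A by (simp add: bounded_op_def)
  have AH: "A f \<in> H" if "f \<in> H" for f using lin that by (auto simp: linear_op_def)
  obtain C where C: "\<And>f. f \<in> H \<Longrightarrow> hnorm cip (A f) \<le> C * hnorm cip f"
    using A by (auto simp: bounded_op_def)
  have "\<exists>h\<in>H. hnorm cip h \<le> \<bar>C\<bar> * hnorm cip g \<and> (\<forall>f\<in>H. cip (A f) g = cip f h)"
  proof (rule riesz)
    show "cip (A (f + f')) g = cip (A f) g + cip (A f') g" if "f \<in> H" "f' \<in> H" for f f'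
      using lin that AH g by (simp add: linear_op_def ip_add)
    show "cip (A (cscale c f)) g = c * cip (A f) g" if "f \<in> H" for c f
      using lin that AH g by (simp add: linear_op_def ip_scale)
    show "cmod (cip (A f) g) \<le> \<bar>C\<bar> * hnorm cip g * hnorm cip f" if "f \<in> H" for f
    proof -
      have "cmod (cip (A f) g) \<le> hnorm cip (A f) * hnorm cip g"
        using that AH g by (intro cauchy_schwarz)
      also have "\<dots> \<le> (\<bar>C\<bar> * hnorm cip f) * hnorm cip g"
        using C[OF that] hnorm_nonneg[OF that] g
        by (intro mult_right_mono order_trans[OF C[OF that]]) auto
      finally show ?thesis by (simp add: mult_ac)
    qed
  qed (use g in auto)
  then show ?thesis by blast
qed

lemma hadjoint:
  assumes A: "bounded_op H cip A" and g: "g \<in> H" and f: "f \<in> H"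
  shows "hadjoint H cip A g \<in> H" "cip (A f) g = cip f (hadjoint H cip A g)"
proof -
  obtain h where h: "h \<in> H" "\<forall>f\<in>H. cip (A f) g = cip f h" using adjoint_ex[OF A g] by blast
  have "h' = h" if h': "h' \<in> H" "\<forall>f\<in>H. cip (A f) g = cip f h'" for h'
  proof -
    have "cip (h' - h) h' = cip (h' - h) h"
      using h h' by (metis diffH)
    then have "cip (h' - h) (h' - h) = 0"
      using h(1) h'(1) by (simp add: ip_diff_right)
    then have "hnorm cip (h' - h) = 0" by (simp add: hnorm_def)
    then show ?thesis using h(1) h'(1) by simp
  qed
  then have "hadjoint H cip A g = h"
    unfolding hadjoint_def using h by (intro the_equality) auto
  then show "hadjoint H cip A g \<in> H" "cip (A f) g = cip f (hadjoint H cip A g)"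
    using h f by auto
qed

end

section \<open>Neumann series\<close>

context hilbert_function_space
begin

context
  fixes A K \<epsilon> z
  assumes lin: "linear_op H A"
    and iter: "\<And>n f. f \<in> H \<Longrightarrow> hnorm ip ((A ^^ n) f) \<le> K * \<epsilon> ^ n * hnorm ip f"
    and K: "K \<ge> 0" and \<epsilon>: "\<epsilon> \<ge> 0" and q: "cmod z * \<epsilon> < 1"
begin

lemma A_in: "f \<in> H \<Longrightarrow> A f \<in> H"
  and A_add: "f \<in> H \<Longrightarrow> g \<in> H \<Longrightarrow> A (f + g) = A f + A g"
  and A_scale: "f \<in> H \<Longrightarrow> A (cscale c f) = cscale c (A f)"
  using lin by (auto simp: linear_op_def)

lemma A_diff: "f \<in> H \<Longrightarrow> g \<in> H \<Longrightarrow> A (f - g) = A f - A g"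
  using A_add[of f "- g"] A_scale[of g "- 1"] by simp

lemma An_in: "f \<in> H \<Longrightarrow> (A ^^ n) f \<in> H"
  by (induction n) (auto simp: A_in)

lemma An_diff: "f \<in> H \<Longrightarrow> g \<in> H \<Longrightarrow> (A ^^ n) (f - g) = (A ^^ n) f - (A ^^ n) g"
  by (induction n) (auto simp: A_diff An_in)

lemma An_scale: "f \<in> H \<Longrightarrow> (A ^^ n) (cscale c f) = cscale c ((A ^^ n) f)"
  by (induction n) (auto simp: A_scale An_in)

text \<open>The assumption bounds the powers of \<open>A\<close> with a constant K in front, not the
  norm of \<open>A\<close>: the norm of \<open>Lb\<close> can be large although its powers decay
  faster than every geometric sequence.\<close>

lemma term_bound: "f \<in> H \<Longrightarrow> hnorm ip (cscale (z ^ n) ((A ^^ n) f)) \<le> K * (cmod z * \<epsilon>) ^ n * hnorm ip f"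
proof -
  assume f: "f \<in> H"
  have "hnorm ip (cscale (z ^ n) ((A ^^ n) f)) = cmod z ^ n * hnorm ip ((A ^^ n) f)"
    using f by (simp add: hnorm_scale An_in norm_power)
  also have "\<dots> \<le> cmod z ^ n * (K * \<epsilon> ^ n * hnorm ip f)"
    by (intro mult_left_mono iter f) auto
  finally show ?thesis by (simp add: power_mult_distrib mult_ac)
qed

lemma summable_geom: "summable (\<lambda>n. K * (cmod z * \<epsilon>) ^ n)"
  using q \<epsilon> by (intro summable_mult summable_geometric) simp

lemma tendsto_geom: "(\<lambda>n. K * (cmod z * \<epsilon>) ^ n * c) \<longlonglongrightarrow> 0"
  using tendsto_mult_right[OF summable_LIMSEQ_zero[OF summable_geom], of c] by simp

lemma neumann_sum:
  assumes "f \<in> H"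
  shows "(\<Sum>n<N. cscale (z ^ n) ((A ^^ n) (f - cscale z (A f)))) = f - cscale (z ^ N) ((A ^^ N) f)"
proof (induction N)
  case 0
  then show ?case by simp
next
  case (Suc N)
  have e: "(A ^^ N) (f - cscale z (A f)) = (A ^^ N) f - cscale z ((A ^^ Suc N) f)"
    using assms by (simp add: An_diff An_scale A_in funpow_swap1)
  then show ?case
    unfolding sum.lessThan_Suc Suc.IH e by (simp add: cscale_def fun_eq_iff algebra_simps)
qed

text \<open>Telescoping gives an a priori estimate before any inverse is known. It yields the
  injectivity and the bound for the inverse at the same time.\<close>

lemma neumann_bound:
  assumes f: "f \<in> H"
  shows "hnorm ip f \<le> (\<Sum>n. K * (cmod z * \<epsilon>) ^ n) * hnorm ip (f - cscale z (A f))"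
proof -
  let ?g = "f - cscale z (A f)"
  have g: "?g \<in> H" using f by (simp add: A_in)
  have le: "hnorm ip f \<le> (\<Sum>n. K * (cmod z * \<epsilon>) ^ n) * hnorm ip ?g + K * (cmod z * \<epsilon>) ^ N * hnorm ip f" for N
  proof -
    have "f = (\<Sum>n<N. cscale (z ^ n) ((A ^^ n) ?g)) + cscale (z ^ N) ((A ^^ N) f)"
      unfolding neumann_sum[OF f] by simp
    then have "hnorm ip f = hnorm ip ((\<Sum>n<N. cscale (z ^ n) ((A ^^ n) ?g)) + cscale (z ^ N) ((A ^^ N) f))"
      by (rule arg_cong)
    also have "\<dots> \<le> hnorm ip (\<Sum>n<N. cscale (z ^ n) ((A ^^ n) ?g)) + hnorm ip (cscale (z ^ N) ((A ^^ N) f))"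
      by (intro hnorm_triangle sumH scaleH An_in f g)
    also have "\<dots> \<le> (\<Sum>n<N. hnorm ip (cscale (z ^ n) ((A ^^ n) ?g))) + K * (cmod z * \<epsilon>) ^ N * hnorm ip f"
      by (intro add_mono hnorm_sum scaleH An_in term_bound f g)
    also have "(\<Sum>n<N. hnorm ip (cscale (z ^ n) ((A ^^ n) ?g))) \<le> (\<Sum>n<N. K * (cmod z * \<epsilon>) ^ n * hnorm ip ?g)"
      by (intro sum_mono term_bound g)
    also have "\<dots> = (\<Sum>n<N. K * (cmod z * \<epsilon>) ^ n) * hnorm ip ?g"
      by (simp add: sum_distrib_right)
    also have "\<dots> \<le> (\<Sum>n. K * (cmod z * \<epsilon>) ^ n) * hnorm ip ?g"
      using K \<epsilon> g by (intro mult_right_mono sum_le_suminf summable_geom) auto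
    finally show ?thesis by simp
  qed
  have "(\<lambda>N. (\<Sum>n. K * (cmod z * \<epsilon>) ^ n) * hnorm ip ?g + K * (cmod z * \<epsilon>) ^ N * hnorm ip f)
      \<longlonglongrightarrow> (\<Sum>n. K * (cmod z * \<epsilon>) ^ n) * hnorm ip ?g + 0"
    by (intro tendsto_add tendsto_const tendsto_geom)
  then show ?thesis
    using le by (intro tendsto_lowerbound[where F = sequentially and a = "hnorm ip f"]) auto
qed

lemma neumann_surj:
  assumes g: "g \<in> H"
  shows "\<exists>f\<in>H. f - cscale z (A f) = g"
proof -
  define s where "s N = (\<Sum>n<N. cscale (z ^ n) ((A ^^ n) g))" for N
  have s: "s N \<in> H" for N unfolding s_def by (intro sumH scaleH An_in g)
  have sz: "s N - cscale z (A (s N)) = g - cscale (z ^ N) ((A ^^ N) g)" for N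
  proof (induction N)
    case 0
    have A0: "A 0 = 0" using A_scale[of 0 0] by simp
    have s0: "s 0 = 0" by (simp add: s_def)
    show ?case unfolding s0 A0 cfun.scale_zero_right by simp
  next
    case (Suc N)
    have e1: "s (Suc N) = s N + cscale (z ^ N) ((A ^^ N) g)" by (simp add: s_def)
    have e2: "A (s N + cscale (z ^ N) ((A ^^ N) g)) = A (s N) + cscale (z ^ N) ((A ^^ Suc N) g)"
      using s g by (simp add: A_add A_scale An_in)
    have "s (Suc N) - cscale z (A (s (Suc N))) =
        (s N - cscale z (A (s N))) + cscale (z ^ N) ((A ^^ N) g) - cscale z (cscale (z ^ N) ((A ^^ Suc N) g))"
      unfolding e1 e2 by (simp add: cscale_def fun_eq_iff algebra_simps)
    then show ?case
      unfolding Suc by (simp add: cscale_def fun_eq_iff algebra_simps)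
  qed
  let ?t = "\<lambda>n. K * (cmod z * \<epsilon>) ^ n * hnorm ip g"
  have t: "summable ?t" by (rule summable_mult2[OF summable_geom])
  have diff: "hnorm ip (s n - s m) \<le> (\<Sum>k=m..<n. ?t k)" if "m \<le> n" for m n
  proof -
    have "s n = s m + (\<Sum>k=m..<n. cscale (z ^ k) ((A ^^ k) g))"
      unfolding s_def lessThan_atLeast0 by (simp add: sum.atLeastLessThan_concat that)
    then have "hnorm ip (s n - s m) = hnorm ip (\<Sum>k=m..<n. cscale (z ^ k) ((A ^^ k) g))" by simp
    also have "\<dots> \<le> (\<Sum>k=m..<n. hnorm ip (cscale (z ^ k) ((A ^^ k) g)))"
      by (intro hnorm_sum scaleH An_in g)
    also have "\<dots> \<le> (\<Sum>k=m..<n. ?t k)"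
      by (intro sum_mono term_bound g)
    finally show ?thesis .
  qed
  have "M.MCauchy s"
    unfolding M.MCauchy_def
  proof (intro conjI allI impI)
    show "range s \<subseteq> H" using s by auto
    fix \<delta> :: real assume "\<delta> > 0"
    then obtain N where N: "\<And>m n. N \<le> m \<Longrightarrow> norm (\<Sum>k=m..<n. ?t k) < \<delta>"
      using t unfolding summable_Cauchy by meson
    have *: "hnorm ip (s n - s m) < \<delta>" if "N \<le> m" "m \<le> n" for m n
    proof -
      have "hnorm ip (s n - s m) \<le> norm (\<Sum>k=m..<n. ?t k)"
        using order_trans[OF diff[OF that(2)] abs_ge_self] by simp
      also have "\<dots> < \<delta>" by (rule N[OF that(1)])
      finally show ?thesis .
    qed
    have "hdist H ip (s n) (s m) < \<delta>" if "N \<le> n" "N \<le> m" for m n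
    proof (cases "m \<le> n")
      case True
      then show ?thesis using *[of m n] that s by (simp add: hdist_eq)
    next
      case False
      then show ?thesis using *[of n m] that s by (simp add: hdist_eq hnorm_minus_commute)
    qed
    then show "\<exists>N. \<forall>n n'. N \<le> n \<longrightarrow> N \<le> n' \<longrightarrow> hdist H ip (s n) (s n') < \<delta>" by blast
  qed
  then obtain f where f: "limitin M.mtopology s f sequentially"
    using complete unfolding M.mcomplete_def by blast
  then have fH: "f \<in> H" by (auto simp: M.limitin_metric)
  have lim: "(\<lambda>N. hnorm ip (f - s N)) \<longlonglongrightarrow> 0"
  proof (rule LIMSEQ_I)
    fix r :: real assume "r > 0"
    then have "\<forall>\<^sub>F N in sequentially. s N \<in> H \<and> hdist H ip (s N) f < r"
      using f by (auto simp: M.limitin_metric)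
    then obtain N0 where "\<And>N. N \<ge> N0 \<Longrightarrow> hdist H ip (s N) f < r"
      by (auto simp: eventually_sequentially)
    then show "\<exists>no. \<forall>n\<ge>no. norm (hnorm ip (f - s n) - 0) < r"
      using s fH by (auto simp: hdist_eq hnorm_minus_commute[of f])
  qed
  have A1: "hnorm ip (A h) \<le> K * \<epsilon> * hnorm ip h" if "h \<in> H" for h
    using iter[OF that, of 1] by simp
  let ?r = "f - cscale z (A f) - g"
  have rH: "?r \<in> H" using fH g by (simp add: A_in)
  \<comment> \<open>The residual of the limit is compared with that of the partial sum
    \<open>s N\<close>, which \<open>sz\<close> computes exactly; continuity of \<open>A\<close> and
    the geometric tail take care of the difference.\<close>
  have "hnorm ip ?r \<le> hnorm ip (f - s N) + cmod z * (K * \<epsilon> * hnorm ip (f - s N)) + ?t N" for N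
  proof -
    have d: "f - s N \<in> H" using fH s by (intro diffH)
    have "?r = (f - s N) - cscale z (A (f - s N)) - cscale (z ^ N) ((A ^^ N) g)"
      using sz[of N] fH s by (simp add: A_diff cscale_def fun_eq_iff algebra_simps)
    then have "hnorm ip ?r = hnorm ip ((f - s N) - cscale z (A (f - s N)) - cscale (z ^ N) ((A ^^ N) g))"
      by (rule arg_cong)
    also have "\<dots> \<le> hnorm ip ((f - s N) - cscale z (A (f - s N))) + hnorm ip (cscale (z ^ N) ((A ^^ N) g))"
      by (intro hnorm_triangle_diff diffH[OF d] scaleH An_in A_in d g)
    also have "\<dots> \<le> hnorm ip (f - s N) + hnorm ip (cscale z (A (f - s N))) + ?t N"
      by (intro add_mono hnorm_triangle_diff d scaleH A_in term_bound g)
    also have "\<dots> \<le> hnorm ip (f - s N) + cmod z * (K * \<epsilon> * hnorm ip (f - s N)) + ?t N"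
      using A1[OF d] by (intro add_mono order_refl) (simp only: hnorm_scale A_in d mult_left_mono norm_ge_zero)
    finally show ?thesis .
  qed
  moreover have "(\<lambda>N. hnorm ip (f - s N) + cmod z * (K * \<epsilon> * hnorm ip (f - s N)) + ?t N)
      \<longlonglongrightarrow> 0 + cmod z * (K * \<epsilon> * 0) + 0"
    by (intro tendsto_add tendsto_mult tendsto_const lim tendsto_geom)
  ultimately have "hnorm ip ?r \<le> 0"
    by (intro tendsto_lowerbound[where F = sequentially and a = "hnorm ip ?r"]) auto
  then have "?r = 0" using rH hnorm_nonneg[OF rH] hnorm_eq_0[OF rH] by simp
  then show ?thesis using fH by (intro bexI[of _ f]) simp_all
qed

lemma neumann_bij: "bij_betw (\<lambda>f. f - cscale z (A f)) H H"
  unfolding bij_betw_def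
proof
  show "inj_on (\<lambda>f. f - cscale z (A f)) H"
  proof (rule inj_onI)
    fix f g assume fg: "f \<in> H" "g \<in> H" "f - cscale z (A f) = g - cscale z (A g)"
    have "f - g - cscale z (A (f - g)) = (f - cscale z (A f)) - (g - cscale z (A g))"
      using fg(1,2) by (simp add: A_diff cscale_def fun_eq_iff algebra_simps)
    then have "f - g - cscale z (A (f - g)) = 0"
      using fg(3) by simp
    then have "hnorm ip (f - g) \<le> 0"
      using neumann_bound[OF diffH[OF fg(1,2)]] by simp
    then show "f = g"
      using hnorm_nonneg[OF diffH[OF fg(1,2)]] hnorm_eq_0[OF diffH[OF fg(1,2)]] by simp
  qed
  show "(\<lambda>f. f - cscale z (A f)) ` H = H"
    using neumann_surj by (auto simp: A_in image_iff)
qed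

lemma neumann_inv:
  defines "R \<equiv> inv_into H (\<lambda>f. f - cscale z (A f))"
  shows "g \<in> H \<Longrightarrow> R g \<in> H"
    and "g \<in> H \<Longrightarrow> R g - cscale z (A (R g)) = g"
    and "f \<in> H \<Longrightarrow> R (f - cscale z (A f)) = f"
    and "bounded_op H ip R"
    and "g \<in> H \<Longrightarrow> hnorm ip (R g) \<le> (\<Sum>n. K * (cmod z * \<epsilon>) ^ n) * hnorm ip g"
proof -
  let ?S = "\<lambda>f. f - cscale z (A f)"
  have S: "?S ` H = H" "inj_on ?S H" using neumann_bij by (auto simp: bij_betw_def)
  show RH: "R g \<in> H" if "g \<in> H" for g
    unfolding R_def using that S by (intro inv_into_into) simp
  show SR: "R g - cscale z (A (R g)) = g" if "g \<in> H" for g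
    unfolding R_def using that S by (intro f_inv_into_f[of g ?S H]) simp
  show RS: "R (f - cscale z (A f)) = f" if "f \<in> H" for f
    unfolding R_def using inv_into_f_f[OF S(2) that] .
  show bd: "hnorm ip (R g) \<le> (\<Sum>n. K * (cmod z * \<epsilon>) ^ n) * hnorm ip g" if "g \<in> H" for g
    using neumann_bound[OF RH[OF that]] SR[OF that] by simp
  have "R (f + g) = R f + R g" if "f \<in> H" "g \<in> H" for f g
  proof -
    have "R f + R g - cscale z (A (R f + R g)) = (R f - cscale z (A (R f))) + (R g - cscale z (A (R g)))"
      using RH that by (simp add: A_add cscale_def fun_eq_iff algebra_simps)
    also have "\<dots> = f + g" using SR that by simp
    finally show ?thesis using RS[of "R f + R g"] RH that by simp
  qed
  moreover have "R (cscale c f) = cscale c (R f)" if "f \<in> H" for c f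
  proof -
    have "cscale c (R f) - cscale z (A (cscale c (R f))) = cscale c (R f - cscale z (A (R f)))"
      unfolding A_scale[OF RH[OF that]] by (simp add: cscale_def fun_eq_iff algebra_simps)
    also have "\<dots> = cscale c f" using SR that by simp
    finally show ?thesis using RS[of "cscale c (R f)"] RH that by simp
  qed
  ultimately show "bounded_op H ip R"
    unfolding bounded_op_def linear_op_def using RH bd by blast
qed

end

lemma bounded_op_scale:
  assumes "bounded_op H ip A"
  shows "bounded_op H ip (\<lambda>f. cscale c (A f))"
proof -
  obtain C where lin: "linear_op H A" and C: "\<And>f. f \<in> H \<Longrightarrow> hnorm ip (A f) \<le> C * hnorm ip f"
    using assms by (auto simp: bounded_op_def)
  have AH: "A f \<in> H" if "f \<in> H" for f using lin that by (auto simp: linear_op_def)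
  have "hnorm ip (cscale c (A f)) \<le> (cmod c * C) * hnorm ip f" if "f \<in> H" for f
    using C[OF that] AH[OF that] by (simp add: hnorm_scale mult.assoc mult_left_mono)
  moreover have "linear_op H (\<lambda>f. cscale c (A f))"
    using lin AH by (auto simp: linear_op_def cfun.scale_right_distrib mult.commute)
  ultimately show ?thesis by (auto simp: bounded_op_def)
qed

text \<open>For nonzero \<mu>, the inverse of \<mu> - A is the Neumann series of \<open>A\<close> at
  1 / \<mu>, divided by \<mu>.\<close>

lemma op_spectral_radius_eq_0:
  assumes lin: "linear_op H A"
    and iter: "\<And>\<epsilon>. \<epsilon> > 0 \<Longrightarrow> \<exists>K\<ge>0. \<forall>n. \<forall>f\<in>H. hnorm ip ((A ^^ n) f) \<le> K * \<epsilon> ^ n * hnorm ip f"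
    and ker: "f0 \<in> H" "f0 \<noteq> 0" "A f0 = 0"
  shows "op_spectral_radius H ip A = 0"
proof -
  have AH: "A f \<in> H" if "f \<in> H" for f using lin that by (auto simp: linear_op_def)
  have "\<mu> \<notin> op_spectrum H ip A" if \<mu>: "\<mu> \<noteq> 0" for \<mu>
  proof -
    \<comment> \<open>Makes the ratio of the Neumann series at 1 / \<mu> equal to one half.\<close>
    define \<epsilon> where "\<epsilon> = cmod \<mu> / 2"
    have \<epsilon>: "\<epsilon> > 0" using \<mu> by (simp add: \<epsilon>_def)
    obtain K where K: "K \<ge> 0" "\<And>n f. f \<in> H \<Longrightarrow> hnorm ip ((A ^^ n) f) \<le> K * \<epsilon> ^ n * hnorm ip f"
      using iter[OF \<epsilon>] by blast
    have q: "cmod (1 / \<mu>) * \<epsilon> < 1" using \<mu> by (simp add: \<epsilon>_def norm_divide)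
    let ?S = "\<lambda>f. f - cscale (1 / \<mu>) (A f)" and ?T = "\<lambda>f. cscale \<mu> f - A f"
    note n = lin K(2) K(1) less_imp_le[OF \<epsilon>] q
    define R where "R = inv_into H ?S"
    have R: "\<And>g. g \<in> H \<Longrightarrow> R g \<in> H" "\<And>g. g \<in> H \<Longrightarrow> ?S (R g) = g" "\<And>f. f \<in> H \<Longrightarrow> R (?S f) = f"
      "bounded_op H ip R"
      unfolding R_def using neumann_inv[OF n] by blast+
    have TS: "?T f = cscale \<mu> (?S f)" for f
      using \<mu> by (simp add: cscale_def fun_eq_iff algebra_simps)
    have bij: "bij_betw ?T H H"
    proof (rule bij_betw_byWitness[where f' = "\<lambda>g. R (cscale (1 / \<mu>) g)"])
      show "\<forall>f\<in>H. R (cscale (1 / \<mu>) (?T f)) = f"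
        using \<mu> R by (simp add: TS)
      show "\<forall>g\<in>H. ?T (R (cscale (1 / \<mu>) g)) = g"
        using \<mu> R by (simp add: TS)
      show "?T ` H \<subseteq> H" using AH by auto
      show "(\<lambda>g. R (cscale (1 / \<mu>) g)) ` H \<subseteq> H" using R by auto
    qed
    have inv: "inv_into H ?T g = cscale (1 / \<mu>) (R g)" if g: "g \<in> H" for g
    proof (rule inv_into_f_eq)
      show "inj_on ?T H" using bij by (simp add: bij_betw_def)
      have "R \<in> H \<rightarrow> H" using R by blast
      show "cscale (1 / \<mu>) (R g) \<in> H" using R g by simp
      have "A (cscale (1 / \<mu>) (R g)) = cscale (1 / \<mu>) (A (R g))"
        using lin R g by (simp add: linear_op_def)
      then have "?T (cscale (1 / \<mu>) (R g)) = ?S (R g)"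
        using \<mu> by (simp add: cscale_def fun_eq_iff)
      then show "?T (cscale (1 / \<mu>) (R g)) = g" using R g by simp
    qed
    have "bounded_op H ip (\<lambda>g. cscale (1 / \<mu>) (R g))"
      by (rule bounded_op_scale[OF R(4)])
    then have "bounded_op H ip (inv_into H ?T)"
      unfolding bounded_op_def linear_op_def by (simp add: inv image_subset_iff)
    then show ?thesis using bij by (simp add: op_spectrum_def)
  qed
  \<comment> \<open>The spectral radius is a \<open>SUP\<close>, whose value on an empty set is
    unspecified; the kernel vector puts 0 into the spectrum.\<close>
  moreover have "0 \<in> op_spectrum H ip A"
  proof -
    have "A (cscale 0 0) = cscale 0 (A 0)" using lin zeroH unfolding linear_op_def by blast
    then have "A 0 = 0" by simp
    then have "cscale 0 f0 - A f0 = cscale 0 0 - A 0" using ker by simp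
    then have "\<not> inj_on (\<lambda>f. cscale 0 f - A f) H"
      using ker(1,2) inj_onD[of "\<lambda>f. cscale 0 f - A f" H f0 0] zeroH by blast
    then show ?thesis by (simp add: op_spectrum_def bij_betw_def)
  qed
  ultimately have "op_spectrum H ip A = {0}" by auto
  then show ?thesis by (simp add: op_spectral_radius_def)
qed

end

section \<open>Operators with rapidly decaying coordinates\<close>

lemma summable_inverse_square_int: "(\<lambda>n::int. 1 / (brk n)\<^sup>2) summable_on UNIV"
proof -
  let ?f = "\<lambda>n::int. 1 / (brk n)\<^sup>2"
  have "summable (\<lambda>n. 1 / (real (Suc n))\<^sup>2)"
    using inverse_power_summable[of 2, where 'a = real] by (subst summable_Suc_iff) (simp add: divide_inverse)
  then have "(\<lambda>n. 1 / (real (Suc n))\<^sup>2) summable_on UNIV"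
    by (subst summable_on_UNIV_nonneg_real_iff) auto
  then have *: "(\<lambda>n::nat. 1 / (1 + real n)\<^sup>2) summable_on UNIV"
    by (simp add: add.commute)
  have "?f summable_on range int"
    using * by (subst summable_on_reindex) (auto simp: o_def)
  moreover have "?f summable_on range (\<lambda>n. - int n)"
    using * by (subst summable_on_reindex) (auto simp: o_def inj_on_def)
  ultimately have "?f summable_on (range int \<union> range (\<lambda>n. - int n))"
    by (rule summable_on_union)
  moreover have "range int \<union> range (\<lambda>n. - int n) = UNIV"
  proof -
    have "n \<in> range int \<union> range (\<lambda>n. - int n)" for n
      by (cases n rule: int_cases2) auto
    then show ?thesis by blast
  qed
  ultimately show ?thesis by simp
qed

text \<open>Gaussian elimination: an equation with a nonzero coefficient is solved for one unknown,
  which is substituted into the other equations.\<close>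

lemma homogeneous_system:
  fixes a :: "'m \<Rightarrow> 'i \<Rightarrow> complex"
  assumes "finite F" "finite I" "card F < card I"
  shows "\<exists>c. (\<exists>i\<in>I. c i \<noteq> 0) \<and> (\<forall>m\<in>F. (\<Sum>i\<in>I. a m i * c i) = 0)"
  using assms
proof (induction F arbitrary: I a rule: finite_induct)
  case empty
  then obtain i where "i \<in> I" by fastforce
  then show ?case by (intro exI[of _ "\<lambda>_. 1"]) auto
next
  case (insert m F)
  show ?case
  proof (cases "\<forall>i\<in>I. a m i = 0")
    case True
    have "card F < card I" using insert by simp
    then obtain c where "\<exists>i\<in>I. c i \<noteq> 0" "\<forall>m\<in>F. (\<Sum>i\<in>I. a m i * c i) = 0"
      using insert.IH[OF insert.prems(1), of a] by blast
    with True show ?thesis by (intro exI[of _ c]) auto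
  next
    case False
    then obtain i0 where i0: "i0 \<in> I" "a m i0 \<noteq> 0" by blast
    define J where "J = I - {i0}"
    have J: "finite J" "card F < card J" "I = insert i0 J" "i0 \<notin> J"
      using insert i0 by (auto simp: J_def)
    obtain c where c: "\<exists>i\<in>J. c i \<noteq> 0"
        "\<forall>m'\<in>F. (\<Sum>i\<in>J. (a m' i - a m' i0 * a m i / a m i0) * c i) = 0"
      using insert.IH[OF J(1,2), of "\<lambda>m' i. a m' i - a m' i0 * a m i / a m i0"] by blast
    define d where "d = c(i0 := - (\<Sum>i\<in>J. a m i * c i) / a m i0)"
    have sum: "(\<Sum>i\<in>I. a m' i * d i) = (\<Sum>i\<in>J. a m' i * c i) - a m' i0 / a m i0 * (\<Sum>i\<in>J. a m i * c i)" for m'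
    proof -
      have "(\<Sum>i\<in>J. a m' i * d i) = (\<Sum>i\<in>J. a m' i * c i)"
        using J(4) by (intro sum.cong) (auto simp: d_def)
      then show ?thesis
        using J by (simp add: d_def)
    qed
    show ?thesis
    proof (intro exI[of _ d] conjI ballI)
      show "\<exists>i\<in>I. d i \<noteq> 0" using c(1) J by (auto simp: d_def)
      fix m' assume m': "m' \<in> insert m F"
      show "(\<Sum>i\<in>I. a m' i * d i) = 0"
      proof (cases "m' = m")
        case True
        then show ?thesis using i0 by (simp add: sum)
      next
        case False
        then have "(\<Sum>i\<in>J. (a m' i - a m' i0 * a m i / a m i0) * c i) = 0" using c(2) m' by auto
        then have "(\<Sum>i\<in>J. a m' i * c i - a m' i0 / a m i0 * (a m i * c i)) = 0"
          by (simp add: left_diff_distrib mult.assoc)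
        then show ?thesis
          by (simp add: sum sum_subtractf sum_distrib_left)
      qed
    qed
  qed
qed

section \<open>Compactness from finite-dimensional approximation\<close>

context coord_space
begin

text \<open>The centres may lie outside \<open>S\<close>, which makes nets easy to build.
  \<open>compact_opI\<close> moves them into \<open>S\<close> by halving the radius.\<close>

definition eps_net :: "('x \<Rightarrow> complex) set \<Rightarrow> real \<Rightarrow> bool" where
  "eps_net S \<epsilon> \<longleftrightarrow> (\<exists>K. finite K \<and> K \<subseteq> H \<and> (\<forall>s\<in>S. \<exists>k\<in>K. hnorm cip (s - k) < \<epsilon>))"

lemma hnorm_bas: "hnorm cip (bas n) = 1"
  by (simp add: hnorm_def cip_bas bas)

text \<open>Adds one coordinate at a time: the net of the smaller section is combined with a finite
  net of a disc in the complex plane.\<close>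

lemma eps_net_trunc:
  assumes "finite F" and "\<epsilon> > 0"
  shows "eps_net (trunc F ` {f \<in> H. \<forall>n. cmod (crd f n) \<le> R}) \<epsilon>"
  using assms
proof (induction F arbitrary: \<epsilon> rule: finite_induct)
  case empty
  have "\<forall>s\<in>trunc {} ` {f \<in> H. \<forall>n. cmod (crd f n) \<le> R}. \<exists>k\<in>{0}. hnorm cip (s - k) < \<epsilon>"
    using empty by (simp add: trunc_def)
  then show ?case unfolding eps_net_def using zeroH by blast
next
  case (insert n F)
  have "\<epsilon> / 2 > 0" using insert.prems by simp
  then obtain K where K: "finite K" "K \<subseteq> H"
      "\<forall>s\<in>trunc F ` {f \<in> H. \<forall>n. cmod (crd f n) \<le> R}. \<exists>k\<in>K. hnorm cip (s - k) < \<epsilon> / 2"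
    using insert.IH[of "\<epsilon> / 2"] unfolding eps_net_def by blast
  obtain Z where Z: "finite Z" "cball (0 :: complex) R \<subseteq> (\<Union>x\<in>Z. ball x (\<epsilon> / 2))"
    using compactE_image[OF compact_cball, of "cball (0 :: complex) R" "\<lambda>x. ball x (\<epsilon> / 2)" 0 R]
      \<open>\<epsilon> / 2 > 0\<close> by (metis UN_I centre_in_ball open_ball subsetI)
  let ?L = "(\<lambda>(z, k). cscale z (bas n) + k) ` (Z \<times> K)"
  have "\<exists>l\<in>?L. hnorm cip (trunc (insert n F) f - l) < \<epsilon>"
    if f: "f \<in> H" "\<forall>n. cmod (crd f n) \<le> R" for f
  proof -
    obtain k where k: "k \<in> K" "hnorm cip (trunc F f - k) < \<epsilon> / 2"
      using K(3) f by blast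
    have "crd f n \<in> cball 0 R" using f by simp
    then have "crd f n \<in> (\<Union>x\<in>Z. ball x (\<epsilon> / 2))" using Z(2) by blast
    then obtain z where z: "z \<in> Z" "dist z (crd f n) < \<epsilon> / 2" by auto
    have kH: "k \<in> H" using k K by blast
    have "trunc (insert n F) f = cscale (crd f n) (bas n) + trunc F f"
      using insert(1,2) by (simp add: trunc_def)
    then have "trunc (insert n F) f - (cscale z (bas n) + k) = cscale (crd f n - z) (bas n) + (trunc F f - k)"
      by (simp add: cscale_def fun_eq_iff algebra_simps)
    then have "hnorm cip (trunc (insert n F) f - (cscale z (bas n) + k))
        = hnorm cip (cscale (crd f n - z) (bas n) + (trunc F f - k))" by (rule arg_cong)
    also have "\<dots> \<le> hnorm cip (cscale (crd f n - z) (bas n)) + hnorm cip (trunc F f - k)"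
      by (intro hnorm_triangle scaleH bas diffH trunc kH)
    also have "\<dots> < \<epsilon> / 2 + \<epsilon> / 2"
      using z k by (intro add_strict_mono) (simp_all add: hnorm_scale bas hnorm_bas dist_norm norm_minus_commute)
    finally have "hnorm cip (trunc (insert n F) f - (cscale z (bas n) + k)) < \<epsilon>" by simp
    then show ?thesis using z k by (intro bexI[of _ "cscale z (bas n) + k"]) auto
  qed
  moreover have "finite ?L" using Z(1) K(1) by blast
  moreover have "?L \<subseteq> H" using K(2) bas(1) by (auto intro!: addH scaleH)
  ultimately show ?case unfolding eps_net_def by blast
qed

text \<open>Up to \<epsilon>, the image of the unit ball is a bounded set in finitely many
  coordinates. Hence it is totally bounded, and completeness turns this into compactness of the
  closure.\<close>

lemma compact_opI:
  assumes lin: "linear_op H A"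
    and C: "\<And>f. f \<in> H \<Longrightarrow> hnorm cip (A f) \<le> C * hnorm cip f" "C \<ge> 0"
    and tail: "\<And>\<epsilon>. \<epsilon> > 0 \<Longrightarrow> \<exists>F. finite F \<and> (\<forall>f\<in>H. hnorm cip f \<le> 1 \<longrightarrow> hnorm cip (A f - trunc F (A f)) \<le> \<epsilon>)"
  shows "compact_op H cip A"
proof -
  have AH: "A f \<in> H" if "f \<in> H" for f using lin that by (auto simp: linear_op_def)
  define S where "S = A ` M.mcball 0 1"
  have S: "\<exists>f\<in>H. hnorm cip f \<le> 1 \<and> s = A f" if "s \<in> S" for s
  proof -
    obtain f where f: "f \<in> M.mcball 0 1" "s = A f" using \<open>s \<in> S\<close> by (auto simp: S_def)
    then have "f \<in> H" "hdist H cip 0 f \<le> 1" by (auto simp: M.in_mcball)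
    then have "f \<in> H" "hnorm cip f \<le> 1"
      using hnorm_minus_commute[OF zeroH, of f] by (simp_all only: hdist_eq zeroH diff_zero)
    then show ?thesis using f by blast
  qed
  have SH: "S \<subseteq> H" using S AH by blast
  have net: "eps_net S \<epsilon>" if \<epsilon>: "\<epsilon> > 0" for \<epsilon>
  proof -
    have "\<epsilon> / 2 > 0" using \<epsilon> by simp
    then obtain F where F: "finite F" "\<forall>f\<in>H. hnorm cip f \<le> 1 \<longrightarrow> hnorm cip (A f - trunc F (A f)) \<le> \<epsilon> / 2"
      using tail by blast
    obtain K where K: "finite K" "K \<subseteq> H"
      "\<forall>s\<in>trunc F ` {f \<in> H. \<forall>n. cmod (crd f n) \<le> C}. \<exists>k\<in>K. hnorm cip (s - k) < \<epsilon> / 2"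
      using eps_net_trunc[OF F(1) \<open>\<epsilon> / 2 > 0\<close>, of C] by (auto simp: eps_net_def)
    have "\<exists>k\<in>K. hnorm cip (s - k) < \<epsilon>" if s: "s \<in> S" for s
    proof -
      obtain f where f: "f \<in> H" "hnorm cip f \<le> 1" "s = A f" using S[OF s] by blast
      have "cmod (crd s n) \<le> C" for n
      proof -
        have "cmod (crd s n) \<le> hnorm cip s" using SH s by (intro crd_le) auto
        also have "\<dots> \<le> C * hnorm cip f" using C(1)[OF f(1)] f(3) by simp
        also have "\<dots> \<le> C * 1" using C(2) f(2) by (intro mult_left_mono)
        finally show ?thesis by simp
      qed
      then obtain k where k: "k \<in> K" "hnorm cip (trunc F s - k) < \<epsilon> / 2"
        using K(3) SH s by blast
      have sH: "s \<in> H" using SH s by blast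
      have kH: "k \<in> H" using k K by blast
      have "hnorm cip (s - k) = hnorm cip ((s - trunc F s) + (trunc F s - k))" by simp
      also have "\<dots> \<le> hnorm cip (s - trunc F s) + hnorm cip (trunc F s - k)"
        by (intro hnorm_triangle diffH sH trunc kH)
      also have "\<dots> < \<epsilon>" using k F(2) f by fastforce
      finally show ?thesis using k by blast
    qed
    then show ?thesis using K unfolding eps_net_def by blast
  qed
  have "M.mtotally_bounded S"
    unfolding M.mtotally_bounded_def
  proof (intro allI impI)
    fix \<epsilon> :: real assume "\<epsilon> > 0"
    then have "\<epsilon> / 2 > 0" by simp
    then obtain K where K: "finite K" "K \<subseteq> H" "\<forall>s\<in>S. \<exists>k\<in>K. hnorm cip (s - k) < \<epsilon> / 2"
      using net unfolding eps_net_def by meson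
    \<comment> \<open>Only centres that serve some point of \<open>S\<close> are kept; each is then
      replaced by such a point.\<close>
    define K0 where "K0 = {k \<in> K. \<exists>s\<in>S. hnorm cip (s - k) < \<epsilon> / 2}"
    have "\<forall>k\<in>K0. \<exists>s\<in>S. hnorm cip (s - k) < \<epsilon> / 2" by (auto simp: K0_def)
    then obtain g where g: "\<forall>k\<in>K0. g k \<in> S \<and> hnorm cip (g k - k) < \<epsilon> / 2" by metis
    have "s \<in> (\<Union>x\<in>g ` K0. M.mball x \<epsilon>)" if s: "s \<in> S" for s
    proof -
      obtain k where k: "k \<in> K" "hnorm cip (s - k) < \<epsilon> / 2" using K(3) s by blast
      then have k0: "k \<in> K0" using s by (auto simp: K0_def)
      have H: "s \<in> H" "k \<in> H" "g k \<in> H" using SH s k K g k0 by auto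
      have "hnorm cip (g k - s) = hnorm cip ((g k - k) + (k - s))" by simp
      also have "\<dots> \<le> hnorm cip (g k - k) + hnorm cip (k - s)"
        using H by (intro hnorm_triangle diffH)
      also have "\<dots> < \<epsilon> / 2 + \<epsilon> / 2"
        using g k0 k H by (intro add_strict_mono) (auto simp: hnorm_minus_commute)
      finally have "s \<in> M.mball (g k) \<epsilon>" using H by (simp add: hdist_eq)
      then show ?thesis using k0 by blast
    qed
    moreover have "finite (g ` K0)" "g ` K0 \<subseteq> S" using K g by (auto simp: K0_def)
    ultimately show "\<exists>K. finite K \<and> K \<subseteq> S \<and> S \<subseteq> (\<Union>x\<in>K. M.mball x \<epsilon>)" by blast
  qed
  then have "compactin M.mtopology (M.mtopology closure_of S)"
    using M.mtotally_bounded_eq_compact_closure_of[OF complete] by blast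
  then show ?thesis
    using lin by (simp add: compact_op_def S_def)
qed

section \<open>Singular values of operators with rapidly decaying coordinates\<close>

context
  fixes A \<gamma>
  assumes lin: "linear_op H A"
    and \<gamma>: "\<And>f m. f \<in> H \<Longrightarrow> cmod (crd (A f) m) \<le> \<gamma> m * hnorm cip f"
    and rapid: "\<And>k::nat. \<exists>C. \<forall>m. \<gamma> m \<le> C / brk m ^ k"
begin

lemma rapid_in: "f \<in> H \<Longrightarrow> A f \<in> H"
  using lin by (auto simp: linear_op_def)

text \<open>Of \<open>k + 1\<close> powers of decay, k become the tail factor and one keeps the l2
  norm of the remaining coordinates finite. The statement is about any g dominated by \<gamma>,
  since it is applied to truncations of \<open>A f\<close> as well as to \<open>A f\<close>
  itself.\<close>

lemma rapid_tail:
  "\<exists>C>0. \<forall>N::nat. \<forall>f\<in>H. \<forall>g\<in>H. (\<forall>m. \<bar>m\<bar> \<le> int N \<longrightarrow> crd g m = 0) \<longrightarrow>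
      (\<forall>m. cmod (crd g m) \<le> \<gamma> m * hnorm cip f) \<longrightarrow> hnorm cip g \<le> C / (1 + real N) ^ k * hnorm cip f"
proof -
  obtain C0 where C0: "\<And>m. \<gamma> m \<le> C0 / brk m ^ (k + 1)" using rapid[of "k + 1"] by blast
  let ?u = "\<lambda>m::int. 1 / (brk m)\<^sup>2"
  define Z where "Z = infsum ?u UNIV"
  have Z: "Z \<ge> 0" unfolding Z_def by (rule infsum_nonneg) simp
  define C where "C = \<bar>C0\<bar> * sqrt Z + 1"
  have Cpos: "C > 0" using Z by (simp add: C_def add_nonneg_pos)
  have "hnorm cip g \<le> C / (1 + real N) ^ k * hnorm cip f"
    if f: "f \<in> H" and g: "g \<in> H" and g0: "\<forall>m. \<bar>m\<bar> \<le> int N \<longrightarrow> crd g m = 0"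
      and g\<gamma>: "\<forall>m. cmod (crd g m) \<le> \<gamma> m * hnorm cip f" for f g and N :: nat
  proof (rule cnorm_leI[OF g])
    let ?D = "\<bar>C0\<bar> / (1 + real N) ^ k * hnorm cip f"
    have D: "?D \<ge> 0" using f by simp
    show "0 \<le> C / (1 + real N) ^ k * hnorm cip f" using Cpos f by simp
    have pt: "cmod (crd g m) \<le> ?D * sqrt (?u m)" for m
    proof (cases "\<bar>m\<bar> \<le> int N")
      case True
      then have "crd g m = 0" using g0 by blast
      then show ?thesis using mult_nonneg_nonneg[OF D, of "sqrt (?u m)"] by simp
    next
      case False
      then have mN: "1 + real N \<le> 1 + \<bar>real_of_int m\<bar>" by linarith
      have "cmod (crd g m) \<le> \<gamma> m * hnorm cip f" using g\<gamma> by blast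
      also have "\<dots> \<le> (C0 / brk m ^ (k + 1)) * hnorm cip f"
        using C0 f by (intro mult_right_mono) auto
      also have "\<dots> \<le> (\<bar>C0\<bar> / ((1 + real N) ^ k * brk m)) * hnorm cip f"
      proof -
        have "(1 + real N) ^ k * (brk m) \<le> brk m ^ (k + 1)"
          using power_mono[OF mN, of k] by (simp add: mult.commute mult_left_mono)
        then show ?thesis
          using f by (intro mult_right_mono frac_le) auto
      qed
      also have "\<dots> = ?D * sqrt (?u m)"
        by (simp add: real_sqrt_divide)
      finally show ?thesis .
    qed
    fix F :: "int set" assume F: "finite F"
    have "L2_set (\<lambda>m. cmod (crd g m)) F \<le> L2_set (\<lambda>m. ?D * sqrt (?u m)) F"
      by (intro L2_set_mono pt) auto
    also have "\<dots> = ?D * L2_set (\<lambda>m. sqrt (?u m)) F"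
      by (rule L2_set_right_distrib[OF D, symmetric])
    also have "L2_set (\<lambda>m. sqrt (?u m)) F = sqrt (\<Sum>m\<in>F. ?u m)"
      unfolding L2_set_def by simp
    also have "?D * sqrt (\<Sum>m\<in>F. ?u m) \<le> ?D * sqrt Z"
      unfolding Z_def using D F
      by (intro mult_left_mono real_sqrt_le_mono finite_sum_le_infsum summable_inverse_square_int) auto
    also have "\<dots> \<le> C / (1 + real N) ^ k * hnorm cip f"
      using f by (simp add: C_def field_simps)
    finally show "L2_set (\<lambda>m. cmod (crd g m)) F \<le> C / (1 + real N) ^ k * hnorm cip f" .
  qed
  then show ?thesis using Cpos by blast
qed

lemma rapid_nonneg: "\<gamma> m \<ge> 0"
proof -
  have "0 \<le> cmod (crd (A (bas m)) m)" by simp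
  also have "\<dots> \<le> \<gamma> m" using \<gamma>[OF bas(1), of m m] by (simp add: hnorm_bas)
  finally show ?thesis .
qed

lemma rapid_bounded: "\<exists>C\<ge>0. \<forall>f\<in>H. hnorm cip (A f) \<le> C * hnorm cip f"
proof -
  obtain C where C: "C > 0" "\<And>(N::nat) f g. f \<in> H \<Longrightarrow> g \<in> H \<Longrightarrow> (\<forall>m. \<bar>m\<bar> \<le> int N \<longrightarrow> crd g m = 0) \<Longrightarrow>
      (\<forall>m. cmod (crd g m) \<le> \<gamma> m * hnorm cip f) \<Longrightarrow> hnorm cip g \<le> C / (1 + real N) ^ 0 * hnorm cip f"
    using rapid_tail[of 0] by blast
  have "hnorm cip (A f) \<le> (C + \<gamma> 0) * hnorm cip f" if f: "f \<in> H" for f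
  proof -
    \<comment> \<open>Even for \<open>N = 0\<close> the tail estimate asks coordinate 0 to vanish,
      so this coordinate is split off and bounded by \<open>\<gamma> 0\<close>.\<close>
    let ?g = "A f - trunc {0} (A f)"
    have g: "?g \<in> H" using f by (intro diffH trunc rapid_in)
    have cg: "crd ?g m = (if m = 0 then 0 else crd (A f) m)" for m
      using f by (simp add: crd_diff trunc rapid_in)
    have "hnorm cip ?g \<le> C / (1 + real 0) ^ 0 * hnorm cip f"
      using \<gamma>[OF f] rapid_nonneg f by (intro C(2)[OF f g]) (auto simp: cg)
    moreover have "hnorm cip (trunc {0} (A f)) \<le> \<gamma> 0 * hnorm cip f"
      using \<gamma>[OF f, of 0] by (simp add: trunc_def hnorm_scale bas hnorm_bas)
    moreover have "hnorm cip (A f) \<le> hnorm cip ?g + hnorm cip (trunc {0} (A f))"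
      using hnorm_triangle[OF g trunc(1)[of "{0}" "A f"]] by simp
    ultimately show ?thesis by (simp add: algebra_simps)
  qed
  then show ?thesis using C(1) rapid_nonneg[of 0] by (intro exI[of _ "C + \<gamma> 0"]) auto
qed

lemma rapid_bounded_op: "bounded_op H cip A"
  using rapid_bounded lin by (auto simp: bounded_op_def)

lemma rapid_compact: "compact_op H cip A"
proof -
  obtain C1 where C1: "C1 \<ge> 0" "\<And>f. f \<in> H \<Longrightarrow> hnorm cip (A f) \<le> C1 * hnorm cip f"
    using rapid_bounded by blast
  obtain C where C: "C > 0" "\<And>(N::nat) f g. f \<in> H \<Longrightarrow> g \<in> H \<Longrightarrow> (\<forall>m. \<bar>m\<bar> \<le> int N \<longrightarrow> crd g m = 0) \<Longrightarrow>
      (\<forall>m. cmod (crd g m) \<le> \<gamma> m * hnorm cip f) \<Longrightarrow> hnorm cip g \<le> C / (1 + real N) ^ 1 * hnorm cip f"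
    using rapid_tail[of 1] by blast
  show ?thesis
  proof (rule compact_opI[OF lin C1(2,1)])
    fix \<epsilon> :: real assume \<epsilon>: "\<epsilon> > 0"
    obtain N :: nat where N: "C / \<epsilon> < real N" using reals_Archimedean2 by blast
    have Ne: "C / (1 + real N) \<le> \<epsilon>" using N \<epsilon> C(1) by (simp add: field_simps)
    let ?F = "{- int N..int N}"
    have "hnorm cip (A f - trunc ?F (A f)) \<le> \<epsilon>" if f: "f \<in> H" "hnorm cip f \<le> 1" for f
    proof -
      let ?g = "A f - trunc ?F (A f)"
      have g: "?g \<in> H" using f by (intro diffH trunc rapid_in)
      have cg: "crd ?g m = (if m \<in> ?F then 0 else crd (A f) m)" for m
        using f by (simp add: crd_diff trunc rapid_in)
      have "hnorm cip ?g \<le> C / (1 + real N) ^ 1 * hnorm cip f"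
        using \<gamma>[OF f(1)] rapid_nonneg f by (intro C(2)[OF f(1) g]) (auto simp: cg)
      also have "\<dots> \<le> \<epsilon> * 1"
        using Ne f \<epsilon> by (intro mult_mono) auto
      finally show ?thesis by simp
    qed
    then show "\<exists>F. finite F \<and> (\<forall>f\<in>H. hnorm cip f \<le> 1 \<longrightarrow> hnorm cip (A f - trunc F (A f)) \<le> \<epsilon>)"
      by (intro exI[of _ ?F]) auto
  qed
qed

definition sing_space :: "real \<Rightarrow> ('x \<Rightarrow> complex) set" where
  "sing_space s = {f \<in> H. hadjoint H cip A (A f) = cscale (complex_of_real (s\<^sup>2)) f}"

lemma sing_space_ip:
  assumes "f \<in> sing_space s" "g \<in> H"
  shows "cip (A g) (A f) = of_real (s\<^sup>2) * cip g f"
proof -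
  have f: "f \<in> H" "hadjoint H cip A (A f) = cscale (complex_of_real (s\<^sup>2)) f"
    using assms by (auto simp: sing_space_def)
  have "cip (A g) (A f) = cip g (hadjoint H cip A (A f))"
    by (rule hadjoint(2)[OF rapid_bounded_op rapid_in[OF f(1)] assms(2)])
  also have "\<dots> = of_real (s\<^sup>2) * cip g f"
    unfolding f(2) using f(1) assms(2) by (simp add: ip_scale_right)
  finally show ?thesis .
qed

text \<open>Given more than $2N+1$ linearly independent vectors, some nontrivial combination \<open>f\<close> of them
  has an image \<open>A f\<close> without coordinates of index at most \<open>N\<close> in absolute value.\<close>

lemma sing_values_count:
  fixes v :: "'i \<Rightarrow> 'x \<Rightarrow> complex" and s :: "'i \<Rightarrow> real"
  assumes I: "finite I" and v: "\<And>i. i \<in> I \<Longrightarrow> v i \<in> sing_space (s i)"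
    and s: "\<And>i. i \<in> I \<Longrightarrow> s i \<ge> \<sigma>" and \<sigma>: "\<sigma> > 0"
    and indep: "\<And>c. (\<Sum>i\<in>I. cscale (c i) (v i)) = 0 \<Longrightarrow> \<forall>i\<in>I. c i = 0"
    and orth: "(\<forall>i\<in>I. \<forall>j\<in>I. i \<noteq> j \<longrightarrow> cip (v i) (v j) = 0) \<or> (\<forall>i\<in>I. s i = \<sigma>)"
    and C: "\<And>f g. f \<in> H \<Longrightarrow> g \<in> H \<Longrightarrow> (\<forall>m. \<bar>m\<bar> \<le> int N \<longrightarrow> crd g m = 0) \<Longrightarrow>
      (\<forall>m. cmod (crd g m) \<le> \<gamma> m * hnorm cip f) \<Longrightarrow> hnorm cip g \<le> \<tau> * hnorm cip f"
    and \<tau>: "\<tau> < \<sigma>"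
  shows "card I \<le> 2 * N + 1"
proof (rule ccontr)
  assume "\<not> card I \<le> 2 * N + 1"
  then have "card {- int N..int N} < card I" by simp
  then obtain c where c: "\<exists>i\<in>I. c i \<noteq> 0" "\<forall>m\<in>{- int N..int N}. (\<Sum>i\<in>I. crd (A (v i)) m * c i) = 0"
    using homogeneous_system[of "{- int N..int N}" I "\<lambda>m i. crd (A (v i)) m"] I by auto
  have vH: "v i \<in> H" if "i \<in> I" for i using v[OF that] by (simp add: sing_space_def)
  define f where "f = (\<Sum>i\<in>I. cscale (c i) (v i))"
  have f: "f \<in> H" unfolding f_def by (intro sumH scaleH vH)
  have f0: "f \<noteq> 0" using indep[of c] c(1) unfolding f_def by blast
  have A0: "A 0 = 0"
  proof -
    have "A (cscale 0 0) = cscale 0 (A 0)" using lin zeroH unfolding linear_op_def by blast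
    then show ?thesis by simp
  qed
  have "A (sum h J) = (\<Sum>i\<in>J. A (h i))" if "finite J" "\<And>i. i \<in> J \<Longrightarrow> h i \<in> H" for h and J :: "'i set"
    using that
  proof (induction J rule: finite_induct)
    case (insert i J)
    have "A (h i + sum h J) = A (h i) + A (sum h J)"
      using lin insert.prems sumH[of J h] unfolding linear_op_def by blast
    then show ?case using insert by (simp only: sum.insert[OF insert(1,2)]) simp
  qed (simp add: A0)
  then have "A f = (\<Sum>i\<in>I. A (cscale (c i) (v i)))" unfolding f_def using I vH by simp
  also have "\<dots> = (\<Sum>i\<in>I. cscale (c i) (A (v i)))"
    using lin vH unfolding linear_op_def by (intro sum.cong) auto
  finally have Af: "A f = (\<Sum>i\<in>I. cscale (c i) (A (v i)))" .
  have "crd (A f) m = 0" if "\<bar>m\<bar> \<le> int N" for m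
  proof -
    have "crd (A f) m = (\<Sum>i\<in>I. crd (A (v i)) m * c i)"
      unfolding Af using vH rapid_in by (simp add: crd_sum crd_scale mult.commute)
    moreover have "m \<in> {- int N..int N}" using that by auto
    ultimately show ?thesis using c(2) by simp
  qed
  then have "hnorm cip (A f) \<le> \<tau> * hnorm cip f"
    using C[OF f rapid_in[OF f]] \<gamma>[OF f] by blast
  also have "\<dots> < \<sigma> * hnorm cip f"
    using \<tau> f f0 hnorm_nonneg[OF f] hnorm_eq_0[OF f] by (intro mult_strict_right_mono) (auto simp: less_le)
  finally have less: "hnorm cip (A f) < \<sigma> * hnorm cip f" .
  have "cip (A f) (A f) = (\<Sum>i\<in>I. cnj (c i) * (of_real ((s i)\<^sup>2) * cip f (v i)))"
  proof -
    have "cip (A f) (A f) = (\<Sum>i\<in>I. cnj (c i) * cip (A f) (A (v i)))"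
      using f vH rapid_in by (subst (2) Af) (simp add: ip_sum_right ip_scale_right)
    also have "\<dots> = (\<Sum>i\<in>I. cnj (c i) * (of_real ((s i)\<^sup>2) * cip f (v i)))"
      by (intro sum.cong refl) (simp only: sing_space_ip[OF v f])
    finally show ?thesis .
  qed
  note AA = this
  have ff: "cip f f = (\<Sum>i\<in>I. cnj (c i) * cip f (v i))"
    using f vH by (subst (2) f_def) (simp add: ip_sum_right ip_scale_right)
  \<comment> \<open>The opposite inequality: on combinations of singular vectors \<open>A\<close>
    expands by at least \<sigma>. If all values equal \<sigma>, the square of the norm is just
    scaled; if the vectors are orthogonal, it is a sum of nonnegative terms scaled by factors of at
    least \<open>\<sigma>\<^sup>2\<close>.\<close>
  have "\<sigma>\<^sup>2 * (hnorm cip f)\<^sup>2 \<le> (hnorm cip (A f))\<^sup>2"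
    using orth
  proof
    assume "\<forall>i\<in>I. s i = \<sigma>"
    then have "cip (A f) (A f) = of_real (\<sigma>\<^sup>2) * cip f f"
      unfolding AA ff sum_distrib_left by (intro sum.cong) (auto simp: mult_ac)
    then show ?thesis using f rapid_in[OF f] by (simp add: hnorm_sq)
  next
    assume o: "\<forall>i\<in>I. \<forall>j\<in>I. i \<noteq> j \<longrightarrow> cip (v i) (v j) = 0"
    have fv: "cip f (v i) = c i * cip (v i) (v i)" if i: "i \<in> I" for i
    proof -
      have "cip f (v i) = (\<Sum>j\<in>I. c j * cip (v j) (v i))"
        unfolding f_def using vH i by (simp add: ip_sum_left ip_scale)
      also have "\<dots> = (\<Sum>j\<in>I. if j = i then c i * cip (v i) (v i) else 0)"
        using o i by (intro sum.cong refl) auto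
      finally show ?thesis using I i by simp
    qed
    have re: "Re (cnj (c i) * cip f (v i)) = (cmod (c i))\<^sup>2 * (hnorm cip (v i))\<^sup>2" if i: "i \<in> I" for i
    proof -
      have "cnj (c i) * cip f (v i) = of_real ((cmod (c i))\<^sup>2) * of_real ((hnorm cip (v i))\<^sup>2)"
        unfolding fv[OF i] complex_norm_square ip_self[OF vH[OF i]] by (simp only: mult_ac)
      then show ?thesis by (simp only: of_real_mult[symmetric] Re_complex_of_real)
    qed
    have e1: "\<sigma>\<^sup>2 * (hnorm cip f)\<^sup>2 = (\<Sum>i\<in>I. \<sigma>\<^sup>2 * Re (cnj (c i) * cip f (v i)))"
    proof -
      have "(hnorm cip f)\<^sup>2 = (\<Sum>i\<in>I. Re (cnj (c i) * cip f (v i)))"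
        by (rule trans[OF hnorm_sq[OF f] trans[OF arg_cong[OF ff, of Re] Re_sum]])
      then show ?thesis by (simp only: sum_distrib_left)
    qed
    have e2: "(\<Sum>i\<in>I. \<sigma>\<^sup>2 * Re (cnj (c i) * cip f (v i))) \<le> (\<Sum>i\<in>I. (s i)\<^sup>2 * Re (cnj (c i) * cip f (v i)))"
    proof (rule sum_mono)
      fix i assume i: "i \<in> I"
      have "\<sigma>\<^sup>2 \<le> (s i)\<^sup>2" using s[OF i] \<sigma> by (intro power_mono) auto
      then show "\<sigma>\<^sup>2 * Re (cnj (c i) * cip f (v i)) \<le> (s i)\<^sup>2 * Re (cnj (c i) * cip f (v i))"
        unfolding re[OF i] by (rule mult_right_mono) simp
    qed
    have e3: "(hnorm cip (A f))\<^sup>2 = (\<Sum>i\<in>I. (s i)\<^sup>2 * Re (cnj (c i) * cip f (v i)))"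
    proof -
      have "Re (cnj (c i) * (of_real ((s i)\<^sup>2) * cip f (v i))) = (s i)\<^sup>2 * Re (cnj (c i) * cip f (v i))" for i
        by (subst mult.left_commute) simp
      moreover have "(hnorm cip (A f))\<^sup>2 = (\<Sum>i\<in>I. Re (cnj (c i) * (of_real ((s i)\<^sup>2) * cip f (v i))))"
        by (rule trans[OF hnorm_sq[OF rapid_in[OF f]] trans[OF arg_cong[OF AA, of Re] Re_sum]])
      ultimately show ?thesis by (simp only:)
    qed
    show ?thesis using e1 e2 e3 by linarith
  qed
  then have "\<sigma> * hnorm cip f \<le> hnorm cip (A f)"
    unfolding power_mult_distrib[symmetric] by (rule power2_le_imp_le[OF _ hnorm_nonneg[OF rapid_in[OF f]]])
  with less show False by simp
qed

text \<open>A single eigenspace, where any basis will do because all values coincide. The other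
  alternative of \<open>orth\<close> is for \<open>sing_card_le\<close>, with one vector for each of
  several distinct values.\<close>

lemma sing_dim_le:
  assumes \<sigma>: "\<sigma> > 0" and \<tau>: "\<tau> < \<sigma>"
    and C: "\<And>f g. f \<in> H \<Longrightarrow> g \<in> H \<Longrightarrow> (\<forall>m. \<bar>m\<bar> \<le> int N \<longrightarrow> crd g m = 0) \<Longrightarrow>
      (\<forall>m. cmod (crd g m) \<le> \<gamma> m * hnorm cip f) \<Longrightarrow> hnorm cip g \<le> \<tau> * hnorm cip f"
  shows "cfun.dim (sing_space \<sigma>) \<le> 2 * N + 1"
proof (cases "cfun.dim (sing_space \<sigma>) = 0")
  case False
  obtain B where B: "B \<subseteq> sing_space \<sigma>" "cfun.independent B" "sing_space \<sigma> \<subseteq> cfun.span B"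
      "card B = cfun.dim (sing_space \<sigma>)"
    by (rule cfun.basis_exists)
  \<comment> \<open>Infinite bases have cardinality 0, so a nonzero dimension forces
    finiteness.\<close>
  have fin: "finite B" using B(4) False by (intro card_ge_0_finite) simp
  have "card B \<le> 2 * N + 1"
  proof (rule sing_values_count[where v = "\<lambda>b. b" and s = "\<lambda>_. \<sigma>" and \<sigma> = \<sigma>, OF fin _ _ \<sigma> _ _ C \<tau>])
    show "\<And>i. i \<in> B \<Longrightarrow> i \<in> sing_space \<sigma>" using B(1) by blast
    show "\<And>c. (\<Sum>i\<in>B. cscale (c i) i) = 0 \<Longrightarrow> \<forall>i\<in>B. c i = 0"
      using cfun.independentD[OF B(2) fin subset_refl] by blast
  qed simp_all
  then show ?thesis using B(4) by simp
qed simp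

lemma sing_space_nonzero:
  assumes "cfun.dim (sing_space s) \<noteq> 0"
  shows "\<exists>f\<in>sing_space s. f \<noteq> 0"
proof -
  obtain B where B: "B \<subseteq> sing_space s" "cfun.independent B" "sing_space s \<subseteq> cfun.span B"
      "card B = cfun.dim (sing_space s)"
    by (rule cfun.basis_exists)
  have "B \<noteq> {}" using assms B(4) by force
  then obtain b where b: "b \<in> B" by blast
  then have "b \<noteq> 0" using B(2) cfun.dependent_zero[of B] by blast
  then show ?thesis using b B(1) by blast
qed

lemma sing_space_orth:
  assumes f: "f \<in> sing_space s" and g: "g \<in> sing_space t" and st: "s > 0" "t > 0" "s \<noteq> t"
  shows "cip f g = 0"
proof -
  have fH: "f \<in> H" and gH: "g \<in> H" using f g by (simp_all add: sing_space_def)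
  have "cip (A f) (A g) = of_real (t\<^sup>2) * cip f g" by (rule sing_space_ip[OF g fH])
  moreover have "cip (A f) (A g) = of_real (s\<^sup>2) * cip f g"
  proof -
    have "cip (A f) (A g) = cnj (cip (A g) (A f))" by (rule ip_cnj[OF rapid_in[OF fH] rapid_in[OF gH]])
    also have "\<dots> = of_real (s\<^sup>2) * cnj (cip g f)"
      unfolding sing_space_ip[OF f gH] complex_cnj_mult complex_cnj_complex_of_real ..
    also have "cnj (cip g f) = cip f g" by (rule ip_cnj[OF fH gH, symmetric])
    finally show ?thesis .
  qed
  ultimately have "complex_of_real (t\<^sup>2) * cip f g = of_real (s\<^sup>2) * cip f g" by (simp only:)
  then have "complex_of_real (t\<^sup>2) = of_real (s\<^sup>2) \<or> cip f g = 0"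
    by (simp only: mult_cancel_right) blast
  then show ?thesis using st by (simp only: of_real_eq_iff power2_eq_iff) auto
qed

lemma sing_card_le:
  assumes \<sigma>: "\<sigma> > 0" and \<tau>: "\<tau> < \<sigma>"
    and C: "\<And>f g. f \<in> H \<Longrightarrow> g \<in> H \<Longrightarrow> (\<forall>m. \<bar>m\<bar> \<le> int N \<longrightarrow> crd g m = 0) \<Longrightarrow>
      (\<forall>m. cmod (crd g m) \<le> \<gamma> m * hnorm cip f) \<Longrightarrow> hnorm cip g \<le> \<tau> * hnorm cip f"
    and G: "finite G" "\<And>s. s \<in> G \<Longrightarrow> s \<ge> \<sigma>" "\<And>s. s \<in> G \<Longrightarrow> cfun.dim (sing_space s) \<noteq> 0"
  shows "card G \<le> 2 * N + 1"
proof -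
  have "\<forall>s\<in>G. \<exists>f. f \<in> sing_space s \<and> f \<noteq> 0" using sing_space_nonzero G(3) by blast
  then obtain v where v: "\<And>s. s \<in> G \<Longrightarrow> v s \<in> sing_space s" "\<And>s. s \<in> G \<Longrightarrow> v s \<noteq> 0"
    using bchoice[of G "\<lambda>s f. f \<in> sing_space s \<and> f \<noteq> 0"] by blast
  have vH: "v s \<in> H" if "s \<in> G" for s using v(1)[OF that] by (simp add: sing_space_def)
  have orth: "cip (v s) (v t) = 0" if "s \<in> G" "t \<in> G" "s \<noteq> t" for s t
    using sing_space_orth[OF v(1)[OF that(1)] v(1)[OF that(2)]] G(2)[OF that(1)] G(2)[OF that(2)] \<sigma> that(3) by simp
  show ?thesis
  proof (rule sing_values_count[where v = v and s = "\<lambda>s. s" and \<sigma> = \<sigma>, OF G(1) v(1) G(2) \<sigma> _ _ C \<tau>])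
    show "(\<forall>i\<in>G. \<forall>j\<in>G. i \<noteq> j \<longrightarrow> cip (v i) (v j) = 0) \<or> (\<forall>i\<in>G. i = \<sigma>)" using orth by blast
    fix c assume c: "(\<Sum>s\<in>G. cscale (c s) (v s)) = 0"
    show "\<forall>t\<in>G. c t = 0"
    proof
      fix t assume t: "t \<in> G"
      have "0 = cip (\<Sum>s\<in>G. cscale (c s) (v s)) (v t)" unfolding c using vH[OF t] by (rule ip_zero_left[symmetric])
      also have "\<dots> = (\<Sum>s\<in>G. c s * cip (v s) (v t))"
        using vH t by (simp add: ip_sum_left ip_scale)
      also have "\<dots> = (\<Sum>s\<in>G. if s = t then c t * cip (v t) (v t) else 0)"
        by (intro sum.cong refl) (simp add: orth t)
      also have "\<dots> = c t * cip (v t) (v t)" using G(1) t by simp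
      finally have "c t = 0 \<or> cip (v t) (v t) = 0" by (metis mult_eq_0_iff)
      moreover have "cip (v t) (v t) \<noteq> 0" using ip_pos[OF vH[OF t] v(2)[OF t]] by (metis less_irrefl zero_complex.sel(1))
      ultimately show "c t = 0" by blast
    qed
  qed
qed

lemma sing_value_le:
  assumes C: "\<And>f. f \<in> H \<Longrightarrow> hnorm cip (A f) \<le> C * hnorm cip f"
    and s: "cfun.dim (sing_space s) \<noteq> 0" "s > 0"
  shows "s \<le> C"
proof -
  obtain f where f: "f \<in> sing_space s" "f \<noteq> 0" using sing_space_nonzero[OF s(1)] by blast
  have fH: "f \<in> H" using f by (simp add: sing_space_def)
  have pos: "hnorm cip f > 0" using hnorm_nonneg[OF fH] hnorm_eq_0[OF fH] f(2) by linarith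
  have "(hnorm cip (A f))\<^sup>2 = s\<^sup>2 * (hnorm cip f)\<^sup>2"
    unfolding hnorm_sq[OF rapid_in[OF fH]] hnorm_sq[OF fH] sing_space_ip[OF f(1) fH]
    by (simp del: of_real_power)
  then have "hnorm cip (A f) = s * hnorm cip f"
    unfolding power_mult_distrib[symmetric]
    by (rule power2_eq_imp_eq[OF _ hnorm_nonneg[OF rapid_in[OF fH]] mult_nonneg_nonneg[OF less_imp_le[OF s(2)] less_imp_le[OF pos]]])
  then have "s * hnorm cip f \<le> C * hnorm cip f" using C[OF fH] by simp
  then show ?thesis using pos by simp
qed

text \<open>A singular value above \<open>C / (1 + real N) ^ k\<close> has multiplicity at most
  \<open>2 * N + 1\<close>, and there are at most as many distinct ones. As k is arbitrary, both the
  multiplicity and the rank of s are bounded by a constant times any small negative power of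
  s.\<close>

theorem rapid_nuclear: "nuclear_order_0 H cip A"
  unfolding nuclear_order_0_def
proof (intro conjI rapid_compact allI impI)
  fix p :: real assume p: "p > 0"
  \<comment> \<open>One quarter of the exponent absorbs the multiplicity of s; the other three give
    the inverse cube of the rank of s.\<close>
  define q where "q = p / 4"
  have q: "q > 0" using p by (simp add: q_def)
  \<comment> \<open>Makes \<open>q - 1 / k\<close> nonnegative, so that powers with this exponent
    stay bounded for s up to \<Lambda>.\<close>
  obtain k :: nat where k: "1 / q < real k" using reals_Archimedean2 by blast
  have k0: "k > 0" using k q by (cases k) (auto simp: field_simps)
  have kq: "1 / real k \<le> q" using k q k0 by (simp add: field_simps)
  obtain C where C: "C > 0" "\<And>(N::nat) f g. f \<in> H \<Longrightarrow> g \<in> H \<Longrightarrow> (\<forall>m. \<bar>m\<bar> \<le> int N \<longrightarrow> crd g m = 0) \<Longrightarrow>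
      (\<forall>m. cmod (crd g m) \<le> \<gamma> m * hnorm cip f) \<Longrightarrow> hnorm cip g \<le> C / (1 + real N) ^ k * hnorm cip f"
    using rapid_tail[of k] by blast
  obtain C1 where C1: "C1 \<ge> 0" "\<And>f. f \<in> H \<Longrightarrow> hnorm cip (A f) \<le> C1 * hnorm cip f"
    using rapid_bounded by blast
  define \<Lambda> where "\<Lambda> = max 1 C1"
  define Q where "Q = 2 * C powr (1 / k) * \<Lambda> powr (q - 1 / k) + 3 * \<Lambda> powr q"
  have Q0: "Q \<ge> 0" by (simp add: Q_def)
  let ?d = "\<lambda>s. real (cfun.dim (sing_space s))"
  have count: "\<exists>N. C / (1 + real N) ^ k < s \<and> real (2 * N + 1) * s powr q \<le> Q" if s: "s > 0" "s \<le> \<Lambda>" for s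
  proof -
    \<comment> \<open>Solves \<open>C / x ^ k = s\<close>. Rounding up gives
      \<open>2 * N + 1\<close> at most 2 x + 3, from which both terms of \<open>Q\<close>
      arise.\<close>
    define x where "x = (C / s) powr (1 / k)"
    have x: "x \<ge> 0" by (simp add: x_def)
    define N where "N = nat \<lceil>x\<rceil>"
    have N: "x \<le> real N" "real N \<le> x + 1" using x unfolding N_def by linarith+
    have "C / s = x ^ k"
      using s C(1) k0 by (simp add: x_def powr_realpow[symmetric] powr_powr)
    also have "\<dots> < (1 + real N) ^ k" using N(1) x k0 by (intro power_strict_mono) auto
    finally have 1: "C / (1 + real N) ^ k < s" using s by (simp add: field_simps)
    have "real (2 * N + 1) * s powr q \<le> (2 * x + 3) * s powr q"
      using N by (intro mult_right_mono) auto
    also have "\<dots> = 2 * C powr (1 / k) * s powr (q - 1 / k) + 3 * s powr q"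
      using s C(1) by (simp add: x_def powr_divide powr_diff field_simps)
    also have "\<dots> \<le> Q"
      unfolding Q_def using s kq q by (intro add_mono mult_left_mono powr_mono2) auto
    finally show ?thesis using 1 by blast
  qed
  have \<Lambda>: "s \<le> \<Lambda>" if "cfun.dim (sing_space s) \<noteq> 0" "s > 0" for s
    using sing_value_le[OF C1(2) that] by (simp add: \<Lambda>_def)
  have dim_le: "?d s * s powr q \<le> Q" if s: "s > 0" for s
  proof (cases "cfun.dim (sing_space s) = 0")
    case False
    obtain N where N: "C / (1 + real N) ^ k < s" "real (2 * N + 1) * s powr q \<le> Q"
      using count[OF s \<Lambda>[OF False s]] by blast
    have d: "cfun.dim (sing_space s) \<le> 2 * N + 1" by (rule sing_dim_le[OF s N(1) C(2)])
    have "?d s * s powr q \<le> real (2 * N + 1) * s powr q"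
      using d by (intro mult_right_mono) simp_all
    then show ?thesis using N(2) by linarith
  qed (use Q0 in simp)
  define Z where "Z = (\<Sum>n. 1 / (real n)\<^sup>2)"
  have Zs: "summable (\<lambda>n. 1 / (real n)\<^sup>2)"
    using inverse_power_summable[of 2, where 'a = real] by (simp add: divide_inverse)
  have fin: "(\<Sum>s\<in>G. ?d s * s powr p) \<le> Q ^ 4 * Z" if G: "finite G" "G \<subseteq> {s. s > 0}" for G
  proof -
    define G' where "G' = {s \<in> G. cfun.dim (sing_space s) \<noteq> 0}"
    have G': "finite G'" "\<And>s. s \<in> G' \<Longrightarrow> s > 0" "\<And>s. s \<in> G' \<Longrightarrow> cfun.dim (sing_space s) \<noteq> 0"
      using G by (auto simp: G'_def)
    \<comment> \<open>The rank of s in decreasing order. It is injective on \<open>G'\<close>, so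
      the sum over singular values is compared with a sum over distinct positive integers.\<close>
    define j where "j s = card {t \<in> G'. s \<le> t}" for s
    have j1: "j s \<ge> 1" if "s \<in> G'" for s
      unfolding j_def using that G'(1) by (simp add: Suc_le_eq card_gt_0_iff) blast
    have jmono: "j t < j s" if "s \<in> G'" "t \<in> G'" "s < t" for s t
      unfolding j_def
    proof (rule psubset_card_mono)
      have "s \<in> {t \<in> G'. s \<le> t} - {u \<in> G'. t \<le> u}" using that by simp
      moreover have "{u \<in> G'. t \<le> u} \<subseteq> {t \<in> G'. s \<le> t}" using that by auto
      ultimately show "{u \<in> G'. t \<le> u} \<subset> {t \<in> G'. s \<le> t}" by blast
    qed (use G'(1) in simp)
    have jinj: "inj_on j G'"
      by (rule inj_onI) (metis jmono less_irrefl linorder_neqE_linordered_idom)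
    have jq: "real (j s) * s powr q \<le> Q" if s: "s \<in> G'" for s
    proof -
      obtain N where N: "C / (1 + real N) ^ k < s" "real (2 * N + 1) * s powr q \<le> Q"
        using count[OF G'(2)[OF s] \<Lambda>[OF G'(3)[OF s] G'(2)[OF s]]] by blast
      have "j s \<le> 2 * N + 1"
        unfolding j_def
        by (rule sing_card_le[OF G'(2)[OF s] N(1) C(2)]) (use G' in auto)
      then have "real (j s) * s powr q \<le> real (2 * N + 1) * s powr q"
        by (intro mult_right_mono) auto
      then show ?thesis using N(2) by linarith
    qed
    have term_le: "?d s * s powr p \<le> Q ^ 4 * (1 / (real (j s))\<^sup>2)" if s: "s \<in> G'" for s
    proof -
      have jp: "real (j s) \<ge> 1" using j1[OF s] by simp
      have "s powr p = (s powr q) * (s powr q) ^ 3"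
        using G'(2)[OF s] by (simp add: q_def powr_realpow[symmetric] powr_powr powr_add[symmetric])
      then have "?d s * s powr p = (?d s * s powr q) * (s powr q) ^ 3" by simp
      also have "\<dots> \<le> Q * (Q / real (j s)) ^ 3"
        using dim_le[OF G'(2)[OF s]] jq[OF s] jp Q0
        by (intro mult_mono power_mono) (auto simp: field_simps)
      also have "\<dots> = Q ^ 4 / (real (j s)) ^ 3" by (simp add: power_divide eval_nat_numeral)
      also have "\<dots> \<le> Q ^ 4 / (real (j s))\<^sup>2"
        using jp Q0 by (intro divide_left_mono power_increasing mult_pos_pos) auto
      finally show ?thesis by simp
    qed
    have "(\<Sum>s\<in>G. ?d s * s powr p) = (\<Sum>s\<in>G'. ?d s * s powr p)"
      using G by (intro sum.mono_neutral_right) (auto simp: G'_def)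
    also have "\<dots> \<le> (\<Sum>s\<in>G'. Q ^ 4 * (1 / (real (j s))\<^sup>2))"
      by (intro sum_mono term_le)
    also have "\<dots> = Q ^ 4 * (\<Sum>n\<in>j ` G'. 1 / (real n)\<^sup>2)"
      by (simp add: sum.reindex[OF jinj] sum_distrib_left)
    also have "\<dots> \<le> Q ^ 4 * Z"
      unfolding Z_def using G'(1) Q0 by (intro mult_left_mono sum_le_suminf Zs) auto
    finally show ?thesis .
  qed
  show "sing_values_summable H cip A p"
    unfolding sing_values_summable_def
  proof (rule nonneg_bdd_above_summable_on)
    have eq: "sing_mult H cip A s = cfun.dim (sing_space s)" for s
      unfolding sing_mult_def sing_space_def ..
    show "bdd_above (sum (\<lambda>s. real (sing_mult H cip A s) * s powr p) ` {F. F \<subseteq> {s. 0 < s} \<and> finite F})"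
      unfolding eq by (rule bdd_aboveI2[where M = "Q ^ 4 * Z"]) (use fin in blast)
  qed simp
qed

end

end

section \<open>Triangular splitting of a matrix by levels\<close>

text \<open>A maximum of exponentials \<open>\<kappa>\<^sup>i\<^sup>K / D (2 * K)\<close> over \<open>K \<le> i\<close> grows faster than every exponential, with
  increment ratios tending to infinity, although its square stays below \<open>1 / e\<close> for every \<open>e\<close>
  that decays faster than every exponential with constants \<open>D\<close>.\<close>

lemma superexponential_weight:
  fixes \<kappa> :: real and D :: "nat \<Rightarrow> real"
  assumes \<kappa>: "\<kappa> > 1" and D: "\<And>K. D K \<ge> 1"
  obtains a :: "nat \<Rightarrow> real" where
    "\<And>i. a i > 0"
    "\<And>K::nat. \<exists>c>0. \<forall>i. c * \<kappa> ^ (K * i) \<le> a i"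
    "\<And>i. a i \<le> a (Suc i)"
    "\<And>R. \<exists>N. \<forall>i\<ge>N. R * a i \<le> a (Suc i)"
    "\<And>i e. e \<ge> 0 \<Longrightarrow> (\<And>K. e \<le> D K / \<kappa> ^ (K * i)) \<Longrightarrow> (a i)\<^sup>2 * e \<le> 1"
proof -
  \<comment> \<open>The index of \<open>D\<close> is doubled because the square of
    \<open>t i K\<close> is to be multiplied by the bound for e with exponent \<open>2 * K\<close>;
    the product is 1 / \<open>D (2 * K)\<close>.\<close>
  define t where "t i K = \<kappa> ^ (K * i) / D (2 * K)" for i K
  define a where "a i = Max (t i ` {..i})" for i
  have Dp: "D K > 0" for K using D[of K] by linarith
  have tpos: "t i K > 0" for i K using \<kappa> Dp by (simp add: t_def)
  have ge: "t i K \<le> a i" if "K \<le> i" for i K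
    unfolding a_def using that by (intro Max_ge) auto
  have arg: "\<exists>K\<le>i. a i = t i K" for i
  proof -
    have "a i \<in> t i ` {..i}" unfolding a_def by (intro Max_in) auto
    then show ?thesis by auto
  qed
  have tSuc: "t (Suc i) K = \<kappa> ^ K * t i K" for i K
    by (simp add: t_def power_add mult.commute)
  have pos: "a i > 0" for i using arg[of i] tpos by auto
  show ?thesis
  proof (rule that[of a])
    show "a i > 0" for i by (rule pos)
    show "\<exists>c>0. \<forall>i. c * \<kappa> ^ (K * i) \<le> a i" for K :: nat
    proof -
      \<comment> \<open>The first constant serves for i from K on, where \<open>t i K\<close> takes
        part in the maximum. The second serves for the finitely many smaller i, through
        \<open>t i 0\<close>.\<close>
      define c where "c = min (1 / D (2 * K)) (1 / (D 0 * \<kappa> ^ (K * K)))"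
      have c: "c > 0" using Dp \<kappa> by (simp add: c_def)
      have "c * \<kappa> ^ (K * i) \<le> a i" for i
      proof (cases "K \<le> i")
        case True
        have "c * \<kappa> ^ (K * i) \<le> (1 / D (2 * K)) * \<kappa> ^ (K * i)"
          using \<kappa> by (intro mult_right_mono) (auto simp: c_def)
        also have "\<dots> = t i K" by (simp add: t_def)
        also have "\<dots> \<le> a i" using ge[OF True] .
        finally show ?thesis .
      next
        case False
        have "c * \<kappa> ^ (K * i) \<le> (1 / (D 0 * \<kappa> ^ (K * K))) * \<kappa> ^ (K * K)"
          using \<kappa> c False Dp by (intro mult_mono power_increasing) (auto simp: c_def less_imp_le)
        also have "\<dots> = t i 0" using \<kappa> by (simp add: t_def)
        also have "\<dots> \<le> a i" by (rule ge) simp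
        finally show ?thesis .
      qed
      then show ?thesis using c by blast
    qed
    have step: "\<kappa> ^ K * a i \<le> a (Suc i)" if "a i = t i K" "K \<le> i" for i K
      using ge[of K "Suc i"] that by (simp add: tSuc)
    show "a i \<le> a (Suc i)" for i
    proof -
      obtain K where K: "K \<le> i" "a i = t i K" using arg by blast
      have "1 * a i \<le> \<kappa> ^ K * a i"
        using \<kappa> pos[of i] by (intro mult_right_mono) auto
      then show ?thesis using step[OF K(2,1)] by simp
    qed
    show "\<exists>N. \<forall>i\<ge>N. R * a i \<le> a (Suc i)" for R
    proof -
      obtain K0 where K0: "R < \<kappa> ^ K0" using real_arch_pow[OF \<kappa>] by blast
      obtain N0 where N0: "D (2 * Suc K0) < \<kappa> ^ N0" using real_arch_pow[OF \<kappa>] by blast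
      have "R * a i \<le> a (Suc i)" if i: "i \<ge> max N0 (Suc K0)" for i
      proof -
        obtain K where K: "K \<le> i" "a i = t i K" using arg by blast
        \<comment> \<open>At high levels the maximum is attained at a large K only:
          \<open>t i (Suc K0)\<close> already beats all candidates up to \<open>K0\<close>. The
          maximiser K then gives the growth factor \<kappa> to the power K in the next step.\<close>
        have "K > K0"
        proof (rule ccontr)
          assume "\<not> K > K0"
          then have "K \<le> K0" by simp
          have "t i K \<le> \<kappa> ^ (K * i) / 1"
            unfolding t_def using D \<kappa> by (intro divide_left_mono) (auto simp: Dp)
          also have "\<dots> \<le> \<kappa> ^ (K0 * i)"
            using \<kappa> \<open>K \<le> K0\<close> by (simp add: power_increasing)
          also have "\<dots> < t i (Suc K0)"
          proof -
            have "D (2 * Suc K0) < \<kappa> ^ i"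
              by (rule less_le_trans[OF N0 power_increasing]) (use i \<kappa> in auto)
            then have "\<kappa> ^ (K0 * i) * D (2 * Suc K0) < \<kappa> ^ (K0 * i) * \<kappa> ^ i"
              using \<kappa> by (intro mult_strict_left_mono) auto
            then show ?thesis
              unfolding t_def using Dp[of "2 * Suc K0"] by (simp add: field_simps power_add)
          qed
          also have "\<dots> \<le> a i" using i by (intro ge) simp
          finally show False using K(2) by simp
        qed
        then have "\<kappa> ^ K0 \<le> \<kappa> ^ K" using \<kappa> by (intro power_increasing) auto
        then have "R \<le> \<kappa> ^ K" using K0 by linarith
        then have "R * a i \<le> \<kappa> ^ K * a i"
          using pos[of i] by (intro mult_right_mono) auto
        then show ?thesis using step[OF K(2,1)] by linarith
      qed
      then show ?thesis by blast
    qed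
    show "(a i)\<^sup>2 * e \<le> 1" if e: "e \<ge> 0" "\<And>K. e \<le> D K / \<kappa> ^ (K * i)" for i e
    proof -
      obtain K where K: "K \<le> i" "a i = t i K" using arg by blast
      have "(a i)\<^sup>2 * e \<le> (t i K)\<^sup>2 * (D (2 * K) / \<kappa> ^ (2 * K * i))"
        unfolding K(2) by (intro mult_left_mono e) auto
      also have "(t i K)\<^sup>2 = \<kappa> ^ (2 * K * i) / (D (2 * K))\<^sup>2"
        unfolding t_def power_divide by (simp add: power_mult[symmetric] mult_ac)
      also have "\<kappa> ^ (2 * K * i) / (D (2 * K))\<^sup>2 * (D (2 * K) / \<kappa> ^ (2 * K * i)) = 1 / D (2 * K)"
        using \<kappa> Dp[of "2 * K"] by (simp add: field_simps power2_eq_square)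
      also have "\<dots> \<le> 1" using D[of "2 * K"] by simp
      finally show ?thesis .
    qed
  qed
qed

text \<open>The quotient \<sigma> of the sum by the last square satisfies \<sigma> (j + 1) \<le>
  (\<sigma> j + 1) \<rho>, so it forgets its start geometrically and settles below 2 \<rho>.\<close>

lemma sum_squares_small:
  fixes a :: "nat \<Rightarrow> real"
  assumes pos: "\<And>i. a i > 0" and ratio: "\<And>R. \<exists>N. \<forall>i\<ge>N. R * a i \<le> a (Suc i)" and \<epsilon>: "\<epsilon> > 0"
  shows "\<exists>N. \<forall>j\<ge>N. (\<Sum>i<j. (a i)\<^sup>2) \<le> \<epsilon> * (a j)\<^sup>2"
proof -
  \<comment> \<open>The bound by 1 / 4 keeps 2 \<rho> stable under the recursion; the bound by
    \<epsilon> / 4 leaves half of \<epsilon> for the forgotten start.\<close>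
  define \<rho> where "\<rho> = min (\<epsilon> / 4) (1 / 4)"
  have \<rho>: "\<rho> > 0" "\<rho> \<le> \<epsilon> / 4" "\<rho> \<le> 1 / 4" using \<epsilon> by (auto simp: \<rho>_def)
  obtain N where N: "\<And>i. i \<ge> N \<Longrightarrow> (1 / sqrt \<rho>) * a i \<le> a (Suc i)" using ratio by blast
  have sq: "(a i)\<^sup>2 \<le> \<rho> * (a (Suc i))\<^sup>2" if "i \<ge> N" for i
  proof -
    have "a i \<le> sqrt \<rho> * a (Suc i)" using N[OF that] \<rho> by (simp add: field_simps)
    then have "(a i)\<^sup>2 \<le> (sqrt \<rho> * a (Suc i))\<^sup>2" using pos[of i] by (intro power_mono) auto
    then show ?thesis using \<rho> by (simp add: power_mult_distrib)
  qed
  define \<sigma> where "\<sigma> j = (\<Sum>i<j. (a i)\<^sup>2) / (a j)\<^sup>2" for j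
  have \<sigma>0: "\<sigma> j \<ge> 0" for j unfolding \<sigma>_def by (intro divide_nonneg_nonneg sum_nonneg) auto
  have rec: "\<sigma> (Suc j) \<le> (\<sigma> j + 1) * \<rho>" if "j \<ge> N" for j
  proof -
    have "\<sigma> (Suc j) = (\<sigma> j + 1) * ((a j)\<^sup>2 / (a (Suc j))\<^sup>2)"
      using pos[of j] pos[of "Suc j"] by (simp add: \<sigma>_def field_simps)
    also have "\<dots> \<le> (\<sigma> j + 1) * \<rho>"
      using sq[OF that] pos[of "Suc j"] \<sigma>0[of j] by (intro mult_left_mono) (auto simp: field_simps)
    finally show ?thesis .
  qed
  have bound: "\<sigma> (N + k) \<le> \<sigma> N * \<rho> ^ k + 2 * \<rho>" for k
  proof (induction k)
    case 0
    then show ?case using \<rho> by simp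
  next
    case (Suc k)
    have "\<sigma> (N + Suc k) \<le> (\<sigma> (N + k) + 1) * \<rho>" using rec[of "N + k"] by simp
    also have "\<dots> \<le> ((\<sigma> N * \<rho> ^ k + 2 * \<rho>) + 1) * \<rho>"
      using Suc \<rho> by (intro mult_right_mono) auto
    also have "\<dots> = \<sigma> N * \<rho> ^ Suc k + (2 * \<rho> + 1) * \<rho>" by (simp add: algebra_simps)
    also have "\<dots> \<le> \<sigma> N * \<rho> ^ Suc k + 2 * \<rho>"
      using \<rho> by (intro add_left_mono mult_right_mono) auto
    finally show ?case .
  qed
  have "(\<lambda>k. \<sigma> N * \<rho> ^ k) \<longlonglongrightarrow> \<sigma> N * 0"
    using \<rho> by (intro tendsto_mult tendsto_const LIMSEQ_power_zero) auto
  then have "\<forall>\<^sub>F k in sequentially. \<sigma> N * \<rho> ^ k < \<epsilon> / 2"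
    using \<epsilon> by (intro order_tendstoD(2)) auto
  then obtain k0 where k0: "\<And>k. k \<ge> k0 \<Longrightarrow> \<sigma> N * \<rho> ^ k < \<epsilon> / 2"
    by (auto simp: eventually_sequentially)
  have "(\<Sum>i<j. (a i)\<^sup>2) \<le> \<epsilon> * (a j)\<^sup>2" if "j \<ge> N + k0" for j
  proof -
    define k where "k = j - N"
    have j: "j = N + k" "k \<ge> k0" using that by (auto simp: k_def)
    have "\<sigma> j \<le> \<epsilon>" using bound[of k] k0[OF j(2)] \<rho> unfolding j(1) by linarith
    then show ?thesis using pos[of j] by (simp add: \<sigma>_def field_simps)
  qed
  then show ?thesis by blast
qed

text \<open>The entry \<open>M m n\<close> is the coefficient of index \<open>m\<close> of the image of the basis vector of index \<open>n\<close>.\<close>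

locale smoothing_matrix =
  fixes M :: "int \<Rightarrow> int \<Rightarrow> complex" and \<kappa> L :: real
  assumes \<kappa>: "\<kappa> > 1" and L: "L \<ge> 0"
    and decay: "\<And>K::nat. \<exists>C. \<forall>m n. \<bar>real_of_int n\<bar> \<le> \<kappa> * \<bar>real_of_int m\<bar> \<longrightarrow>
      cmod (M m n) \<le> C / brk m ^ K"
    and row_abs: "\<And>m. (\<lambda>n. M m n) abs_summable_on UNIV"
    and l2_bound: "\<And>c N S. finite N \<Longrightarrow> finite S \<Longrightarrow>
      (\<Sum>n\<in>N. (cmod (\<Sum>m\<in>S. c m * M m n))\<^sup>2) \<le> L\<^sup>2 * (\<Sum>m\<in>S. (cmod (c m))\<^sup>2)"
begin

text \<open>Level 0 contains the frequency 0 alone, and level j + 1 the frequencies of absolute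
  value from \<kappa> to the power j, up to but not including the next power.\<close>

definition lev :: "int \<Rightarrow> nat" where
  "lev n = (LEAST j. \<bar>real_of_int n\<bar> < \<kappa> ^ j)"

lemma lev_upper: "\<bar>real_of_int n\<bar> < \<kappa> ^ lev n"
  unfolding lev_def using real_arch_pow[OF \<kappa>, of "\<bar>real_of_int n\<bar>"] by (auto intro: LeastI)

lemma lev_le: "\<bar>real_of_int n\<bar> < \<kappa> ^ j \<Longrightarrow> lev n \<le> j"
  unfolding lev_def by (rule Least_le)

lemma lev_lower: "lev n = Suc j \<Longrightarrow> \<kappa> ^ j \<le> \<bar>real_of_int n\<bar>"
  using lev_le[of n j] by (cases "\<bar>real_of_int n\<bar> < \<kappa> ^ j") auto

lemma lev_zero: "lev 0 = 0"
  using lev_le[of 0 0] by simp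

lemma lev_power_le: "\<kappa> ^ lev n \<le> \<kappa> * brk n"
proof (cases "lev n")
  case 0
  then show ?thesis using \<kappa> mult_mono[of 1 \<kappa> 1 "1 + \<bar>real_of_int n\<bar>"] by simp
next
  case (Suc j)
  then show ?thesis using lev_lower[OF Suc] \<kappa> by simp
qed

lemma kappa_ge_1: "1 \<le> \<kappa> ^ N"
  using \<kappa> by (intro one_le_power) simp

lemma kappa_mono: "m \<le> n \<Longrightarrow> \<kappa> ^ m \<le> \<kappa> ^ n"
  using \<kappa> by (intro power_increasing) auto

lemma lev_power_ge: "1 + \<bar>real_of_int n\<bar> \<le> 2 * \<kappa> ^ lev n"
proof -
  have "1 + \<bar>real_of_int n\<bar> \<le> \<kappa> ^ lev n + \<kappa> ^ lev n"
    by (intro add_mono kappa_ge_1 less_imp_le[OF lev_upper])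
  then show ?thesis by simp
qed

text \<open>This is why the ratio of the levels is the constant of \<open>decay\<close>: all entries
  that do not strictly decrease the level lie in the region of rapid decay.\<close>

lemma lev_mono_imp: "lev n \<le> lev m \<Longrightarrow> \<bar>real_of_int n\<bar> \<le> \<kappa> * \<bar>real_of_int m\<bar>"
proof (cases "lev m")
  case 0
  assume "lev n \<le> lev m"
  then have "lev n = 0" using 0 by simp
  then have "\<bar>real_of_int n\<bar> < 1" using lev_upper[of n] by simp
  then have "n = 0" by linarith
  then show ?thesis using \<kappa> by simp
next
  case (Suc j)
  assume "lev n \<le> lev m"
  then have "\<bar>real_of_int n\<bar> \<le> \<kappa> ^ lev m"
    using lev_upper[of n] power_increasing[of "lev n" "lev m" \<kappa>] \<kappa> by linarith
  also have "\<dots> = \<kappa> * \<kappa> ^ j" by (simp add: Suc)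
  also have "\<dots> \<le> \<kappa> * \<bar>real_of_int m\<bar>" using lev_lower[OF Suc] \<kappa> by simp
  finally show ?thesis .
qed

lemma lev_subset: "{n. lev n \<le> N} \<subseteq> {- \<lceil>\<kappa> ^ N\<rceil>..\<lceil>\<kappa> ^ N\<rceil>}"
proof
  fix n assume "n \<in> {n. lev n \<le> N}"
  then have "\<bar>real_of_int n\<bar> < \<kappa> ^ N"
    using less_le_trans[OF lev_upper kappa_mono] by simp
  then have "\<bar>real_of_int n\<bar> \<le> of_int \<lceil>\<kappa> ^ N\<rceil>"
    using le_of_int_ceiling[of "\<kappa> ^ N"] by (rule order_trans[OF less_imp_le])
  then show "n \<in> {- \<lceil>\<kappa> ^ N\<rceil>..\<lceil>\<kappa> ^ N\<rceil>}" by (simp add: abs_le_iff)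
qed

lemma finite_lev: "finite {n. lev n \<le> N}"
  using lev_subset by (rule finite_subset) simp

lemma card_lev: "real (card {n. lev n \<le> N}) \<le> 5 * \<kappa> ^ N"
proof -
  \<comment> \<open>The ceiling adds less than 1 on either side, for a total below 2 x + 3, and x is
    at least 1.\<close>
  have *: "real (nat (2 * \<lceil>x\<rceil> + 1)) \<le> 5 * x" if "1 \<le> x" for x :: real
    using that by linarith
  have "card {n. lev n \<le> N} \<le> card {- \<lceil>\<kappa> ^ N\<rceil>..\<lceil>\<kappa> ^ N\<rceil>}"
    using lev_subset by (intro card_mono) auto
  also have "\<dots> = nat (2 * \<lceil>\<kappa> ^ N\<rceil> + 1)" by simp
  finally have "real (card {n. lev n \<le> N}) \<le> real (nat (2 * \<lceil>\<kappa> ^ N\<rceil> + 1))" by (rule of_nat_mono)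
  also have "\<dots> \<le> 5 * \<kappa> ^ N" by (rule *[OF kappa_ge_1])
  finally show ?thesis .
qed

text \<open>Superexponential growth in the level means growth beyond every power of the frequency,
  which makes the Fourier series smooth. The sums of squares bound the level-decreasing part, whose
  rows of level i < j meet columns of level j. The last clause keeps the decay of the rest after
  multiplication by the weight of the row; the weight of the column enters later through its lower
  bound.\<close>

definition admissible :: "(nat \<Rightarrow> real) \<Rightarrow> bool" where
  "admissible a \<longleftrightarrow> (\<forall>i. a i > 0) \<and> (\<forall>K::nat. \<exists>c>0. \<forall>i. c * \<kappa> ^ (K * i) \<le> a i) \<and>
     (\<forall>i. a i \<le> a (Suc i)) \<and>
     (\<forall>\<epsilon>>0. \<exists>N. \<forall>j\<ge>N. (\<Sum>i<j. (a i)\<^sup>2) \<le> \<epsilon> * (a j)\<^sup>2) \<and>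
     (\<forall>K::nat. \<exists>C. \<forall>m n. lev n \<le> lev m \<longrightarrow> a (lev m) * cmod (M m n) \<le> C / \<kappa> ^ (K * lev m))"

lemma admissible_ex: "\<exists>a. admissible a"
proof -
  have "\<exists>D\<ge>1. \<forall>m n. lev n \<le> lev m \<longrightarrow> cmod (M m n) \<le> D / \<kappa> ^ (K * lev m)" for K :: nat
  proof -
    obtain C where C: "\<And>m n. \<bar>real_of_int n\<bar> \<le> \<kappa> * \<bar>real_of_int m\<bar> \<Longrightarrow> cmod (M m n) \<le> C / brk m ^ K"
      using decay[of K] by blast
    have "cmod (M m n) \<le> max 1 (\<bar>C\<bar> * \<kappa> ^ K) / \<kappa> ^ (K * lev m)" if "lev n \<le> lev m" for m n
    proof -
      have "\<kappa> ^ (K * lev m) = (\<kappa> ^ lev m) ^ K" by (simp add: power_mult[symmetric] mult.commute)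
      also have "\<dots> \<le> (\<kappa> * brk m) ^ K"
        using lev_power_le[of m] \<kappa> by (intro power_mono) auto
      finally have pw: "\<kappa> ^ (K * lev m) \<le> \<kappa> ^ K * brk m ^ K" by (simp add: power_mult_distrib)
      have "cmod (M m n) \<le> C / brk m ^ K" by (rule C[OF lev_mono_imp[OF that]])
      also have "\<dots> \<le> \<bar>C\<bar> / brk m ^ K" by (intro divide_right_mono) auto
      also have "\<dots> = (\<bar>C\<bar> * \<kappa> ^ K) / (\<kappa> ^ K * brk m ^ K)" using \<kappa> by simp
      also have "\<dots> \<le> (\<bar>C\<bar> * \<kappa> ^ K) / \<kappa> ^ (K * lev m)"
        using \<kappa> pw by (intro divide_left_mono mult_pos_pos) auto
      also have "\<dots> \<le> max 1 (\<bar>C\<bar> * \<kappa> ^ K) / \<kappa> ^ (K * lev m)"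
        using \<kappa> by (intro divide_right_mono) auto
      finally show ?thesis .
    qed
    then show ?thesis by (intro exI[of _ "max 1 (\<bar>C\<bar> * \<kappa> ^ K)"]) auto
  qed
  then have "\<exists>D. \<forall>K. D K \<ge> 1 \<and> (\<forall>m n. lev n \<le> lev m \<longrightarrow> cmod (M m n) \<le> D K / \<kappa> ^ (K * lev m))"
    by (intro choice) blast
  then obtain D where D: "\<And>K. D K \<ge> 1"
      "\<And>K m n. lev n \<le> lev m \<Longrightarrow> cmod (M m n) \<le> D K / \<kappa> ^ (K * lev m)" by blast
  obtain a where a: "\<And>i. a i > 0" "\<And>K::nat. \<exists>c>0. \<forall>i. c * \<kappa> ^ (K * i) \<le> a i"
      "\<And>i. a i \<le> a (Suc i)" "\<And>R. \<exists>N. \<forall>i\<ge>N. R * a i \<le> a (Suc i)"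
      "\<And>i e. e \<ge> 0 \<Longrightarrow> (\<And>K. e \<le> D K / \<kappa> ^ (K * i)) \<Longrightarrow> (a i)\<^sup>2 * e \<le> 1"
    using superexponential_weight[of \<kappa> D] \<kappa> D(1) by blast
  have "\<exists>C. \<forall>m n. lev n \<le> lev m \<longrightarrow> a (lev m) * cmod (M m n) \<le> C / \<kappa> ^ (K * lev m)" for K :: nat
  proof -
    \<comment> \<open>The weight is at most the inverse square root of each such entry, so
      multiplying by it still leaves the square root of the decay. This is why the constant of index
      \<open>2 * K\<close> appears.\<close>
    have "a (lev m) * cmod (M m n) \<le> sqrt (D (2 * K)) / \<kappa> ^ (K * lev m)" if l: "lev n \<le> lev m" for m n
    proof -
      let ?e = "cmod (M m n)"
      have "(a (lev m) * ?e)\<^sup>2 = ((a (lev m))\<^sup>2 * ?e) * ?e" by (simp add: power2_eq_square mult_ac)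
      also have "\<dots> \<le> 1 * ?e"
        using a(5)[of ?e "lev m"] D(2)[OF l] by (intro mult_right_mono) auto
      also have "\<dots> \<le> D (2 * K) / \<kappa> ^ (2 * K * lev m)" using D(2)[OF l, of "2 * K"] by simp
      also have "\<dots> = (sqrt (D (2 * K)) / \<kappa> ^ (K * lev m))\<^sup>2"
        using D(1)[of "2 * K"] by (simp add: power_divide power_mult[symmetric] mult_ac)
      finally show ?thesis
        by (rule power2_le_imp_le) (use \<kappa> D(1)[of "2 * K"] in auto)
    qed
    then show ?thesis by blast
  qed
  moreover have "\<exists>N. \<forall>j\<ge>N. (\<Sum>i<j. (a i)\<^sup>2) \<le> \<epsilon> * (a j)\<^sup>2" if "\<epsilon> > 0" for \<epsilon>
    by (rule sum_squares_small[OF a(1) a(4) that])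
  ultimately have "admissible a" unfolding admissible_def using a(1-3) by blast
  then show ?thesis by blast
qed

end

section \<open>The two parts of the matrix on weighted sequences\<close>

context smoothing_matrix
begin

text \<open>The matrix entries that strictly decrease the level. The sum is infinite, unlike that of
  \<open>upper\<close>, so statements about it carry summability assumptions.\<close>

definition lower :: "(int \<Rightarrow> complex) \<Rightarrow> int \<Rightarrow> complex" where
  "lower x m = (\<Sum>\<^sub>\<infinity>n\<in>{n. lev m < lev n}. M m n * x n)"

definition upper :: "(int \<Rightarrow> complex) \<Rightarrow> int \<Rightarrow> complex" where
  "upper x m = (\<Sum>n\<in>{n. lev n \<le> lev m}. M m n * x n)"

definition ws :: "(nat \<Rightarrow> real) \<Rightarrow> (int \<Rightarrow> complex) \<Rightarrow> bool" where
  "ws a x \<longleftrightarrow> (\<lambda>n. (a (lev n) * cmod (x n))\<^sup>2) summable_on UNIV"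

definition wn :: "(nat \<Rightarrow> real) \<Rightarrow> (int \<Rightarrow> complex) \<Rightarrow> real" where
  "wn a x = sqrt (\<Sum>\<^sub>\<infinity>n. (a (lev n) * cmod (x n))\<^sup>2)"

lemma wn_nonneg [simp]: "wn a x \<ge> 0"
  by (simp add: wn_def infsum_nonneg)

lemma wn_sq: "(wn a x)\<^sup>2 = (\<Sum>\<^sub>\<infinity>n. (a (lev n) * cmod (x n))\<^sup>2)"
  by (simp add: wn_def infsum_nonneg)

lemma wn_le: "ws a x \<Longrightarrow> \<bar>a (lev n) * cmod (x n)\<bar> \<le> wn a x"
proof -
  assume "ws a x"
  then have "(\<Sum>n\<in>{n}. (a (lev n) * cmod (x n))\<^sup>2) \<le> (wn a x)\<^sup>2"
    unfolding wn_sq ws_def by (intro finite_sum_le_infsum) auto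
  then show ?thesis by (simp add: abs_le_square_iff[symmetric])
qed

lemma wsI:
  assumes B: "B \<ge> 0" and le: "\<And>F. finite F \<Longrightarrow> (\<Sum>n\<in>F. (a (lev n) * cmod (x n))\<^sup>2) \<le> B\<^sup>2"
  shows "ws a x" "wn a x \<le> B"
proof -
  show ws: "ws a x"
    unfolding ws_def
    by (rule nonneg_bdd_above_summable_on) (use le in \<open>auto intro!: bdd_aboveI2[where M = "B\<^sup>2"]\<close>)
  have "(wn a x)\<^sup>2 \<le> B\<^sup>2"
    unfolding wn_sq by (rule infsum_le_finite_sums) (use ws le in \<open>auto simp: ws_def\<close>)
  then show "wn a x \<le> B" using B by (rule power2_le_imp_le)
qed

lemma row_summable:
  assumes "\<And>n. cmod (x n) \<le> B"
  shows "(\<lambda>n. M m n * x n) abs_summable_on A"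
proof (rule Infinite_Sum.abs_summable_on_comparison_test')
  show "(\<lambda>n. B * cmod (M m n)) summable_on A"
    by (rule summable_on_subset[OF summable_on_cmult_right[OF row_abs]]) simp
  show "norm (M m n * x n) \<le> B * cmod (M m n)" for n
    using assms[of n] by (simp add: norm_mult mult.commute mult_right_mono)
qed

text \<open>Duality: the image y is paired with itself, which moves the matrix onto finite
  combinations of its rows, where \<open>l2_bound\<close> applies. The outcome T \<le> L sqrt T X is
  divided by sqrt T and squared.\<close>

lemma block_bound:
  assumes S: "finite S" and x: "(\<lambda>n. (cmod (x n))\<^sup>2) summable_on A" and B: "\<And>n. cmod (x n) \<le> B"
  shows "(\<Sum>m\<in>S. (cmod (\<Sum>\<^sub>\<infinity>n\<in>A. M m n * x n))\<^sup>2) \<le> L\<^sup>2 * (\<Sum>\<^sub>\<infinity>n\<in>A. (cmod (x n))\<^sup>2)"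
proof -
  define y where "y m = (\<Sum>\<^sub>\<infinity>n\<in>A. M m n * x n)" for m
  define T where "T = (\<Sum>m\<in>S. (cmod (y m))\<^sup>2)"
  define X where "X = sqrt (\<Sum>\<^sub>\<infinity>n\<in>A. (cmod (x n))\<^sup>2)"
  have T0: "T \<ge> 0" by (simp add: T_def sum_nonneg)
  have X0: "X \<ge> 0" by (simp add: X_def infsum_nonneg)
  define g where "g n = (\<Sum>m\<in>S. cnj (y m) * M m n)" for n
  have "((\<lambda>n. \<Sum>m\<in>S. cnj (y m) * (M m n * x n)) has_sum (\<Sum>m\<in>S. cnj (y m) * y m)) A"
    unfolding y_def
    by (intro has_sum_sum S has_sum_cmult_right has_sum_infsum abs_summable_summable[OF row_summable[OF B]])
  moreover have "(\<Sum>m\<in>S. cnj (y m) * (M m n * x n)) = g n * x n" for n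
    by (simp add: g_def sum_distrib_right mult.assoc)
  moreover have "(\<Sum>m\<in>S. cnj (y m) * y m) = of_real T"
    unfolding T_def of_real_sum by (intro sum.cong refl) (metis complex_norm_square mult.commute)
  ultimately have "((\<lambda>n. g n * x n) has_sum of_real T) A" by simp
  then have "((\<lambda>F. \<Sum>n\<in>F. g n * x n) \<longlongrightarrow> of_real T) (finite_subsets_at_top A)"
    by (simp add: has_sum_def)
  then have lim: "((\<lambda>F. cmod (\<Sum>n\<in>F. g n * x n)) \<longlongrightarrow> cmod (of_real T)) (finite_subsets_at_top A)"
    by (rule tendsto_norm)
  have "cmod (\<Sum>n\<in>F. g n * x n) \<le> (L * sqrt T) * X" if F: "finite F" "F \<subseteq> A" for F
  proof -
    have "cmod (\<Sum>n\<in>F. g n * x n) \<le> (\<Sum>n\<in>F. \<bar>cmod (g n)\<bar> * \<bar>cmod (x n)\<bar>)"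
      by (rule order_trans[OF norm_sum]) (simp add: norm_mult)
    also have "\<dots> \<le> L2_set (\<lambda>n. cmod (g n)) F * L2_set (\<lambda>n. cmod (x n)) F"
      by (rule L2_set_mult_ineq)
    also have "\<dots> \<le> (L * sqrt T) * X"
    proof (intro mult_mono)
      have "(\<Sum>n\<in>F. (cmod (g n))\<^sup>2) \<le> L\<^sup>2 * (\<Sum>m\<in>S. (cmod (cnj (y m)))\<^sup>2)"
        unfolding g_def by (rule l2_bound[OF F(1) S])
      then have "(\<Sum>n\<in>F. (cmod (g n))\<^sup>2) \<le> L\<^sup>2 * T" by (simp add: T_def)
      then have "L2_set (\<lambda>n. cmod (g n)) F \<le> sqrt (L\<^sup>2 * T)"
        unfolding L2_set_def by (rule real_sqrt_le_mono)
      then show "L2_set (\<lambda>n. cmod (g n)) F \<le> L * sqrt T" using L by (simp add: real_sqrt_mult)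
      show "L2_set (\<lambda>n. cmod (x n)) F \<le> X"
        unfolding L2_set_def X_def by (intro real_sqrt_le_mono finite_sum_le_infsum x F) auto
    qed (use L T0 in auto)
    finally show ?thesis .
  qed
  then have "cmod (of_real T) \<le> (L * sqrt T) * X"
    by (intro tendsto_upperbound[OF lim] eventually_finite_subsets_at_top_weakI) auto
  then have "sqrt T * sqrt T \<le> (L * X) * sqrt T" using T0 by (simp add: mult_ac)
  then have "sqrt T \<le> L * X"
  proof (cases "T = 0")
    case False
    then have "sqrt T > 0" using T0 by simp
    with \<open>sqrt T * sqrt T \<le> (L * X) * sqrt T\<close> show ?thesis by (rule mult_right_le_imp_le)
  qed (use L X0 in simp)
  then have "(sqrt T)\<^sup>2 \<le> (L * X)\<^sup>2" using T0 by (intro power_mono) auto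
  then show ?thesis
    using T0 by (simp add: power_mult_distrib X_def infsum_nonneg T_def y_def)
qed

text \<open>The rows of level \<open>i\<close> of \<^const>\<open>lower\<close> only see columns of levels above \<open>i\<close>, so the
  \<open>\<ell>\<^sup>2\<close> bound is applied level by level.\<close>

lemma lower_bound:
  assumes o: "\<And>j. (\<Sum>i<j. (v i)\<^sup>2) \<le> \<epsilon> * (a j)\<^sup>2" and \<epsilon>: "\<epsilon> \<ge> 0"
    and x: "ws a x" "(\<lambda>n. (cmod (x n))\<^sup>2) summable_on UNIV" and F: "finite F"
  shows "(\<Sum>m\<in>F. (v (lev m) * cmod (lower x m))\<^sup>2) \<le> L\<^sup>2 * \<epsilon> * (wn a x)\<^sup>2"
proof -
  obtain I where I: "\<And>m. m \<in> F \<Longrightarrow> lev m \<le> I"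
    using F finite_nat_set_iff_bounded_le[of "lev ` F"] by auto
  let ?s = "\<lambda>n. (cmod (x n))\<^sup>2"
  have B: "cmod (x n) \<le> sqrt (infsum ?s UNIV)" for n
    using finite_sum_le_infsum[OF x(2), of "{n}"] by (simp add: real_le_rsqrt)
  have "(\<Sum>m\<in>F. (v (lev m) * cmod (lower x m))\<^sup>2)
      = (\<Sum>i\<le>I. \<Sum>m\<in>{m\<in>F. lev m = i}. (v (lev m) * cmod (lower x m))\<^sup>2)"
    using F I by (intro sum.group[symmetric]) auto
  also have "\<dots> \<le> (\<Sum>i\<le>I. (v i)\<^sup>2 * (L\<^sup>2 * (\<Sum>\<^sub>\<infinity>n\<in>{n. i < lev n}. ?s n)))"
  proof (rule sum_mono)
    fix i
    have "(\<Sum>m\<in>{m\<in>F. lev m = i}. (v (lev m) * cmod (lower x m))\<^sup>2)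
        = (v i)\<^sup>2 * (\<Sum>m\<in>{m\<in>F. lev m = i}. (cmod (\<Sum>\<^sub>\<infinity>n\<in>{n. i < lev n}. M m n * x n))\<^sup>2)"
      unfolding sum_distrib_left by (intro sum.cong) (auto simp: lower_def power_mult_distrib)
    also have "\<dots> \<le> (v i)\<^sup>2 * (L\<^sup>2 * (\<Sum>\<^sub>\<infinity>n\<in>{n. i < lev n}. ?s n))"
      using F by (intro mult_left_mono block_bound[OF _ summable_on_subset[OF x(2)] B]) auto
    finally show "(\<Sum>m\<in>{m\<in>F. lev m = i}. (v (lev m) * cmod (lower x m))\<^sup>2)
        \<le> (v i)\<^sup>2 * (L\<^sup>2 * (\<Sum>\<^sub>\<infinity>n\<in>{n. i < lev n}. ?s n))" .
  qed
  also have "\<dots> = L\<^sup>2 * (\<Sum>i\<le>I. (v i)\<^sup>2 * (\<Sum>\<^sub>\<infinity>n\<in>{n. i < lev n}. ?s n))"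
    by (simp add: sum_distrib_left mult_ac)
  also have "(\<Sum>i\<le>I. (v i)\<^sup>2 * (\<Sum>\<^sub>\<infinity>n\<in>{n. i < lev n}. ?s n)) \<le> \<epsilon> * (wn a x)\<^sup>2"
  proof -
    have "(\<Sum>\<^sub>\<infinity>n\<in>{n. i < lev n}. ?s n) = (\<Sum>\<^sub>\<infinity>n. if i < lev n then ?s n else 0)" for i
      by (rule infsum_cong_neutral) auto
    moreover have "((\<lambda>n. if i < lev n then ?s n else 0) has_sum (\<Sum>\<^sub>\<infinity>n. if i < lev n then ?s n else 0)) UNIV" for i
      by (intro has_sum_infsum summable_on_comparison_test[OF x(2)]) auto
    ultimately have hs: "((\<lambda>n. \<Sum>i\<le>I. (v i)\<^sup>2 * (if i < lev n then ?s n else 0)) has_sum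
        (\<Sum>i\<le>I. (v i)\<^sup>2 * (\<Sum>\<^sub>\<infinity>n\<in>{n. i < lev n}. ?s n))) UNIV"
      by (intro has_sum_sum has_sum_cmult_right) auto
    have hs2: "((\<lambda>n. \<epsilon> * (a (lev n) * cmod (x n))\<^sup>2) has_sum \<epsilon> * (wn a x)\<^sup>2) UNIV"
      unfolding wn_sq using x(1) by (intro has_sum_cmult_right has_sum_infsum) (simp add: ws_def)
    show ?thesis
    \<comment> \<open>After exchanging the sums, column n is counted once for each level i below its
      own, with factor \<open>(v i)\<^sup>2\<close>; this is the sum in the hypothesis at
      \<open>j = lev n\<close>.\<close>
    proof (rule has_sum_mono[OF hs hs2])
      fix n
      have "(\<Sum>i\<le>I. (v i)\<^sup>2 * (if i < lev n then ?s n else 0)) = (\<Sum>i\<in>{i\<in>{..I}. i < lev n}. (v i)\<^sup>2 * ?s n)"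
        by (subst sum.inter_filter) (auto intro!: sum.cong)
      also have "\<dots> \<le> (\<Sum>i<lev n. (v i)\<^sup>2 * ?s n)"
        by (intro sum_mono2) auto
      also have "\<dots> = (\<Sum>i<lev n. (v i)\<^sup>2) * ?s n" by (simp add: sum_distrib_right)
      also have "\<dots> \<le> (\<epsilon> * (a (lev n))\<^sup>2) * ?s n" by (intro mult_right_mono o) auto
      finally show "(\<Sum>i\<le>I. (v i)\<^sup>2 * (if i < lev n then ?s n else 0)) \<le> \<epsilon> * (a (lev n) * cmod (x n))\<^sup>2"
        by (simp add: power_mult_distrib mult.assoc)
    qed
  qed
  finally show ?thesis by (simp add: mult.assoc mult_left_mono)
qed

lemma lower_add:
  assumes "\<And>n. cmod (x n) \<le> B" "\<And>n. cmod (y n) \<le> B'"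
  shows "lower (\<lambda>n. x n + y n) m = lower x m + lower y m"
  unfolding lower_def distrib_left
  by (rule infsum_add[OF abs_summable_summable[OF row_summable[OF assms(1)]]
      abs_summable_summable[OF row_summable[OF assms(2)]]])

lemma lower_scale: "lower (\<lambda>n. c * x n) m = c * lower x m"
  unfolding lower_def mult.left_commute[of _ c] by (rule infsum_cmult_right')

lemma upper_add: "upper (\<lambda>n. x n + y n) m = upper x m + upper y m"
  by (simp add: upper_def distrib_left sum.distrib)

lemma upper_scale: "upper (\<lambda>n. c * x n) m = c * upper x m"
  by (simp add: upper_def sum_distrib_left mult.left_commute)

context
  fixes a assumes a: "admissible a"
begin

lemma a_pos: "a i > 0" using a by (simp add: admissible_def)

lemma a_lower: "\<exists>c>0. \<forall>i. c \<le> a i"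
proof -
  have "\<exists>c>0. \<forall>i. c * \<kappa> ^ (0 * i) \<le> a i" using a unfolding admissible_def by blast
  then show ?thesis by simp
qed

lemma a_mono: "i \<le> j \<Longrightarrow> a i \<le> a j"
proof -
  have "a n \<le> a (Suc n)" for n using a unfolding admissible_def by blast
  then show "i \<le> j \<Longrightarrow> a i \<le> a j" by (rule lift_Suc_mono_le)
qed

lemma ws_bounded: "\<exists>C>0. \<forall>x n. ws a x \<longrightarrow> cmod (x n) \<le> C * wn a x"
proof -
  obtain c where c: "c > 0" "\<And>i. c \<le> a i" using a_lower by blast
  have "cmod (x n) \<le> 1 / c * wn a x" if "ws a x" for x n
  proof -
    have "c * cmod (x n) \<le> a (lev n) * cmod (x n)" by (intro mult_right_mono c) auto
    also have "\<dots> \<le> wn a x" using wn_le[OF that, of n] by linarith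
    finally show ?thesis using c(1) by (simp add: field_simps)
  qed
  then show ?thesis using c(1) by (intro exI[of _ "1 / c"]) simp
qed

lemma ws_l2:
  assumes "ws a x" shows "(\<lambda>n. (cmod (x n))\<^sup>2) summable_on UNIV"
proof -
  obtain c where c: "c > 0" "\<And>i. c \<le> a i" using a_lower by blast
  have "(\<lambda>n. (1 / c)\<^sup>2 * (a (lev n) * cmod (x n))\<^sup>2) summable_on UNIV"
    using assms unfolding ws_def by (rule summable_on_cmult_right)
  then show ?thesis
  proof (rule summable_on_comparison_test)
    fix n
    have "cmod (x n) \<le> 1 / c * (a (lev n) * cmod (x n))"
      using mult_right_mono[OF c(2)[of "lev n"], of "cmod (x n)"] c(1) by (simp add: field_simps)
    then have "(cmod (x n))\<^sup>2 \<le> (1 / c * (a (lev n) * cmod (x n)))\<^sup>2" by (intro power_mono) auto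
    then show "(cmod (x n))\<^sup>2 \<le> (1 / c)\<^sup>2 * (a (lev n) * cmod (x n))\<^sup>2" by (simp add: power_mult_distrib power_divide)
  qed auto
qed

lemma lower_small_tail:
  assumes \<delta>: "\<delta> > 0"
  shows "\<exists>N. \<forall>x F. ws a x \<longrightarrow> finite F \<longrightarrow> F \<subseteq> {m. N < lev m} \<longrightarrow>
    (\<Sum>m\<in>F. (a (lev m) * cmod (lower x m))\<^sup>2) \<le> (\<delta> * wn a x)\<^sup>2"
proof -
  \<comment> \<open>Compensates the constant of the l2 bound; the added 1 covers the case that L is
    0.\<close>
  define \<epsilon> where "\<epsilon> = \<delta>\<^sup>2 / (L\<^sup>2 + 1)"
  have L1: "L\<^sup>2 + 1 > 0" by (intro add_nonneg_pos) auto
  have \<epsilon>: "\<epsilon> > 0" using \<delta> L1 by (simp add: \<epsilon>_def)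
  have L\<epsilon>: "L\<^sup>2 * \<epsilon> \<le> \<delta>\<^sup>2" using L1 by (simp add: \<epsilon>_def field_simps)
  obtain N where N: "\<And>j. j \<ge> N \<Longrightarrow> (\<Sum>i<j. (a i)\<^sup>2) \<le> \<epsilon> * (a j)\<^sup>2"
    using a \<epsilon> unfolding admissible_def by meson
  \<comment> \<open>Output and input weights may differ in \<open>lower_bound\<close>; cutting the
    output weight off at N selects the rows of level above N.\<close>
  define v where "v i = (if N < i then a i else 0)" for i
  have v: "(\<Sum>i<j. (v i)\<^sup>2) \<le> \<epsilon> * (a j)\<^sup>2" for j
  proof (cases "j \<ge> N")
    case True
    have "(\<Sum>i<j. (v i)\<^sup>2) \<le> (\<Sum>i<j. (a i)\<^sup>2)" by (intro sum_mono) (auto simp: v_def)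
    then show ?thesis using N[OF True] by linarith
  next
    case False
    then have "(\<Sum>i<j. (v i)\<^sup>2) = 0" by (intro sum.neutral) (auto simp: v_def)
    then show ?thesis using \<epsilon> by simp
  qed
  have "(\<Sum>m\<in>F. (a (lev m) * cmod (lower x m))\<^sup>2) \<le> (\<delta> * wn a x)\<^sup>2"
    if x: "ws a x" and F: "finite F" "F \<subseteq> {m. N < lev m}" for x F
  proof -
    have "(\<Sum>m\<in>F. (a (lev m) * cmod (lower x m))\<^sup>2) = (\<Sum>m\<in>F. (v (lev m) * cmod (lower x m))\<^sup>2)"
      using F(2) by (intro sum.cong) (auto simp: v_def)
    also have "\<dots> \<le> L\<^sup>2 * \<epsilon> * (wn a x)\<^sup>2"
      using \<epsilon> by (intro lower_bound[OF v _ x ws_l2[OF x] F(1)]) simp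
    also have "\<dots> \<le> \<delta>\<^sup>2 * (wn a x)\<^sup>2" by (intro mult_right_mono L\<epsilon>) simp
    finally show ?thesis by (simp add: power_mult_distrib)
  qed
  then show ?thesis by blast
qed

text \<open>In an equivalent norm, whose weights grow fast from level 0 on, \<^const>\<open>lower\<close> is a
  contraction with an arbitrarily small constant.\<close>

lemma lower_iterates:
  assumes \<delta>: "\<delta> > 0"
  shows "\<exists>K\<ge>0. \<forall>j x. ws a x \<longrightarrow> ws a ((lower ^^ j) x) \<and> wn a ((lower ^^ j) x) \<le> K * \<delta> ^ j * wn a x"
proof -
  define \<epsilon> where "\<epsilon> = \<delta>\<^sup>2 / (L\<^sup>2 + 1)"
  have L1: "L\<^sup>2 + 1 > 0" by (intro add_nonneg_pos) auto
  have \<epsilon>: "\<epsilon> > 0" using \<delta> L1 by (simp add: \<epsilon>_def)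
  have L\<epsilon>: "L\<^sup>2 * \<epsilon> \<le> \<delta>\<^sup>2" using L1 by (simp add: \<epsilon>_def field_simps)
  obtain N where N: "\<And>j. j \<ge> N \<Longrightarrow> (\<Sum>i<j. (a i)\<^sup>2) \<le> \<epsilon> * (a j)\<^sup>2"
    using a \<epsilon> unfolding admissible_def by meson
  \<comment> \<open>Chosen so that the sum of the powers of r below j is (r^j - 1) \<epsilon>, hence
    at most \<epsilon> times the next power.\<close>
  define r where "r = 1 + 1 / \<epsilon>"
  have r: "r > 1" using \<epsilon> by (simp add: r_def)
  \<comment> \<open>The weights are steepened on the first N levels only, where \<open>a\<close> may
    grow too slowly. The total distortion is at most N factors, so the norm stays
    equivalent.\<close>
  define b where "b i = a i * sqrt r ^ min i N" for i
  have bsq: "(b i)\<^sup>2 = (a i)\<^sup>2 * r ^ min i N" for i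
    using r by (simp add: b_def power_mult_distrib power_even_eq[symmetric] power_mult[symmetric] mult.commute[of _ 2])
      (simp add: power_mult)
  have b: "(\<Sum>i<j. (b i)\<^sup>2) \<le> \<epsilon> * (b j)\<^sup>2" for j
  proof (cases "j \<ge> N")
    case True
    have "(\<Sum>i<j. (b i)\<^sup>2) \<le> (\<Sum>i<j. (a i)\<^sup>2 * r ^ N)"
      unfolding bsq using r by (intro sum_mono mult_left_mono power_increasing) auto
    also have "\<dots> = (\<Sum>i<j. (a i)\<^sup>2) * r ^ N" by (simp add: sum_distrib_right)
    also have "\<dots> \<le> (\<epsilon> * (a j)\<^sup>2) * r ^ N" using r by (intro mult_right_mono N[OF True]) auto
    also have "\<dots> = \<epsilon> * (b j)\<^sup>2" using True by (simp add: bsq min_def)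
    finally show ?thesis .
  next
    case False
    have "(\<Sum>i<j. (b i)\<^sup>2) \<le> (\<Sum>i<j. (a j)\<^sup>2 * r ^ i)"
      unfolding bsq using r False a_mono a_pos
      by (intro sum_mono mult_mono power_mono power_increasing) (auto simp: less_imp_le)
    also have "\<dots> = (a j)\<^sup>2 * (\<Sum>i<j. r ^ i)" by (simp add: sum_distrib_left)
    also have "\<dots> \<le> (a j)\<^sup>2 * (\<epsilon> * r ^ j)"
    proof (rule mult_left_mono)
      have "(\<Sum>i<j. r ^ i) = (r ^ j - 1) * \<epsilon>"
        using r \<epsilon> by (simp add: geometric_sum r_def)
      also have "\<dots> \<le> r ^ j * \<epsilon>" using \<epsilon> by (intro mult_right_mono) auto
      finally show "(\<Sum>i<j. r ^ i) \<le> \<epsilon> * r ^ j" by (simp add: mult.commute)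
    qed simp
    also have "\<dots> = \<epsilon> * (b j)\<^sup>2" using False by (simp add: bsq)
    finally show ?thesis .
  qed
  have ab: "a i \<le> b i" "b i \<le> sqrt r ^ N * a i" for i
  proof -
    have "1 \<le> sqrt r ^ min i N" "sqrt r ^ min i N \<le> sqrt r ^ N"
      using r by (auto intro: one_le_power power_increasing)
    then show "a i \<le> b i" "b i \<le> sqrt r ^ N * a i"
      using a_pos[of i] by (simp_all add: b_def)
  qed
  have comp1: "ws b x \<and> wn b x \<le> sqrt r ^ N * wn a x" if x: "ws a x" for x
  proof -
    have B: "sqrt r ^ N * wn a x \<ge> 0" using r by simp
    have "(\<Sum>n\<in>F. (b (lev n) * cmod (x n))\<^sup>2) \<le> (sqrt r ^ N * wn a x)\<^sup>2" if "finite F" for F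
    proof -
      have "(\<Sum>n\<in>F. (b (lev n) * cmod (x n))\<^sup>2) \<le> (\<Sum>n\<in>F. (sqrt r ^ N * (a (lev n) * cmod (x n)))\<^sup>2)"
      proof (intro sum_mono power_mono)
        fix n
        show "b (lev n) * cmod (x n) \<le> sqrt r ^ N * (a (lev n) * cmod (x n))"
          using mult_right_mono[OF ab(2)[of "lev n"], of "cmod (x n)"] by (simp add: mult.assoc)
        show "0 \<le> b (lev n) * cmod (x n)" using ab(1)[of "lev n"] a_pos[of "lev n"] by simp
      qed
      also have "\<dots> = (sqrt r ^ N)\<^sup>2 * (\<Sum>n\<in>F. (a (lev n) * cmod (x n))\<^sup>2)"
        by (simp only: power_mult_distrib sum_distrib_left)
      also have "\<dots> \<le> (sqrt r ^ N)\<^sup>2 * (wn a x)\<^sup>2"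
        unfolding wn_sq using x that by (intro mult_left_mono finite_sum_le_infsum) (auto simp: ws_def)
      finally show ?thesis by (simp only: power_mult_distrib)
    qed
    then show ?thesis by (intro conjI wsI[OF B])
  qed
  have comp2: "ws a x \<and> wn a x \<le> wn b x" if x: "ws b x" for x
  proof -
    have "(\<Sum>n\<in>F. (a (lev n) * cmod (x n))\<^sup>2) \<le> (wn b x)\<^sup>2" if "finite F" for F
    proof -
      have "(\<Sum>n\<in>F. (a (lev n) * cmod (x n))\<^sup>2) \<le> (\<Sum>n\<in>F. (b (lev n) * cmod (x n))\<^sup>2)"
        using ab(1) a_pos by (intro sum_mono power_mono mult_right_mono) (auto simp: less_imp_le)
      also have "\<dots> \<le> (wn b x)\<^sup>2"
        unfolding wn_sq using x that by (intro finite_sum_le_infsum) (auto simp: ws_def)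
      finally show ?thesis .
    qed
    then show ?thesis by (intro conjI wsI[OF wn_nonneg])
  qed
  have step: "ws b (lower x) \<and> wn b (lower x) \<le> \<delta> * wn b x" if x: "ws b x" for x
  proof -
    have "(\<Sum>m\<in>F. (b (lev m) * cmod (lower x m))\<^sup>2) \<le> (\<delta> * wn b x)\<^sup>2" if F: "finite F" for F
    proof -
      have "(\<Sum>m\<in>F. (b (lev m) * cmod (lower x m))\<^sup>2) \<le> L\<^sup>2 * \<epsilon> * (wn b x)\<^sup>2"
        using \<epsilon> by (intro lower_bound[OF b _ x ws_l2 F]) (use comp2[OF x] in auto)
      also have "\<dots> \<le> \<delta>\<^sup>2 * (wn b x)\<^sup>2" by (intro mult_right_mono L\<epsilon>) simp
      finally show ?thesis by (simp add: power_mult_distrib)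
    qed
    then show ?thesis by (intro conjI wsI[OF mult_nonneg_nonneg[OF less_imp_le[OF \<delta>] wn_nonneg]])
  qed
  have iter: "ws b ((lower ^^ j) x) \<and> wn b ((lower ^^ j) x) \<le> \<delta> ^ j * wn b x" if x: "ws b x" for j x
  proof (induction j)
    case (Suc j)
    have "wn b (lower ((lower ^^ j) x)) \<le> \<delta> * wn b ((lower ^^ j) x)" using step Suc by blast
    also have "\<dots> \<le> \<delta> * (\<delta> ^ j * wn b x)" using Suc \<delta> by (intro mult_left_mono) auto
    finally show ?case using step Suc by (simp add: mult.assoc)
  qed (use x in simp)
  have "ws a ((lower ^^ j) x) \<and> wn a ((lower ^^ j) x) \<le> sqrt r ^ N * \<delta> ^ j * wn a x" if x: "ws a x" for j x
  proof -
    have "wn a ((lower ^^ j) x) \<le> wn b ((lower ^^ j) x)" using comp2 iter comp1[OF x] by blast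
    also have "\<dots> \<le> \<delta> ^ j * wn b x" using iter comp1[OF x] by blast
    also have "\<dots> \<le> \<delta> ^ j * (sqrt r ^ N * wn a x)" using comp1[OF x] \<delta> by (intro mult_left_mono) auto
    finally show ?thesis using comp2 iter comp1[OF x] by (simp add: mult_ac)
  qed
  moreover have "sqrt r ^ N \<ge> 0" using r by simp
  ultimately show ?thesis by blast
qed

text \<open>Row m has at most 5 times \<kappa> to the power \<open>lev m\<close> entries, so one
  extra power of decay pays for their number. The remaining K powers in the level become K powers of
  \<open>brk m\<close>, with the factor \<open>2 ^ K\<close> from
  \<open>lev_power_ge\<close>.\<close>

lemma upper_rapid:
  "\<exists>C\<ge>0. \<forall>m x. ws a x \<longrightarrow> a (lev m) * cmod (upper x m) \<le> C / brk m ^ K * wn a x"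
proof -
  obtain B where B: "B > 0" "\<And>x n. ws a x \<Longrightarrow> cmod (x n) \<le> B * wn a x" using ws_bounded by blast
  have "\<exists>C. \<forall>m n. lev n \<le> lev m \<longrightarrow> a (lev m) * cmod (M m n) \<le> C / \<kappa> ^ ((K + 1) * lev m)"
    using a unfolding admissible_def by blast
  then obtain C where C: "\<And>m n. lev n \<le> lev m \<Longrightarrow> a (lev m) * cmod (M m n) \<le> C / \<kappa> ^ ((K + 1) * lev m)" by blast
  define C' where "C' = 5 * \<bar>C\<bar> * B * 2 ^ K"
  have "a (lev m) * cmod (upper x m) \<le> C' / brk m ^ K * wn a x" if x: "ws a x" for m x
  proof -
    let ?k = "\<kappa> ^ lev m"
    have k: "?k > 0" using \<kappa> by simp
    have "a (lev m) * cmod (upper x m) \<le> a (lev m) * (\<Sum>n\<in>{n. lev n \<le> lev m}. cmod (M m n * x n))"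
      unfolding upper_def using a_pos[of "lev m"] by (intro mult_left_mono norm_sum) auto
    also have "\<dots> = (\<Sum>n\<in>{n. lev n \<le> lev m}. (a (lev m) * cmod (M m n)) * cmod (x n))"
      by (simp add: sum_distrib_left norm_mult mult.assoc)
    also have "\<dots> \<le> (\<Sum>n\<in>{n. lev n \<le> lev m}. (\<bar>C\<bar> / \<kappa> ^ ((K + 1) * lev m)) * (B * wn a x))"
    proof (rule sum_mono)
      fix n assume "n \<in> {n. lev n \<le> lev m}"
      then have "a (lev m) * cmod (M m n) \<le> C / \<kappa> ^ ((K + 1) * lev m)" using C by simp
      also have "\<dots> \<le> \<bar>C\<bar> / \<kappa> ^ ((K + 1) * lev m)" using \<kappa> by (intro divide_right_mono) auto
      finally show "(a (lev m) * cmod (M m n)) * cmod (x n) \<le> (\<bar>C\<bar> / \<kappa> ^ ((K + 1) * lev m)) * (B * wn a x)"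
        using B(2)[OF x, of n] a_pos[of "lev m"] \<kappa> by (intro mult_mono) auto
    qed
    also have "\<dots> = real (card {n. lev n \<le> lev m}) * ((\<bar>C\<bar> / \<kappa> ^ ((K + 1) * lev m)) * (B * wn a x))" by simp
    also have "\<dots> \<le> (5 * ?k) * ((\<bar>C\<bar> / \<kappa> ^ ((K + 1) * lev m)) * (B * wn a x))"
      using card_lev[of "lev m"] B(1) \<kappa> by (intro mult_right_mono) auto
    also have "\<kappa> ^ ((K + 1) * lev m) = ?k * ?k ^ K"
      by (simp add: power_add power_mult[symmetric] mult.commute)
    also have "(5 * ?k) * ((\<bar>C\<bar> / (?k * ?k ^ K)) * (B * wn a x)) = 5 * \<bar>C\<bar> * B / ?k ^ K * wn a x"
      using \<kappa> by simp
    also have "\<dots> \<le> C' / brk m ^ K * wn a x"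
    proof (rule mult_right_mono)
      have "brk m ^ K \<le> (2 * ?k) ^ K" using lev_power_ge[of m] by (intro power_mono) auto
      then have "5 * \<bar>C\<bar> * B * brk m ^ K \<le> 5 * \<bar>C\<bar> * B * (2 * ?k) ^ K"
        using B(1) by (intro mult_left_mono) auto
      then show "5 * \<bar>C\<bar> * B / ?k ^ K \<le> C' / brk m ^ K"
        using k by (simp add: C'_def field_simps power_mult_distrib)
    qed simp
    finally show ?thesis .
  qed
  moreover have "C' \<ge> 0" using B(1) by (simp add: C'_def)
  ultimately show ?thesis by blast
qed

end

end

section \<open>Determinants of finite sections\<close>

text \<open>A permutation meets every column once, so each product has the same bound; the factorial
  counts the permutations.\<close>

lemma pminor_le:
  assumes fin: "finite K" and N: "\<And>k l. k \<in> K \<Longrightarrow> l \<in> K \<Longrightarrow> cmod (N k l) \<le> s l"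
  shows "cmod (pminor N K) \<le> fact (card K) * (\<Prod>k\<in>K. s k)"
proof -
  have "cmod (pminor N K) \<le> (\<Sum>p | p permutes K. cmod (of_int (sign p) * (\<Prod>k\<in>K. N k (p k))))"
    unfolding pminor_def by (rule norm_sum)
  also have "\<dots> \<le> (\<Sum>p | p permutes K. \<Prod>k\<in>K. s k)"
  proof (rule sum_mono)
    fix p assume "p \<in> {p. p permutes K}"
    then have p: "p permutes K" by simp
    have "cmod (of_int (sign p) * (\<Prod>k\<in>K. N k (p k))) = (\<Prod>k\<in>K. cmod (N k (p k)))"
      by (simp add: norm_mult sign_def prod_norm)
    also have "\<dots> \<le> (\<Prod>k\<in>K. s (p k))"
      using N p by (intro prod_mono conjI) (auto simp: permutes_in_image)
    also have "\<dots> = (\<Prod>k\<in>K. s k)" using prod.permute[OF p, of s] by (simp add: o_def)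
    finally show "cmod (of_int (sign p) * (\<Prod>k\<in>K. N k (p k))) \<le> (\<Prod>k\<in>K. s k)" .
  qed
  also have "\<dots> = fact (card K) * (\<Prod>k\<in>K. s k)" using fin by (simp add: card_permutations)
  finally show ?thesis .
qed

text \<open>The majorant makes the finite partial sums converge uniformly in N, which allows the two
  limits to be exchanged.\<close>

lemma infsum_dominated_convergence:
  fixes f :: "nat \<Rightarrow> 'a \<Rightarrow> complex"
  assumes le: "\<And>N k. cmod (f N k) \<le> g k" and g: "g summable_on A"
    and lim: "\<And>k. (\<lambda>N. f N k) \<longlonglongrightarrow> h k"
  shows "(\<lambda>N. \<Sum>\<^sub>\<infinity>k\<in>A. f N k) \<longlonglongrightarrow> (\<Sum>\<^sub>\<infinity>k\<in>A. h k)" and "h abs_summable_on A"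
proof -
  have hle: "cmod (h k) \<le> g k" for k
    by (rule LIMSEQ_le_const2[OF tendsto_norm[OF lim]]) (use le in blast)
  show h: "h abs_summable_on A"
    by (rule Infinite_Sum.abs_summable_on_comparison_test'[OF g hle])
  have "uniform_limit UNIV (\<lambda>X N. \<Sum>k\<in>X. f N k) (\<lambda>N. \<Sum>\<^sub>\<infinity>k\<in>A. f N k) (finite_subsets_at_top A)"
    by (rule Weierstrass_m_test_general[OF _ g]) (rule le)
  moreover have "\<forall>\<^sub>F X in finite_subsets_at_top A. ((\<lambda>N. \<Sum>k\<in>X. f N k) \<longlongrightarrow> (\<Sum>k\<in>X. h k)) sequentially"
    by (intro always_eventually allI tendsto_sum lim)
  moreover have "(sum h \<longlongrightarrow> (\<Sum>\<^sub>\<infinity>k\<in>A. h k)) (finite_subsets_at_top A)"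
    by (rule infsum_tendsto[OF abs_summable_summable[OF h]])
  ultimately show "(\<lambda>N. \<Sum>\<^sub>\<infinity>k\<in>A. f N k) \<longlonglongrightarrow> (\<Sum>\<^sub>\<infinity>k\<in>A. h k)"
    by (intro swap_uniform_limit'[of "\<lambda>X N. \<Sum>k\<in>X. f N k" "sum h" sequentially "finite_subsets_at_top A" _ UNIV]) simp_all
qed

section \<open>The determinant as a limit of finite sections\<close>

context smoothing_matrix
begin

abbreviation sect :: "nat \<Rightarrow> int set" where
  "sect N \<equiv> {n. lev n \<le> N}"

definition lpow :: "nat \<Rightarrow> int \<Rightarrow> int \<Rightarrow> complex" where
  "lpow j k = (lower ^^ j) (\<lambda>n. if n = k then 1 else 0)"

text \<open>Column \<open>k\<close> of the inverse of \<open>1 - z lower\<close>. The Neumann series is a finite sum, because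
  \<^const>\<open>lower\<close> decreases the level. The matrix \<open>fmat z\<close> is \<open>- z upper (1 - z lower)\<^sup>-\<^sup>1\<close>, transposed.\<close>

definition resolv :: "complex \<Rightarrow> int \<Rightarrow> int \<Rightarrow> complex" where
  "resolv z k n = (\<Sum>j\<le>lev k. z ^ j * lpow j k n)"

definition fmat :: "complex \<Rightarrow> int \<Rightarrow> int \<Rightarrow> complex" where
  "fmat z k l = - z * upper (resolv z k) l"

definition fdet :: "complex \<Rightarrow> complex" where
  "fdet z = (\<Sum>\<^sub>\<infinity>K\<in>fin_subsets UNIV. pminor (fmat z) K)"

lemma lower_finite:
  assumes x: "\<And>n. x n \<noteq> 0 \<Longrightarrow> lev n \<le> N"
  shows "lower x l = (\<Sum>n\<in>sect N. (if lev l < lev n then M l n else 0) * x n)"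
proof -
  have "lower x l = (\<Sum>\<^sub>\<infinity>n\<in>sect N. (if lev l < lev n then M l n else 0) * x n)"
    unfolding lower_def using x by (intro infsum_cong_neutral) auto
  then show ?thesis by (simp add: finite_lev)
qed

lemma lpow_support: "lpow j k n \<noteq> 0 \<Longrightarrow> lev n + j \<le> lev k"
proof (induction j arbitrary: n)
  case 0
  then show ?case by (simp add: lpow_def split: if_splits)
next
  case (Suc j)
  show ?case
  proof (rule ccontr)
    assume "\<not> lev n + Suc j \<le> lev k"
    then have "lpow j k l = 0" if "lev n < lev l" for l
      using Suc.IH[of l] that by fastforce
    then have "lower (lpow j k) n = (\<Sum>\<^sub>\<infinity>l\<in>{l. lev n < lev l}. 0)"
      unfolding lower_def by (intro infsum_cong) simp
    then show False using Suc.prems by (simp add: lpow_def)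
  qed
qed

lemma resolv_support: "resolv z k n \<noteq> 0 \<Longrightarrow> lev n \<le> lev k"
proof -
  assume "resolv z k n \<noteq> 0"
  then obtain j where "lpow j k n \<noteq> 0" unfolding resolv_def by (metis (no_types, lifting) mult_zero_right sum.neutral)
  then show ?thesis using lpow_support by fastforce
qed

lemma lower_resolv: "lower (resolv z k) l = (\<Sum>j\<le>lev k. z ^ j * lpow (Suc j) k l)"
proof -
  let ?c = "\<lambda>n. if lev l < lev n then M l n else 0"
  have "lower (resolv z k) l = (\<Sum>n\<in>sect (lev k). ?c n * resolv z k n)"
    by (rule lower_finite) (rule resolv_support)
  also have "\<dots> = (\<Sum>n\<in>sect (lev k). \<Sum>j\<le>lev k. z ^ j * (?c n * lpow j k n))"
    unfolding resolv_def sum_distrib_left by (intro sum.cong refl) (simp add: mult_ac)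
  also have "\<dots> = (\<Sum>j\<le>lev k. \<Sum>n\<in>sect (lev k). z ^ j * (?c n * lpow j k n))"
    by (rule sum.swap)
  also have "\<dots> = (\<Sum>j\<le>lev k. z ^ j * lpow (Suc j) k l)"
  proof (intro sum.cong refl)
    fix j
    have "lpow (Suc j) k l = lower (lpow j k) l" by (simp add: lpow_def)
    also have "\<dots> = (\<Sum>n\<in>sect (lev k). ?c n * lpow j k n)"
      by (rule lower_finite) (use lpow_support in fastforce)
    finally show "(\<Sum>n\<in>sect (lev k). z ^ j * (?c n * lpow j k n)) = z ^ j * lpow (Suc j) k l"
      by (simp only: sum_distrib_left)
  qed
  finally show ?thesis .
qed

lemma resolv_eq: "resolv z k l - z * lower (resolv z k) l = (if l = k then 1 else 0)"
proof -
  have tele: "(\<Sum>j\<le>J. z ^ j * lpow j k l) - z * (\<Sum>j\<le>J. z ^ j * lpow (Suc j) k l)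
      = lpow 0 k l - z ^ Suc J * lpow (Suc J) k l" for J
    by (induction J) (simp_all add: algebra_simps)
  have "lpow (Suc (lev k)) k l = 0" using lpow_support[of "Suc (lev k)" k l] by fastforce
  then show ?thesis
    using tele[of "lev k"] unfolding lower_resolv by (simp add: resolv_def lpow_def)
qed

text \<open>On each section \<open>1 - z M = (1 - z lower) (1 - z (1 - z lower)\<^sup>-\<^sup>1 upper)\<close>, where the first factor
  is unitriangular.\<close>

lemma section_det:
  "(\<Sum>F\<in>Pow (sect N). pminor (fmat z) F) = pminor (\<lambda>i j. (if i = j then 1 else 0) + (- z * M i j)) (sect N)"
proof -
  let ?S = "sect N"
  have fin: "finite ?S" by (rule finite_lev)
  let ?lo = "\<lambda>l n. if lev l < lev n then M l n else 0"
  \<comment> \<open>Columns of the resolvent stay within the levels up to that of their index, so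
    cutting to the section loses nothing: the finite identity is exact, not asymptotic.\<close>
  have lo: "lower (resolv z k) l = (\<Sum>n\<in>?S. ?lo l n * resolv z k n)" if "k \<in> ?S" for k l
    by (rule lower_finite) (use that resolv_support in fastforce)
  have up: "upper (resolv z k) l = (\<Sum>n\<in>?S. (if lev n \<le> lev l then M l n else 0) * resolv z k n)" if "l \<in> ?S" for k l
  proof -
    have "upper (resolv z k) l = (\<Sum>n\<in>{n \<in> ?S. lev n \<le> lev l}. M l n * resolv z k n)"
      unfolding upper_def using that by (intro sum.cong) auto
    also have "\<dots> = (\<Sum>n\<in>?S. if lev n \<le> lev l then M l n * resolv z k n else 0)"
      by (rule sum.inter_filter[OF fin])
    finally show ?thesis by (simp add: if_distrib[of "\<lambda>x. x * _"] cong: if_cong)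
  qed
  have del: "(\<Sum>n\<in>?S. (if l = n then 1 else 0) * resolv z k n) = resolv z k l" if "l \<in> ?S" for k l
    using that fin by (simp add: if_distrib[of "\<lambda>x. x * _"] cong: if_cong)
  have "pminor (\<lambda>l k. \<Sum>n\<in>?S. ((if l = n then 1 else 0) + (- z * ?lo l n)) * resolv z k n) ?S
      = pminor (\<lambda>l k. if l = k then 1 else 0) ?S"
  proof (rule pminor_cong)
    fix l k assume lk: "l \<in> ?S" "k \<in> ?S"
    have "(\<Sum>n\<in>?S. ((if l = n then 1 else 0) + (- z * ?lo l n)) * resolv z k n)
        = (\<Sum>n\<in>?S. (if l = n then 1 else 0) * resolv z k n) - z * (\<Sum>n\<in>?S. ?lo l n * resolv z k n)"
      unfolding sum_distrib_left sum_subtractf[symmetric] by (intro sum.cong refl) (simp add: algebra_simps)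
    also have "\<dots> = (if l = k then 1 else 0)"
      unfolding del[OF lk(1)] lo[OF lk(2), symmetric] by (rule resolv_eq)
    finally show "(\<Sum>n\<in>?S. ((if l = n then 1 else 0) + (- z * ?lo l n)) * resolv z k n) = (if l = k then 1 else 0)" .
  qed
  moreover have "pminor (\<lambda>l k. if l = k then 1 else 0) ?S = 1"
    using pminor_triangular[OF fin, of "\<lambda>_ _. 0" lev] by simp
  moreover have "pminor (\<lambda>l n. (if l = n then 1 else 0) + (- z * ?lo l n)) ?S = 1"
    by (rule pminor_triangular[OF fin, of _ lev]) (auto split: if_splits)
  \<comment> \<open>The section of the resolvent is a right inverse of a matrix of determinant 1, so
    multiplicativity gives its determinant.\<close>
  ultimately have R1: "pminor (\<lambda>n k. resolv z k n) ?S = 1"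
    by (simp only: pminor_mult[OF fin] mult_1_left)
  have "(\<Sum>F\<in>Pow ?S. pminor (fmat z) F) = (\<Sum>F\<in>Pow ?S. pminor (\<lambda>l k. fmat z k l) F)"
    using fin by (intro sum.cong refl pminor_transpose[symmetric]) (auto intro: finite_subset)
  also have "\<dots> = pminor (\<lambda>l k. (if l = k then 1 else 0) + fmat z k l) ?S"
    by (rule pminor_add_id[OF fin, symmetric])
  also have "\<dots> = pminor (\<lambda>l k. \<Sum>n\<in>?S. ((if l = n then 1 else 0) + (- z * M l n)) * resolv z k n) ?S"
  proof (rule pminor_cong)
    fix l k assume lk: "l \<in> ?S" "k \<in> ?S"
    have "(\<Sum>n\<in>?S. ((if l = n then 1 else 0) + (- z * M l n)) * resolv z k n)
        = (\<Sum>n\<in>?S. (if l = n then 1 else 0) * resolv z k n) - z * (\<Sum>n\<in>?S. ?lo l n * resolv z k n)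
          - z * (\<Sum>n\<in>?S. (if lev n \<le> lev l then M l n else 0) * resolv z k n)"
      unfolding sum_distrib_left sum_subtractf[symmetric] by (intro sum.cong refl) (simp add: algebra_simps)
    also have "\<dots> = (if l = k then 1 else 0) - z * upper (resolv z k) l"
      unfolding del[OF lk(1)] lo[OF lk(2), symmetric] up[OF lk(1), symmetric] resolv_eq ..
    finally show "(if l = k then 1 else 0) + fmat z k l =
        (\<Sum>n\<in>?S. ((if l = n then 1 else 0) + (- z * M l n)) * resolv z k n)"
      by (simp add: fmat_def)
  qed
  also have "\<dots> = pminor (\<lambda>i j. (if i = j then 1 else 0) + (- z * M i j)) ?S"
    unfolding pminor_mult[OF fin] R1 by simp
  finally show ?thesis .
qed

lemma wn_unit:
  assumes "a (lev k) > 0"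
  shows "ws a (\<lambda>n. if n = k then 1 else 0)" "wn a (\<lambda>n. if n = k then 1 else 0) = a (lev k)"
proof -
  have "((\<lambda>n. (a (lev n) * cmod (if n = k then 1 else 0))\<^sup>2) has_sum (a (lev k))\<^sup>2) UNIV"
    by (rule has_sum_finite_neutralI[where B = "{k}"]) auto
  then show "ws a (\<lambda>n. if n = k then 1 else 0)" "wn a (\<lambda>n. if n = k then 1 else 0) = a (lev k)"
    using assms by (auto simp: ws_def wn_def has_sum_iff)
qed

text \<open>Conjugated by the weights, the matrix has a summable column bound that is uniform for z
  in a disc. Since conjugation preserves minors, this controls the series of minors of
  \<open>fmat\<close> itself.\<close>

lemma fmat_bound:
  assumes a: "admissible a"
  shows "\<exists>s. (\<forall>l. s l \<ge> 0) \<and> (\<lambda>l. brk l * s l) summable_on UNIV \<and>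
    (\<forall>z k l. cmod z \<le> r \<longrightarrow> cmod (fmat z k l * complex_of_real (a (lev l)) / complex_of_real (a (lev k))) \<le> s l)"
proof -
  define r' where "r' = \<bar>r\<bar> + 1"
  have r': "r' > 0" by (simp add: r'_def)
  \<comment> \<open>With iterates of \<open>lower\<close> bounded by powers of \<delta>, the Neumann
    sum is dominated by a geometric series of ratio 1 / 2; this is the factor 2 in
    \<open>s\<close>.\<close>
  define \<delta> where "\<delta> = 1 / (2 * r')"
  have \<delta>: "\<delta> > 0" using r' by (simp add: \<delta>_def)
  obtain B where B: "B \<ge> 0" "\<And>j x. ws a x \<Longrightarrow> ws a ((lower ^^ j) x)"
      "\<And>j x. ws a x \<Longrightarrow> wn a ((lower ^^ j) x) \<le> B * \<delta> ^ j * wn a x"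
    using lower_iterates[OF a \<delta>] by blast
  \<comment> \<open>Three powers of decay: one is consumed by the factor \<open>brk l\<close> that
    pays for the factorials, two give summability.\<close>
  obtain C where C: "C \<ge> 0" "\<And>m x. ws a x \<Longrightarrow> a (lev m) * cmod (upper x m) \<le> C / brk m ^ 3 * wn a x"
    using upper_rapid[OF a, of 3] by blast
  define s where "s l = r' * (2 * (C * B)) / brk l ^ 3" for l
  have "cmod (fmat z k l * complex_of_real (a (lev l)) / complex_of_real (a (lev k))) \<le> s l" if z: "cmod z \<le> r" for z k l
  proof -
    let ?u = "brk l ^ 3"
    have zr: "cmod z \<le> r'" using z by (simp add: r'_def)
    note ak = a_pos[OF a, of "lev k"] and al = a_pos[OF a, of "lev l"]
    have "upper (resolv z k) l = (\<Sum>n\<in>{n. lev n \<le> lev l}. \<Sum>j\<le>lev k. z ^ j * (M l n * lpow j k n))"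
      unfolding upper_def resolv_def sum_distrib_left by (intro sum.cong refl) (simp add: mult_ac)
    also have "\<dots> = (\<Sum>j\<le>lev k. z ^ j * upper (lpow j k) l)"
      unfolding upper_def sum_distrib_left by (rule sum.swap)
    finally have "a (lev l) * cmod (upper (resolv z k) l) \<le> a (lev l) * (\<Sum>j\<le>lev k. cmod (z ^ j * upper (lpow j k) l))"
      using al by (simp only: mult_left_mono norm_sum less_imp_le)
    also have "\<dots> = (\<Sum>j\<le>lev k. cmod z ^ j * (a (lev l) * cmod (upper (lpow j k) l)))"
      by (simp add: sum_distrib_left norm_mult norm_power mult_ac)
    also have "\<dots> \<le> (\<Sum>j\<le>lev k. r' ^ j * (C / ?u * (B * \<delta> ^ j * a (lev k))))"
    proof (rule sum_mono)
      fix j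
      have "a (lev l) * cmod (upper (lpow j k) l) \<le> C / ?u * wn a (lpow j k)"
        unfolding lpow_def by (rule C(2)[OF B(2)[OF wn_unit(1)[of a, OF ak]]])
      also have "\<dots> \<le> C / ?u * (B * \<delta> ^ j * a (lev k))"
        using B(3)[OF wn_unit(1)[of a, OF ak], of j] C(1) unfolding lpow_def wn_unit(2)[of a, OF ak]
        by (intro mult_left_mono) auto
      finally have "a (lev l) * cmod (upper (lpow j k) l) \<le> C / ?u * (B * \<delta> ^ j * a (lev k))" .
      moreover have "cmod z ^ j \<le> r' ^ j" by (rule power_mono[OF zr]) simp
      ultimately show "cmod z ^ j * (a (lev l) * cmod (upper (lpow j k) l)) \<le> r' ^ j * (C / ?u * (B * \<delta> ^ j * a (lev k)))"
        using al by (metis mult_mono' mult_nonneg_nonneg norm_ge_zero less_imp_le zero_le_power)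
    qed
    also have "\<dots> = (C * B / ?u * a (lev k)) * (\<Sum>j\<le>lev k. (r' * \<delta>) ^ j)"
      unfolding sum_distrib_left by (intro sum.cong refl) (simp add: power_mult_distrib)
    also have "\<dots> \<le> (C * B / ?u * a (lev k)) * 2"
    proof (rule mult_left_mono)
      have "r' * \<delta> = 1 / 2" using r' by (simp add: \<delta>_def)
      then have "(\<Sum>j\<le>lev k. (r' * \<delta>) ^ j) \<le> (\<Sum>j. (1 / 2) ^ j)"
        by (simp only:) (rule sum_le_suminf, auto)
      also have "\<dots> = (2 :: real)" by (subst suminf_geometric) auto
      finally show "(\<Sum>j\<le>lev k. (r' * \<delta>) ^ j) \<le> 2" .
    qed (use C(1) B(1) ak in auto)
    finally have up: "a (lev l) * cmod (upper (resolv z k) l) \<le> (C * B / ?u * a (lev k)) * 2" .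
    have "cmod (fmat z k l * complex_of_real (a (lev l)) / complex_of_real (a (lev k)))
        = cmod z * (a (lev l) * cmod (upper (resolv z k) l)) / a (lev k)"
      using ak al by (simp add: fmat_def norm_mult norm_divide)
    also have "\<dots> \<le> r' * ((C * B / ?u * a (lev k)) * 2) / a (lev k)"
    proof (rule divide_right_mono)
      show "cmod z * (a (lev l) * cmod (upper (resolv z k) l)) \<le> r' * ((C * B / ?u * a (lev k)) * 2)"
        by (rule mult_mono'[OF zr up]) (use al in simp_all)
    qed (use ak in simp)
    also have "\<dots> = s l" using ak by (simp add: s_def field_simps)
    finally show ?thesis .
  qed
  moreover have "(\<lambda>l. brk l * s l) summable_on UNIV"
  proof -
    have "brk l * s l = r' * (2 * (C * B)) * (1 / (brk l)\<^sup>2)" for l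
    proof -
      have "1 + \<bar>real_of_int l\<bar> > 0" by linarith
      then show ?thesis by (simp add: s_def power3_eq_cube power2_eq_square)
    qed
    then show ?thesis
      by (simp only:) (intro summable_on_cmult_right summable_inverse_square_int)
  qed
  moreover have "s l \<ge> 0" for l using r' C(1) B(1) by (simp add: s_def)
  ultimately show ?thesis by blast
qed

text \<open>The subsets of growing sections exhaust the finite sets of frequencies, and by
  \<open>section_det\<close> the corresponding partial sums are determinants of sections of 1 - z M.
  The Weierstrass test makes the convergence uniform on discs.\<close>

lemma fdet_limit:
  "uniform_limit (cball 0 r) (\<lambda>N z. pminor (\<lambda>i j. (if i = j then 1 else 0) + (- z * M i j)) (sect N)) fdet sequentially"
proof -
  obtain a where a: "admissible a" using admissible_ex by blast
  obtain s where s: "\<And>l. s l \<ge> 0" "(\<lambda>l. brk l * s l) summable_on UNIV"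
    "\<And>z k l. cmod z \<le> r \<Longrightarrow> cmod (fmat z k l * complex_of_real (a (lev l)) / complex_of_real (a (lev k))) \<le> s l"
    using fmat_bound[OF a, of r] by blast
  have le: "cmod (pminor (fmat z) K) \<le> fact (card K) * (\<Prod>k\<in>K. s k)" if "K \<in> fin_subsets UNIV" "z \<in> cball 0 r" for K z
  proof -
    have "pminor (\<lambda>k l. fmat z k l * complex_of_real (a (lev l)) / complex_of_real (a (lev k))) K = pminor (fmat z) K"
      by (rule pminor_conj) (use a_pos[OF a] in \<open>simp add: less_imp_neq[symmetric]\<close>)
    moreover have "cmod (pminor (\<lambda>k l. fmat z k l * complex_of_real (a (lev l)) / complex_of_real (a (lev k))) K)
        \<le> fact (card K) * (\<Prod>k\<in>K. s k)"
      using that by (intro pminor_le s(3)) auto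
    ultimately show ?thesis by simp
  qed
  have "uniform_limit (cball 0 r) (\<lambda>X z. \<Sum>K\<in>X. pminor (fmat z) K) (\<lambda>z. fdet z) (finite_subsets_at_top (fin_subsets UNIV))"
    unfolding fdet_def by (rule Weierstrass_m_test_general[OF le summable_on_fact_prod[OF s(1,2)]])
  moreover have "filterlim (\<lambda>N. Pow (sect N)) (finite_subsets_at_top (fin_subsets UNIV)) sequentially"
    unfolding filterlim_finite_subsets_at_top
  proof (intro allI impI)
    fix X :: "int set set" assume X: "finite X \<and> X \<subseteq> fin_subsets UNIV"
    then have "finite (\<Union>X)" by auto
    then obtain N0 where N0: "\<And>n. n \<in> \<Union>X \<Longrightarrow> lev n \<le> N0"
      using finite_nat_set_iff_bounded_le[of "lev ` (\<Union>X)"] by auto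
    show "\<forall>\<^sub>F N in sequentially. finite (Pow (sect N)) \<and> X \<subseteq> Pow (sect N) \<and> Pow (sect N) \<subseteq> fin_subsets UNIV"
      using eventually_ge_at_top[of N0]
    proof eventually_elim
      case (elim N)
      have "finite (sect N)" by (rule finite_lev)
      moreover have "X \<subseteq> Pow (sect N)" using N0 elim by fastforce
      ultimately show ?case by (auto intro: finite_subset)
    qed
  qed
  ultimately have "uniform_limit (cball 0 r) (\<lambda>N z. \<Sum>K\<in>Pow (sect N). pminor (fmat z) K) fdet sequentially"
    by (rule filterlim_compose)
  then show ?thesis by (simp only: section_det)
qed

lemma section_holomorphic:
  "(\<lambda>z. pminor (\<lambda>i j. (if i = j then 1 else 0) + (- z * M i j)) S) holomorphic_on A"
  unfolding pminor_def by (intro holomorphic_intros)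

lemma fdet_holomorphic: "fdet holomorphic_on UNIV"
proof (rule holomorphic_uniform_sequence)
  fix x :: complex
  have "uniform_limit (cball x 1) (\<lambda>N z. pminor (\<lambda>i j. (if i = j then 1 else 0) + (- z * M i j)) (sect N)) fdet sequentially"
  proof (rule uniform_limit_on_subset[OF fdet_limit[of "cmod x + 1"]], rule subsetI)
    fix y assume "y \<in> cball x 1"
    then have "cmod (y - x) \<le> 1" by (simp add: dist_norm norm_minus_commute)
    then show "y \<in> cball 0 (cmod x + 1)" using norm_triangle_sub[of y x] by simp
  qed
  then show "\<exists>d>0. cball x d \<subseteq> UNIV \<and>
      uniform_limit (cball x d) (\<lambda>N z. pminor (\<lambda>i j. (if i = j then 1 else 0) + (- z * M i j)) (sect N)) fdet sequentially"
    by (intro exI[of _ 1]) auto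
qed (rule section_holomorphic open_UNIV)+

end

section \<open>Traces of powers\<close>

text \<open>The radius on which \<open>D N\<close> is the exponential of its series may shrink as N
  grows. Therefore the series are compared through their Taylor coefficients at 0, which converge
  because the logarithms converge uniformly on a fixed disc where \<open>d\<close> is close to
  1.\<close>

lemma log_series_limit:
  fixes D :: "nat \<Rightarrow> complex \<Rightarrow> complex"
  assumes u: "uniform_limit (cball 0 1) D d sequentially"
    and D: "\<And>N. D N holomorphic_on UNIV" and d: "d holomorphic_on UNIV" and d0: "d 0 = 1"
    and ex: "\<And>N. \<exists>r>0. \<forall>z. cmod z < r \<longrightarrow> summable (\<lambda>n. z ^ Suc n / of_nat (Suc n) * t N n) \<and>
        D N z = exp (- (\<Sum>n. z ^ Suc n / of_nat (Suc n) * t N n))"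
    and lim: "\<And>n. (\<lambda>N. t N n) \<longlonglongrightarrow> \<tau> n"
  shows "\<exists>r>0. \<forall>z. cmod z < r \<longrightarrow> summable (\<lambda>n. z ^ Suc n / of_nat (Suc n) * \<tau> n) \<and>
        d z = exp (- (\<Sum>n. z ^ Suc n / of_nat (Suc n) * \<tau> n))"
proof -
  \<comment> \<open>Taylor coefficients of the logarithm: \<open>s n\<close> belongs to order n + 1,
    and order 0 has coefficient 0.\<close>
  let ?c = "\<lambda>s n. if n = 0 then 0 else - (s (n - 1) / of_nat n :: complex)"
  have "isCont d 0"
    using holomorphic_on_imp_continuous_on[OF d] by (simp add: continuous_on_eq_continuous_at)
  then obtain e where e: "e > 0" "\<And>z. dist z 0 < e \<Longrightarrow> dist (d z) (d 0) < 1 / 4"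
    unfolding continuous_at_eps_delta by (metis zero_less_divide_1_iff zero_less_numeral)
  define r where "r = min e 1"
  have r: "r > 0" "r \<le> e" "r \<le> 1" using e by (auto simp: r_def)
  have dr: "dist (d z) 1 < 1 / 4" if "z \<in> ball 0 r" for z
    using e(2)[of z] that r d0 by (simp add: dist_commute)
  have u': "uniform_limit (ball 0 r) D d sequentially"
    by (rule uniform_limit_on_subset[OF u]) (use r in auto)
  have ev: "\<forall>\<^sub>F N in sequentially. \<forall>z\<in>ball 0 r. D N z \<in> cball 1 (1 / 2)"
    using uniform_limitD[OF u', of "1 / 4", simplified]
  proof eventually_elim
    case (elim N)
    show ?case
    proof
      fix z :: complex assume z: "z \<in> ball 0 r"
      then have "dist (D N z) (d z) < 1 / 4" using elim by simp
      then show "D N z \<in> cball 1 (1 / 2)"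
        using dr[OF z] dist_triangle[of 1 "D N z" "d z"] by (simp add: dist_commute)
    qed
  qed
  \<comment> \<open>The disc of radius 1 / 2 around 1, which contains the values of \<open>d\<close>
    and of almost all \<open>D N\<close>, avoids the branch cut of \<open>Ln\<close>.\<close>
  have pos: "w \<notin> \<real>\<^sub>\<le>\<^sub>0" if "w \<in> cball 1 (1 / 2)" for w :: complex
  proof -
    have "\<bar>Re (1 - w)\<bar> \<le> 1 / 2"
      using that abs_Re_le_cmod[of "1 - w"] by (simp add: dist_norm)
    then show ?thesis by (auto simp: complex_nonpos_Reals_iff)
  qed
  have uc: "uniformly_continuous_on (cball 1 (1 / 2)) (Ln :: complex \<Rightarrow> complex)"
    by (intro compact_uniformly_continuous continuous_on_Ln continuous_on_id) (use pos in auto)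
  have ul: "uniform_limit (ball 0 r) (\<lambda>N z. Ln (D N z)) (\<lambda>z. Ln (d z)) sequentially"
    by (rule uniform_limit_compose_uniformly_continuous_on[OF u' uc ev]) simp
  have hol: "\<forall>\<^sub>F N in sequentially. (\<lambda>z. Ln (D N z)) holomorphic_on ball 0 r"
    using ev
  proof eventually_elim
    case (elim N)
    then show ?case
      by (intro holomorphic_on_Ln' holomorphic_on_subset[OF D] pos) auto
  qed
  have hold: "(\<lambda>z. Ln (d z)) holomorphic_on ball 0 r"
  proof (intro holomorphic_on_Ln' holomorphic_on_subset[OF d] pos subset_UNIV)
    fix z :: complex assume "z \<in> ball 0 r"
    from dr[OF this] have "dist 1 (d z) \<le> 1 / 2" unfolding dist_commute[of 1] by linarith
    then show "d z \<in> cball 1 (1 / 2)" by simp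
  qed
  have coef: "(deriv ^^ n) (\<lambda>z. Ln (D N z)) 0 / fact n = ?c (t N) n" for N n
  proof -
    obtain \<rho> where \<rho>': "\<rho> > 0 \<and> (\<forall>z. cmod z < \<rho> \<longrightarrow> summable (\<lambda>n. z ^ Suc n / of_nat (Suc n) * t N n) \<and>
        D N z = exp (- (\<Sum>n. z ^ Suc n / of_nat (Suc n) * t N n)))"
      using ex[of N] ..
    have \<rho>: "\<rho> > 0" by (rule \<rho>'[THEN conjunct1])
    have \<rho>s: "summable (\<lambda>n. z ^ Suc n / of_nat (Suc n) * t N n)" if "cmod z < \<rho>" for z
      by (rule \<rho>'[THEN conjunct2, rule_format, OF that, THEN conjunct1])
    have \<rho>e: "D N z = exp (- (\<Sum>n. z ^ Suc n / of_nat (Suc n) * t N n))" if "cmod z < \<rho>" for z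
      by (rule \<rho>'[THEN conjunct2, rule_format, OF that, THEN conjunct2])
    define P where "P z = - (\<Sum>n. z ^ Suc n / of_nat (Suc n) * t N n)" for z
    have near: "\<forall>\<^sub>F z in nhds 0. cmod z < \<rho>"
      using \<rho> eventually_nhds_ball[of \<rho> "0 :: complex"] by (simp add: eventually_mono)
    have fps: "P has_fps_expansion Abs_fps (?c (t N))"
    proof (rule has_fps_expansionI)
      show "\<forall>\<^sub>F z in nhds 0. (\<lambda>n. fps_nth (Abs_fps (?c (t N))) n * z ^ n) sums P z"
        using near
      proof eventually_elim
        case (elim z)
        have "(\<lambda>n. - (z ^ Suc n / of_nat (Suc n) * t N n)) sums P z"
          unfolding P_def by (intro sums_minus summable_sums \<rho>s elim)
        then have "(\<lambda>n. ?c (t N) (Suc n) * z ^ Suc n) sums P z"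
          by (simp add: mult_ac)
        then show ?case by (subst (asm) sums_Suc_iff) simp
      qed
    qed
    have P0: "P 0 = 0" by (simp add: P_def)
    have "isCont P 0"
      using has_fps_expansion_imp_continuous[OF fps, of UNIV] by simp
    then have "\<forall>\<^sub>F z in nhds 0. dist (P z) 0 < 3"
      using P0 by (auto simp: isCont_def tendsto_iff eventually_at_filter dest!: spec[of _ 3] elim!: eventually_mono)
    with near have "\<forall>\<^sub>F z in nhds 0. Ln (D N z) = P z"
    proof eventually_elim
      case (elim z)
      then have "\<bar>Im (P z)\<bar> < 3" using abs_Im_le_cmod[of "P z"] by simp
      \<comment> \<open>Near 0 the imaginary part of \<open>P z\<close> is below 3 and so below pi;
        hence the principal branch returns \<open>P z\<close> without a multiple of 2 pi i.\<close>
      then have "Ln (exp (P z)) = P z" using pi_gt3 by (intro Ln_exp) auto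
      then show ?case using \<rho>e[of z] elim by (simp add: P_def)
    qed
    then have "(\<lambda>z. Ln (D N z)) has_fps_expansion Abs_fps (?c (t N))"
      by (subst has_fps_expansion_cong[OF _ refl]) (assumption, rule fps)
    then show ?thesis by (simp only: fps_nth_fps_expansion[symmetric] fps_nth_Abs_fps)
  qed
  have cd: "(deriv ^^ n) (\<lambda>z. Ln (d z)) 0 / fact n = ?c \<tau> n" for n
  proof (rule LIMSEQ_unique)
    show "(\<lambda>N. (deriv ^^ n) (\<lambda>z. Ln (D N z)) 0 / fact n) \<longlonglongrightarrow> (deriv ^^ n) (\<lambda>z. Ln (d z)) 0 / fact n"
      by (intro tendsto_divide higher_deriv_complex_uniform_limit[OF ul hol] tendsto_const) (use r in auto)
    show "(\<lambda>N. (deriv ^^ n) (\<lambda>z. Ln (D N z)) 0 / fact n) \<longlonglongrightarrow> ?c \<tau> n"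
      unfolding coef by (cases "n = 0") (auto intro!: tendsto_intros lim)
  qed
  show ?thesis
  proof (intro exI[of _ r] conjI allI impI r(1))
    fix z :: complex assume z: "cmod z < r"
    have "(\<lambda>n. ?c \<tau> n * z ^ n) sums Ln (d z)"
      using holomorphic_power_series[OF hold, of z] z unfolding cd by simp
    then have "(\<lambda>n. ?c \<tau> (Suc n) * z ^ Suc n) sums Ln (d z)" by (subst sums_Suc_iff) simp
    then have "(\<lambda>n. - (z ^ Suc n / of_nat (Suc n) * \<tau> n)) sums Ln (d z)" by (simp add: mult_ac)
    from sums_minus[OF this] have s: "(\<lambda>n. z ^ Suc n / of_nat (Suc n) * \<tau> n) sums (- Ln (d z))" by simp
    then show "summable (\<lambda>n. z ^ Suc n / of_nat (Suc n) * \<tau> n)" by (rule sums_summable)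
    have "d z \<noteq> 0" using dr[of z] z by auto
    then show "d z = exp (- (\<Sum>n. z ^ Suc n / of_nat (Suc n) * \<tau> n))"
      using s by (simp add: sums_iff)
  qed
qed

lemma norm_infsum_inverse_square:
  assumes "\<And>j::int. cmod (f j) \<le> U * (1 / (brk j)\<^sup>2)"
  shows "cmod (\<Sum>\<^sub>\<infinity>j. f j) \<le> U * (\<Sum>\<^sub>\<infinity>j::int. 1 / (brk j)\<^sup>2)"
proof -
  have s: "(\<lambda>j::int. U * (1 / (brk j)\<^sup>2)) summable_on UNIV"
    by (intro summable_on_cmult_right summable_inverse_square_int)
  have a: "f abs_summable_on UNIV"
    by (rule Infinite_Sum.abs_summable_on_comparison_test'[OF s assms])
  have "cmod (\<Sum>\<^sub>\<infinity>j. f j) \<le> (\<Sum>\<^sub>\<infinity>j. cmod (f j))" by (rule norm_infsum_bound[OF a])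
  also have "\<dots> \<le> (\<Sum>\<^sub>\<infinity>j::int. U * (1 / (brk j)\<^sup>2))"
    by (rule infsum_mono[OF a s assms])
  finally show ?thesis by (simp only: infsum_cmult_right')
qed

section \<open>Limits of the traces of powers of sections\<close>

context smoothing_matrix
begin

primrec ipow :: "nat \<Rightarrow> int \<Rightarrow> int \<Rightarrow> complex" where
  "ipow 0 m k = (if m = k then 1 else 0)"
| "ipow (Suc n) m k = (\<Sum>\<^sub>\<infinity>j. M m j * ipow n j k)"

text \<open>Bounds that survive multiplication by \<open>M\<close> from the left and that all
  sections share: at most polynomial growth in the column index, and rapid decay in the row index on
  and beyond the diagonal. On the diagonal itself they give a summable majorant for the
  traces.\<close>

definition tame :: "real \<Rightarrow> nat \<Rightarrow> (nat \<Rightarrow> real) \<Rightarrow> (int \<Rightarrow> int \<Rightarrow> complex) \<Rightarrow> bool" where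
  "tame C p E X \<longleftrightarrow> (\<forall>j k. cmod (X j k) \<le> C * brk k ^ p) \<and>
    (\<forall>K j k. \<bar>k\<bar> \<le> \<bar>j\<bar> \<longrightarrow> cmod (X j k) \<le> E K / brk j ^ K)"

lemma entry_le: "cmod (M m n) \<le> L"
proof -
  have "(cmod (M m n))\<^sup>2 \<le> L\<^sup>2" using l2_bound[of "{n}" "{m}" "\<lambda>_. 1"] by simp
  then show ?thesis using L by (rule power2_le_imp_le)
qed

lemma tame_nonneg:
  assumes "tame C p E X" shows "0 \<le> C" "0 \<le> E K"
proof -
  have "0 \<le> cmod (X 0 0)" by simp
  also have "\<dots> \<le> C * brk 0 ^ p" using assms unfolding tame_def by blast
  finally show "0 \<le> C" by simp
  have "0 \<le> cmod (X 0 0)" by simp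
  also have "\<dots> \<le> E K / brk 0 ^ K" using assms unfolding tame_def by blast
  finally show "0 \<le> E K" by simp
qed

lemma tame_term:
  assumes t: "tame C p E X"
  shows "cmod (M m j * X j k) \<le> L * (C + E 2) * brk k ^ (p + 2) * (1 / (brk j)\<^sup>2)"
proof -
  define u v where "u = 1 + \<bar>real_of_int k\<bar>" and "v = 1 + \<bar>real_of_int j\<bar>"
  have uv: "u \<ge> 1" "v \<ge> 1" by (auto simp: u_def v_def)
  have up: "u ^ i \<ge> 1" for i using uv by (simp add: one_le_power)
  note nn = tame_nonneg[OF t]
  have "cmod (X j k) \<le> (C + E 2) * u ^ (p + 2) / v\<^sup>2"
  proof (cases "\<bar>k\<bar> \<le> \<bar>j\<bar>")
    case True
    then have "cmod (X j k) \<le> E 2 / v\<^sup>2" using t unfolding tame_def v_def by blast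
    also have "\<dots> \<le> ((C + E 2) * u ^ (p + 2)) / v\<^sup>2"
    proof (rule divide_right_mono)
      have "E 2 * 1 \<le> (C + E 2) * u ^ (p + 2)"
        by (rule mult_mono) (use nn(1) nn(2)[of 2] up[of "p + 2"] in auto)
      then show "E 2 \<le> (C + E 2) * u ^ (p + 2)" by simp
    qed simp
    finally show ?thesis .
  next
    case False
    then have "v \<le> u" by (simp add: u_def v_def)
    then have "v\<^sup>2 \<le> u\<^sup>2" using uv by (intro power_mono) auto
    have "cmod (X j k) \<le> C * u ^ p" using t unfolding tame_def u_def by blast
    also have "\<dots> \<le> (C + E 2) * u ^ p" using nn(2)[of 2] uv by (intro mult_right_mono) auto
    also have "\<dots> = (C + E 2) * u ^ p * v\<^sup>2 / v\<^sup>2" using uv by simp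
    also have "\<dots> \<le> (C + E 2) * u ^ p * u\<^sup>2 / v\<^sup>2"
      using \<open>v\<^sup>2 \<le> u\<^sup>2\<close> nn(1) nn(2)[of 2] uv by (intro divide_right_mono mult_left_mono) auto
    finally show ?thesis by (simp only: power_add mult.assoc)
  qed
  then have "cmod (M m j) * cmod (X j k) \<le> L * ((C + E 2) * u ^ (p + 2) / v\<^sup>2)"
    using entry_le L by (intro mult_mono) auto
  then show ?thesis by (simp add: u_def v_def norm_mult mult_ac)
qed

text \<open>For j up to \<kappa> times m in absolute value, the rapid decay of \<open>M m j\<close>
  in m beats the polynomial growth of X. For all other j the inequalities |k| \<le> |m| \<le> |j|
  put \<open>X j k\<close> into its own region of rapid decay.\<close>

lemma tame_step:
  assumes t0: "tame C p E X0"
  shows "\<exists>C' p' E'. \<forall>X. tame C p E X \<longrightarrow> tame C' p' E' (\<lambda>m k. \<Sum>\<^sub>\<infinity>j. M m j * X j k)"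
proof -
  note nn = tame_nonneg[OF t0]
  define Z where "Z = (\<Sum>\<^sub>\<infinity>j::int. 1 / (brk j)\<^sup>2)"
  obtain D where D: "\<And>K m n. \<bar>real_of_int n\<bar> \<le> \<kappa> * \<bar>real_of_int m\<bar> \<Longrightarrow> cmod (M m n) \<le> D K / brk m ^ K"
    using decay by metis
  have Dnn: "0 \<le> D K" for K
    using D[of 0 0 K] norm_ge_zero[of "M 0 0"] by (simp del: norm_ge_zero)
  define E' where "E' K = (D (K + p + 2) * C * \<kappa>\<^sup>2 + L * E (K + 2)) * Z" for K
  have "tame (L * (C + E 2) * Z) (p + 2) E' (\<lambda>m k. \<Sum>\<^sub>\<infinity>j. M m j * X j k)" if t: "tame C p E X" for X
    unfolding tame_def
  proof (intro conjI allI impI)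
    fix m k
    have "cmod (\<Sum>\<^sub>\<infinity>j. M m j * X j k) \<le> L * (C + E 2) * brk k ^ (p + 2) * Z"
      unfolding Z_def by (rule norm_infsum_inverse_square[OF tame_term[OF t]])
    then show "cmod (\<Sum>\<^sub>\<infinity>j. M m j * X j k) \<le> L * (C + E 2) * Z * brk k ^ (p + 2)"
      by (simp only: mult_ac)
  next
    fix K :: nat and m k :: int assume km: "\<bar>k\<bar> \<le> \<bar>m\<bar>"
    define u where "u = 1 + \<bar>real_of_int m\<bar>"
    have u: "u \<ge> 1" by (simp add: u_def)
    have "cmod (M m j * X j k) \<le> (D (K + p + 2) * C * \<kappa>\<^sup>2 + L * E (K + 2)) / u ^ K * (1 / (brk j)\<^sup>2)" for j
    proof -
      define v where "v = 1 + \<bar>real_of_int j\<bar>"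
      have v: "v \<ge> 1" by (simp add: v_def)
      have "cmod (M m j) * cmod (X j k) \<le> (D (K + p + 2) * C * \<kappa>\<^sup>2 + L * E (K + 2)) / (u ^ K * v\<^sup>2)"
      proof (cases "\<bar>real_of_int j\<bar> \<le> \<kappa> * \<bar>real_of_int m\<bar>")
        case True
        have k: "\<kappa> \<ge> 1" using \<kappa> by simp
        have "v \<le> \<kappa> * u" using True k by (simp add: u_def v_def algebra_simps)
        then have "v\<^sup>2 \<le> (\<kappa> * u)\<^sup>2" using v by (intro power_mono) auto
        then have vv: "v\<^sup>2 \<le> \<kappa>\<^sup>2 * u\<^sup>2" by (simp add: power_mult_distrib)
        \<comment> \<open>The exponent \<open>K + p + 2\<close> provides the K powers wanted, p
          powers against the growth of X, and two that are traded for an inverse square in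
          j.\<close>
        have "cmod (M m j) \<le> D (K + p + 2) / u ^ (K + p + 2)" unfolding u_def by (rule D[OF True])
        moreover have "cmod (X j k) \<le> C * u ^ p"
        proof -
          have "cmod (X j k) \<le> C * brk k ^ p" using t unfolding tame_def by blast
          also have "\<dots> \<le> C * u ^ p" using km nn(1) by (intro mult_left_mono power_mono) (auto simp: u_def)
          finally show ?thesis .
        qed
        ultimately have "cmod (M m j) * cmod (X j k) \<le> D (K + p + 2) / u ^ (K + p + 2) * (C * u ^ p)"
          using Dnn u by (intro mult_mono) auto
        also have "\<dots> = D (K + p + 2) * C / (u ^ K * u\<^sup>2)"
          using u by (simp add: power_add power2_eq_square)
        also have "\<dots> \<le> D (K + p + 2) * C * \<kappa>\<^sup>2 / (u ^ K * v\<^sup>2)"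
        proof -
          have "D (K + p + 2) * C / (u ^ K * u\<^sup>2) = (D (K + p + 2) * C / u ^ K) * (1 / u\<^sup>2)" by simp
          also have "\<dots> \<le> (D (K + p + 2) * C / u ^ K) * (\<kappa>\<^sup>2 / v\<^sup>2)"
            using vv u v Dnn nn(1) by (intro mult_left_mono) (auto simp: field_simps)
          finally show ?thesis by simp
        qed
        also have "\<dots> \<le> (D (K + p + 2) * C * \<kappa>\<^sup>2 + L * E (K + 2)) / (u ^ K * v\<^sup>2)"
          using nn(2)[of "K + 2"] L u v by (intro divide_right_mono) auto
        finally show ?thesis .
      next
        case False
        have "\<kappa> * \<bar>real_of_int m\<bar> \<ge> 1 * \<bar>real_of_int m\<bar>" using \<kappa> by (intro mult_right_mono) auto
        with False have jm: "\<bar>m\<bar> \<le> \<bar>j\<bar>" by linarith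
        then have uv: "u \<le> v" by (simp add: u_def v_def)
        have "cmod (X j k) \<le> E (K + 2) / v ^ (K + 2)"
          using t km jm unfolding tame_def v_def by (meson order_trans)
        also have "\<dots> \<le> E (K + 2) / (u ^ K * v\<^sup>2)"
          using uv u v nn(2)[of "K + 2"] unfolding power_add
          by (intro divide_left_mono mult_right_mono power_mono) auto
        finally have "cmod (M m j) * cmod (X j k) \<le> L * (E (K + 2) / (u ^ K * v\<^sup>2))"
          using entry_le L by (intro mult_mono) auto
        also have "\<dots> = L * E (K + 2) / (u ^ K * v\<^sup>2)" by simp
        also have "\<dots> \<le> (D (K + p + 2) * C * \<kappa>\<^sup>2 + L * E (K + 2)) / (u ^ K * v\<^sup>2)"
          using Dnn nn(1) u v by (intro divide_right_mono) auto
        finally show ?thesis .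
      qed
      then show ?thesis by (simp add: norm_mult v_def)
    qed
    then have "cmod (\<Sum>\<^sub>\<infinity>j. M m j * X j k) \<le> (D (K + p + 2) * C * \<kappa>\<^sup>2 + L * E (K + 2)) / u ^ K * Z"
      unfolding Z_def by (rule norm_infsum_inverse_square)
    then show "cmod (\<Sum>\<^sub>\<infinity>j. M m j * X j k) \<le> E' K / brk m ^ K"
      by (simp add: E'_def u_def)
  qed
  then show ?thesis by blast
qed

lemma ipow_1: "ipow (Suc 0) m k = M m k"
proof -
  have "(\<Sum>\<^sub>\<infinity>j. M m j * (if j = k then 1 else 0)) = (\<Sum>\<^sub>\<infinity>j\<in>{k}. M m j)"
    by (rule infsum_cong_neutral) auto
  then show ?thesis by simp
qed

text \<open>Extended by 0 outside the section, so that products of sections become sums over all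
  integers and dominated convergence applies to them.\<close>

definition spow :: "nat \<Rightarrow> nat \<Rightarrow> int \<Rightarrow> int \<Rightarrow> complex" where
  "spow N n j k = (if j \<in> sect N \<and> k \<in> sect N then mpow (sect N) M n j k else 0)"

lemma spow_Suc:
  "spow N (Suc n) m k = (if m \<in> sect N \<and> k \<in> sect N then \<Sum>\<^sub>\<infinity>j. M m j * spow N n j k else 0)"
proof -
  have "(\<Sum>\<^sub>\<infinity>j. M m j * spow N n j k) = (\<Sum>\<^sub>\<infinity>j\<in>sect N. M m j * mpow (sect N) M n j k)" if "k \<in> sect N"
    using that by (intro infsum_cong_neutral) (auto simp: spow_def)
  then show ?thesis by (simp add: spow_def finite_lev)
qed

text \<open>The constants do not depend on N because \<open>tame_step\<close> chooses the new ones
  before the matrix, and cutting a matrix to a section only replaces entries by 0.\<close>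

lemma spow_tame: "\<exists>C p E. \<forall>N. tame C p E (spow N (Suc n))"
proof (induction n)
  case 0
  obtain D where D: "\<And>K m n. \<bar>real_of_int n\<bar> \<le> \<kappa> * \<bar>real_of_int m\<bar> \<Longrightarrow> cmod (M m n) \<le> D K / brk m ^ K"
    using decay by metis
  have Dnn: "0 \<le> D K" for K
    using D[of 0 0 K] norm_ge_zero[of "M 0 0"] by (simp del: norm_ge_zero)
  have s1: "spow N (Suc 0) m k = (if m \<in> sect N \<and> k \<in> sect N then M m k else 0)" for N m k
    unfolding spow_def by (simp add: finite_lev if_distrib[of "\<lambda>x. _ * x"] cong: if_cong)
  have "tame L 0 D (spow N (Suc 0))" for N
    unfolding tame_def s1
  proof (intro conjI allI impI)
    fix K :: nat and j k :: int assume "\<bar>k\<bar> \<le> \<bar>j\<bar>"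
    moreover have "\<kappa> * \<bar>real_of_int j\<bar> \<ge> 1 * \<bar>real_of_int j\<bar>" using \<kappa> by (intro mult_right_mono) auto
    ultimately have "cmod (M j k) \<le> D K / brk j ^ K" by (intro D) linarith
    then show "cmod (if j \<in> sect N \<and> k \<in> sect N then M j k else 0) \<le> D K / brk j ^ K"
      using Dnn by simp
  qed (use entry_le L in simp)
  then show ?case by blast
next
  case (Suc n)
  then obtain C p E where t: "\<And>N. tame C p E (spow N (Suc n))" by blast
  then obtain C' p' E' where t': "\<And>X. tame C p E X \<Longrightarrow> tame C' p' E' (\<lambda>m k. \<Sum>\<^sub>\<infinity>j. M m j * X j k)"
    using tame_step[OF t] by blast
  have "tame C' p' E' (spow N (Suc (Suc n)))" for N
    using t'[OF t[of N]] tame_nonneg[OF t'[OF t[of N]]]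
    unfolding spow_Suc[of N "Suc n"] tame_def by auto
  then show ?case by blast
qed

lemma spow_limit: "(\<lambda>N. spow N (Suc n) m k) \<longlonglongrightarrow> ipow (Suc n) m k"
proof (induction n arbitrary: m)
  case 0
  have "\<forall>\<^sub>F N in sequentially. spow N (Suc 0) m k = M m k"
    using eventually_ge_at_top[of "max (lev m) (lev k)"]
    by eventually_elim (simp add: spow_def finite_lev if_distrib[of "\<lambda>x. _ * x"] cong: if_cong)
  then show ?case by (simp only: ipow_1 tendsto_eventually)
next
  case (Suc n)
  obtain C p E where t: "\<And>N. tame C p E (spow N (Suc n))" using spow_tame by blast
  have "(\<lambda>N. \<Sum>\<^sub>\<infinity>j. M m j * spow N (Suc n) j k) \<longlonglongrightarrow> (\<Sum>\<^sub>\<infinity>j. M m j * ipow (Suc n) j k)"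
    by (rule infsum_dominated_convergence[OF tame_term[OF t]])
       (intro summable_on_cmult_right summable_inverse_square_int tendsto_intros Suc.IH)+
  moreover have "\<forall>\<^sub>F N in sequentially. (\<Sum>\<^sub>\<infinity>j. M m j * spow N (Suc n) j k) = spow N (Suc (Suc n)) m k"
    using eventually_ge_at_top[of "max (lev m) (lev k)"]
    by eventually_elim (simp only: spow_Suc[of _ "Suc n"], simp)
  ultimately show ?case unfolding ipow.simps(2)[of "Suc n"]
    by (rule Lim_transform_eventually)
qed

lemma trace_limit:
  "(\<lambda>N. \<Sum>k\<in>sect N. mpow (sect N) M (Suc n) k k) \<longlonglongrightarrow> (\<Sum>\<^sub>\<infinity>k. ipow (Suc n) k k)"
  "(\<lambda>k. ipow (Suc n) k k) abs_summable_on UNIV"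
proof -
  obtain C p E where t: "\<And>N. tame C p E (spow N (Suc n))" using spow_tame by blast
  have b: "cmod (spow N (Suc n) k k) \<le> E 2 * (1 / (brk k)\<^sup>2)" for N k
    using t[of N] unfolding tame_def by simp
  have s: "(\<lambda>k::int. E 2 * (1 / (brk k)\<^sup>2)) summable_on UNIV"
    by (intro summable_on_cmult_right summable_inverse_square_int)
  have "(\<Sum>\<^sub>\<infinity>k. spow N (Suc n) k k) = (\<Sum>\<^sub>\<infinity>k\<in>sect N. mpow (sect N) M (Suc n) k k)" for N
    by (rule infsum_cong_neutral) (auto simp: spow_def)
  then have eq: "(\<Sum>\<^sub>\<infinity>k. spow N (Suc n) k k) = (\<Sum>k\<in>sect N. mpow (sect N) M (Suc n) k k)" for N
    by (simp only: infsum_finite finite_lev)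
  show "(\<lambda>N. \<Sum>k\<in>sect N. mpow (sect N) M (Suc n) k k) \<longlonglongrightarrow> (\<Sum>\<^sub>\<infinity>k. ipow (Suc n) k k)"
    unfolding eq[symmetric] by (rule infsum_dominated_convergence(1)[OF b s spow_limit])
  show "(\<lambda>k. ipow (Suc n) k k) abs_summable_on UNIV"
    by (rule infsum_dominated_convergence(2)[OF b s spow_limit])
qed

lemma fdet_0: "fdet 0 = 1"
proof -
  have l: "(\<lambda>N. pminor (\<lambda>i j. (if i = j then 1 else 0) + (- 0 * M i j)) (sect N)) \<longlonglongrightarrow> fdet 0"
    by (rule tendsto_uniform_limitI[OF fdet_limit[of 0]]) simp
  have e: "pminor (\<lambda>i j. (if i = j then 1 else 0) + (- 0 * M i j)) (sect N) = 1" for N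
    using pminor_triangular[OF finite_lev[of N], of "\<lambda>_ _. 0" lev] by simp
  show ?thesis using l unfolding e by (rule LIMSEQ_unique[OF _ tendsto_const])
qed

theorem fdet_exp_trace:
  "\<exists>r>0. \<forall>z. cmod z < r \<longrightarrow> summable (\<lambda>n. z ^ Suc n / of_nat (Suc n) * (\<Sum>\<^sub>\<infinity>k. ipow (Suc n) k k)) \<and>
        fdet z = exp (- (\<Sum>n. z ^ Suc n / of_nat (Suc n) * (\<Sum>\<^sub>\<infinity>k. ipow (Suc n) k k)))"
proof (rule log_series_limit[OF fdet_limit section_holomorphic fdet_holomorphic fdet_0 _ trace_limit(1)])
  fix N
  obtain r where "r > 0"
    "\<And>z. cmod z < r \<Longrightarrow> summable (\<lambda>n. z ^ Suc n / of_nat (Suc n) * (\<Sum>i\<in>sect N. mpow (sect N) M (Suc n) i i))"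
    "\<And>z. cmod z < r \<Longrightarrow> pminor (\<lambda>i j. (if i = j then 1 else 0) + (- z * M i j)) (sect N) =
        exp (- (\<Sum>n. z ^ Suc n / of_nat (Suc n) * (\<Sum>i\<in>sect N. mpow (sect N) M (Suc n) i i)))"
    using pminor_exp_trace[OF finite_lev[of N], of M] by blast
  then show "\<exists>r>0. \<forall>z. cmod z < r \<longrightarrow>
      summable (\<lambda>n. z ^ Suc n / of_nat (Suc n) * (\<Sum>k\<in>sect N. mpow (sect N) M (Suc n) k k)) \<and>
      pminor (\<lambda>i j. (if i = j then 1 else 0) + (- z * M i j)) (sect N) =
        exp (- (\<Sum>n. z ^ Suc n / of_nat (Suc n) * (\<Sum>k\<in>sect N. mpow (sect N) M (Suc n) k k)))"
    by blast
qed

end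

section \<open>Fourier coefficients\<close>

definition em :: "real \<Rightarrow> complex" where
  "em x = exp (2 * of_real pi * \<i> * of_real x)"

lemma em_add: "em (x + y) = em x * em y"
  by (simp add: em_def exp_add[symmetric] algebra_simps)

lemma em_0 [simp]: "em 0 = 1" by (simp add: em_def)

lemma em_eq_1_iff: "em x = 1 \<longleftrightarrow> x \<in> \<int>"
proof
  assume "em x = 1"
  then obtain n :: int where "2 * pi * x = of_int (2 * n) * pi"
    unfolding em_def exp_eq_1 by auto
  then have "x = of_int n" by simp
  then show "x \<in> \<int>" by simp
next
  assume "x \<in> \<int>"
  then obtain n where "x = of_int n" by (elim Ints_cases)
  then show "em x = 1" unfolding em_def exp_eq_1 by (auto intro!: exI[of _ n])
qed

lemma em_of_int [simp]: "em (of_int n) = 1" by (simp add: em_eq_1_iff)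

lemma norm_em [simp]: "cmod (em x) = 1" by (simp add: em_def)

lemma em_nz [simp]: "em x \<noteq> 0" by (simp add: em_def)

lemma em_minus: "em (- x) = inverse (em x)"
  by (simp add: em_def exp_minus)

lemma cnj_em: "cnj (em x) = em (- x)"
  by (simp add: em_def exp_cnj)

lemma em_eq_iff: "em x = em y \<longleftrightarrow> x - y \<in> \<int>"
proof -
  have "em (x - y) = em x / em y" using em_add[of x "- y"] by (simp add: em_minus divide_inverse)
  then show ?thesis by (simp add: em_eq_1_iff[symmetric])
qed

lemma em_has_vector_derivative:
  assumes "(\<phi> has_real_derivative \<phi>') (at t within A)"
  shows "((\<lambda>t. em (\<phi> t)) has_vector_derivative (2 * of_real pi * \<i> * of_real \<phi>' * em (\<phi> t))) (at t within A)"
proof -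
  have "((\<lambda>t. complex_of_real (\<phi> t)) has_vector_derivative of_real \<phi>') (at t within A)"
    by (rule has_vector_derivative_of_real[OF assms])
  then have "((\<lambda>t. 2 * of_real pi * \<i> * complex_of_real (\<phi> t)) has_vector_derivative (2 * of_real pi * \<i>) * of_real \<phi>') (at t within A)"
    by (rule has_vector_derivative_mult_right)
  from field_vector_diff_chain_within[OF this DERIV_exp[THEN DERIV_subset, OF subset_UNIV]]
  show ?thesis by (simp add: o_def em_def[abs_def] mult_ac)
qed

lemma continuous_on_em [continuous_intros]:
  "continuous_on A f \<Longrightarrow> continuous_on A (\<lambda>x. em (f x))"
  unfolding em_def by (intro continuous_intros)

lemma integral_em: "((\<lambda>t. em (of_int n * t)) has_integral (if n = 0 then 1 else 0)) {0..1}"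
proof (cases "n = 0")
  case True
  then show ?thesis using has_integral_const_real[of "1 :: complex" 0 1] by simp
next
  case False
  let ?c = "2 * of_real pi * \<i> * of_int n :: complex"
  have c: "?c \<noteq> 0" using False by simp
  have "((\<lambda>t. 1 / ?c * em (of_int n * t)) has_vector_derivative 1 / ?c * (?c * em (of_int n * t))) (at t within {0..1})" for t
    using em_has_vector_derivative[of "\<lambda>t. of_int n * t" "of_int n" t "{0..1}"]
    by (intro has_vector_derivative_mult_right) (auto intro!: derivative_eq_intros)
  then have "((\<lambda>t. 1 / ?c * (?c * em (of_int n * t))) has_integral (1 / ?c * em (of_int n * 1) - 1 / ?c * em (of_int n * 0))) {0..1}"
    by (intro fundamental_theorem_of_calculus) simp_all
  then show ?thesis using False by simp
qed

definition fcoef :: "(real \<Rightarrow> complex) \<Rightarrow> int \<Rightarrow> complex" where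
  "fcoef f k = integral {0..1} (\<lambda>t. f t * em (- (of_int k * t)))"

lemma fcoef_has_integral:
  assumes "continuous_on {0..1} f"
  shows "((\<lambda>t. f t * em (- (of_int k * t))) has_integral fcoef f k) {0..1}"
  unfolding fcoef_def
  by (intro integrable_integral integrable_continuous_interval continuous_intros assms)

lemma fcoef_trig_poly:
  assumes "finite N" "l \<in> N"
  shows "((\<lambda>t. (\<Sum>k\<in>N. c k * em (of_int k * t)) * em (- (of_int l * t))) has_integral c l) {0..1}"
proof -
  have "((\<lambda>t. \<Sum>k\<in>N. c k * em (of_int (k - l) * t)) has_integral (\<Sum>k\<in>N. c k * (if k - l = 0 then 1 else 0))) {0..1}"
    using assms(1) by (intro has_integral_sum has_integral_mult_right integral_em)
  moreover have "(\<Sum>k\<in>N. c k * em (of_int (k - l) * t)) = (\<Sum>k\<in>N. c k * em (of_int k * t)) * em (- (of_int l * t))" for t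
    unfolding sum_distrib_right mult.assoc em_add[symmetric] by (simp add: algebra_simps)
  moreover have "(\<Sum>k\<in>N. c k * (if k - l = 0 then 1 else 0)) = c l"
    using assms by (simp add: if_distrib[of "\<lambda>x. _ * x"] cong: if_cong)
  ultimately show ?thesis by simp
qed

lemma bessel_fcoef:
  assumes f: "continuous_on {0..1} f" and N: "finite N"
  shows "(\<Sum>k\<in>N. (cmod (fcoef f k))\<^sup>2) \<le> integral {0..1} (\<lambda>t. (cmod (f t))\<^sup>2)"
proof -
  define c where "c = fcoef f"
  define p where "p t = (\<Sum>k\<in>N. c k * em (of_int k * t))" for t
  define S where "S = (\<Sum>k\<in>N. (cmod (c k))\<^sup>2)"
  have pc: "continuous_on {0..1} p" unfolding p_def by (intro continuous_intros)
  have cp: "cnj (p t) = (\<Sum>k\<in>N. cnj (c k) * em (- (of_int k * t)))" for t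
    by (simp add: p_def cnj_em)
  have gen: "((\<lambda>t. Re (g t * cnj (p t))) has_integral S) {0..1}"
    if g: "\<And>k. k \<in> N \<Longrightarrow> ((\<lambda>t. g t * em (- (of_int k * t))) has_integral c k) {0..1}" for g
  proof -
    have "((\<lambda>t. \<Sum>k\<in>N. cnj (c k) * (g t * em (- (of_int k * t)))) has_integral (\<Sum>k\<in>N. cnj (c k) * c k)) {0..1}"
      by (intro has_integral_sum N has_integral_mult_right g)
    moreover have "(\<Sum>k\<in>N. cnj (c k) * (g t * em (- (of_int k * t)))) = g t * cnj (p t)" for t
      unfolding cp sum_distrib_left by (simp add: mult_ac)
    ultimately have "((\<lambda>t. g t * cnj (p t)) has_integral (\<Sum>k\<in>N. cnj (c k) * c k)) {0..1}" by simp
    moreover have "(\<Sum>k\<in>N. cnj (c k) * c k) = of_real S"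
      unfolding S_def of_real_sum by (intro sum.cong refl) (simp only: complex_norm_square mult.commute)
    ultimately have "((\<lambda>t. g t * cnj (p t)) has_integral of_real S) {0..1}" by simp
    from has_integral_Re[OF this] show ?thesis by simp
  qed
  have fp: "((\<lambda>t. Re (f t * cnj (p t))) has_integral S) {0..1}"
    by (rule gen) (simp add: c_def fcoef_has_integral[OF f])
  have pp: "((\<lambda>t. Re (p t * cnj (p t))) has_integral S) {0..1}"
    by (rule gen) (simp only: p_def fcoef_trig_poly[OF N])
  have ff: "((\<lambda>t. (cmod (f t))\<^sup>2) has_integral integral {0..1} (\<lambda>t. (cmod (f t))\<^sup>2)) {0..1}"
    by (intro integrable_integral integrable_continuous_interval continuous_intros f)
  have "((\<lambda>t. (cmod (f t))\<^sup>2 - 2 * Re (f t * cnj (p t)) + Re (p t * cnj (p t))) has_integral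
      (integral {0..1} (\<lambda>t. (cmod (f t))\<^sup>2) - 2 * S + S)) {0..1}"
    by (intro has_integral_add has_integral_diff has_integral_mult_right ff fp pp)
  moreover have "(cmod (f t))\<^sup>2 - 2 * Re (f t * cnj (p t)) + Re (p t * cnj (p t)) = (cmod (f t - p t))\<^sup>2" for t
    unfolding cmod_power2 by (simp add: power2_eq_square algebra_simps)
  ultimately have "((\<lambda>t. (cmod (f t - p t))\<^sup>2) has_integral
      (integral {0..1} (\<lambda>t. (cmod (f t))\<^sup>2) - 2 * S + S)) {0..1}" by simp
  then have "0 \<le> integral {0..1} (\<lambda>t. (cmod (f t))\<^sup>2) - 2 * S + S"
    by (rule has_integral_nonneg) simp
  then show ?thesis by (simp add: S_def c_def)
qed

text \<open>By Bessel's inequality the squares are summable along any sequence of distinct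
  frequencies.\<close>

lemma riemann_lebesgue:
  assumes f: "continuous_on {0..1} f" and h: "inj h"
  shows "(\<lambda>N::nat. fcoef f (h N)) \<longlonglongrightarrow> 0"
proof -
  have "(\<Sum>i<n. (cmod (fcoef f (h i)))\<^sup>2) \<le> integral {0..1} (\<lambda>t. (cmod (f t))\<^sup>2)" for n
  proof -
    have "(\<Sum>i<n. (cmod (fcoef f (h i)))\<^sup>2) = (\<Sum>k\<in>h ` {..<n}. (cmod (fcoef f k))\<^sup>2)"
      using h by (subst sum.reindex) (auto intro: inj_on_subset)
    also have "\<dots> \<le> integral {0..1} (\<lambda>t. (cmod (f t))\<^sup>2)" by (rule bessel_fcoef[OF f]) simp
    finally show ?thesis .
  qed
  then have "summable (\<lambda>i. (cmod (fcoef f (h i)))\<^sup>2)" by (intro summableI_nonneg_bounded) auto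
  then have "(\<lambda>i. (cmod (fcoef f (h i)))\<^sup>2) \<longlonglongrightarrow> 0" by (rule summable_LIMSEQ_zero)
  then have "(\<lambda>i. sqrt ((cmod (fcoef f (h i)))\<^sup>2)) \<longlonglongrightarrow> sqrt 0" by (rule tendsto_real_sqrt)
  then show ?thesis by (simp add: tendsto_norm_zero_iff)
qed

text \<open>Dividing \<open>f t - f 0\<close> by \<open>em t - 1\<close> leaves a continuous function, whose Fourier
  coefficients make the symmetric partial sums of \<open>f\<close> at 0 telescope.\<close>

lemma fourier_inversion_0:
  assumes f: "continuous_on UNIV f" and per: "\<And>t. f (t + 1) = f t"
    and d: "(f has_vector_derivative v) (at 0)"
  shows "(\<lambda>N. \<Sum>k\<in>{- int N..int N}. fcoef f k) \<longlonglongrightarrow> f 0"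
proof -
  \<comment> \<open>The value at the integers is the limit of the quotient there: the derivative of
    f at 0 over that of \<open>em\<close>, which is 2 pi i.\<close>
  define K where "K t = (if t \<in> \<int> then v / (2 * of_real pi * \<i>) else (f t - f 0) / (em t - 1))" for t
  have nearnz: "\<forall>\<^sub>F t in at (0::real). t \<notin> \<int>"
  proof -
    have "t \<notin> \<int>" if "t \<noteq> 0" "dist t 0 < 1" for t :: real
      using that by (auto elim!: Ints_cases)
    then show ?thesis unfolding eventually_at by (intro exI[of _ 1]) auto
  qed
  have q: "((\<lambda>t. (g t - g 0) / of_real t) \<longlongrightarrow> w) (at 0)" if "(g has_vector_derivative w) (at (0::real))" for g :: "real \<Rightarrow> complex" and w
  proof -
    have "((\<lambda>t. (1 / norm (t - 0)) *\<^sub>R (g t - (g 0 + (t - 0) *\<^sub>R w))) \<longlongrightarrow> 0) (at 0)"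
      using that unfolding has_vector_derivative_def has_derivative_at2 by blast
    then have "((\<lambda>t. norm ((1 / norm (t - 0)) *\<^sub>R (g t - (g 0 + (t - 0) *\<^sub>R w)))) \<longlongrightarrow> 0) (at 0)"
      by (rule tendsto_norm_zero)
    moreover have "\<forall>\<^sub>F t in at 0. norm ((1 / norm (t - 0)) *\<^sub>R (g t - (g 0 + (t - 0) *\<^sub>R w))) = norm ((g t - g 0) / of_real t - w)"
      using eventually_neq_at_within[of 0 0 UNIV]
    proof eventually_elim
      case (elim t)
      then have "(g t - g 0) / of_real t - w = (g t - (g 0 + of_real t * w)) / of_real t" by (simp add: field_simps)
      then show ?case by (simp add: norm_divide scaleR_conv_of_real)
    qed
    ultimately have "((\<lambda>t. norm ((g t - g 0) / of_real t - w)) \<longlongrightarrow> 0) (at 0)"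
      by (rule Lim_transform_eventually)
    then show ?thesis by (simp only: tendsto_norm_zero_iff LIM_zero_iff)
  qed
  have "((\<lambda>t. em t) has_vector_derivative 2 * of_real pi * \<i> * of_real 1 * em 0) (at 0)"
    by (rule em_has_vector_derivative) (rule DERIV_ident)
  from q[OF d] q[OF this] have "((\<lambda>t. ((f t - f 0) / of_real t) / ((em t - em 0) / of_real t)) \<longlongrightarrow>
      v / (2 * of_real pi * \<i> * of_real 1 * em 0)) (at 0)"
    by (rule tendsto_divide) simp
  moreover have "\<forall>\<^sub>F t in at 0. ((f t - f 0) / of_real t) / ((em t - em 0) / of_real t) = K t"
    using nearnz by eventually_elim (auto simp: K_def)
  ultimately have "(K \<longlongrightarrow> v / (2 * of_real pi * \<i> * of_real 1 * em 0)) (at 0)"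
    by (rule Lim_transform_eventually)
  then have K0: "isCont K 0" by (simp add: isCont_def K_def)
  have perK: "K (t - 1) = K t" for t
  proof -
    have "t - 1 \<in> \<int> \<longleftrightarrow> t \<in> \<int>" by (metis Ints_1 Ints_add Ints_diff diff_add_cancel)
    moreover have "em (t - 1) = em t" by (simp add: em_eq_iff)
    ultimately show ?thesis using per[of "t - 1"] by (simp add: K_def)
  qed
  have K1: "isCont K 1"
  proof -
    have "isCont (\<lambda>t. K (t - 1)) 1" by (rule isCont_o2[where f = "\<lambda>t. t - 1"]) (use K0 in simp_all)
    then show ?thesis by (simp add: perK)
  qed
  have nz: "em t \<noteq> 1" if "0 < t" "t < 1" for t
    using that unfolding em_eq_1_iff by (auto elim!: Ints_cases)
  have "continuous_on {0<..<1} (\<lambda>t. (f t - f 0) / (em t - 1))"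
    by (intro continuous_intros continuous_on_subset[OF f]) (use nz in auto)
  moreover have "K t = (f t - f 0) / (em t - 1)" if "t \<in> {0<..<1}" for t
    using that nz[of t] by (auto simp: K_def em_eq_1_iff)
  ultimately have "continuous_on {0<..<1} K" by (metis (no_types, lifting) continuous_on_cong)
  then have Ki: "isCont K t" if "0 < t" "t < 1" for t
    using that by (simp add: continuous_on_eq_continuous_at)
  have Kc: "continuous_on {0..1} K"
  proof (rule continuous_at_imp_continuous_on, rule ballI)
    fix t :: real assume "t \<in> {0..1}"
    then consider "t = 0" | "t = 1" | "0 < t" "t < 1" by fastforce
    then show "isCont K t" using K0 K1 Ki by cases auto
  qed
  have feq: "f t = f 0 + (em t * K t - K t)" if "t \<in> {0..1}" for t
  proof (cases "t \<in> \<int>")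
    case True
    then have "t = 0 \<or> t = 1" using that by (auto elim!: Ints_cases)
    then have "f t = f 0" using per[of 0] by auto
    moreover have "em t = 1" using True by (simp add: em_eq_1_iff)
    ultimately show ?thesis by simp
  next
    case False
    then have "em t - 1 \<noteq> 0" by (simp add: em_eq_1_iff)
    then have "(em t - 1) * K t = f t - f 0" using False by (simp add: K_def)
    then show ?thesis by (simp add: algebra_simps)
  qed
  have coef: "fcoef f k = f 0 * (if k = 0 then 1 else 0) + (fcoef K (k - 1) - fcoef K k)" for k
  proof -
    have "((\<lambda>t. f 0 * em (of_int (- k) * t) + (K t * em (- (of_int (k - 1) * t)) - K t * em (- (of_int k * t))))
        has_integral (f 0 * (if - k = 0 then 1 else 0) + (fcoef K (k - 1) - fcoef K k))) {0..1}"
      by (intro has_integral_add has_integral_diff has_integral_mult_right integral_em fcoef_has_integral Kc)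
    moreover have "f 0 * em (of_int (- k) * t) + (K t * em (- (of_int (k - 1) * t)) - K t * em (- (of_int k * t)))
        = f t * em (- (of_int k * t))" if "t \<in> {0..1}" for t
    proof -
      have "em (- (of_int (k - 1) * t)) = em t * em (- (of_int k * t))"
        unfolding em_add[symmetric] by (simp add: algebra_simps)
      then show ?thesis by (subst feq[OF that]) (simp add: algebra_simps)
    qed
    ultimately have "((\<lambda>t. f t * em (- (of_int k * t)))
        has_integral (f 0 * (if - k = 0 then 1 else 0) + (fcoef K (k - 1) - fcoef K k))) {0..1}"
      by (rule has_integral_eq[rotated])
    then show ?thesis unfolding fcoef_def[of f] by (simp add: integral_unique)
  qed
  have sum: "(\<Sum>k\<in>{- int N..int N}. fcoef f k) = f 0 + (fcoef K (- int N - 1) - fcoef K (int N))" for N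
  proof (induction N)
    case 0
    then show ?case by (simp add: coef)
  next
    case (Suc N)
    have "{- int (Suc N)..int (Suc N)} = insert (- int (Suc N)) (insert (int (Suc N)) {- int N..int N})" by auto
    then have "(\<Sum>k\<in>{- int (Suc N)..int (Suc N)}. fcoef f k)
        = fcoef f (- int (Suc N)) + (fcoef f (int (Suc N)) + (\<Sum>k\<in>{- int N..int N}. fcoef f k))"
      by simp
    also have "\<dots> = f 0 + (fcoef K (- int (Suc N) - 1) - fcoef K (int (Suc N)))"
    proof -
      have "- int N - 1 = - int (Suc N)" "int (Suc N) - 1 = int N" by simp_all
      then show ?thesis unfolding Suc.IH coef[of "- int (Suc N)"] coef[of "int (Suc N)"]
        by (simp only:) (simp del: of_nat_Suc)
    qed
    finally show ?case .
  qed
  have "(\<lambda>N. f 0 + (fcoef K (- int N - 1) - fcoef K (int N))) \<longlonglongrightarrow> f 0 + (0 - 0)"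
    by (intro tendsto_intros riemann_lebesgue[OF Kc]) (auto simp: inj_def)
  then show ?thesis by (simp add: sum)
qed

section \<open>Sums over the zeros of lifts as Fourier sums\<close>

lemma shift_by_int:
  fixes f :: "real \<Rightarrow> 'a::ring_1"
  assumes "\<And>t. f (t + 1) = f t + d"
  shows "f (t + of_int k) = f t + of_int k * d"
proof (induction k rule: int_induct[where k = 0])
  case (step1 i)
  then show ?case using assms[of "t + of_int i"] by (simp add: algebra_simps)
next
  case (step2 i)
  then show ?case using assms[of "t + of_int (i - 1)"] by (simp add: algebra_simps)
qed simp

lemma inverse_of_increasing_lift:
  fixes S S1 :: "real \<Rightarrow> real"
  assumes S: "\<And>t. (S has_real_derivative S1 t) (at t)" and pos: "\<And>t. S1 t > 0"
    and per: "\<And>t. S (t + 1) = S t + of_int q"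
  obtains G where "q > 0" "\<And>s. S (G s) = s" "\<And>t. G (S t) = t" "\<And>s. (G has_real_derivative inverse (S1 (G s))) (at s)"
    "\<And>s. G (s + of_int q) = G s + 1"
proof -
  have mono: "S x < S y" if "x < y" for x y
    by (rule DERIV_pos_imp_increasing[OF that]) (use S pos in blast)
  have q: "q > 0" using mono[of 0 1] per[of 0] by simp
  have perk: "S (of_int k) = S 0 + of_int k * of_int q" for k
    using shift_by_int[of S "of_int q" 0 k] per by simp
  have cont: "isCont S t" for t using S DERIV_isCont by blast
  have surj: "\<exists>t. S t = s" for s
  proof -
    define k where "k = \<lfloor>(s - S 0) / of_int q\<rfloor>"
    have "of_int k \<le> (s - S 0) / of_int q" "(s - S 0) / of_int q \<le> of_int (k + 1)"
      unfolding k_def by linarith+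
    then have "S (of_int k) \<le> s" "s \<le> S (of_int (k + 1))"
      unfolding perk using q by (simp_all add: field_simps)
    then show ?thesis
      using IVT[of S "of_int k" s "of_int (k + 1)"] cont by auto
  qed
  have inj: "x = y" if "S x = S y" for x y
    using mono[of x y] mono[of y x] that by fastforce
  define G where "G s = (THE t. S t = s)" for s
  have SG: "S (G s) = s" for s
  proof -
    obtain t where t: "S t = s" using surj by blast
    show ?thesis unfolding G_def by (rule theI[of "\<lambda>t. S t = s", OF t]) (rule inj, simp add: t)
  qed
  have GS: "G (S t) = t" for t by (rule inj) (rule SG)
  have contG: "isCont G s" for s
    using isCont_inverse_function[where d = 1 and x = "G s" and g = G and f = S] GS cont SG by simp
  have "(G has_real_derivative inverse (S1 (G s))) (at s)" for s
    by (rule DERIV_inverse_function[where f = S and g = G and x = s and a = "s - 1" and b = "s + 1"]) (use S pos[of "G s"] SG contG in auto)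
  moreover have "G (s + of_int q) = G s + 1" for s
    by (rule inj) (simp add: SG per)
  ultimately show ?thesis using that q SG GS by blast
qed

lemma antiderivative_ex:
  fixes g :: "real \<Rightarrow> complex"
  assumes "continuous_on UNIV g"
  obtains \<Phi> where "\<And>t. (\<Phi> has_vector_derivative g t) (at t)"
proof -
  have "\<exists>F. \<forall>x. - \<infinity> < ereal x \<longrightarrow> ereal x < \<infinity> \<longrightarrow> (F has_vector_derivative g x) (at x)"
    by (rule einterval_antiderivative) (use assms in \<open>auto simp: continuous_on_eq_continuous_at\<close>)
  then show ?thesis using that by auto
qed

text \<open>In the coordinate \<open>s = S t\<close> the integrals become the Fourier coefficients of the sum of
  \<open>\<psi> / S'\<close> over the branches of the inverse of \<open>S\<close>.\<close>

lemma poisson_increasing: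
  fixes S S1 S2 :: "real \<Rightarrow> real" and \<psi> \<psi>' :: "real \<Rightarrow> complex"
  assumes S: "\<And>t. (S has_real_derivative S1 t) (at t)" and S1: "\<And>t. (S1 has_real_derivative S2 t) (at t)"
    and pos: "\<And>t. S1 t > 0" and per: "\<And>t. S (t + 1) = S t + of_int q"
    and \<psi>: "\<And>t. (\<psi> has_vector_derivative \<psi>' t) (at t)" and per\<psi>: "\<And>t. \<psi> (t + 1) = \<psi> t"
  shows "finite {t\<in>{0..<1}. S t \<in> \<int>}" (is ?fin)
    and "(\<lambda>N. \<Sum>m\<in>{- int N..int N}. integral {0..1} (\<lambda>t. \<psi> t * em (- (of_int m * S t)))) \<longlonglongrightarrow>
      (\<Sum>t\<in>{t\<in>{0..<1}. S t \<in> \<int>}. \<psi> t / of_real \<bar>S1 t\<bar>)" (is ?lim)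
proof -
  obtain G where q: "q > 0" and SG: "\<And>s. S (G s) = s" and GS: "\<And>t. G (S t) = t"
    and G: "\<And>s. (G has_real_derivative inverse (S1 (G s))) (at s)" and Gq: "\<And>s. G (s + of_int q) = G s + 1"
    using inverse_of_increasing_lift[OF S pos per] by metis
  define q' where "q' = nat q"
  have q': "q = int q'" using q by (simp add: q'_def)
  have perS1: "S1 (t + 1) = S1 t" for t
  proof (rule DERIV_unique)
    show "((\<lambda>x. S (x + 1)) has_real_derivative S1 (t + 1)) (at t)" by (rule DERIV_shift[THEN iffD1, OF S])
    show "((\<lambda>x. S (x + 1)) has_real_derivative S1 t) (at t)"
      unfolding per using S[of t] by (auto intro!: derivative_eq_intros)
  qed
  define P where "P t = inverse (of_real (S1 t)) * \<psi> t" for t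
  have perP: "P (t + 1) = P t" for t by (simp add: P_def perS1 per\<psi>)
  have "\<exists>D. (P has_vector_derivative D) (at t)" for t
  proof -
    have "((\<lambda>t. inverse (S1 t)) has_real_derivative - (inverse (S1 t) * S2 t * inverse (S1 t))) (at t)"
      using S1[of t] pos[of t] by (auto intro!: derivative_eq_intros)
    from has_vector_derivative_mult[OF has_vector_derivative_of_real[OF this] \<psi>[of t]]
    show ?thesis unfolding P_def by auto
  qed
  then obtain P' where P': "\<And>t. (P has_vector_derivative P' t) (at t)" by metis
  \<comment> \<open>A shift of s by 1 permutes the branches cyclically, the last one returning to
    the first up to an integer; so f has period 1 although the single branches do not.\<close>
  define f where "f s = (\<Sum>j<q'. P (G (s + of_nat j)))" for s
  have df: "\<exists>D. (f has_vector_derivative D) (at s)" for s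
  proof -
    have "\<exists>D. ((\<lambda>s. P (G (s + of_nat j))) has_vector_derivative D) (at s)" for j
    proof -
      have "((\<lambda>s. G (s + of_nat j)) has_real_derivative inverse (S1 (G (s + of_nat j)))) (at s)"
        by (rule DERIV_shift[THEN iffD1, OF G])
      from vector_diff_chain_at[OF this[unfolded has_real_derivative_iff_has_vector_derivative] P'] show ?thesis
        by (auto simp: o_def)
    qed
    then obtain D where "\<And>j. ((\<lambda>s. P (G (s + of_nat j))) has_vector_derivative D j) (at s)" by metis
    then have "((\<lambda>s. \<Sum>j<q'. P (G (s + of_nat j))) has_vector_derivative (\<Sum>j<q'. D j)) (at s)"
      by (intro has_vector_derivative_sum) auto
    then show ?thesis unfolding f_def[abs_def] by blast
  qed
  have fc: "continuous_on UNIV f"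
    using df has_vector_derivative_continuous by (fastforce simp: continuous_on_eq_continuous_within)
  have fper: "f (s + 1) = f s" for s
  proof -
    have "f (s + 1) - f s = (\<Sum>j<q'. P (G (s + of_nat (Suc j))) - P (G (s + of_nat j)))"
      unfolding f_def sum_subtractf[symmetric] by (simp add: add.assoc)
    also have "\<dots> = P (G (s + of_nat q')) - P (G (s + of_nat 0))" by (rule sum_lessThan_telescope)
    also have "\<dots> = 0" using Gq[of s] by (simp add: q' perP)
    finally show ?thesis by simp
  qed
  obtain v where v: "(f has_vector_derivative v) (at 0)" using df by blast
  have coef: "fcoef f m = integral {0..1} (\<lambda>t. \<psi> t * em (- (of_int m * S t)))" for m
  proof -
    let ?g = "\<lambda>t. \<psi> t * em (- (of_int m * S t))"
    have \<psi>c: "continuous_on UNIV \<psi>" using \<psi> has_vector_derivative_continuous by (fastforce simp: continuous_on_eq_continuous_within)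
    have Sc: "continuous_on UNIV S" using S DERIV_isCont by (fastforce simp: continuous_on_eq_continuous_at)
    have gc: "continuous_on UNIV ?g" by (intro continuous_intros \<psi>c Sc)
    \<comment> \<open>Substitution is carried out through an antiderivative: on each branch the
      integral is a difference of values of \<Phi> composed with \<open>G\<close>, and the sum over
      the branches telescopes.\<close>
    obtain \<Phi> where \<Phi>: "\<And>t. (\<Phi> has_vector_derivative ?g t) (at t)" using antiderivative_ex[OF gc] by blast
    have gper: "?g (t + 1) = ?g t" for t
    proof -
      have "em (- (of_int m * S (t + 1))) = em (- (of_int m * S t))"
        unfolding em_eq_iff per by (simp add: algebra_simps)
      then show ?thesis by (simp add: per\<psi>)
    qed
    \<comment> \<open>The telescoped interval starts at \<open>G 0\<close> instead of 0; the
      integrand is periodic, so every interval of length 1 gives the same integral.\<close>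
    have \<Phi>1: "\<Phi> (t + 1) - \<Phi> t = \<Phi> 1 - \<Phi> 0" for t
    proof -
      have "((\<lambda>t. \<Phi> (t + 1) - \<Phi> t) has_vector_derivative 0) (at t)" for t
      proof -
        have "((\<lambda>t. t + 1) has_vector_derivative 1) (at t)"
          by (auto intro!: derivative_eq_intros)
        from vector_diff_chain_at[OF this \<Phi>] have "((\<lambda>t. \<Phi> (t + 1)) has_vector_derivative ?g (t + 1)) (at t)"
          by (simp add: o_def)
        from has_vector_derivative_diff[OF this \<Phi>] show ?thesis by (simp add: gper)
      qed
      then have "((\<lambda>t. \<Phi> (t + 1) - \<Phi> t) has_derivative (\<lambda>h. 0)) (at t within UNIV)" for t
        by (simp add: has_vector_derivative_def)
      then have "\<exists>c. \<forall>t\<in>UNIV. \<Phi> (t + 1) - \<Phi> t = c"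
        by (intro has_derivative_zero_constant) auto
      then show ?thesis by (metis UNIV_I add.left_neutral)
    qed
    have "((\<lambda>s. P (G (s + of_nat j)) * em (- (of_int m * s))) has_integral (\<Phi> (G (of_nat (Suc j))) - \<Phi> (G (of_nat j)))) {0..1}" for j
    proof -
      have "((\<lambda>s. \<Phi> (G (s + of_nat j))) has_vector_derivative P (G (s + of_nat j)) * em (- (of_int m * s))) (at s within {0..1})" for s
      proof -
        have "((\<lambda>s. G (s + of_nat j)) has_real_derivative inverse (S1 (G (s + of_nat j)))) (at s)"
          by (rule DERIV_shift[THEN iffD1, OF G])
        from vector_diff_chain_at[OF this[unfolded has_real_derivative_iff_has_vector_derivative] \<Phi>]
        have "((\<lambda>s. \<Phi> (G (s + of_nat j))) has_vector_derivative
            inverse (of_real (S1 (G (s + of_nat j)))) * (\<psi> (G (s + of_nat j)) * em (- (of_int m * (s + of_nat j))))) (at s)"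
          by (simp add: o_def SG scaleR_conv_of_real)
        moreover have "em (- (of_int m * (s + of_nat j))) = em (- (of_int m * s))"
          unfolding em_eq_iff by (simp add: algebra_simps)
        moreover have "inverse (of_real (S1 (G (s + of_nat j)))) * (\<psi> (G (s + of_nat j)) * em (- (of_int m * s)))
            = P (G (s + of_nat j)) * em (- (of_int m * s))" by (simp only: P_def mult.assoc)
        ultimately show ?thesis by (simp only: has_vector_derivative_at_within)
      qed
      then have "((\<lambda>s. P (G (s + of_nat j)) * em (- (of_int m * s))) has_integral (\<Phi> (G (1 + of_nat j)) - \<Phi> (G (0 + of_nat j)))) {0..1}"
        by (intro fundamental_theorem_of_calculus) auto
      then show ?thesis by (simp add: add.commute)
    qed
    then have "((\<lambda>s. \<Sum>j<q'. P (G (s + of_nat j)) * em (- (of_int m * s))) has_integral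
        (\<Sum>j<q'. \<Phi> (G (of_nat (Suc j))) - \<Phi> (G (of_nat j)))) {0..1}"
      by (intro has_integral_sum) auto
    then have "fcoef f m = (\<Sum>j<q'. \<Phi> (G (of_nat (Suc j))) - \<Phi> (G (of_nat j)))"
      unfolding fcoef_def f_def sum_distrib_right by (rule integral_unique)
    also have "\<dots> = \<Phi> (G (of_nat q')) - \<Phi> (G (of_nat 0))" by (rule sum_lessThan_telescope)
    also have "\<dots> = \<Phi> 1 - \<Phi> 0" using Gq[of 0] \<Phi>1[of "G 0"] by (simp add: q')
    also have "\<dots> = integral {0..1} ?g"
      using fundamental_theorem_of_calculus[of 0 1 \<Phi> ?g] has_vector_derivative_at_within[OF \<Phi>]
      by (metis integral_unique zero_le_one)
    finally show ?thesis .
  qed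
  \<comment> \<open>The zeros modulo 1 are the \<open>G j\<close> reduced modulo 1. Shifting t by 1
    changes \<open>S t\<close> by q, so the residue of \<open>S t\<close> modulo q identifies the
    zero.\<close>
  have bij: "bij_betw (\<lambda>j. frac (G (of_nat j))) {..<q'} {t\<in>{0..<1}. S t \<in> \<int>}"
  proof -
    have Sk: "S (t + of_int k) = S t + of_int k * of_int q" for t k by (rule shift_by_int[of S "of_int q" t k, OF per])
    have frac: "frac x = x + of_int (- \<lfloor>x\<rfloor>)" for x :: real by (simp add: frac_def)
    show ?thesis
      unfolding bij_betw_def
    proof (intro conjI inj_onI equalityI subsetI)
      fix i j assume ij: "i \<in> {..<q'}" "j \<in> {..<q'}" "frac (G (of_nat i)) = frac (G (of_nat j))"
      then have "S (frac (G (of_nat i))) = S (frac (G (of_nat j)))" by simp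
      then have "real i + of_int (- \<lfloor>G (of_nat i)\<rfloor>) * of_int q = real j + of_int (- \<lfloor>G (of_nat j)\<rfloor>) * of_int q"
        unfolding frac Sk SG .
      then have "of_int (int i + (- \<lfloor>G (of_nat i)\<rfloor>) * q) = (of_int (int j + (- \<lfloor>G (of_nat j)\<rfloor>) * q) :: real)"
        by simp
      then have "int i + (- \<lfloor>G (of_nat i)\<rfloor>) * q = int j + (- \<lfloor>G (of_nat j)\<rfloor>) * q"
        by (simp only: of_int_eq_iff)
      then have "int i mod q = int j mod q" by (metis mod_mult_self1)
      then show "i = j" using ij by (simp add: q')
    next
      fix t assume "t \<in> (\<lambda>j. frac (G (of_nat j))) ` {..<q'}"
      then obtain j where t: "t = frac (G (of_nat j))" by auto
      have "S t \<in> \<int>" unfolding t unfolding frac Sk SG by auto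
      then show "t \<in> {t\<in>{0..<1}. S t \<in> \<int>}" using t by (simp add: frac_lt_1)
    next
      fix t assume "t \<in> {t\<in>{0..<1}. S t \<in> \<int>}"
      then obtain l where t: "0 \<le> t" "t < 1" "S t = of_int l" by (auto elim!: Ints_cases)
      define j where "j = nat (l mod q)"
      have j: "int j = l mod q" using q by (simp add: j_def)
    then have jq: "j < q'" using pos_mod_bound[OF q, of l] q' by linarith
      have "l = int j + (l div q) * q" by (simp add: j)
      then have "real_of_int l = real_of_int (int j + (l div q) * q)" by simp
      then have l: "S t = real j + of_int (l div q) * of_int q" unfolding t(3) by simp
      have "G (of_nat j) = t + of_int (- (l div q))"
      proof -
        have "S (t + of_int (- (l div q))) = real j" unfolding Sk l by simp
        then show ?thesis using GS by metis
      qed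
      then have "frac (G (of_nat j)) = frac t" by (simp add: frac_def)
      also have "\<dots> = t" using t by (simp add: frac_eq)
      finally show "t \<in> (\<lambda>j. frac (G (of_nat j))) ` {..<q'}" using jq by (intro image_eqI[of _ _ j]) auto
    qed
  qed
  show ?fin using bij_betw_finite[OF bij] by simp
  have perPk: "P (t + of_int k) = P t" for t k using shift_by_int[of P 0 t k] perP by simp
  have "f 0 = (\<Sum>j<q'. P (frac (G (of_nat j))))"
    unfolding f_def
  proof (intro sum.cong refl)
    fix j
    show "P (G (0 + of_nat j)) = P (frac (G (of_nat j)))"
      using perPk[of "G (of_nat j)" "- \<lfloor>G (of_nat j)\<rfloor>"] by (simp add: frac_def)
  qed
  also have "\<dots> = (\<Sum>t\<in>{t\<in>{0..<1}. S t \<in> \<int>}. P t)" by (rule sum.reindex_bij_betw[OF bij])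
  also have "\<dots> = (\<Sum>t\<in>{t\<in>{0..<1}. S t \<in> \<int>}. \<psi> t / of_real \<bar>S1 t\<bar>)"
    using pos by (intro sum.cong refl) (simp add: P_def abs_of_pos divide_inverse mult.commute)
  finally show ?lim using fourier_inversion_0[OF fc fper v] by (simp only: coef)
qed

section \<open>Lifts of circle maps\<close>

lemma to_circle_eq_iff: "to_circle s = to_circle t \<longleftrightarrow> s - t \<in> \<int>"
  by (rule circle.abs_eq_iff)

lemma to_circle_rep: "to_circle (rep_circle x) = x"
  by (rule Quotient3_abs_rep[OF Quotient3_circle])

lemma fourier_mode_to_circle: "fourier_mode n (to_circle t) = em (of_int n * t)"
  by (simp add: fourier_mode.abs_eq em_def mult.assoc)

lemma bij_to_circle: "bij_betw to_circle {0..<1} UNIV"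
  unfolding bij_betw_def
proof (intro conjI inj_onI equalityI subsetI)
  fix s t :: real assume "s \<in> {0..<1}" "t \<in> {0..<1}" "to_circle s = to_circle t"
  then obtain k where "s - t = of_int k" "\<bar>s - t\<bar> < 1" by (fastforce simp: to_circle_eq_iff elim!: Ints_cases)
  then have "real_of_int \<bar>k\<bar> < 1" by simp
  then have "k = 0" by linarith
  then show "s = t" using \<open>s - t = of_int k\<close> by simp
next
  fix x
  have "to_circle (frac (rep_circle x)) = to_circle (rep_circle x)"
    unfolding to_circle_eq_iff frac_def by simp
  then have "x = to_circle (frac (rep_circle x))" by (simp add: to_circle_rep)
  then show "x \<in> to_circle ` {0..<1}" by (rule image_eqI) (simp add: frac_lt_1)
qed simp

lemma bij_to_circle_Collect: "bij_betw to_circle {t\<in>{0..<1}. P (to_circle t)} {x. P x}"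
proof (rule bij_betw_subset[OF bij_to_circle])
  show "to_circle ` {t\<in>{0..<1}. P (to_circle t)} = {x. P x}"
  proof (intro equalityI subsetI)
    fix x assume x: "x \<in> {x. P x}"
    obtain t where "t \<in> {0..<1}" "x = to_circle t" using bij_betw_imp_surj_on[OF bij_to_circle] by blast
    then show "x \<in> to_circle ` {t\<in>{0..<1}. P (to_circle t)}" using x by blast
  qed auto
qed auto

lemma integer_difference_locally_constant:
  fixes f g :: "real \<Rightarrow> real"
  assumes f: "isCont f x" and g: "isCont g x" and int: "\<forall>\<^sub>F s in nhds x. f s - g s \<in> \<int>"
  shows "\<forall>\<^sub>F s in nhds x. f s = g s + (f x - g x)"
proof -
  have "isCont (\<lambda>s. f s - g s) x" using f g by (rule continuous_diff)
  then have "((\<lambda>s. f s - g s) \<longlongrightarrow> f x - g x) (nhds x)"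
    using tendsto_at_iff_tendsto_nhds[of "\<lambda>s. f s - g s" x] by (simp add: isCont_def)
  then have "\<forall>\<^sub>F s in nhds x. dist (f s - g s) (f x - g x) < 1" by (rule tendstoD) simp
  with int show ?thesis
  proof eventually_elim
    case (elim s)
    have "f x - g x \<in> \<int>" by (rule eventually_nhds_x_imp_x[OF int])
    then obtain i j where ij: "f x - g x = of_int i" "f s - g s = of_int j" using elim by (auto elim!: Ints_cases)
    then have "i = j" using elim by (simp add: dist_real_def)
    then show ?case using ij by simp
  qed
qed

text \<open>Two local lifts at points over the same circle point differ locally by an integer
  constant after a shift of the argument, so the description in \<open>THE\<close> determines a
  single number.\<close>

lemma circle_deriv_eq:
  assumes lift: "\<And>s. T (to_circle s) = to_circle (F s)" and D: "(F has_real_derivative D) (at t)"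
  shows "circle_deriv T (to_circle t) = D"
  unfolding circle_deriv_def
proof (rule the_equality)
  show "\<exists>s G. to_circle s = to_circle t \<and> (\<forall>\<^sub>F u in nhds s. T (to_circle u) = to_circle (G u)) \<and> (G has_real_derivative D) (at s)"
    using lift D by (intro exI[of _ t] exI[of _ F]) simp
next
  fix D'
  assume "\<exists>s G. to_circle s = to_circle t \<and> (\<forall>\<^sub>F u in nhds s. T (to_circle u) = to_circle (G u)) \<and> (G has_real_derivative D') (at s)"
  then obtain s G where s: "to_circle s = to_circle t" "\<forall>\<^sub>F u in nhds s. T (to_circle u) = to_circle (G u)"
    "(G has_real_derivative D') (at s)" by blast
  obtain k where k: "s - t = of_int k" using s(1) by (auto simp: to_circle_eq_iff elim: Ints_cases)
  let ?F = "\<lambda>u. F (u + (- of_int k))"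
  have "(F has_real_derivative D) (at (s + (- of_int k)))" using D k by (simp add: algebra_simps)
  then have dF: "(?F has_real_derivative D) (at s)" by (rule DERIV_shift[THEN iffD1])
  have "\<forall>\<^sub>F u in nhds s. G u - ?F u \<in> \<int>"
    using s(2)
  proof eventually_elim
    case (elim u)
    have "to_circle (u + (- of_int k)) = to_circle u" by (simp add: to_circle_eq_iff)
    then have "to_circle (G u) = to_circle (?F u)" using elim lift by metis
    then show ?case by (simp add: to_circle_eq_iff)
  qed
  then have "\<forall>\<^sub>F u in nhds s. G u = ?F u + (G s - ?F s)"
    using integer_difference_locally_constant[OF DERIV_isCont[OF s(3)] DERIV_isCont[OF dF]] by blast
  moreover have "((\<lambda>u. ?F u + (G s - ?F s)) has_real_derivative D) (at s)"
    using DERIV_add[OF dF DERIV_const] by simp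
  ultimately have "(G has_real_derivative D) (at s)" by (subst DERIV_cong_ev[OF refl _ refl])
  then show "D' = D" using s(3) DERIV_unique by blast
qed

text \<open>Differentiability is not assumed: \<open>vector_derivative\<close> depends only on the
  set of possible derivatives, which is the same for both functions.\<close>

lemma vderiv_cong_ev:
  assumes "\<forall>\<^sub>F s in nhds t. f s = g s + (c :: real)"
  shows "vderiv f t = vderiv g t"
proof -
  have "(f has_real_derivative D) (at t) \<longleftrightarrow> ((\<lambda>s. g s + c) has_real_derivative D) (at t)" for D
    by (rule DERIV_cong_ev[OF refl assms refl])
  moreover have "((\<lambda>s. g s + c) has_real_derivative D) (at t) \<longleftrightarrow> (g has_real_derivative D) (at t)" for D
    by (simp only: has_real_derivative_iff_has_vector_derivative has_vector_derivative_add_const)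
  ultimately show ?thesis
    by (simp add: vderiv_def vector_derivative_def has_real_derivative_iff_has_vector_derivative[symmetric])
qed

text \<open>The map, viewed with values in the unit circle of the complex plane, has a continuous
  logarithm on the line, whose imaginary part is a global lift. Smoothness comes from the local
  lifts, from which the global one differs by local constants.\<close>

lemma smooth_lift_ex:
  assumes T: "smooth_circle_map T"
  obtains F where "\<And>s. T (to_circle s) = to_circle (F s)"
    "\<And>k t. ((vderiv ^^ k) F has_real_derivative (vderiv ^^ Suc k) F t) (at t)"
proof -
  define g where "g t = fourier_mode 1 (T (to_circle t))" for t
  have loc: "\<exists>G. (\<forall>\<^sub>F s in nhds t. T (to_circle s) = to_circle (G s)) \<and> (\<forall>k. (vderiv ^^ k) G differentiable (at t)) \<and>
      (\<exists>U. open U \<and> t \<in> U \<and> (\<forall>k. \<forall>s\<in>U. (vderiv ^^ k) G differentiable (at s)))" for t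
  proof -
    obtain U G where U: "open U" "t \<in> U" "smooth_on U G" "\<And>s. s \<in> U \<Longrightarrow> T (to_circle s) = to_circle (G s)"
      using T[unfolded smooth_circle_map_def, rule_format, of t] by (elim exE conjE) blast
    have "\<forall>\<^sub>F s in nhds t. s \<in> U" using U(1,2) eventually_nhds by blast
    then have "\<forall>\<^sub>F s in nhds t. T (to_circle s) = to_circle (G s)" by (rule eventually_mono) (rule U(4))
    then show ?thesis using U unfolding smooth_on_def by blast
  qed
  have "isCont g t" for t
  proof -
    obtain G where G: "\<forall>\<^sub>F s in nhds t. T (to_circle s) = to_circle (G s)" "\<And>k. (vderiv ^^ k) G differentiable (at t)"
      using loc[of t] by blast
    have "isCont G t" using G(2)[of 0] differentiable_imp_continuous_within by fastforce
    then have "isCont (\<lambda>s. em (G s)) t" unfolding em_def by (intro continuous_intros)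
    moreover have "\<forall>\<^sub>F s in nhds t. g s = em (G s)"
      using G(1) by eventually_elim (simp add: g_def fourier_mode_to_circle)
    ultimately show ?thesis by (simp add: isCont_cong)
  qed
  then have gc: "continuous_on UNIV g" by (simp add: continuous_at_imp_continuous_on)
  have ge: "g t = em (rep_circle (T (to_circle t)))" for t
    unfolding g_def by (metis fourier_mode_to_circle mult_1 of_int_1 to_circle_rep)
  obtain h where h: "continuous_on UNIV h" "\<And>t. g t = exp (h t)"
    using continuous_logarithm_on_contractible[OF gc convex_imp_contractible[OF convex_UNIV]] ge by auto
  define F where "F t = Im (h t) / (2 * pi)" for t
  have emF: "em (F t) = g t" for t
  proof -
    have "exp (Re (h t)) = 1" using arg_cong[OF h(2)[of t], of cmod] ge[of t] by (simp del: exp_eq_one_iff)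
    then have "h t = \<i> * of_real (Im (h t))" by (simp add: complex_eq_iff)
    then have "exp (h t) = exp (\<i> * of_real (Im (h t)))" by simp
    then show ?thesis using h(2)[of t] by (simp add: em_def F_def mult_ac)
  qed
  have lift: "T (to_circle s) = to_circle (F s)" for s
  proof -
    have "em (rep_circle (T (to_circle s))) = em (F s)" using emF ge by simp
    then have "to_circle (rep_circle (T (to_circle s))) = to_circle (F s)"
      unfolding em_eq_iff to_circle_eq_iff .
    then show ?thesis by (simp add: to_circle_rep)
  qed
  have Fc: "isCont F t" for t
    using h(1) unfolding F_def by (intro continuous_intros) (auto simp: continuous_on_eq_continuous_at)
  have "((vderiv ^^ k) F has_real_derivative (vderiv ^^ Suc k) F t) (at t)" for k t
  proof -
    obtain G U where G: "\<forall>\<^sub>F s in nhds t. T (to_circle s) = to_circle (G s)" "\<And>k. (vderiv ^^ k) G differentiable (at t)"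
      using loc[of t] by blast
    have Gc: "isCont G t" using G(2)[of 0] differentiable_imp_continuous_within by fastforce
    have "\<forall>\<^sub>F s in nhds t. F s - G s \<in> \<int>"
      using G(1) by eventually_elim (simp add: lift to_circle_eq_iff)
    then have e0: "\<forall>\<^sub>F s in nhds t. F s = G s + (F t - G t)"
      by (rule integer_difference_locally_constant[OF Fc Gc])
    have "\<exists>c. \<forall>\<^sub>F s in nhds t. (vderiv ^^ k) F s = (vderiv ^^ k) G s + c" for k
    proof (induction k)
      case 0
      show ?case using e0 by (intro exI) simp
    next
      case (Suc k)
      then obtain c where "\<forall>\<^sub>F s in nhds t. (vderiv ^^ k) F s = (vderiv ^^ k) G s + c" by blast
      \<comment> \<open>Equality near t is equality near every s near t, which is what comparing the
        derivatives at all such s requires.\<close>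
      then have "\<forall>\<^sub>F s in nhds t. \<forall>\<^sub>F u in nhds s. (vderiv ^^ k) F u = (vderiv ^^ k) G u + c"
        by (simp only: eventually_eventually)
      then have "\<forall>\<^sub>F s in nhds t. (vderiv ^^ Suc k) F s = (vderiv ^^ Suc k) G s + 0"
        by (rule eventually_mono) (simp add: vderiv_cong_ev)
      then show ?case by blast
    qed
    then obtain c where c: "\<forall>\<^sub>F s in nhds t. (vderiv ^^ k) F s = (vderiv ^^ k) G s + c" by blast
    obtain D where "((vderiv ^^ k) G has_real_derivative D) (at t)"
      using G(2)[of k] by (auto simp: real_differentiable_def)
    then have "((\<lambda>s. (vderiv ^^ k) G s + c) has_real_derivative D) (at t)"
      using DERIV_add[OF _ DERIV_const] by fastforce
    then have D: "((vderiv ^^ k) F has_real_derivative D) (at t)"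
      using DERIV_cong_ev[OF refl c refl] by blast
    then have "(vderiv ^^ Suc k) F t = D"
      by (simp add: vderiv_def vector_derivative_at has_real_derivative_iff_has_vector_derivative)
    then show ?thesis using D by simp
  qed
  then show ?thesis using that lift by blast
qed

text \<open>\<open>F k\<close> is the derivative of order \<open>k\<close> of the lift \<open>F 0\<close>.\<close>

locale circle_lift =
  fixes T :: "circle \<Rightarrow> circle" and F :: "nat \<Rightarrow> real \<Rightarrow> real" and q :: int and c :: real
  assumes lift: "\<And>s. T (to_circle s) = to_circle (F 0 s)"
    and deriv: "\<And>k t. (F k has_real_derivative F (Suc k) t) (at t)"
    and shift: "\<And>t. F 0 (t + 1) = F 0 t + of_int q"
    and c: "c > 1" and expand: "\<And>t. c \<le> \<bar>F 1 t\<bar>"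

lemma circle_lift_ex:
  assumes T: "smooth_circle_map T" and "expanding T"
  shows "\<exists>F q c. circle_lift T F q c"
proof -
  obtain F where F: "\<And>s. T (to_circle s) = to_circle (F s)"
    "\<And>k t. ((vderiv ^^ k) F has_real_derivative (vderiv ^^ Suc k) F t) (at t)"
    using smooth_lift_ex[OF T] by blast
  obtain c where c: "c > 1" "\<And>x. \<bar>circle_deriv T x\<bar> \<ge> c" using assms(2) unfolding expanding_def by blast
  have F0: "(F has_real_derivative vderiv F t) (at t)" for t using F(2)[of 0] by simp
  have int: "F (t + 1) - F t \<in> \<int>" for t
  proof -
    have "to_circle (t + 1) = to_circle t" by (simp add: to_circle_eq_iff)
    then have "to_circle (F (t + 1)) = to_circle (F t)" using F(1) by metis
    then show ?thesis by (simp add: to_circle_eq_iff)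
  qed
  have "(\<lambda>t. F (t + 1) - F t) constant_on UNIV"
  proof (rule continuous_discrete_range_constant)
    have "isCont (\<lambda>t. F (t + 1) - F t) t" for t
      by (intro DERIV_isCont[OF DERIV_diff[OF DERIV_shift[THEN iffD1, OF F0] F0]])
    then show "continuous_on UNIV (\<lambda>t. F (t + 1) - F t)" by (simp add: continuous_at_imp_continuous_on)
    show "\<exists>e>0. \<forall>y. y \<in> UNIV \<and> F (y + 1) - F y \<noteq> F (x + 1) - F x \<longrightarrow> e \<le> norm (F (y + 1) - F y - (F (x + 1) - F x))" for x
    proof (intro exI[of _ 1] conjI allI impI)
      fix y assume y: "y \<in> UNIV \<and> F (y + 1) - F y \<noteq> F (x + 1) - F x"
      obtain i j where "F (y + 1) - F y = of_int i" "F (x + 1) - F x = of_int j"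
        using int[of x] int[of y] by (auto elim!: Ints_cases)
      then show "1 \<le> norm (F (y + 1) - F y - (F (x + 1) - F x))" using y by simp
    qed simp
  qed simp
  then obtain q' where q': "\<And>t. F (t + 1) - F t = q'" unfolding constant_on_def by auto
  then have "q' \<in> \<int>" using int[of 0] by metis
  then obtain q where q: "q' = of_int q" by (elim Ints_cases)
  have "circle_lift T (\<lambda>k. (vderiv ^^ k) F) q c"
  proof
    show "(vderiv ^^ 0) F (t + 1) = (vderiv ^^ 0) F t + real_of_int q" for t
      using q'[of t] q by (simp add: algebra_simps)
    show "c \<le> \<bar>(vderiv ^^ 1) F t\<bar>" for t
      using c(2)[of "to_circle t"] circle_deriv_eq[OF F(1) F0] by simp
  qed (use F c in auto)
  then show ?thesis by blast
qed

lemma nonvanishing_sign: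
  fixes S1 S2 :: "real \<Rightarrow> real"
  assumes S1: "\<And>t. (S1 has_real_derivative S2 t) (at t)" and nz: "\<And>t. S1 t \<noteq> 0"
  shows "(\<forall>t. S1 t > 0) \<or> (\<forall>t. S1 t < 0)"
proof (rule ccontr)
  assume "\<not> ?thesis"
  then obtain x y where xy: "S1 x < 0" "S1 y > 0" using nz by (metis linorder_neqE_linordered_idom)
  have "connected (S1 ` UNIV)"
    by (rule connected_continuous_image)
       (intro continuous_at_imp_continuous_on ballI DERIV_isCont[OF S1], rule connected_UNIV)
  then have "0 \<in> S1 ` UNIV"
    using xy connectedD_interval[of "S1 ` UNIV" "S1 x" "S1 y" 0] by auto
  then show False using nz by auto
qed

text \<open>If S decreases, - S increases and has the same zeros modulo 1; the symmetric sum absorbs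
  the change of sign of m.\<close>

lemma poisson:
  fixes S S1 S2 :: "real \<Rightarrow> real" and \<psi> \<psi>' :: "real \<Rightarrow> complex"
  assumes S: "\<And>t. (S has_real_derivative S1 t) (at t)" and S1: "\<And>t. (S1 has_real_derivative S2 t) (at t)"
    and nz: "\<And>t. S1 t \<noteq> 0" and per: "\<And>t. S (t + 1) = S t + of_int q"
    and \<psi>: "\<And>t. (\<psi> has_vector_derivative \<psi>' t) (at t)" and per\<psi>: "\<And>t. \<psi> (t + 1) = \<psi> t"
  shows "(\<lambda>N. \<Sum>m\<in>{- int N..int N}. integral {0..1} (\<lambda>t. \<psi> t * em (- (of_int m * S t)))) \<longlonglongrightarrow>
      (\<Sum>t\<in>{t\<in>{0..<1}. S t \<in> \<int>}. \<psi> t / of_real \<bar>S1 t\<bar>)"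
proof -
  show ?thesis
    using nonvanishing_sign[OF S1 nz]
  proof
    assume pos: "\<forall>t. S1 t > 0"
    show ?thesis by (rule poisson_increasing(2)[OF S S1 _ per \<psi> per\<psi>]) (use pos in auto)
  next
    assume neg: "\<forall>t. S1 t < 0"
    have "(\<lambda>N. \<Sum>m\<in>{- int N..int N}. integral {0..1} (\<lambda>t. \<psi> t * em (- (of_int m * - S t)))) \<longlonglongrightarrow>
      (\<Sum>t\<in>{t\<in>{0..<1}. - S t \<in> \<int>}. \<psi> t / of_real \<bar>- S1 t\<bar>)"
    proof (rule poisson_increasing(2))
      show "((\<lambda>t. - S t) has_real_derivative - S1 t) (at t)" "((\<lambda>t. - S1 t) has_real_derivative - S2 t) (at t)" for t
        using S S1 by (auto intro: DERIV_minus)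
      show "- S (t + 1) = - S t + of_int (- q)" for t by (simp add: per)
    qed (use neg \<psi> per\<psi> in auto)
    moreover have "(\<Sum>m\<in>{- int N..int N}. integral {0..1} (\<lambda>t. \<psi> t * em (- (of_int m * - S t))))
        = (\<Sum>m\<in>{- int N..int N}. integral {0..1} (\<lambda>t. \<psi> t * em (- (of_int m * S t))))" for N
      by (rule sum.reindex_bij_witness[of _ uminus uminus]) auto
    moreover have "- S t \<in> \<int> \<longleftrightarrow> S t \<in> \<int>" for t by simp
    ultimately show ?thesis by simp
  qed
qed

section \<open>Iterates of the lift and the matrix entries\<close>

context circle_lift
begin

lemma iterate_lift: "(T ^^ n) (to_circle t) = to_circle ((F 0 ^^ n) t)"
  by (induction n) (simp_all add: lift)

lemma shift_int: "F 0 (t + of_int k) = F 0 t + of_int (k * q)"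
  using shift_by_int[of "F 0", OF shift, of t k] by simp

lemma iterate_shift: "(F 0 ^^ n) (t + 1) = (F 0 ^^ n) t + of_int (q ^ n)"
proof (induction n)
  case (Suc n)
  then show ?case using shift_int[of "(F 0 ^^ n) t" "q ^ n"] by (simp add: mult.commute)
qed simp

lemma iterate_deriv:
  "\<exists>S1 S2. \<forall>t. ((F 0 ^^ n) has_real_derivative S1 t) (at t) \<and> (S1 has_real_derivative S2 t) (at t) \<and> c ^ n \<le> \<bar>S1 t\<bar>"
proof (induction n)
  case 0
  have "((F 0 ^^ 0) has_real_derivative 1) (at t)" for t by (simp add: id_def)
  then show ?case by (intro exI[of _ "\<lambda>_. 1"] exI[of _ "\<lambda>_. 0"]) auto
next
  case (Suc n)
  then obtain S1 S2 where S: "\<And>t. ((F 0 ^^ n) has_real_derivative S1 t) (at t)" "\<And>t. (S1 has_real_derivative S2 t) (at t)"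
    "\<And>t. c ^ n \<le> \<bar>S1 t\<bar>" by blast
  let ?S = "F 0 ^^ n"
  have 1: "((F 0 ^^ Suc n) has_real_derivative F 1 (?S t) * S1 t) (at t)" for t
    using DERIV_chain[OF deriv[of 0 "?S t"] S(1)[of t]] by (simp add: o_def)
  have "((\<lambda>t. F 1 (?S t)) has_real_derivative F (Suc 1) (?S t) * S1 t) (at t)" for t
    using DERIV_chain[OF deriv[of 1 "?S t"] S(1)[of t]] by (simp add: o_def)
  from DERIV_mult[OF this S(2)]
  have 2: "((\<lambda>t. F 1 (?S t) * S1 t) has_real_derivative F (Suc 1) (?S t) * S1 t * S1 t + S2 t * F 1 (?S t)) (at t)" for t .
  have 3: "c ^ Suc n \<le> \<bar>F 1 (?S t) * S1 t\<bar>" for t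
    unfolding abs_mult power_Suc using c by (intro mult_mono expand S(3)) auto
  show ?case
    by (rule exI[of _ "\<lambda>t. F 1 (?S t) * S1 t"], rule exI[of _ "\<lambda>t. F (Suc 1) (?S t) * S1 t * S1 t + S2 t * F 1 (?S t)"])
       (use 1 2 3 in blast)
qed

text \<open>Integrating the p-th power of the transfer operator applied to a function against a mode
  amounts to integrating the function against the mode composed with the p-th iterate. By this
  duality the integral is the Fourier coefficient of index m of the image of mode n, without any
  derivative of the map.\<close>

definition entry :: "nat \<Rightarrow> int \<Rightarrow> int \<Rightarrow> complex" where
  "entry p m n = integral {0..1} (\<lambda>t. em (of_int n * t) * em (- (of_int m * (F 0 ^^ p) t)))"

lemma mode_deriv:
  "((\<lambda>t. em (of_int n * t)) has_vector_derivative (2 * of_real pi * \<i> * of_real (of_int n) * em (of_int n * t))) (at t)"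
  by (rule em_has_vector_derivative) (auto intro!: derivative_eq_intros)

lemma mode_per: "em (of_int n * (t + 1)) = em (of_int n * t)"
  by (simp add: em_eq_iff algebra_simps)

text \<open>The zeros modulo 1 of \<open>F 0 - s\<close> are the preimages of the point s, so
  \<open>poisson\<close> with this function is the sum over the fibre.\<close>

lemma transfer_mode_limit:
  "(\<lambda>N. \<Sum>m\<in>{- int N..int N}. entry 1 m n * em (of_int m * s)) \<longlonglongrightarrow> transfer T (fourier_mode n) (to_circle s)"
proof -
  let ?A = "{t\<in>{0..<1}. F 0 t - s \<in> \<int>}"
  have "(\<lambda>N. \<Sum>m\<in>{- int N..int N}. integral {0..1} (\<lambda>t. em (of_int n * t) * em (- (of_int m * (F 0 t - s))))) \<longlonglongrightarrow>
      (\<Sum>t\<in>?A. em (of_int n * t) / of_real \<bar>F 1 t\<bar>)"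
  proof (rule poisson[OF _ _ _ _ mode_deriv mode_per])
    show "((\<lambda>t. F 0 t - s) has_real_derivative F 1 t) (at t)" for t
      using DERIV_diff[OF deriv[of 0] DERIV_const[of s]] by simp
    show "(F 1 has_real_derivative F 2 t) (at t)" for t using deriv[of 1] by (simp add: numeral_2_eq_2)
    show "F 1 t \<noteq> 0" for t using expand[of t] c by auto
    show "F 0 (t + 1) - s = F 0 t - s + of_int q" for t by (simp add: shift)
  qed
  moreover have "integral {0..1} (\<lambda>t. em (of_int n * t) * em (- (of_int m * (F 0 t - s)))) = entry 1 m n * em (of_int m * s)" for m
  proof -
    have "em (- (of_int m * (F 0 t - s))) = em (- (of_int m * F 0 t)) * em (of_int m * s)" for t
      unfolding em_add[symmetric] by (simp add: algebra_simps)
    then show ?thesis by (simp add: entry_def mult.assoc[symmetric])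
  qed
  moreover have "(\<Sum>t\<in>?A. em (of_int n * t) / of_real \<bar>F 1 t\<bar>) = transfer T (fourier_mode n) (to_circle s)"
  proof -
    have "?A = {t\<in>{0..<1}. T (to_circle t) = to_circle s}" by (simp add: lift to_circle_eq_iff)
    then have "bij_betw to_circle ?A {y. T y = to_circle s}"
      using bij_to_circle_Collect[of "\<lambda>y. T y = to_circle s"] by simp
    from sum.reindex_bij_betw[OF this]
    have "transfer T (fourier_mode n) (to_circle s)
        = (\<Sum>t\<in>?A. complex_of_real (1 / \<bar>circle_deriv T (to_circle t)\<bar>) * fourier_mode n (to_circle t))"
      unfolding transfer_def by (rule sym)
    also have "\<dots> = (\<Sum>t\<in>?A. em (of_int n * t) / of_real \<bar>F 1 t\<bar>)"
    proof (rule sum.cong[OF refl])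
      fix t
      have "circle_deriv T (to_circle t) = F 1 t" using circle_deriv_eq[OF lift deriv[of 0 t]] by simp
      then show "complex_of_real (1 / \<bar>circle_deriv T (to_circle t)\<bar>) * fourier_mode n (to_circle t)
          = em (of_int n * t) / of_real \<bar>F 1 t\<bar>" by (simp add: fourier_mode_to_circle)
    qed
    finally show ?thesis by (rule sym)
  qed
  ultimately show ?thesis by simp
qed

end

section \<open>The Fourier matrix of the transfer operator\<close>

lemma symmetric_intervals_at_top:
  "filterlim (\<lambda>N. {- int N..int N}) (finite_subsets_at_top UNIV) sequentially"
  unfolding filterlim_finite_subsets_at_top
proof (intro allI impI)
  fix X :: "int set" assume X: "finite X \<and> X \<subseteq> UNIV"
  then obtain N0 where N0: "\<And>n. n \<in> X \<Longrightarrow> nat \<bar>n\<bar> \<le> N0"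
    using finite_nat_set_iff_bounded_le[of "(\<lambda>n. nat \<bar>n\<bar>) ` X"] by auto
  show "\<forall>\<^sub>F N in sequentially. finite {- int N..int N} \<and> X \<subseteq> {- int N..int N} \<and> {- int N..int N} \<subseteq> UNIV"
    using eventually_ge_at_top[of N0] by eventually_elim (use N0 in fastforce)
qed

text \<open>\<open>poisson\<close> delivers symmetric partial sums only; absolute summability
  upgrades them to unordered sums.\<close>

lemma infsum_eq_symmetric_limit:
  fixes f :: "int \<Rightarrow> complex"
  assumes "f abs_summable_on UNIV" and "(\<lambda>N. \<Sum>k\<in>{- int N..int N}. f k) \<longlonglongrightarrow> l"
  shows "(f has_sum l) UNIV"
proof -
  have s: "(f has_sum infsum f UNIV) UNIV" by (rule has_sum_infsum[OF abs_summable_summable[OF assms(1)]])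
  then have "(\<lambda>N. \<Sum>k\<in>{- int N..int N}. f k) \<longlonglongrightarrow> infsum f UNIV"
    unfolding has_sum_def by (rule filterlim_compose[OF _ symmetric_intervals_at_top])
  then show ?thesis using s LIMSEQ_unique[OF assms(2)] by metis
qed

lemma periodic_bounded:
  fixes g :: "real \<Rightarrow> 'a::real_normed_algebra_1"
  assumes "continuous_on UNIV g" and per: "\<And>t. g (t + 1) = g t"
  shows "\<exists>B\<ge>0. \<forall>t. norm (g t) \<le> B"
proof -
  have perk: "g (t + of_int k) = g t" for t k using shift_by_int[of g 0 t k] per by simp
  have "bounded (g ` {0..1})"
    by (intro compact_imp_bounded compact_continuous_image continuous_on_subset[OF assms(1)]) auto
  then obtain B where B: "B > 0" "\<And>t. t \<in> {0..1} \<Longrightarrow> norm (g t) \<le> B" unfolding bounded_pos by auto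
  have "norm (g t) \<le> B" for t
  proof -
    have "g t = g (frac t)" using perk[of t "- \<lfloor>t\<rfloor>"] by (simp add: frac_def)
    then show ?thesis using B(2)[of "frac t"] by (simp add: frac_lt_1 less_imp_le)
  qed
  then show ?thesis using B(1) by (intro exI[of _ B]) auto
qed

context circle_lift
begin

lemma F_continuous: "continuous_on A (F k)"
  by (intro continuous_at_imp_continuous_on ballI DERIV_isCont[OF deriv])

lemma iterate_continuous: "continuous_on A (F 0 ^^ n)"
proof -
  have "isCont (F 0 ^^ n) t" for t using iterate_deriv[of n] DERIV_isCont by blast
  then show ?thesis by (simp add: continuous_at_imp_continuous_on)
qed

lemma flat_trace_limit:
  assumes n: "n > 0"
  shows "(\<lambda>N. \<Sum>k\<in>{- int N..int N}. entry n k k) \<longlonglongrightarrow> of_real (flat_trace T n)"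
proof -
  obtain S1 S2 where S: "\<And>t. ((F 0 ^^ n) has_real_derivative S1 t) (at t)" "\<And>t. (S1 has_real_derivative S2 t) (at t)"
    "\<And>t. c ^ n \<le> \<bar>S1 t\<bar>" using iterate_deriv[of n] by blast
  \<comment> \<open>Expansion enters here: the derivative of the iterate exceeds 1 in absolute
    value, so that of the iterate minus the identity has no zero.\<close>
  have cn: "c ^ n > 1" using c n by (simp add: one_less_power)
  let ?S = "\<lambda>t. (F 0 ^^ n) t - t"
  let ?A = "{t\<in>{0..<1}. ?S t \<in> \<int>}"
  have "(\<lambda>N. \<Sum>m\<in>{- int N..int N}. integral {0..1} (\<lambda>t. 1 * em (- (of_int m * ?S t)))) \<longlonglongrightarrow>
      (\<Sum>t\<in>?A. 1 / of_real \<bar>S1 t - 1\<bar>)"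
  proof (rule poisson)
    show "(?S has_real_derivative S1 t - 1) (at t)" for t by (rule DERIV_diff[OF S(1) DERIV_ident])
    show "((\<lambda>t. S1 t - 1) has_real_derivative S2 t) (at t)" for t
      using DERIV_diff[OF S(2) DERIV_const[of 1]] by simp
    show "S1 t - 1 \<noteq> 0" for t using S(3)[of t] cn by auto
    show "(F 0 ^^ n) (t + 1) - (t + 1) = ?S t + of_int (q ^ n - 1)" for t by (simp add: iterate_shift)
    show "((\<lambda>_. 1 :: complex) has_vector_derivative 0) (at t)" for t by (rule has_vector_derivative_const)
  qed simp
  moreover have "integral {0..1} (\<lambda>t. 1 * em (- (of_int k * ?S t))) = entry n k k" for k
    unfolding entry_def em_add[symmetric] by (simp add: algebra_simps)
  moreover have "(\<Sum>t\<in>?A. 1 / of_real \<bar>S1 t - 1\<bar>) = complex_of_real (flat_trace T n)"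
  proof -
    have "?A = {t\<in>{0..<1}. (T ^^ n) (to_circle t) = to_circle t}" by (simp add: iterate_lift to_circle_eq_iff)
    then have "bij_betw to_circle ?A {x. (T ^^ n) x = x}"
      using bij_to_circle_Collect[of "\<lambda>x. (T ^^ n) x = x"] by simp
    from sum.reindex_bij_betw[OF this]
    have "flat_trace T n = (\<Sum>t\<in>?A. 1 / \<bar>1 - circle_deriv (T ^^ n) (to_circle t)\<bar>)"
      unfolding flat_trace_def by (rule sym)
    also have "\<dots> = (\<Sum>t\<in>?A. 1 / \<bar>S1 t - 1\<bar>)"
      by (intro sum.cong refl) (simp only: circle_deriv_eq[OF iterate_lift S(1)] abs_minus_commute)
    finally show ?thesis by simp
  qed
  ultimately show ?thesis by simp
qed

text \<open>The pointwise Fourier inversion of the mode composed with \<open>F 0\<close>, obtained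
  from \<open>poisson\<close> with the translation t - u. The sign of the index flips because
  \<open>entry 1 m j\<close> is the Fourier coefficient of index -j of that function.\<close>

lemma mode_inversion:
  assumes "(\<lambda>j. entry 1 m j) abs_summable_on UNIV"
  shows "((\<lambda>j. entry 1 m j * em (- (of_int j * u))) has_sum em (- (of_int m * F 0 u))) UNIV"
proof (rule infsum_eq_symmetric_limit)
  show "(\<lambda>j. entry 1 m j * em (- (of_int j * u))) abs_summable_on UNIV"
    using assms by (simp add: norm_mult)
  let ?\<psi> = "\<lambda>t. em (- (of_int m * F 0 t))"
  let ?A = "{t\<in>{0..<1}. t - u \<in> \<int>}"
  have per: "?\<psi> (t + 1) = ?\<psi> t" for t unfolding em_eq_iff shift by (simp add: algebra_simps)
  have perk: "?\<psi> (t + of_int k) = ?\<psi> t" for t k unfolding em_eq_iff shift_int by (simp add: algebra_simps)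
  have "(\<lambda>N. \<Sum>k\<in>{- int N..int N}. integral {0..1} (\<lambda>t. ?\<psi> t * em (- (of_int k * (t - u))))) \<longlonglongrightarrow>
      (\<Sum>t\<in>?A. ?\<psi> t / of_real \<bar>1\<bar>)"
  proof (rule poisson[where S = "\<lambda>t. t - u" and ?S1.0 = "\<lambda>_. 1" and ?S2.0 = "\<lambda>_. 0" and \<psi> = ?\<psi> and q = 1, OF _ _ _ _ _ per])
    show "((\<lambda>t. t - u) has_real_derivative 1) (at t)" for t by (auto intro!: derivative_eq_intros)
    show "((\<lambda>t. 1) has_real_derivative 0) (at t)" for t by (rule DERIV_const)
    show "t + 1 - u = t - u + of_int 1" for t by simp
    show "(?\<psi> has_vector_derivative 2 * of_real pi * \<i> * of_real (- (of_int m * F (Suc 0) t)) * ?\<psi> t) (at t)" for t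
      by (rule em_has_vector_derivative) (intro DERIV_minus DERIV_cmult deriv)
  qed simp
  moreover have "?A = {frac u}"
  proof -
    have "t = frac u" if t: "0 \<le> t" "t < 1" "t - u \<in> \<int>" for t
    proof -
      obtain k where "t - u = of_int k" using t(3) by (elim Ints_cases)
      then have "u = t + of_int (- k)" by simp
      then show ?thesis using t by (simp add: frac_def floor_eq_iff)
    qed
    moreover have "frac u - u \<in> \<int>" by (simp add: frac_def)
    ultimately show ?thesis by (auto simp: frac_lt_1)
  qed
  moreover have "?\<psi> (frac u) = ?\<psi> u" using perk[of u "- \<lfloor>u\<rfloor>"] by (simp add: frac_def)
  moreover have "(\<Sum>k\<in>{- int N..int N}. integral {0..1} (\<lambda>t. ?\<psi> t * em (- (of_int k * (t - u)))))
      = (\<Sum>j\<in>{- int N..int N}. entry 1 m j * em (- (of_int j * u)))" for N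
  proof (rule sum.reindex_bij_witness[of _ uminus uminus])
    fix k
    have "?\<psi> t * em (- (of_int k * (t - u))) = em (of_int (- k) * t) * em (- (of_int m * (F 0 ^^ 1) t)) * em (- (of_int (- k) * u))" for t
      unfolding em_add[symmetric] by (simp add: algebra_simps)
    then show "entry 1 m (- k) * em (- (of_int (- k) * u)) = integral {0..1} (\<lambda>t. ?\<psi> t * em (- (of_int k * (t - u))))"
      by (simp only: entry_def integral_mult_left)
  qed auto
  ultimately show "(\<lambda>N. \<Sum>j\<in>{- int N..int N}. entry 1 m j * em (- (of_int j * u))) \<longlonglongrightarrow> em (- (of_int m * F 0 u))"
    by simp
qed

text \<open>The Fourier expansion of the mode composed with \<open>F 0\<close> is evaluated at the
  p-th iterate and integrated term by term, the absolutely summable row giving uniform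
  convergence.\<close>

lemma entry_compose:
  assumes row: "(\<lambda>j. entry 1 m j) abs_summable_on UNIV"
  shows "((\<lambda>j. entry 1 m j * entry p j k) has_sum entry (Suc p) m k) UNIV"
proof -
  let ?g = "\<lambda>j t. entry 1 m j * (em (of_int k * t) * em (- (of_int j * (F 0 ^^ p) t)))"
  let ?h = "\<lambda>t. em (of_int k * t) * em (- (of_int m * (F 0 ^^ Suc p) t))"
  have hs: "((\<lambda>j. ?g j t) has_sum ?h t) UNIV" for t
    using has_sum_cmult_right[OF mode_inversion[OF row, of "(F 0 ^^ p) t"], of "em (of_int k * t)"]
    by (simp add: mult_ac)
  have ul: "uniform_limit {0..1} (\<lambda>X t. \<Sum>j\<in>X. ?g j t) ?h (finite_subsets_at_top UNIV)"
    by (rule Weierstrass_m_test_general'[OF _ hs row]) (simp add: norm_mult)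
  have cont: "continuous_on {0..1} (\<lambda>t. \<Sum>j\<in>X. ?g j t)" for X
    by (intro continuous_intros iterate_continuous)
  obtain I J where IJ: "\<And>X. ((\<lambda>t. \<Sum>j\<in>X. ?g j t) has_integral I X) {0..1}" "(?h has_integral J) {0..1}"
    "(I \<longlongrightarrow> J) (finite_subsets_at_top UNIV)"
    by (rule uniform_limit_integral[OF ul cont finite_subsets_at_top_neq_bot]) (rule that)
  have "I X = (\<Sum>j\<in>X. entry 1 m j * entry p j k)" if "finite X" for X
  proof -
    have "((\<lambda>t. em (of_int k * t) * em (- (of_int j * (F 0 ^^ p) t))) has_integral entry p j k) {0..1}" for j
      unfolding entry_def by (intro integrable_integral integrable_continuous_interval continuous_intros iterate_continuous)
    then have "((\<lambda>t. \<Sum>j\<in>X. ?g j t) has_integral (\<Sum>j\<in>X. entry 1 m j * entry p j k)) {0..1}"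
      by (intro has_integral_sum that has_integral_mult_right)
    then show ?thesis using IJ(1) has_integral_unique by blast
  qed
  moreover have "J = entry (Suc p) m k" using IJ(2) unfolding entry_def by (simp add: integral_unique)
  ultimately show ?thesis
    unfolding has_sum_def using IJ(3) by (auto elim!: Lim_transform_eventually intro: eventually_finite_subsets_at_top_weakI)
qed

lemma entry_0: "entry 0 m k = (if m = k then 1 else 0)"
proof -
  have "em (of_int k * t) * em (- (of_int m * t)) = em (of_int (k - m) * t)" for t
    unfolding em_add[symmetric] by (simp add: algebra_simps)
  then show ?thesis using integral_unique[OF integral_em[of "k - m"]] by (simp add: entry_def)
qed

section \<open>Non-stationary phase\<close>

lemma F_per: "F (Suc k) (t + 1) = F (Suc k) t"
proof (induction k arbitrary: t)
  case 0
  show ?case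
  proof (rule DERIV_unique)
    show "((\<lambda>x. F 0 (x + 1)) has_real_derivative F (Suc 0) (t + 1)) (at t)" by (rule DERIV_shift[THEN iffD1, OF deriv])
    show "((\<lambda>x. F 0 (x + 1)) has_real_derivative F (Suc 0) t) (at t)"
      unfolding shift using DERIV_add[OF deriv DERIV_const] by simp
  qed
next
  case (Suc k)
  show ?case
  proof (rule DERIV_unique)
    show "((\<lambda>x. F (Suc k) (x + 1)) has_real_derivative F (Suc (Suc k)) (t + 1)) (at t)"
      by (rule DERIV_shift[THEN iffD1, OF deriv])
    show "((\<lambda>x. F (Suc k) (x + 1)) has_real_derivative F (Suc (Suc k)) t) (at t)"
      unfolding Suc.IH by (rule deriv)
  qed
qed

text \<open>The amplitudes that repeated integration by parts produces.\<close>

inductive amplitude :: "(real \<Rightarrow> real) \<Rightarrow> bool" where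
  amp_const: "amplitude (\<lambda>_. a)"
| amp_mult: "amplitude b \<Longrightarrow> amplitude (\<lambda>t. b t * F (Suc (Suc k)) t)"
| amp_add: "amplitude b \<Longrightarrow> amplitude b' \<Longrightarrow> amplitude (\<lambda>t. b t + b' t)"

lemma amplitude_deriv: "amplitude b \<Longrightarrow> \<exists>b'. amplitude b' \<and> (\<forall>t. (b has_real_derivative b' t) (at t))"
proof (induction rule: amplitude.induct)
  case (amp_const a)
  show ?case using amplitude.amp_const[of 0] by (intro exI[of _ "\<lambda>_. 0"]) simp
next
  case (amp_mult b k)
  then obtain b' where b': "amplitude b'" "\<And>t. (b has_real_derivative b' t) (at t)" by blast
  have "amplitude (\<lambda>t. b' t * F (Suc (Suc k)) t + b t * F (Suc (Suc (Suc k))) t)"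
    by (intro amplitude.intros b' amp_mult.hyps)
  moreover have "((\<lambda>t. b t * F (Suc (Suc k)) t) has_real_derivative b' t * F (Suc (Suc k)) t + b t * F (Suc (Suc (Suc k))) t) (at t)" for t
    using DERIV_mult[OF b'(2)[of t] deriv[of "Suc (Suc k)" t]] by (simp add: mult_ac)
  ultimately show ?case by blast
next
  case (amp_add b d)
  then obtain b' d' where bd: "amplitude b'" "\<And>t. (b has_real_derivative b' t) (at t)"
    "amplitude d'" "\<And>t. (d has_real_derivative d' t) (at t)" by blast
  show ?case using amplitude.amp_add[OF bd(1,3)] DERIV_add[OF bd(2) bd(4)] by blast
qed

lemma amplitude_continuous: "amplitude b \<Longrightarrow> continuous_on A b"
  using amplitude_deriv[of b] DERIV_isCont by (blast intro: continuous_at_imp_continuous_on)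

lemma amplitude_per: "amplitude b \<Longrightarrow> b (t + 1) = b t"
  by (induction rule: amplitude.induct) (simp_all add: F_per)

text \<open>The frequencies n and m are rescaled by \<Lambda> into \<alpha> and \<beta>, so that the
  constant is uniform in both. Each integration by parts gains a factor 1 / \<Lambda>.
  Differentiating the inverse power of the phase derivative brings down \<beta> times the second
  derivative of the lift; hence the induction ranges over all amplitudes and all exponents
  j.\<close>

lemma oscillatory_decay:
  assumes \<delta>: "\<delta> > 0"
  shows "amplitude b \<Longrightarrow> \<exists>C. \<forall>\<alpha> \<beta> \<Lambda>. \<Lambda> > 0 \<longrightarrow> \<bar>\<beta>\<bar> \<le> 1 \<longrightarrow> (\<forall>t. \<delta> \<le> \<bar>\<alpha> - \<beta> * F 1 t\<bar>) \<longrightarrow>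
      \<Lambda> * \<alpha> \<in> \<int> \<longrightarrow> \<Lambda> * \<beta> \<in> \<int> \<longrightarrow>
      cmod (integral {0..1} (\<lambda>t. of_real (b t * inverse (\<alpha> - \<beta> * F 1 t) ^ j) * em (\<Lambda> * (\<alpha> * t - \<beta> * F 0 t)))) \<le> C / \<Lambda> ^ N"
proof (induction N arbitrary: b j)
  case 0
  obtain B where B: "B \<ge> 0" "\<And>t. \<bar>b t\<bar> \<le> B"
    using periodic_bounded[OF amplitude_continuous[OF 0] amplitude_per[OF 0]] by auto
  show ?case
  proof (intro exI[of _ "B * (1 / \<delta>) ^ j"] allI impI)
    fix \<alpha> \<beta> \<Lambda> :: real assume W: "\<forall>t. \<delta> \<le> \<bar>\<alpha> - \<beta> * F 1 t\<bar>"
    have nz: "\<alpha> - \<beta> * F 1 t \<noteq> 0" for t using W[rule_format, of t] \<delta> by auto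
    let ?f = "\<lambda>t. of_real (b t * inverse (\<alpha> - \<beta> * F 1 t) ^ j) * em (\<Lambda> * (\<alpha> * t - \<beta> * F 0 t))"
    have "cmod (integral {0..1} ?f) \<le> B * (1 / \<delta>) ^ j * (1 - 0)"
    proof (rule integral_bound)
      show "continuous_on {0..1} ?f"
        by (intro continuous_intros amplitude_continuous[OF 0] F_continuous) (use nz in auto)
      fix t
      have "cmod (?f t) = \<bar>b t\<bar> * (1 / \<bar>\<alpha> - \<beta> * F 1 t\<bar>) ^ j"
      proof -
        have "\<bar>inverse (\<alpha> - \<beta> * F 1 t)\<bar> = 1 / \<bar>\<alpha> - \<beta> * F 1 t\<bar>" by (simp add: abs_inverse divide_inverse)
        then show ?thesis by (simp only: norm_mult norm_of_real norm_em mult_1_right abs_mult power_abs)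
      qed
      also have "\<dots> \<le> B * (1 / \<delta>) ^ j"
      proof (rule mult_mono)
        show "(1 / \<bar>\<alpha> - \<beta> * F 1 t\<bar>) ^ j \<le> (1 / \<delta>) ^ j"
          using W[rule_format, of t] \<delta> by (intro power_mono divide_left_mono) (auto simp: nz)
      qed (use B \<delta> in auto)
      finally show "cmod (?f t) \<le> B * (1 / \<delta>) ^ j" .
    qed simp
    then show "cmod (integral {0..1} ?f) \<le> B * (1 / \<delta>) ^ j / \<Lambda> ^ 0" by simp
  qed
next
  case (Suc N)
  obtain b' where b': "amplitude b'" "\<And>t. (b has_real_derivative b' t) (at t)" using amplitude_deriv[OF Suc.prems] by blast
  have b2: "amplitude (\<lambda>t. b t * F (Suc (Suc 0)) t)" by (rule amp_mult[OF Suc.prems])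
  define I where "I b j \<alpha> \<beta> \<Lambda> = integral {0..1} (\<lambda>t. of_real (b t * inverse (\<alpha> - \<beta> * F 1 t) ^ j) * em (\<Lambda> * (\<alpha> * t - \<beta> * F 0 t)))"
    for b j \<alpha> \<beta> \<Lambda>
  define good where "good \<alpha> \<beta> \<Lambda> \<longleftrightarrow> \<Lambda> > 0 \<and> \<bar>\<beta>\<bar> \<le> 1 \<and> (\<forall>t. \<delta> \<le> \<bar>\<alpha> - \<beta> * F 1 t\<bar>) \<and> \<Lambda> * \<alpha> \<in> \<int> \<and> \<Lambda> * \<beta> \<in> \<int>"
    for \<alpha> \<beta> \<Lambda>
  obtain C1 where C1: "\<And>\<alpha> \<beta> \<Lambda>. good \<alpha> \<beta> \<Lambda> \<Longrightarrow> cmod (I b' (Suc j) \<alpha> \<beta> \<Lambda>) \<le> C1 / \<Lambda> ^ N"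
    using Suc.IH[OF b'(1), of "Suc j"] unfolding I_def good_def by blast
  obtain C2 where C2: "\<And>\<alpha> \<beta> \<Lambda>. good \<alpha> \<beta> \<Lambda> \<Longrightarrow> cmod (I (\<lambda>t. b t * F (Suc (Suc 0)) t) (Suc (Suc j)) \<alpha> \<beta> \<Lambda>) \<le> C2 / \<Lambda> ^ N"
    using Suc.IH[OF b2, of "Suc (Suc j)"] unfolding I_def good_def by blast
  define C where "C = (C1 + real (Suc j) * C2) / (2 * pi)"
  have "cmod (I b j \<alpha> \<beta> \<Lambda>) \<le> C / \<Lambda> ^ Suc N" if g: "good \<alpha> \<beta> \<Lambda>" for \<alpha> \<beta> \<Lambda>
  proof -
    have \<Lambda>: "\<Lambda> > 0" and \<beta>: "\<bar>\<beta>\<bar> \<le> 1" and W: "\<And>t. \<delta> \<le> \<bar>\<alpha> - \<beta> * F 1 t\<bar>" and int: "\<Lambda> * \<alpha> \<in> \<int>" "\<Lambda> * \<beta> \<in> \<int>"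
      using g unfolding good_def by auto
    have nz: "\<alpha> - \<beta> * F 1 t \<noteq> 0" for t using W[of t] \<delta> by auto
    let ?V = "\<lambda>t. inverse (\<alpha> - \<beta> * F 1 t)"
    let ?e = "\<lambda>t. em (\<Lambda> * (\<alpha> * t - \<beta> * F 0 t))"
    let ?f = "\<lambda>b j t. of_real (b t * ?V t ^ j) * ?e t"
    let ?G = "\<lambda>t. of_real (b t * ?V t ^ Suc j) * ?e t"
    let ?b2 = "\<lambda>t. b t * F (Suc (Suc 0)) t"
    have I: "(?f d i has_integral I d i \<alpha> \<beta> \<Lambda>) {0..1}" if "amplitude d" for d i
      unfolding I_def
      by (intro integrable_integral integrable_continuous_interval continuous_intros amplitude_continuous[OF that] F_continuous) (use nz in auto)
    \<comment> \<open>Differentiating the exponential multiplies by the phase derivative, which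
      cancels one inverse power and leaves the integrand of exponent j; the other two terms have
      exponents covered by the induction hypothesis.\<close>
    have dG: "(?G has_vector_derivative (?f b' (Suc j) t + (of_nat (Suc j) * of_real \<beta>) * ?f ?b2 (Suc (Suc j)) t
        + (2 * of_real pi * \<i> * of_real \<Lambda>) * ?f b j t)) (at t)" for t
    proof -
      have dV: "(?V has_real_derivative \<beta> * F (Suc (Suc 0)) t * (?V t * ?V t)) (at t)"
      proof -
        have "((\<lambda>t. \<alpha> - \<beta> * F 1 t) has_real_derivative 0 - \<beta> * F (Suc (Suc 0)) t) (at t)"
          using deriv[of 1 t] by (intro DERIV_diff DERIV_const DERIV_cmult) simp
        from DERIV_inverse'[OF this nz] show ?thesis by (simp add: mult_ac)
      qed
      have "((\<lambda>t. ?V t ^ Suc j) has_real_derivative real (Suc j) * (?V t ^ j * (\<beta> * F (Suc (Suc 0)) t * (?V t * ?V t)))) (at t)"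
        using DERIV_power[OF dV, of "Suc j"] by (simp add: mult_ac)
      from DERIV_mult[OF b'(2) this]
      have 1: "((\<lambda>t. b t * ?V t ^ Suc j) has_real_derivative
          (b' t * ?V t ^ Suc j + real (Suc j) * \<beta> * (?b2 t * ?V t ^ Suc (Suc j)))) (at t)"
        by (rule back_subst[of "\<lambda>D. (_ has_real_derivative D) _"]) (simp add: algebra_simps)
      have 2: "((\<lambda>t. \<Lambda> * (\<alpha> * t - \<beta> * F 0 t)) has_real_derivative \<Lambda> * (\<alpha> - \<beta> * F 1 t)) (at t)"
        using DERIV_cmult[OF DERIV_diff[OF DERIV_cmult[OF DERIV_ident, of \<alpha>] DERIV_cmult[OF deriv[of 0 t], of \<beta>]], of \<Lambda>] by simp
      have VW: "complex_of_real (?V t) * of_real (\<alpha> - \<beta> * F 1 t) = 1"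
        using nz[of t] by (simp only: of_real_mult[symmetric]) simp
      show ?thesis
      proof (rule back_subst[of "\<lambda>D. (_ has_vector_derivative D) _", OF has_vector_derivative_mult[OF has_vector_derivative_of_real[OF 1] em_has_vector_derivative[OF 2]]])
        have "complex_of_real (b t * ?V t ^ Suc j) * (2 * of_real pi * \<i> * of_real (\<Lambda> * (\<alpha> - \<beta> * F 1 t)) * ?e t)
            = (2 * of_real pi * \<i> * of_real \<Lambda>) * (of_real (b t * ?V t ^ j) * ?e t) * (complex_of_real (?V t) * of_real (\<alpha> - \<beta> * F 1 t))"
          by (simp only: of_real_mult power_Suc mult_1_right mult_ac)
        then have e: "complex_of_real (b t * ?V t ^ Suc j) * (2 * of_real pi * \<i> * of_real (\<Lambda> * (\<alpha> - \<beta> * F 1 t)) * ?e t)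
            = (2 * of_real pi * \<i> * of_real \<Lambda>) * (of_real (b t * ?V t ^ j) * ?e t)" unfolding VW by simp
        show "complex_of_real (b t * ?V t ^ Suc j) * (2 * of_real pi * \<i> * of_real (\<Lambda> * (\<alpha> - \<beta> * F 1 t)) * ?e t) +
            of_real (b' t * ?V t ^ Suc j + real (Suc j) * \<beta> * (?b2 t * ?V t ^ Suc (Suc j))) * ?e t
            = ?f b' (Suc j) t + (of_nat (Suc j) * of_real \<beta>) * ?f ?b2 (Suc (Suc j)) t + (2 * of_real pi * \<i> * of_real \<Lambda>) * ?f b j t"
          unfolding e by (simp only: of_real_add of_real_mult of_real_of_nat_eq distrib_right mult.assoc add_ac)
      qed
    qed
    \<comment> \<open>No boundary term arises: all factors are periodic, the exponential because
      \<Lambda> \<alpha> and \<Lambda> \<beta> are integers.\<close>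
    have G01: "?G 1 = ?G 0"
    proof -
      have "?e 1 = ?e 0"
      proof -
        have "\<Lambda> * (\<alpha> * 1 - \<beta> * F 0 1) - \<Lambda> * (\<alpha> * 0 - \<beta> * F 0 0) = \<Lambda> * \<alpha> - \<Lambda> * \<beta> * of_int q"
          using shift[of 0] by (simp add: algebra_simps)
        then show ?thesis unfolding em_eq_iff using int by (auto intro!: Ints_diff Ints_mult)
      qed
      moreover have "b 1 = b 0" "F 1 1 = F 1 0" using amplitude_per[OF Suc.prems, of 0] F_per[of 0 0] by simp_all
      ultimately show ?thesis by simp
    qed
    have e1: "((\<lambda>t. ?f b' (Suc j) t + (of_nat (Suc j) * of_real \<beta>) * ?f ?b2 (Suc (Suc j)) t
        + (2 * of_real pi * \<i> * of_real \<Lambda>) * ?f b j t) has_integral (?G 1 - ?G 0)) {0..1}"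
      by (intro fundamental_theorem_of_calculus has_vector_derivative_at_within[OF dG]) simp
    have e2: "((\<lambda>t. ?f b' (Suc j) t + (of_nat (Suc j) * of_real \<beta>) * ?f ?b2 (Suc (Suc j)) t
        + (2 * of_real pi * \<i> * of_real \<Lambda>) * ?f b j t) has_integral
        (I b' (Suc j) \<alpha> \<beta> \<Lambda> + (of_nat (Suc j) * of_real \<beta>) * I ?b2 (Suc (Suc j)) \<alpha> \<beta> \<Lambda> + (2 * of_real pi * \<i> * of_real \<Lambda>) * I b j \<alpha> \<beta> \<Lambda>)) {0..1}"
      by (intro has_integral_add has_integral_mult_right I b'(1) b2 Suc.prems)
    have "I b' (Suc j) \<alpha> \<beta> \<Lambda> + (of_nat (Suc j) * of_real \<beta>) * I ?b2 (Suc (Suc j)) \<alpha> \<beta> \<Lambda>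
        + (2 * of_real pi * \<i> * of_real \<Lambda>) * I b j \<alpha> \<beta> \<Lambda> = 0"
      using has_integral_unique[OF e2 e1] by (simp only: G01 diff_self)
    then have "(2 * of_real pi * \<i> * of_real \<Lambda>) * I b j \<alpha> \<beta> \<Lambda>
        = - (I b' (Suc j) \<alpha> \<beta> \<Lambda> + (of_nat (Suc j) * of_real \<beta>) * I ?b2 (Suc (Suc j)) \<alpha> \<beta> \<Lambda>)"
      by (simp only: eq_neg_iff_add_eq_0 add.commute)
    then have "cmod ((2 * of_real pi * \<i> * of_real \<Lambda>) * I b j \<alpha> \<beta> \<Lambda>)
        = cmod (I b' (Suc j) \<alpha> \<beta> \<Lambda> + (of_nat (Suc j) * of_real \<beta>) * I ?b2 (Suc (Suc j)) \<alpha> \<beta> \<Lambda>)"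
      by (simp only: norm_minus_cancel)
    then have "2 * pi * \<Lambda> * cmod (I b j \<alpha> \<beta> \<Lambda>)
        = cmod (I b' (Suc j) \<alpha> \<beta> \<Lambda> + (of_nat (Suc j) * of_real \<beta>) * I ?b2 (Suc (Suc j)) \<alpha> \<beta> \<Lambda>)"
      using \<Lambda> by (simp add: norm_mult)
    also have "\<dots> \<le> C1 / \<Lambda> ^ N + real (Suc j) * (C2 / \<Lambda> ^ N)"
    proof (rule norm_triangle_le[OF add_mono[OF C1[OF g]]])
      have "cmod ((of_nat (Suc j) * of_real \<beta>) * I ?b2 (Suc (Suc j)) \<alpha> \<beta> \<Lambda>)
          = (real (Suc j) * \<bar>\<beta>\<bar>) * cmod (I ?b2 (Suc (Suc j)) \<alpha> \<beta> \<Lambda>)" by (simp add: norm_mult del: of_nat_Suc)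
      also have "\<dots> \<le> (real (Suc j) * 1) * (C2 / \<Lambda> ^ N)"
        by (rule mult_mono[OF mult_left_mono[OF \<beta>] C2[OF g]]) simp_all
      finally show "cmod ((of_nat (Suc j) * of_real \<beta>) * I ?b2 (Suc (Suc j)) \<alpha> \<beta> \<Lambda>) \<le> real (Suc j) * (C2 / \<Lambda> ^ N)" by simp
    qed
    also have "\<dots> = (2 * pi * C) / \<Lambda> ^ N"
    proof -
      have "2 * pi * C = C1 + real (Suc j) * C2" by (simp add: C_def)
      then show ?thesis by (simp only: add_divide_distrib times_divide_eq_right)
    qed
    finally have "cmod (I b j \<alpha> \<beta> \<Lambda>) * (2 * pi * \<Lambda>) \<le> (2 * pi * C) / \<Lambda> ^ N" by (simp only: mult.commute)
    then have "cmod (I b j \<alpha> \<beta> \<Lambda>) \<le> (2 * pi * C) / \<Lambda> ^ N / (2 * pi * \<Lambda>)"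
      using \<Lambda> by (simp only: pos_le_divide_eq mult_pos_pos pi_gt_zero zero_less_numeral)
    also have "\<dots> = C / \<Lambda> ^ Suc N" using \<Lambda> by (simp add: field_simps)
    finally show ?thesis .
  qed
  then show ?case unfolding I_def good_def by blast
qed

text \<open>Free choice of \<Lambda> serves two regimes: a multiple of |m| for decay in the row
  index, and |n| for decay along a fixed row.\<close>

lemma entry_decay:
  assumes "\<delta> > 0"
  shows "\<exists>C. \<forall>m n \<Lambda>. \<Lambda> > 0 \<longrightarrow> \<bar>of_int m\<bar> \<le> \<Lambda> \<longrightarrow> (\<forall>t. \<delta> * \<Lambda> \<le> \<bar>of_int n - of_int m * F 1 t\<bar>) \<longrightarrow>
    cmod (entry 1 m n) \<le> C / \<Lambda> ^ N"
proof -
  obtain C where C: "\<And>\<alpha> \<beta> \<Lambda>. \<Lambda> > 0 \<Longrightarrow> \<bar>\<beta>\<bar> \<le> 1 \<Longrightarrow> (\<And>t. \<delta> \<le> \<bar>\<alpha> - \<beta> * F 1 t\<bar>) \<Longrightarrow>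
      \<Lambda> * \<alpha> \<in> \<int> \<Longrightarrow> \<Lambda> * \<beta> \<in> \<int> \<Longrightarrow>
      cmod (integral {0..1} (\<lambda>t. of_real (1 * inverse (\<alpha> - \<beta> * F 1 t) ^ 0) * em (\<Lambda> * (\<alpha> * t - \<beta> * F 0 t)))) \<le> C / \<Lambda> ^ N"
    using oscillatory_decay[OF assms amp_const[of 1], of 0 N] by blast
  show ?thesis
  proof (intro exI[of _ C] allI impI)
    fix m n :: int and \<Lambda> :: real assume \<Lambda>: "\<Lambda> > 0" and m: "\<bar>of_int m\<bar> \<le> \<Lambda>"
      and W: "\<forall>t. \<delta> * \<Lambda> \<le> \<bar>of_int n - of_int m * F 1 t\<bar>"
    have "\<delta> \<le> \<bar>of_int n / \<Lambda> - of_int m / \<Lambda> * F 1 t\<bar>" for t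
    proof -
      have "of_int n / \<Lambda> - of_int m / \<Lambda> * F 1 t = (of_int n - of_int m * F 1 t) / \<Lambda>" by (simp add: diff_divide_distrib)
      then show ?thesis using W[rule_format, of t] \<Lambda> by (simp add: pos_le_divide_eq)
    qed
    from C[OF \<Lambda> _ this] m \<Lambda>
    have "cmod (integral {0..1} (\<lambda>t. of_real (1 * inverse (of_int n / \<Lambda> - of_int m / \<Lambda> * F 1 t) ^ 0) *
        em (\<Lambda> * (of_int n / \<Lambda> * t - of_int m / \<Lambda> * F 0 t)))) \<le> C / \<Lambda> ^ N" by simp
    moreover have "of_real (1 * inverse (of_int n / \<Lambda> - of_int m / \<Lambda> * F 1 t) ^ 0) * em (\<Lambda> * (of_int n / \<Lambda> * t - of_int m / \<Lambda> * F 0 t))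
        = em (of_int n * t) * em (- (of_int m * (F 0 ^^ 1) t))" for t
      unfolding em_add[symmetric] using \<Lambda> by (simp add: algebra_simps)
    ultimately show "cmod (entry 1 m n) \<le> C / \<Lambda> ^ N" by (simp only: entry_def)
  qed
qed

end

section \<open>Decay and l2 bounds of the Fourier matrix\<close>

context circle_lift
begin

lemma entry_has_integral:
  "((\<lambda>t. em (of_int n * t) * em (- (of_int m * F 0 t))) has_integral entry 1 m n) {0..1}"
proof -
  have "((\<lambda>t. em (of_int n * t) * em (- (of_int m * (F 0 ^^ 1) t))) has_integral entry 1 m n) {0..1}"
    unfolding entry_def by (intro integrable_integral integrable_continuous_interval continuous_intros iterate_continuous)
  then show ?thesis by simp
qed

lemma entry_le_1: "cmod (entry 1 m n) \<le> 1"
proof -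
  have "cmod (integral {0..1} (\<lambda>t. em (of_int n * t) * em (- (of_int m * F 0 t)))) \<le> 1 * (1 - 0)"
    by (rule integral_bound) (auto simp: norm_mult intro!: continuous_intros F_continuous)
  then show ?thesis using integral_unique[OF entry_has_integral] by simp
qed

text \<open>The constant lies strictly between 1 and c. Since it is below c, the derivative of the
  phase is at least (c - k) |m| in absolute value; since it is above 1, its powers can define the
  levels.\<close>

lemma matrix_decay:
  "\<exists>C. \<forall>m n. \<bar>real_of_int n\<bar> \<le> (1 + c) / 2 * \<bar>real_of_int m\<bar> \<longrightarrow>
      cmod (entry 1 m n) \<le> C / brk m ^ K"
proof -
  define k where "k = (1 + c) / 2"
  have k: "k > 1" "k < c" using c by (auto simp: k_def)
  have \<delta>: "(c - k) / k > 0" using k by simp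
  obtain C where C: "\<And>m n \<Lambda>. \<Lambda> > 0 \<Longrightarrow> \<bar>of_int m\<bar> \<le> \<Lambda> \<Longrightarrow> (\<And>t. (c - k) / k * \<Lambda> \<le> \<bar>of_int n - of_int m * F 1 t\<bar>) \<Longrightarrow>
      cmod (entry 1 m n) \<le> C / \<Lambda> ^ K"
    using entry_decay[OF \<delta>, of K] by blast
  have "cmod (entry 1 m n) \<le> (1 + \<bar>C\<bar> * 2 ^ K) / brk m ^ K"
    if mn: "\<bar>real_of_int n\<bar> \<le> k * \<bar>real_of_int m\<bar>" for m n
  \<comment> \<open>Row 0 would give \<Lambda> = 0; the trivial bound by 1 suffices there and is the
    1 added to the constant.\<close>
  proof (cases "m = 0")
    case True
    then show ?thesis using entry_le_1[of m n] by (simp add: add_increasing2)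
  next
    case False
    define \<mu> where "\<mu> = \<bar>real_of_int m\<bar>"
    have \<mu>: "\<mu> \<ge> 1" using False by (simp add: \<mu>_def)
    have k\<mu>: "\<mu> \<le> k * \<mu>" using k \<mu> by simp
    have "(c - k) / k * (k * \<mu>) \<le> \<bar>of_int n - of_int m * F 1 t\<bar>" for t
    proof -
      have "c * \<mu> \<le> \<bar>F 1 t\<bar> * \<mu>" using expand \<mu> by (intro mult_right_mono) auto
      also have "\<dots> = \<bar>of_int m * F 1 t\<bar>" by (simp add: \<mu>_def abs_mult)
      finally have "c * \<mu> - k * \<mu> \<le> \<bar>of_int n - of_int m * F 1 t\<bar>" using mn unfolding \<mu>_def by linarith
      moreover have "(c - k) / k * (k * \<mu>) = c * \<mu> - k * \<mu>" using k by (simp add: field_simps)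
      ultimately show ?thesis by simp
    qed
    then have "cmod (entry 1 m n) \<le> C / (k * \<mu>) ^ K"
      using k \<mu> k\<mu> by (intro C) (auto simp: \<mu>_def)
    also have "\<dots> \<le> \<bar>C\<bar> / (k * \<mu>) ^ K" using k \<mu> by (intro divide_right_mono) auto
    also have "\<dots> \<le> \<bar>C\<bar> / \<mu> ^ K"
      using k\<mu> \<mu> k by (intro divide_left_mono power_mono) auto
    also have "\<dots> = \<bar>C\<bar> * 2 ^ K / (2 * \<mu>) ^ K" by (simp add: power_mult_distrib)
    also have "\<dots> \<le> \<bar>C\<bar> * 2 ^ K / (1 + \<mu>) ^ K"
      using \<mu> by (intro divide_left_mono power_mono) auto
    also have "\<dots> \<le> (1 + \<bar>C\<bar> * 2 ^ K) / (1 + \<mu>) ^ K"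
      using \<mu> by (intro divide_right_mono) auto
    finally show ?thesis by (simp add: \<mu>_def)
  qed
  then show ?thesis unfolding k_def by blast
qed

text \<open>For fixed m and large |n| the term n dominates the derivative of the phase, so \<Lambda>
  = |n| works. The finitely many other n are absorbed into a constant that depends on m.\<close>

lemma matrix_row: "(\<lambda>n. entry 1 m n) abs_summable_on UNIV"
proof -
  obtain B where B: "B \<ge> 0" "\<And>t. norm (F (Suc 0) t) \<le> B"
    using periodic_bounded[OF F_continuous F_per, of 0] by blast
  \<comment> \<open>Bounds both m times the derivative of the lift and |m| itself, as
    \<open>entry_decay\<close> asks for |m| \<le> \<Lambda>.\<close>
  define A where "A = B * \<bar>real_of_int m\<bar> + \<bar>real_of_int m\<bar>"
  have A: "A \<ge> 0" using B by (simp add: A_def)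
  obtain C where C: "\<And>n \<Lambda>. \<Lambda> > 0 \<Longrightarrow> \<bar>of_int m\<bar> \<le> \<Lambda> \<Longrightarrow> (\<And>t. 1 / 2 * \<Lambda> \<le> \<bar>of_int n - of_int m * F 1 t\<bar>) \<Longrightarrow>
      cmod (entry 1 m n) \<le> C / \<Lambda> ^ 2"
  proof -
    have "(0 :: real) < 1 / 2" by simp
    from entry_decay[OF this, of 2] show ?thesis using that by blast
  qed
  have le: "cmod (entry 1 m n) \<le> (4 * \<bar>C\<bar> + (2 + 2 * A)\<^sup>2) * (1 / (brk n)\<^sup>2)" for n
  proof -
    define \<nu> where "\<nu> = \<bar>real_of_int n\<bar>"
    have "cmod (entry 1 m n) \<le> (4 * \<bar>C\<bar> + (2 + 2 * A)\<^sup>2) / (1 + \<nu>)\<^sup>2"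
    proof (cases "1 + 2 * A \<le> \<nu>")
      case True
      then have \<nu>: "\<nu> \<ge> 1" using A by simp
      have "1 / 2 * \<nu> \<le> \<bar>of_int n - of_int m * F 1 t\<bar>" for t
      proof -
        have "\<bar>of_int m * F 1 t\<bar> \<le> \<bar>of_int m\<bar> * B" using B(2)[of t] by (simp add: abs_mult mult_left_mono)
        also have "\<dots> \<le> A" by (simp add: A_def mult.commute)
        finally have "\<nu> - A \<le> \<bar>of_int n - of_int m * F 1 t\<bar>" unfolding \<nu>_def by linarith
        then show ?thesis using True by linarith
      qed
      moreover have "\<bar>real_of_int m\<bar> \<le> A" using B(1) by (simp add: A_def)
      ultimately have "cmod (entry 1 m n) \<le> C / \<nu>\<^sup>2" using \<nu> True A by (intro C) auto
      also have "\<dots> \<le> \<bar>C\<bar> / \<nu>\<^sup>2" by (intro divide_right_mono) auto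
      also have "\<dots> = 4 * \<bar>C\<bar> / (2 * \<nu>)\<^sup>2" by (simp add: power_mult_distrib)
      also have "\<dots> \<le> 4 * \<bar>C\<bar> / (1 + \<nu>)\<^sup>2"
        using \<nu> by (intro divide_left_mono power_mono) auto
      also have "\<dots> \<le> (4 * \<bar>C\<bar> + (2 + 2 * A)\<^sup>2) / (1 + \<nu>)\<^sup>2" by (intro divide_right_mono) auto
      finally show ?thesis .
    next
      case False
      have n0: "0 \<le> \<nu>" by (simp add: \<nu>_def)
      have "(1 + \<nu>)\<^sup>2 \<le> (2 + 2 * A)\<^sup>2" using False n0 by (intro power_mono) auto
      then have "1 * (1 + \<nu>)\<^sup>2 \<le> 4 * \<bar>C\<bar> + (2 + 2 * A)\<^sup>2" by simp
      then have "1 \<le> (4 * \<bar>C\<bar> + (2 + 2 * A)\<^sup>2) / (1 + \<nu>)\<^sup>2"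
        using n0 by (subst pos_le_divide_eq) auto
      then show ?thesis using entry_le_1[of m n] by linarith
    qed
    then show ?thesis by (simp add: \<nu>_def)
  qed
  have "(\<lambda>n. (4 * \<bar>C\<bar> + (2 + 2 * A)\<^sup>2) * (1 / (brk n)\<^sup>2)) summable_on UNIV"
    by (intro summable_on_cmult_right summable_inverse_square_int)
  from Infinite_Sum.abs_summable_on_comparison_test'[OF this le] show ?thesis .
qed

lemma integral_em_lift:
  "((\<lambda>t. em (of_int k * F 0 t) * of_real (F 1 t)) has_integral (if k = 0 then of_int q else 0)) {0..1}"
proof (cases "k = 0")
  case True
  have "((\<lambda>t. complex_of_real (F (Suc 0) t)) has_integral (of_real (F 0 1) - of_real (F 0 0))) {0..1}"
    by (intro fundamental_theorem_of_calculus has_vector_derivative_of_real has_field_derivative_at_within[OF deriv]) simp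
  then show ?thesis using True shift[of 0] by simp
next
  case False
  let ?c = "2 * of_real pi * \<i> * of_int k :: complex"
  have "((\<lambda>t. 1 / ?c * em (of_int k * F 0 t)) has_vector_derivative
      1 / ?c * (2 * of_real pi * \<i> * of_real (of_int k * F (Suc 0) t) * em (of_int k * F 0 t))) (at t within {0..1})" for t
    by (intro has_vector_derivative_mult_right em_has_vector_derivative DERIV_cmult has_field_derivative_at_within[OF deriv])
  then have "((\<lambda>t. 1 / ?c * (2 * of_real pi * \<i> * of_real (of_int k * F (Suc 0) t) * em (of_int k * F 0 t)))
      has_integral (1 / ?c * em (of_int k * F 0 1) - 1 / ?c * em (of_int k * F 0 0))) {0..1}"
    by (intro fundamental_theorem_of_calculus) simp_all
  moreover have "1 / ?c * (2 * of_real pi * \<i> * of_real (of_int k * F (Suc 0) t) * em (of_int k * F 0 t))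
      = em (of_int k * F 0 t) * of_real (F 1 t)" for t using False by simp
  moreover have "em (of_int k * F 0 1) = em (of_int k * F 0 0)"
    using shift[of 0] by (simp add: em_eq_iff algebra_simps)
  ultimately show ?thesis using False by (simp add: mult.commute)
qed

text \<open>A combination of rows lists the Fourier coefficients of a function g of
  \<open>F 0 t\<close>, so Bessel's inequality reduces the claim to the integral of
  \<open>(cmod (g t))\<^sup>2\<close>. Inserting |F'| / c \<ge> 1 turns this into an integral over
  the image, which covers the circle |q| times and where the modes are orthonormal.\<close>

lemma matrix_l2:
  assumes N: "finite N" and S: "finite S"
  shows "(\<Sum>n\<in>N. (cmod (\<Sum>m\<in>S. x m * entry 1 m n))\<^sup>2) \<le> (sqrt (\<bar>of_int q\<bar> / c))\<^sup>2 * (\<Sum>m\<in>S. (cmod (x m))\<^sup>2)"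
proof -
  define g where "g t = (\<Sum>m\<in>S. x m * em (- (of_int m * F 0 t)))" for t
  define X where "X = (\<Sum>m\<in>S. (cmod (x m))\<^sup>2)"
  have gc: "continuous_on {0..1} g" unfolding g_def by (intro continuous_intros F_continuous)
  have "fcoef g (- n) = (\<Sum>m\<in>S. x m * entry 1 m n)" for n
  proof -
    have "((\<lambda>t. \<Sum>m\<in>S. x m * (em (of_int n * t) * em (- (of_int m * F 0 t)))) has_integral (\<Sum>m\<in>S. x m * entry 1 m n)) {0..1}"
      by (intro has_integral_sum S has_integral_mult_right entry_has_integral)
    moreover have "(\<Sum>m\<in>S. x m * (em (of_int n * t) * em (- (of_int m * F 0 t)))) = g t * em (- (of_int (- n) * t))" for t
      unfolding g_def sum_distrib_right by (simp add: mult_ac)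
    ultimately show ?thesis unfolding fcoef_def by (simp add: integral_unique)
  qed
  then have "(\<Sum>n\<in>N. (cmod (\<Sum>m\<in>S. x m * entry 1 m n))\<^sup>2) = (\<Sum>n\<in>uminus ` N. (cmod (fcoef g n))\<^sup>2)"
    by (subst sum.reindex) auto
  also have "\<dots> \<le> integral {0..1} (\<lambda>t. (cmod (g t))\<^sup>2)" using N by (intro bessel_fcoef[OF gc]) simp
  also have "\<dots> \<le> \<bar>of_int q\<bar> / c * X"
  proof -
    have cg: "cnj (g t) = (\<Sum>l\<in>S. cnj (x l) * em (of_int l * F 0 t))" for t by (simp add: g_def cnj_em)
    have "((\<lambda>t. \<Sum>m\<in>S. \<Sum>l\<in>S. (x m * cnj (x l)) * (em (of_int (l - m) * F 0 t) * of_real (F 1 t))) has_integral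
        (\<Sum>m\<in>S. \<Sum>l\<in>S. (x m * cnj (x l)) * (if l - m = 0 then of_int q else 0))) {0..1}"
      by (intro has_integral_sum S has_integral_mult_right integral_em_lift)
    moreover have "(\<Sum>m\<in>S. \<Sum>l\<in>S. (x m * cnj (x l)) * (em (of_int (l - m) * F 0 t) * of_real (F 1 t)))
        = of_real ((cmod (g t))\<^sup>2 * F 1 t)" for t
    proof -
      have "of_real ((cmod (g t))\<^sup>2 * F 1 t) = g t * cnj (g t) * of_real (F 1 t)"
        by (simp only: of_real_mult complex_norm_square)
      also have "\<dots> = (\<Sum>m\<in>S. \<Sum>l\<in>S. (x m * em (- (of_int m * F 0 t))) * (cnj (x l) * em (of_int l * F 0 t)) * of_real (F 1 t))"
      proof -
        have "g t * cnj (g t) = (\<Sum>m\<in>S. \<Sum>l\<in>S. (x m * em (- (of_int m * F 0 t))) * (cnj (x l) * em (of_int l * F 0 t)))"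
          unfolding cg unfolding g_def by (rule sum_product)
        then show ?thesis by (simp only: sum_distrib_right)
      qed
      also have "\<dots> = (\<Sum>m\<in>S. \<Sum>l\<in>S. (x m * cnj (x l)) * (em (of_int (l - m) * F 0 t) * of_real (F 1 t)))"
      proof (intro sum.cong refl)
        fix m l
        have "em (of_int (l - m) * F 0 t) = em (- (of_int m * F 0 t)) * em (of_int l * F 0 t)"
          unfolding em_add[symmetric] by (simp add: algebra_simps)
        then show "(x m * em (- (of_int m * F 0 t))) * (cnj (x l) * em (of_int l * F 0 t)) * of_real (F 1 t)
            = (x m * cnj (x l)) * (em (of_int (l - m) * F 0 t) * of_real (F 1 t))" by (simp only: mult_ac)
      qed
      finally show ?thesis by (rule sym)
    qed
    moreover have "(\<Sum>m\<in>S. \<Sum>l\<in>S. (x m * cnj (x l)) * (if l - m = 0 then of_int q else 0)) = of_real (of_int q * X)"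
    proof -
      have "(\<Sum>l\<in>S. (x m * cnj (x l)) * (if l - m = 0 then of_int q else 0)) = of_int q * of_real ((cmod (x m))\<^sup>2)" if "m \<in> S" for m
      proof -
        have "(\<Sum>l\<in>S. (x m * cnj (x l)) * (if l - m = 0 then of_int q else 0)) = x m * cnj (x m) * of_int q"
          using S that by (simp add: if_distrib[of "\<lambda>y. _ * y"] cong: if_cong)
        then show ?thesis by (simp only: complex_norm_square mult.commute)
      qed
      then show ?thesis
        unfolding X_def of_real_mult of_real_of_int_eq of_real_sum sum_distrib_left by (rule sum.cong[OF refl])
    qed
    ultimately have "((\<lambda>t. complex_of_real ((cmod (g t))\<^sup>2 * F 1 t)) has_integral of_real (of_int q * X)) {0..1}" by (simp only:)
    from has_integral_Re[OF this] have I: "((\<lambda>t. (cmod (g t))\<^sup>2 * F 1 t) has_integral of_int q * X) {0..1}" by simp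
    have gi: "((\<lambda>t. (cmod (g t))\<^sup>2) has_integral integral {0..1} (\<lambda>t. (cmod (g t))\<^sup>2)) {0..1}"
      by (intro integrable_integral integrable_continuous_interval continuous_intros gc)
    obtain s :: real where s: "\<bar>s\<bar> = 1" "\<And>t. \<bar>F 1 t\<bar> = s * F 1 t"
    proof -
      have "F 1 t \<noteq> 0" for t using expand[of t] c by auto
      from nonvanishing_sign[OF deriv this] show ?thesis
      proof
        assume "\<forall>t. F 1 t > 0"
        then show thesis by (intro that[of 1]) (auto simp: abs_of_pos)
      next
        assume "\<forall>t. F 1 t < 0"
        then show thesis by (intro that[of "- 1"]) (auto simp: abs_of_neg)
      qed
    qed
    have "integral {0..1} (\<lambda>t. (cmod (g t))\<^sup>2) * c \<le> s * (of_int q * X)"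
    proof (rule has_integral_le[OF has_integral_mult_left[OF gi] has_integral_mult_right[OF I]])
      fix t
      have "(cmod (g t))\<^sup>2 * c \<le> (cmod (g t))\<^sup>2 * \<bar>F 1 t\<bar>" by (intro mult_left_mono expand) simp
      also have "\<dots> = s * ((cmod (g t))\<^sup>2 * F 1 t)" unfolding s(2) by simp
      finally show "(cmod (g t))\<^sup>2 * c \<le> s * ((cmod (g t))\<^sup>2 * F 1 t)" .
    qed
    also have "\<dots> \<le> \<bar>s * (of_int q * X)\<bar>" by simp
    also have "\<dots> = \<bar>of_int q\<bar> * X" using s(1) by (simp add: abs_mult X_def sum_nonneg)
    finally show ?thesis using c by (simp add: field_simps)
  qed
  finally have "(\<Sum>n\<in>N. (cmod (\<Sum>m\<in>S. x m * entry 1 m n))\<^sup>2) \<le> \<bar>of_int q\<bar> / c * X" .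
  moreover have "(sqrt (\<bar>of_int q\<bar> / c))\<^sup>2 = \<bar>of_int q\<bar> / c" using c by simp
  ultimately show ?thesis by (simp only: X_def)
qed

end

sublocale circle_lift \<subseteq> smoothing_matrix "entry 1" "(1 + c) / 2" "sqrt (\<bar>of_int q\<bar> / c)"
proof
  show "(1 + c) / 2 > 1" "sqrt (\<bar>of_int q\<bar> / c) \<ge> 0" using c by simp_all
qed (rule matrix_decay matrix_row matrix_l2; assumption)+

context circle_lift
begin

lemma ipow_entry: "ipow n m k = entry n m k"
proof (induction n arbitrary: m)
  case 0
  show ?case by (simp only: ipow.simps entry_0)
next
  case (Suc n)
  show ?case by (simp only: ipow.simps Suc.IH infsumI[OF entry_compose[OF matrix_row]])
qed

lemma trace_flat: "(\<Sum>\<^sub>\<infinity>k. ipow (Suc n) k k) = of_real (flat_trace T (Suc n))"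
proof (rule infsumI, rule infsum_eq_symmetric_limit)
  show "(\<lambda>k. ipow (Suc n) k k) abs_summable_on UNIV" by (rule trace_limit(2))
  show "(\<lambda>N. \<Sum>k\<in>{- int N..int N}. ipow (Suc n) k k) \<longlonglongrightarrow> of_real (flat_trace T (Suc n))"
    unfolding ipow_entry by (rule flat_trace_limit) simp
qed

theorem fdet_dyn_det:
  "\<exists>r>0. \<forall>z. cmod z < r \<longrightarrow> summable (dyn_det_term T z) \<and> fdet z = dyn_det T z"
proof -
  have "z ^ Suc n / of_nat (Suc n) * (\<Sum>\<^sub>\<infinity>k. ipow (Suc n) k k) = dyn_det_term T z n" for z n
    unfolding trace_flat dyn_det_term_def by simp
  then show ?thesis using fdet_exp_trace unfolding dyn_det_def by simp
qed

text \<open>A majorant for exchanging sums over both indices. The square growth in n makes the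
  region |m| < |n| trivial, and decaying coefficients compensate it later.\<close>

lemma column_bound: "\<exists>D\<ge>0. \<forall>m n. cmod (entry 1 m n) \<le> D * (brk n)\<^sup>2 * (1 / (brk m)\<^sup>2)"
proof -
  obtain D where D: "\<And>m n. \<bar>real_of_int n\<bar> \<le> (1 + c) / 2 * \<bar>real_of_int m\<bar> \<Longrightarrow>
      cmod (entry 1 m n) \<le> D / brk m ^ 2"
    using matrix_decay[of 2] by blast
  have "cmod (entry 1 m n) \<le> (\<bar>D\<bar> + 1) * (brk n)\<^sup>2 * (1 / (brk m)\<^sup>2)" for m n
  proof (cases "\<bar>real_of_int n\<bar> \<le> \<bar>real_of_int m\<bar>")
    case True
    have "1 * \<bar>real_of_int m\<bar> \<le> (1 + c) / 2 * \<bar>real_of_int m\<bar>" using c by (intro mult_right_mono) auto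
    then have "cmod (entry 1 m n) \<le> D / (brk m)\<^sup>2" using True by (intro D) simp
    also have "\<dots> \<le> ((\<bar>D\<bar> + 1) * (brk n)\<^sup>2) / (brk m)\<^sup>2"
    proof (rule divide_right_mono)
      have "(\<bar>D\<bar> + 1) * 1 \<le> (\<bar>D\<bar> + 1) * (brk n)\<^sup>2" by (intro mult_left_mono one_le_power) auto
      moreover have "D \<le> (\<bar>D\<bar> + 1) * 1" by simp
      ultimately show "D \<le> (\<bar>D\<bar> + 1) * (brk n)\<^sup>2" by (rule order_trans[rotated])
    qed simp
    finally show ?thesis by simp
  next
    case False
    then have "(brk m)\<^sup>2 \<le> (brk n)\<^sup>2" by (intro power_mono) auto
    also have "\<dots> \<le> (\<bar>D\<bar> + 1) * (brk n)\<^sup>2" using mult_right_mono[of 1 "\<bar>D\<bar> + 1" "(brk n)\<^sup>2"] by simp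
    finally have "1 \<le> (\<bar>D\<bar> + 1) * (brk n)\<^sup>2 / (brk m)\<^sup>2"
      by (subst pos_le_divide_eq) (simp_all add: add_pos_nonneg)
    from order_trans[OF entry_le_1 this] show ?thesis by (simp only: times_divide_eq_right mult_1_right)
  qed
  then show ?thesis by (intro exI[of _ "\<bar>D\<bar> + 1"]) auto
qed

text \<open>This identifies the integrals \<open>entry 1 m n\<close> as the matrix of the operator
  \<open>transfer T\<close> in the Fourier modes.\<close>

lemma transfer_mode:
  "((\<lambda>m. entry 1 m n * fourier_mode m p) has_sum transfer T (fourier_mode n) p) UNIV"
proof -
  obtain s where p: "p = to_circle s" using to_circle_rep by metis
  obtain D where D: "\<And>m n. cmod (entry 1 m n) \<le> D * (brk n)\<^sup>2 * (1 / (brk m)\<^sup>2)"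
    using column_bound by blast
  have "(\<lambda>m::int. D * (brk n)\<^sup>2 * (1 / (brk m)\<^sup>2)) summable_on UNIV"
    by (intro summable_on_cmult_right summable_inverse_square_int)
  from Infinite_Sum.abs_summable_on_comparison_test'[OF this D]
  have "(\<lambda>m. entry 1 m n * em (of_int m * s)) abs_summable_on UNIV" by (simp add: norm_mult)
  from infsum_eq_symmetric_limit[OF this transfer_mode_limit] show ?thesis
    by (simp add: p fourier_mode_to_circle)
qed

end

section \<open>Hilbert spaces of Fourier series\<close>

text \<open>Growth of the weights beyond every power of the frequency is what makes all derivatives
  of the Fourier series converge.\<close>

locale fourier_weight =
  fixes w :: "int \<Rightarrow> real"
  assumes w_pos: "\<And>n. w n > 0" and w_growth: "\<And>K::nat. \<exists>C. \<forall>n. brk n ^ K \<le> C * w n"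
begin

definition wsum :: "(int \<Rightarrow> complex) \<Rightarrow> bool" where
  "wsum x \<longleftrightarrow> (\<lambda>n. (w n * cmod (x n))\<^sup>2) summable_on UNIV"

definition wnorm :: "(int \<Rightarrow> complex) \<Rightarrow> real" where
  "wnorm x = sqrt (\<Sum>\<^sub>\<infinity>n. (w n * cmod (x n))\<^sup>2)"

lemma wnorm_nonneg: "0 \<le> wnorm x"
  by (simp add: wnorm_def infsum_nonneg)

lemma coef_le: "wsum x \<Longrightarrow> w n * cmod (x n) \<le> wnorm x"
proof -
  assume "wsum x"
  then have "(\<Sum>n\<in>{n}. (w n * cmod (x n))\<^sup>2) \<le> (\<Sum>\<^sub>\<infinity>n. (w n * cmod (x n))\<^sup>2)"
    unfolding wsum_def by (intro finite_sum_le_infsum) auto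
  then show ?thesis unfolding wnorm_def by (intro real_le_rsqrt) simp
qed

lemma coef_decay:
  "\<exists>C\<ge>0. \<forall>x n. wsum x \<longrightarrow> brk n ^ K * cmod (x n) \<le> C * wnorm x * (1 / (brk n)\<^sup>2)"
proof -
  obtain C where C: "\<And>n. brk n ^ (K + 2) \<le> C * w n" using w_growth[of "K + 2"] by blast
  have "0 < C * w 0" using C[of 0] by simp
  then have C0: "C \<ge> 0" using w_pos[of 0] by (simp add: zero_less_mult_iff)
  have "brk n ^ K * cmod (x n) \<le> C * wnorm x * (1 / (brk n)\<^sup>2)" if x: "wsum x" for x n
  proof -
    define u where "u = 1 + \<bar>real_of_int n\<bar>"
    have u: "u > 0" by (simp add: u_def)
    have "u ^ (K + 2) * cmod (x n) \<le> C * w n * cmod (x n)" using C unfolding u_def by (intro mult_right_mono) auto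
    also have "\<dots> \<le> C * wnorm x" using mult_left_mono[OF coef_le[OF x] C0] by (simp add: mult.assoc)
    finally have "u ^ K * cmod (x n) * u\<^sup>2 \<le> C * wnorm x" by (simp add: power_add power2_eq_square mult_ac)
    then have "u ^ K * cmod (x n) \<le> C * wnorm x / u\<^sup>2" using u by (simp add: pos_le_divide_eq)
    then show ?thesis by (simp add: u_def)
  qed
  then show ?thesis using C0 by blast
qed

definition dterm :: "nat \<Rightarrow> (int \<Rightarrow> complex) \<Rightarrow> int \<Rightarrow> real \<Rightarrow> complex" where
  "dterm k x n t = (2 * of_real pi * \<i> * of_int n) ^ k * x n * em (of_int n * t)"

definition dser :: "nat \<Rightarrow> (int \<Rightarrow> complex) \<Rightarrow> real \<Rightarrow> complex" where
  "dser k x t = (\<Sum>\<^sub>\<infinity>n. dterm k x n t)"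

lemma dterm_bound:
  "\<exists>C\<ge>0. \<forall>x n t. wsum x \<longrightarrow> cmod (dterm k x n t) \<le> C * wnorm x * (1 / (brk n)\<^sup>2)"
proof -
  obtain C where C: "C \<ge> 0" "\<And>x n. wsum x \<Longrightarrow> brk n ^ k * cmod (x n) \<le> C * wnorm x * (1 / (brk n)\<^sup>2)"
    using coef_decay[of k] by blast
  have "cmod (dterm k x n t) \<le> ((2 * pi) ^ k * C) * wnorm x * (1 / (brk n)\<^sup>2)" if x: "wsum x" for x n t
  proof -
    have "cmod (dterm k x n t) = (2 * pi) ^ k * (\<bar>real_of_int n\<bar> ^ k * cmod (x n))"
      by (simp add: dterm_def norm_mult norm_power power_mult_distrib)
    also have "\<dots> \<le> (2 * pi) ^ k * (brk n ^ k * cmod (x n))"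
      by (intro mult_left_mono mult_right_mono power_mono) auto
    also have "\<dots> \<le> (2 * pi) ^ k * (C * wnorm x * (1 / (brk n)\<^sup>2))"
      using C(2)[OF x] by (intro mult_left_mono) auto
    finally show ?thesis by (simp only: mult.assoc)
  qed
  then show ?thesis using C(1) by (intro exI[of _ "(2 * pi) ^ k * C"]) auto
qed

lemma dser_bound: "\<exists>C\<ge>0. \<forall>x t. wsum x \<longrightarrow> cmod (dser k x t) \<le> C * wnorm x"
proof -
  obtain C where C: "C \<ge> 0" "\<And>x n t. wsum x \<Longrightarrow> cmod (dterm k x n t) \<le> C * wnorm x * (1 / (brk n)\<^sup>2)"
    using dterm_bound[of k] by blast
  define Z where "Z = (\<Sum>\<^sub>\<infinity>j::int. 1 / (brk j)\<^sup>2)"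
  have Z: "Z \<ge> 0" unfolding Z_def by (rule infsum_nonneg) simp
  have "cmod (dser k x t) \<le> (C * Z) * wnorm x" if "wsum x" for x t
    using norm_infsum_inverse_square[OF C(2)[OF that, of _ t]] unfolding dser_def Z_def by (simp add: mult_ac)
  then show ?thesis using C(1) Z by (intro exI[of _ "C * Z"]) auto
qed

lemma inverse_square_summable: "(\<lambda>n::int. c * (1 / (brk n)\<^sup>2)) summable_on UNIV"
  by (intro summable_on_cmult_right summable_inverse_square_int)

lemma dterm_summable: "wsum x \<Longrightarrow> (\<lambda>n. dterm k x n t) abs_summable_on UNIV"
proof -
  assume x: "wsum x"
  obtain C where "\<And>n t. cmod (dterm k x n t) \<le> C * wnorm x * (1 / (brk n)\<^sup>2)"
    using dterm_bound[of k] x by blast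
  from Infinite_Sum.abs_summable_on_comparison_test'[OF inverse_square_summable this] show ?thesis .
qed

lemma dser_uniform: "wsum x \<Longrightarrow> uniform_limit UNIV (\<lambda>X t. \<Sum>n\<in>X. dterm k x n t) (dser k x) (finite_subsets_at_top UNIV)"
proof -
  assume x: "wsum x"
  obtain C where C: "\<And>n t. cmod (dterm k x n t) \<le> C * wnorm x * (1 / (brk n)\<^sup>2)"
    using dterm_bound[of k] x by blast
  show ?thesis unfolding dser_def[abs_def] by (rule Weierstrass_m_test_general[OF C inverse_square_summable])
qed

text \<open>Partial sums over symmetric intervals turn the unordered series into a sequence; uniform
  convergence of its derivatives allows termwise differentiation.\<close>

lemma dser_deriv:
  assumes x: "wsum x"
  shows "(dser k x has_vector_derivative dser (Suc k) x t) (at t)"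
proof -
  let ?p = "\<lambda>k N t. \<Sum>n\<in>{- int N..int N}. dterm k x n t"
  have lim: "(\<lambda>N. ?p k N t) \<longlonglongrightarrow> dser k x t" for k t
    by (rule tendsto_uniform_limitI[OF filterlim_compose[OF dser_uniform[OF x] symmetric_intervals_at_top]]) simp
  have "(dterm k x n has_vector_derivative dterm (Suc k) x n t) (at t)" for n t
  proof -
    have "((\<lambda>t. em (of_int n * t)) has_vector_derivative 2 * of_real pi * \<i> * of_real (of_int n) * em (of_int n * t)) (at t)"
      by (rule em_has_vector_derivative) (auto intro!: derivative_eq_intros)
    from has_vector_derivative_mult_right[OF this, of "(2 * of_real pi * \<i> * of_int n) ^ k * x n"]
    show ?thesis by (simp add: dterm_def[abs_def] mult_ac)
  qed
  then have dp: "(?p k N has_derivative (\<lambda>h. h *\<^sub>R ?p (Suc k) N t)) (at t within UNIV)" for N t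
    unfolding has_vector_derivative_def[symmetric] by (intro has_vector_derivative_sum) auto
  have "\<exists>g. \<forall>t\<in>UNIV. (\<lambda>N. ?p k N t) \<longlonglongrightarrow> g t \<and> (g has_derivative (\<lambda>h. h *\<^sub>R dser (Suc k) x t)) (at t within UNIV)"
  proof (rule has_derivative_sequence[OF convex_UNIV dp _ UNIV_I lim[of _ 0]])
    fix e :: real assume e: "e > 0"
    have "\<forall>\<^sub>F N in sequentially. \<forall>t\<in>UNIV. dist (?p (Suc k) N t) (dser (Suc k) x t) < e"
      by (rule uniform_limitD[OF filterlim_compose[OF dser_uniform[OF x] symmetric_intervals_at_top] e])
    then show "\<forall>\<^sub>F N in sequentially. \<forall>t\<in>UNIV. \<forall>h. norm (h *\<^sub>R ?p (Suc k) N t - h *\<^sub>R dser (Suc k) x t) \<le> e * norm h"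
    proof eventually_elim
      case (elim N)
      show ?case
      proof (intro ballI allI)
        fix t h :: real
        have "norm (h *\<^sub>R ?p (Suc k) N t - h *\<^sub>R dser (Suc k) x t) = \<bar>h\<bar> * dist (?p (Suc k) N t) (dser (Suc k) x t)"
          by (simp only: scaleR_diff_right[symmetric] norm_scaleR dist_norm)
        also have "\<dots> \<le> \<bar>h\<bar> * e" using elim by (intro mult_left_mono) (auto simp: less_imp_le)
        finally show "norm (h *\<^sub>R ?p (Suc k) N t - h *\<^sub>R dser (Suc k) x t) \<le> e * norm h" by (simp only: real_norm_def mult.commute)
      qed
    qed
  qed
  then obtain g where g: "\<And>t. (\<lambda>N. ?p k N t) \<longlonglongrightarrow> g t" "\<And>t. (g has_derivative (\<lambda>h. h *\<^sub>R dser (Suc k) x t)) (at t)"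
    by auto
  have "g = dser k x" using LIMSEQ_unique[OF g(1) lim] by blast
  then show ?thesis using g(2) unfolding has_vector_derivative_def by simp
qed

text \<open>Integration of the uniformly convergent series term by term recovers the coefficients;
  this makes the coordinates of a function in \<open>H\<close> well defined.\<close>

lemma fcoef_dser:
  assumes x: "wsum x"
  shows "fcoef (dser 0 x) n = x n"
proof -
  let ?f = "\<lambda>j t. dterm 0 x j t * em (- (of_int n * t))"
  obtain C where C: "\<And>n t. cmod (dterm 0 x n t) \<le> C * wnorm x * (1 / (brk n)\<^sup>2)"
    using dterm_bound[of 0] x by blast
  have hs: "((\<lambda>j. ?f j t) has_sum dser 0 x t * em (- (of_int n * t))) UNIV" for t
    unfolding dser_def by (intro has_sum_cmult_left has_sum_infsum abs_summable_summable[OF dterm_summable[OF x]])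
  have ul: "uniform_limit {0..1} (\<lambda>X t. \<Sum>j\<in>X. ?f j t) (\<lambda>t. dser 0 x t * em (- (of_int n * t))) (finite_subsets_at_top UNIV)"
    by (rule Weierstrass_m_test_general'[OF _ hs inverse_square_summable[of "C * wnorm x"]]) (simp only: norm_mult norm_em mult_1_right C)
  have cont: "continuous_on {0..1} (\<lambda>t. \<Sum>j\<in>X. ?f j t)" for X
    unfolding dterm_def by (intro continuous_intros)
  obtain I J where IJ: "\<And>X. ((\<lambda>t. \<Sum>j\<in>X. ?f j t) has_integral I X) {0..1}"
    "((\<lambda>t. dser 0 x t * em (- (of_int n * t))) has_integral J) {0..1}" "(I \<longlongrightarrow> J) (finite_subsets_at_top UNIV)"
    by (rule uniform_limit_integral[OF ul cont finite_subsets_at_top_neq_bot]) (rule that)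
  have "I X = x n" if "finite X" "n \<in> X" for X
  proof -
    have "(\<lambda>t. \<Sum>j\<in>X. ?f j t) = (\<lambda>t. (\<Sum>j\<in>X. x j * em (of_int j * t)) * em (- (of_int n * t)))"
      by (simp add: dterm_def sum_distrib_right)
    then have "((\<lambda>t. \<Sum>j\<in>X. ?f j t) has_integral x n) {0..1}" using fcoef_trig_poly[OF that, of x] by simp
    then show ?thesis using IJ(1) has_integral_unique by blast
  qed
  then have "\<forall>\<^sub>F X in finite_subsets_at_top UNIV. x n = I X"
    unfolding eventually_finite_subsets_at_top by (intro exI[of _ "{n}"]) auto
  from Lim_transform_eventually[OF tendsto_const this] have "J = x n"
    using tendsto_unique[OF finite_subsets_at_top_neq_bot IJ(3)] by blast
  then show ?thesis using IJ(2) unfolding fcoef_def by (simp add: integral_unique)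
qed

definition synth :: "(int \<Rightarrow> complex) \<Rightarrow> circle \<Rightarrow> complex" where
  "synth x p = (\<Sum>\<^sub>\<infinity>n. x n * fourier_mode n p)"

definition fc :: "(circle \<Rightarrow> complex) \<Rightarrow> int \<Rightarrow> complex" where
  "fc \<phi> n = fcoef (\<lambda>t. \<phi> (to_circle t)) n"

text \<open>Multiplying by the weight turns the weighted condition \<open>wsum\<close> into plain
  square summability, the form expected by \<open>coord_space\<close>.\<close>

definition crd :: "(circle \<Rightarrow> complex) \<Rightarrow> int \<Rightarrow> complex" where
  "crd \<phi> n = of_real (w n) * fc \<phi> n"

text \<open>As an image of coefficient sequences, so that membership supplies a Fourier series
  converging to the function.\<close>

definition H :: "(circle \<Rightarrow> complex) set" where
  "H = synth ` {x. wsum x}"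

lemma synth_to_circle: "synth x (to_circle t) = dser 0 x t"
  by (simp add: synth_def dser_def dterm_def fourier_mode_to_circle)

lemma fc_synth: "wsum x \<Longrightarrow> fc (synth x) = x"
  by (rule ext) (simp add: fc_def synth_to_circle fcoef_dser)

lemma H_synth: "\<phi> \<in> H \<Longrightarrow> wsum (fc \<phi>)" "\<phi> \<in> H \<Longrightarrow> synth (fc \<phi>) = \<phi>"
  by (auto simp: H_def fc_synth)

lemma synth_in: "wsum x \<Longrightarrow> synth x \<in> H" by (simp add: H_def)

lemma synth_has_sum: "wsum x \<Longrightarrow> ((\<lambda>n. x n * fourier_mode n p) has_sum synth x p) UNIV"
proof -
  assume x: "wsum x"
  obtain t where p: "p = to_circle t" using to_circle_rep by metis
  show ?thesis
    unfolding synth_def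
    by (rule has_sum_infsum, rule abs_summable_summable)
       (use dterm_summable[OF x, of 0 t] in \<open>simp add: p fourier_mode_to_circle dterm_def\<close>)
qed

lemma wsum_add: "wsum x \<Longrightarrow> wsum y \<Longrightarrow> wsum (\<lambda>n. x n + y n)"
proof -
  assume xy: "wsum x" "wsum y"
  have s: "(\<lambda>n. 2 * (w n * cmod (x n))\<^sup>2 + 2 * (w n * cmod (y n))\<^sup>2) summable_on UNIV"
    using xy unfolding wsum_def by (intro summable_on_add summable_on_cmult_right)
  have "(\<lambda>n. (w n * cmod (x n + y n))\<^sup>2) abs_summable_on UNIV"
  proof (rule Infinite_Sum.abs_summable_on_comparison_test'[OF s])
    fix n
    have "w n * cmod (x n + y n) \<le> w n * cmod (x n) + w n * cmod (y n)"
      using mult_left_mono[OF norm_triangle_ineq less_imp_le[OF w_pos]] by (simp add: distrib_left)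
    then have "(w n * cmod (x n + y n))\<^sup>2 \<le> (w n * cmod (x n) + w n * cmod (y n))\<^sup>2"
      using less_imp_le[OF w_pos[of n]] by (intro power_mono) auto
    also have "\<dots> \<le> 2 * (w n * cmod (x n))\<^sup>2 + 2 * (w n * cmod (y n))\<^sup>2"
      by (rule sum_squares_bound[THEN order_trans[rotated], THEN order_trans[rotated]] | (simp add: power2_sum, use sum_squares_bound[of "w n * cmod (x n)" "w n * cmod (y n)"] in linarith))
    finally show "norm ((w n * cmod (x n + y n))\<^sup>2) \<le> 2 * (w n * cmod (x n))\<^sup>2 + 2 * (w n * cmod (y n))\<^sup>2" by simp
  qed
  then show ?thesis by (simp add: wsum_def)
qed

lemma wsum_scale: "wsum x \<Longrightarrow> wsum (\<lambda>n. c * x n)"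
proof -
  assume x: "wsum x"
  have "(\<lambda>n. (cmod c)\<^sup>2 * (w n * cmod (x n))\<^sup>2) summable_on UNIV"
    using x unfolding wsum_def by (intro summable_on_cmult_right)
  then show ?thesis by (simp add: wsum_def norm_mult power_mult_distrib mult_ac)
qed

lemma synth_add: "wsum x \<Longrightarrow> wsum y \<Longrightarrow> synth (\<lambda>n. x n + y n) = synth x + synth y"
proof
  fix p assume xy: "wsum x" "wsum y"
  from has_sum_add[OF synth_has_sum[OF xy(1), of p] synth_has_sum[OF xy(2), of p]]
  have "((\<lambda>n. (x n + y n) * fourier_mode n p) has_sum synth x p + synth y p) UNIV" by (simp add: distrib_right)
  then show "synth (\<lambda>n. x n + y n) p = (synth x + synth y) p" unfolding synth_def by (simp add: infsumI)
qed

lemma synth_scale: "wsum x \<Longrightarrow> synth (\<lambda>n. c * x n) = cscale c (synth x)"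
proof
  fix p assume x: "wsum x"
  from has_sum_cmult_right[OF synth_has_sum[OF x, of p], of c]
  have "((\<lambda>n. c * x n * fourier_mode n p) has_sum c * synth x p) UNIV" by (simp add: mult.assoc)
  then show "synth (\<lambda>n. c * x n) p = cscale c (synth x) p" unfolding synth_def cscale_def by (simp add: infsumI)
qed

lemma wsum_unit: "wsum (\<lambda>n. if n = k then 1 else 0)"
proof -
  have "((\<lambda>n. (w n * cmod (if n = k then 1 else 0))\<^sup>2) has_sum (w k)\<^sup>2) UNIV"
    by (rule has_sum_finite_neutralI[where B = "{k}"]) auto
  then show ?thesis unfolding wsum_def by (rule has_sum_imp_summable)
qed

lemma synth_unit: "synth (\<lambda>n. if n = k then 1 else 0) = fourier_mode k"
proof
  fix p
  have "((\<lambda>n. (if n = k then 1 else 0) * fourier_mode n p) has_sum fourier_mode k p) UNIV"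
    by (rule has_sum_finite_neutralI[where B = "{k}"]) auto
  then show "synth (\<lambda>n. if n = k then 1 else 0) p = fourier_mode k p" unfolding synth_def by (rule infsumI)
qed

lemma mode_in: "fourier_mode k \<in> H"
  using synth_in[OF wsum_unit[of k]] by (simp only: synth_unit)

lemma fc_mode: "fc (fourier_mode k) n = (if n = k then 1 else 0)"
  using fc_synth[OF wsum_unit[of k]] by (simp only: synth_unit)

lemma zero_in: "0 \<in> H"
  using synth_in[OF wsum_scale[OF wsum_unit[of 0], of 0]] synth_scale[OF wsum_unit[of 0], of 0] by (simp add: cscale_def zero_fun_def)

lemma H_add: "\<phi> \<in> H \<Longrightarrow> \<psi> \<in> H \<Longrightarrow> \<phi> + \<psi> \<in> H \<and> fc (\<phi> + \<psi>) = (\<lambda>n. fc \<phi> n + fc \<psi> n)"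
proof -
  assume h: "\<phi> \<in> H" "\<psi> \<in> H"
  let ?x = "\<lambda>n. fc \<phi> n + fc \<psi> n"
  have x: "wsum ?x" using h by (intro wsum_add H_synth)
  have "\<phi> + \<psi> = synth ?x" using synth_add[OF H_synth(1)[OF h(1)] H_synth(1)[OF h(2)]] H_synth(2) h by simp
  then show ?thesis using synth_in[OF x] fc_synth[OF x] by simp
qed

lemma H_scale: "\<phi> \<in> H \<Longrightarrow> cscale c \<phi> \<in> H \<and> fc (cscale c \<phi>) = (\<lambda>n. c * fc \<phi> n)"
proof -
  assume h: "\<phi> \<in> H"
  let ?x = "\<lambda>n. c * fc \<phi> n"
  have x: "wsum ?x" using h by (intro wsum_scale H_synth)
  have "cscale c \<phi> = synth ?x" using synth_scale[OF H_synth(1)[OF h]] H_synth(2) h by simp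
  then show ?thesis using synth_in[OF x] fc_synth[OF x] by simp
qed

sublocale coord_space H crd
proof
  show "cfun.subspace H"
    by (rule cfun.subspaceI) (use zero_in H_add H_scale in auto)
  show "crd (f + g) n = crd f n + crd g n" if "f \<in> H" "g \<in> H" for f g n
    using H_add[OF that] by (simp add: crd_def distrib_left)
  show "crd (cscale c f) n = c * crd f n" if "f \<in> H" for f c n
    using H_scale[OF that] by (simp add: crd_def)
  show "f = 0" if "f \<in> H" "\<And>n. crd f n = 0" for f
  proof -
    have "fc f = (\<lambda>n. 0)" using that(2) w_pos by (simp add: crd_def fun_eq_iff less_imp_neq[symmetric])
    then have "f = synth (\<lambda>n. 0)" using H_synth(2)[OF that(1)] by simp
    then show ?thesis by (simp add: synth_def[abs_def] zero_fun_def)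
  qed
  show "(\<lambda>n. (cmod (crd f n))\<^sup>2) summable_on UNIV" if "f \<in> H" for f
    using H_synth(1)[OF that] w_pos unfolding wsum_def by (simp add: crd_def norm_mult abs_of_pos)
  show "\<exists>f\<in>H. \<forall>n. crd f n = x n" if x: "(\<lambda>n. (cmod (x n))\<^sup>2) summable_on UNIV" for x
  proof -
    let ?y = "\<lambda>n. x n / of_real (w n)"
    have "w n * cmod (?y n) = cmod (x n)" for n using w_pos[of n] by (simp add: norm_divide)
    then have y: "wsum ?y" using x by (simp add: wsum_def)
    have "crd (synth ?y) n = x n" for n using w_pos[of n] by (simp add: crd_def fc_synth[OF y])
    then show ?thesis using synth_in[OF y] by blast
  qed
qed

lemma norm_eq: "f \<in> H \<Longrightarrow> hnorm cip f = wnorm (fc f)"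
  using w_pos by (simp add: cnorm wnorm_def crd_def norm_mult abs_of_pos)

lemma dser_higher_deriv: "wsum x \<Longrightarrow> (vderiv ^^ k) (dser 0 x) = dser k x"
proof (induction k)
  case (Suc k)
  have "vderiv (dser k x) t = dser (Suc k) x t" for t
    unfolding vderiv_def by (rule vector_derivative_at[OF dser_deriv[OF Suc.prems]])
  then have "vderiv (dser k x) = dser (Suc k) x" by (rule ext)
  then show ?case using Suc.IH[OF Suc.prems] by simp
qed simp

lemma H_deriv: "f \<in> H \<Longrightarrow> (vderiv ^^ k) (f \<circ> to_circle) = dser k (fc f)"
proof -
  assume f: "f \<in> H"
  have "f \<circ> to_circle = dser 0 (fc f)"
    using H_synth(2)[OF f] by (simp add: fun_eq_iff synth_to_circle[symmetric])
  then show ?thesis using dser_higher_deriv[OF H_synth(1)[OF f]] by simp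
qed

lemma H_Cinf: "H \<subseteq> Cinf"
proof
  fix f assume f: "f \<in> H"
  show "f \<in> Cinf"
    unfolding Cinf_def smooth_on_def H_deriv[OF f] mem_Collect_eq
    using dser_deriv[OF H_synth(1)[OF f]] differentiableI_vector by blast
qed

lemma seminorm_bound: "\<exists>C\<ge>0. \<forall>f\<in>H. Cinf_seminorm k f \<le> C * hnorm cip f"
proof -
  obtain C where C: "C \<ge> 0" "\<And>x t. wsum x \<Longrightarrow> cmod (dser k x t) \<le> C * wnorm x" using dser_bound[of k] by blast
  have "Cinf_seminorm k f \<le> C * hnorm cip f" if f: "f \<in> H" for f
    unfolding Cinf_seminorm_def H_deriv[OF f] norm_eq[OF f]
    by (rule cSUP_least) (use C(2)[OF H_synth(1)[OF f]] in auto)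
  then show ?thesis using C(1) by blast
qed

end

section \<open>Smooth functions and their seminorms\<close>

lemma Cinf_has_deriv:
  "\<phi> \<in> Cinf \<Longrightarrow> ((vderiv ^^ k) (\<phi> \<circ> to_circle) has_vector_derivative (vderiv ^^ Suc k) (\<phi> \<circ> to_circle) t) (at t)"
  unfolding Cinf_def smooth_on_def by (simp add: vderiv_def vector_derivative_works)

lemma Cinf_add:
  assumes "\<phi> \<in> Cinf" "\<psi> \<in> Cinf"
  shows "(vderiv ^^ k) ((\<lambda>x. \<phi> x + c * \<psi> x) \<circ> to_circle) =
    (\<lambda>t. (vderiv ^^ k) (\<phi> \<circ> to_circle) t + c * (vderiv ^^ k) (\<psi> \<circ> to_circle) t)"
proof (induction k)
  case 0
  show ?case by (simp add: fun_eq_iff)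
next
  case (Suc k)
  have "((\<lambda>t. (vderiv ^^ k) (\<phi> \<circ> to_circle) t + c * (vderiv ^^ k) (\<psi> \<circ> to_circle) t) has_vector_derivative
      (vderiv ^^ Suc k) (\<phi> \<circ> to_circle) t + c * (vderiv ^^ Suc k) (\<psi> \<circ> to_circle) t) (at t)" for t
    by (intro has_vector_derivative_add has_vector_derivative_mult_right Cinf_has_deriv assms)
  then have "vderiv ((vderiv ^^ k) ((\<lambda>x. \<phi> x + c * \<psi> x) \<circ> to_circle)) =
      (\<lambda>t. (vderiv ^^ Suc k) (\<phi> \<circ> to_circle) t + c * (vderiv ^^ Suc k) (\<psi> \<circ> to_circle) t)"
    unfolding Suc.IH by (intro ext vector_derivative_at[folded vderiv_def])
  then show ?case by (subst funpow.simps(2), subst o_apply)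
qed

lemma Cinf_add_in:
  assumes "\<phi> \<in> Cinf" "\<psi> \<in> Cinf"
  shows "(\<lambda>x. \<phi> x + c * \<psi> x) \<in> Cinf"
proof -
  have "((\<lambda>t. (vderiv ^^ k) (\<phi> \<circ> to_circle) t + c * (vderiv ^^ k) (\<psi> \<circ> to_circle) t) has_vector_derivative
      (vderiv ^^ Suc k) (\<phi> \<circ> to_circle) t + c * (vderiv ^^ Suc k) (\<psi> \<circ> to_circle) t) (at t)" for t k
    by (intro has_vector_derivative_add has_vector_derivative_mult_right Cinf_has_deriv assms)
  then show ?thesis
    unfolding Cinf_def smooth_on_def mem_Collect_eq Cinf_add[OF assms] using differentiableI_vector by blast
qed

text \<open>Derivatives of a function lifted from the circle are continuous and periodic, hence
  bounded. This gives the \<open>SUP\<close> in \<open>Cinf_seminorm\<close> its meaning as a least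
  upper bound.\<close>

lemma Cinf_bounded:
  assumes \<phi>: "\<phi> \<in> Cinf"
  shows "\<exists>B. \<forall>t. cmod ((vderiv ^^ k) (\<phi> \<circ> to_circle) t) \<le> B"
proof -
  have per: "(vderiv ^^ k) (\<phi> \<circ> to_circle) (t + 1) = (vderiv ^^ k) (\<phi> \<circ> to_circle) t" for t
  proof (induction k arbitrary: t)
    case 0
    have "to_circle (t + 1) = to_circle t" by (simp add: to_circle_eq_iff)
    then show ?case by simp
  next
    case (Suc k)
    let ?g = "(vderiv ^^ k) (\<phi> \<circ> to_circle)"
    have "((\<lambda>t. t + 1) has_vector_derivative 1) (at t)" by (auto intro!: derivative_eq_intros)
    from vector_diff_chain_at[OF this Cinf_has_deriv[OF \<phi>, of k "t + 1"]]
    have "((\<lambda>t. ?g (t + 1)) has_vector_derivative (vderiv ^^ Suc k) (\<phi> \<circ> to_circle) (t + 1)) (at t)"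
      by (simp only: o_def scaleR_one)
    then have "(?g has_vector_derivative (vderiv ^^ Suc k) (\<phi> \<circ> to_circle) (t + 1)) (at t)" by (simp only: Suc.IH)
    then show ?case using vector_derivative_unique_at[OF _ Cinf_has_deriv[OF \<phi>]] by blast
  qed
  have "continuous_on UNIV ((vderiv ^^ k) (\<phi> \<circ> to_circle))"
    using has_vector_derivative_continuous[OF Cinf_has_deriv[OF \<phi>]] by (simp add: continuous_at_imp_continuous_on)
  from periodic_bounded[OF this per] show ?thesis by blast
qed

lemma seminorm_triangle:
  assumes "\<phi> \<in> Cinf" "\<psi> \<in> Cinf"
  shows "Cinf_seminorm k (\<phi> + \<psi>) \<le> Cinf_seminorm k \<phi> + Cinf_seminorm k \<psi>"
proof -
  have le: "cmod ((vderiv ^^ k) (\<eta> \<circ> to_circle) t) \<le> Cinf_seminorm k \<eta>" if \<eta>: "\<eta> \<in> Cinf" for \<eta> t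
  proof -
    obtain B where B: "\<And>t. cmod ((vderiv ^^ k) (\<eta> \<circ> to_circle) t) \<le> B" using Cinf_bounded[OF \<eta>] by blast
    show ?thesis unfolding Cinf_seminorm_def by (rule cSUP_upper[OF UNIV_I]) (rule bdd_aboveI2[OF B])
  qed
  have eq: "\<phi> + \<psi> = (\<lambda>x. \<phi> x + 1 * \<psi> x)" by (simp add: fun_eq_iff)
  show ?thesis
    unfolding eq unfolding Cinf_seminorm_def[of k "\<lambda>x. \<phi> x + 1 * \<psi> x"] Cinf_add[OF assms]
    by (rule cSUP_least) (auto intro!: norm_triangle_le add_mono le assms)
qed

context fourier_weight
begin

lemma identity_continuous: "continuous_map (htop H cip) Cinf_topology (\<lambda>\<phi>. \<phi>)"
  unfolding Cinf_topology_def
proof (rule continuous_on_generated_topo)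
  fix U assume "U \<in> {{\<psi> \<in> Cinf. Cinf_seminorm k (\<psi> - \<phi>) < \<epsilon>} | k \<phi> \<epsilon>. \<phi> \<in> Cinf \<and> \<epsilon> > 0}"
  then obtain k \<phi> \<epsilon> where U: "U = {\<psi> \<in> Cinf. Cinf_seminorm k (\<psi> - \<phi>) < \<epsilon>}" "\<phi> \<in> Cinf" by blast
  have "\<exists>r>0. M.mball \<psi> r \<subseteq> U \<inter> H" if \<psi>: "\<psi> \<in> U \<inter> H" for \<psi>
  proof -
    obtain C where C: "C \<ge> 0" "\<And>f. f \<in> H \<Longrightarrow> Cinf_seminorm k f \<le> C * hnorm cip f" using seminorm_bound[of k] by blast
    \<comment> \<open>The room left in the subbasic set, divided by the constant of
      \<open>seminorm_bound\<close> plus 1; the 1 avoids division by 0 and makes the final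
      inequality strict.\<close>
    define r where "r = (\<epsilon> - Cinf_seminorm k (\<psi> - \<phi>)) / (C + 1)"
    have r: "r > 0" using \<psi> C(1) unfolding r_def U by (intro divide_pos_pos) auto
    have diff: "\<psi> - \<phi> = (\<lambda>x. \<psi> x + (- 1) * \<phi> x)" by (simp add: fun_eq_iff)
    have d: "\<psi> - \<phi> \<in> Cinf" unfolding diff using \<psi> U by (intro Cinf_add_in) auto
    have "\<eta> \<in> U \<inter> H" if "\<eta> \<in> M.mball \<psi> r" for \<eta>
    proof -
      have \<eta>: "\<eta> \<in> H" "hdist H cip \<psi> \<eta> < r" using that by auto
      have pH: "\<psi> \<in> H" using \<psi> by blast
      have "hnorm cip (\<eta> - \<psi>) < r" using \<eta> pH hnorm_minus_commute[of \<psi> \<eta>] by (simp add: hdist_eq)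
      have dH: "\<eta> - \<psi> \<in> H" using \<eta>(1) pH by (rule diffH)
      have "\<eta> - \<phi> = (\<eta> - \<psi>) + (\<psi> - \<phi>)" by simp
      then have "Cinf_seminorm k (\<eta> - \<phi>) \<le> Cinf_seminorm k (\<eta> - \<psi>) + Cinf_seminorm k (\<psi> - \<phi>)"
        using seminorm_triangle[of "\<eta> - \<psi>" "\<psi> - \<phi>"] dH d H_Cinf by auto
      also have "\<dots> \<le> C * hnorm cip (\<eta> - \<psi>) + Cinf_seminorm k (\<psi> - \<phi>)" using C(2)[OF dH] by simp
      also have "\<dots> \<le> C * r + Cinf_seminorm k (\<psi> - \<phi>)"
        using \<open>hnorm cip (\<eta> - \<psi>) < r\<close> C(1) by (intro add_right_mono mult_left_mono) auto
      also have "\<dots> < (C + 1) * r + Cinf_seminorm k (\<psi> - \<phi>)" using r by (simp add: algebra_simps)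
      also have "\<dots> = \<epsilon>" using C(1) by (simp add: r_def)
      finally show ?thesis using \<eta>(1) H_Cinf by (auto simp: U)
    qed
    then show ?thesis using r by blast
  qed
  then have "openin M.mtopology (U \<inter> H)" unfolding M.openin_mtopology by blast
  then show "openin (htop H cip) ((\<lambda>\<phi>. \<phi>) -` U \<inter> topspace (htop H cip))" by simp
next
  show "(\<lambda>\<phi>. \<phi>) ` topspace (htop H cip) \<subseteq> \<Union> {{\<psi> \<in> Cinf. Cinf_seminorm k (\<psi> - \<phi>) < \<epsilon>} | k \<phi> \<epsilon>. \<phi> \<in> Cinf \<and> \<epsilon> > 0}"
  proof
    fix \<psi> assume "\<psi> \<in> (\<lambda>\<phi>. \<phi>) ` topspace (htop H cip)"
    then have \<psi>: "\<psi> \<in> Cinf" using H_Cinf by auto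
    have lt: "Cinf_seminorm 0 0 < 1" by (simp add: Cinf_seminorm_def)
    show "\<psi> \<in> \<Union> {{\<psi> \<in> Cinf. Cinf_seminorm k (\<psi> - \<phi>) < \<epsilon>} | k \<phi> \<epsilon>. \<phi> \<in> Cinf \<and> \<epsilon> > 0}"
    proof (rule UnionI)
      show "{\<eta> \<in> Cinf. Cinf_seminorm 0 (\<eta> - \<psi>) < 1} \<in>
          {{\<psi> \<in> Cinf. Cinf_seminorm k (\<psi> - \<phi>) < \<epsilon>} | k \<phi> \<epsilon>. \<phi> \<in> Cinf \<and> \<epsilon> > 0}"
        by (rule CollectI, rule exI[of _ 0], rule exI[of _ \<psi>], rule exI[of _ 1]) (simp add: \<psi>)
    qed (use \<psi> lt in simp)
  qed
qed

lemma bas_mode: "bas k = cscale (1 / of_real (w k)) (fourier_mode k)"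
proof -
  have b: "cscale (1 / of_real (w k)) (fourier_mode k) \<in> H" using H_scale mode_in by blast
  have "bas k - cscale (1 / of_real (w k)) (fourier_mode k) = 0"
  proof (rule crd_inj)
    show "bas k - cscale (1 / of_real (w k)) (fourier_mode k) \<in> H" by (rule diffH[OF bas(1) b])
    fix n
    show "crd (bas k - cscale (1 / of_real (w k)) (fourier_mode k)) n = 0"
      using H_scale[OF mode_in[of k], of "1 / of_real (w k)"] w_pos[of k]
      by (simp add: crd_diff[OF bas(1) b] bas crd_def[of "cscale _ _"] fc_mode)
  qed
  then show ?thesis by simp
qed

lemma trig_polys_dense: "trig_polys \<subseteq> H" "htop H cip closure_of trig_polys = H"
proof -
  show sub: "trig_polys \<subseteq> H"
    unfolding trig_polys_def by (rule cfun.span_minimal[OF _ subspace]) (use mode_in in blast)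
  have "cfun.span (range bas) \<subseteq> trig_polys"
    unfolding trig_polys_def
    by (rule cfun.span_minimal[OF _ cfun.subspace_span]) (auto simp: bas_mode intro: cfun.span_scale cfun.span_base)
  then have "htop H cip closure_of (cfun.span (range bas)) \<subseteq> htop H cip closure_of trig_polys"
    by (rule closure_of_mono)
  moreover have "htop H cip closure_of (cfun.span (range bas)) = H"
    using orthonormal_bas by (simp add: orthonormal_basis_def)
  moreover have "htop H cip closure_of trig_polys \<subseteq> H"
    using closure_of_subset_topspace[of "htop H cip" trig_polys] by simp
  ultimately show "htop H cip closure_of trig_polys = H" by blast
qed

end

section \<open>The decomposition of the transfer operator\<close>

text \<open>The weights are fixed only after the lift, since admissibility refers to the Fourier
  matrix that the lift determines.\<close>

locale circle_space = circle_lift +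
  fixes a :: "nat \<Rightarrow> real"
  assumes adm: "admissible a"
begin

lemma weight_growth: "\<exists>C. \<forall>n. brk n ^ K \<le> C * a (lev n)"
proof -
  let ?k = "(1 + c) / 2"
  obtain e where e: "e > 0" "\<And>i. e * ?k ^ (K * i) \<le> a i" using adm unfolding admissible_def by blast
  have "brk n ^ K \<le> 2 ^ K / e * a (lev n)" for n
  proof -
    have "brk n ^ K \<le> (2 * ?k ^ lev n) ^ K" by (intro power_mono lev_power_ge) simp
    also have "\<dots> = 2 ^ K * ?k ^ (K * lev n)" by (simp only: power_mult_distrib power_mult[symmetric] mult.commute)
    also have "\<dots> = 2 ^ K / e * (e * ?k ^ (K * lev n))" using e(1) by simp
    also have "\<dots> \<le> 2 ^ K / e * a (lev n)" using e by (intro mult_left_mono) auto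
    finally show ?thesis .
  qed
  then show ?thesis by blast
qed

sublocale fourier_weight "\<lambda>n. a (lev n)"
  by unfold_locales (rule a_pos[OF adm], rule weight_growth)

lemma wsum_ws: "wsum = ws a" by (simp add: fun_eq_iff wsum_def ws_def)

lemma wnorm_wn: "wnorm = wn a" by (simp add: fun_eq_iff wnorm_def wn_def)

lemma lower_ws: "\<exists>B\<ge>0. \<forall>x. wsum x \<longrightarrow> wsum (lower x) \<and> wnorm (lower x) \<le> B * wnorm x"
proof -
  obtain B where B: "B \<ge> 0" "\<And>j x. ws a x \<Longrightarrow> ws a ((lower ^^ j) x) \<and> wn a ((lower ^^ j) x) \<le> B * 1 ^ j * wn a x"
  proof -
    have "(0 :: real) < 1" by simp
    from lower_iterates[OF adm this] show ?thesis using that by blast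
  qed
  show ?thesis unfolding wsum_ws wnorm_wn using B(1) B(2)[of _ 1] by (intro exI[of _ B]) simp
qed

lemma upper_ws: "wsum x \<Longrightarrow> wsum (upper x)"
proof -
  assume x: "wsum x"
  obtain C where C: "\<And>m x. ws a x \<Longrightarrow> a (lev m) * cmod (upper x m) \<le> C / brk m ^ 1 * wn a x"
    using upper_rapid[OF adm, of 1] by blast
  have "(a (lev m) * cmod (upper x m))\<^sup>2 \<le> (C * wn a x)\<^sup>2 * (1 / (brk m)\<^sup>2)" for m
  proof -
    have "(a (lev m) * cmod (upper x m))\<^sup>2 \<le> (C / brk m ^ 1 * wn a x)\<^sup>2"
      using x C[of x m] a_pos[OF adm, of "lev m"] unfolding wsum_ws by (intro power_mono) auto
    then show ?thesis by (simp add: power_mult_distrib power_divide)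
  qed
  then have "(\<lambda>m. (a (lev m) * cmod (upper x m))\<^sup>2) abs_summable_on UNIV"
    by (intro Infinite_Sum.abs_summable_on_comparison_test'[OF inverse_square_summable[of "(C * wn a x)\<^sup>2"]]) simp
  then show ?thesis by (simp add: wsum_def)
qed

definition Lb :: "(circle \<Rightarrow> complex) \<Rightarrow> circle \<Rightarrow> complex" where
  "Lb \<phi> = synth (lower (fc \<phi>))"

definition Lc :: "(circle \<Rightarrow> complex) \<Rightarrow> circle \<Rightarrow> complex" where
  "Lc \<phi> = synth (upper (fc \<phi>))"

lemma Lb_in: "\<phi> \<in> H \<Longrightarrow> Lb \<phi> \<in> H" and fc_Lb: "\<phi> \<in> H \<Longrightarrow> fc (Lb \<phi>) = lower (fc \<phi>)"
  using lower_ws H_synth(1) by (auto simp: Lb_def synth_in fc_synth)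

lemma Lc_in: "\<phi> \<in> H \<Longrightarrow> Lc \<phi> \<in> H" and fc_Lc: "\<phi> \<in> H \<Longrightarrow> fc (Lc \<phi>) = upper (fc \<phi>)"
  using upper_ws H_synth(1) by (auto simp: Lc_def synth_in fc_synth)

lemma wsum_bounded: "wsum x \<Longrightarrow> \<exists>B. \<forall>n. cmod (x n) \<le> B"
  using ws_bounded[OF adm] unfolding wsum_ws by blast

lemma linear_synth:
  assumes A: "\<And>x. wsum x \<Longrightarrow> wsum (A x)"
    and add: "\<And>x y m. wsum x \<Longrightarrow> wsum y \<Longrightarrow> A (\<lambda>n. x n + y n) m = A x m + A y m"
    and scale: "\<And>k x m. A (\<lambda>n. k * x n) m = k * A x m"
  shows "linear_op H (\<lambda>\<phi>. synth (A (fc \<phi>)))"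
  unfolding linear_op_def
proof (intro conjI ballI allI)
  show "(\<lambda>\<phi>. synth (A (fc \<phi>))) ` H \<subseteq> H" using A H_synth(1) synth_in by blast
  fix f assume f: "f \<in> H"
  note wf = H_synth(1)[OF f]
  show "synth (A (fc (f + g))) = synth (A (fc f)) + synth (A (fc g))" if g: "g \<in> H" for g
  proof -
    have "A (\<lambda>n. fc f n + fc g n) = (\<lambda>m. A (fc f) m + A (fc g) m)" by (intro ext add wf H_synth(1)[OF g])
    then show ?thesis using H_add[OF f g] synth_add[OF A[OF wf] A[OF H_synth(1)[OF g]]] by simp
  qed
  show "synth (A (fc (cscale k f))) = cscale k (synth (A (fc f)))" for k
  proof -
    have "A (\<lambda>n. k * fc f n) = (\<lambda>m. k * A (fc f) m)" by (intro ext scale)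
    then show ?thesis using H_scale[OF f, of k] synth_scale[OF A[OF wf], of k] by simp
  qed
qed

lemma linear_Lb: "linear_op H Lb"
  unfolding Lb_def[abs_def]
proof (rule linear_synth)
  show "wsum (lower x)" if "wsum x" for x using lower_ws that by blast
  show "lower (\<lambda>n. x n + y n) m = lower x m + lower y m" if xy: "wsum x" "wsum y" for x y m
  proof -
    obtain B B' where "\<And>n. cmod (x n) \<le> B" "\<And>n. cmod (y n) \<le> B'" using xy wsum_bounded by metis
    then show ?thesis by (rule lower_add)
  qed
qed (rule lower_scale)

lemma linear_Lc: "linear_op H Lc"
  unfolding Lc_def[abs_def] by (rule linear_synth[OF upper_ws upper_add upper_scale])

lemma Lb_iterates:
  assumes "\<delta> > 0"
  shows "\<exists>B\<ge>0. \<forall>n. \<forall>f\<in>H. hnorm cip ((Lb ^^ n) f) \<le> B * \<delta> ^ n * hnorm cip f"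
proof -
  obtain B where B: "B \<ge> 0" "\<And>j x. ws a x \<Longrightarrow> wn a ((lower ^^ j) x) \<le> B * \<delta> ^ j * wn a x"
    using lower_iterates[OF adm assms] by blast
  have it: "(Lb ^^ n) f \<in> H \<and> fc ((Lb ^^ n) f) = (lower ^^ n) (fc f)" if f: "f \<in> H" for n f
    by (induction n) (use f in \<open>simp_all add: Lb_in fc_Lb\<close>)
  have "hnorm cip ((Lb ^^ n) f) \<le> B * \<delta> ^ n * hnorm cip f" if f: "f \<in> H" for n f
    using it[OF f, of n] B(2)[of "fc f" n] H_synth(1)[OF f] f by (simp add: norm_eq wnorm_wn wsum_ws)
  then show ?thesis using B(1) by blast
qed

text \<open>Stated for every finite F above a section, so that one F can serve for the tails of
  \<open>Lb\<close> and of \<open>Lc\<close> in the compactness of their sum.\<close>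

lemma Lb_tail:
  assumes "\<epsilon> > 0"
  shows "\<exists>N. \<forall>F f. finite F \<longrightarrow> sect N \<subseteq> F \<longrightarrow> f \<in> H \<longrightarrow> hnorm cip f \<le> 1 \<longrightarrow> hnorm cip (Lb f - trunc F (Lb f)) \<le> \<epsilon>"
proof -
  obtain N where N: "\<And>x G. ws a x \<Longrightarrow> finite G \<Longrightarrow> G \<subseteq> {m. N < lev m} \<Longrightarrow>
      (\<Sum>m\<in>G. (a (lev m) * cmod (lower x m))\<^sup>2) \<le> (\<epsilon> * wn a x)\<^sup>2"
    using lower_small_tail[OF adm assms] by blast
  have "hnorm cip (Lb f - trunc F (Lb f)) \<le> \<epsilon>"
    if F: "finite F" "sect N \<subseteq> F" and f: "f \<in> H" "hnorm cip f \<le> 1" for F f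
  proof (rule cnorm_leI)
    note L = Lb_in[OF f(1)]
    show "Lb f - trunc F (Lb f) \<in> H" by (rule diffH[OF L trunc(1)])
    show "0 \<le> \<epsilon>" using assms by simp
    fix G :: "int set" assume G: "finite G"
    have c: "cmod (crd (Lb f - trunc F (Lb f)) m) = (if m \<in> F then 0 else a (lev m) * cmod (lower (fc f) m))" for m
      using a_pos[OF adm, of "lev m"]
      by (simp add: crd_diff[OF L trunc(1)] trunc(2)[OF F(1)] crd_def[of "Lb f"] fc_Lb[OF f(1)] norm_mult)
    have "(\<Sum>m\<in>G. (cmod (crd (Lb f - trunc F (Lb f)) m))\<^sup>2) = (\<Sum>m\<in>G - F. (a (lev m) * cmod (lower (fc f) m))\<^sup>2)"
      unfolding c using G by (intro sum.mono_neutral_cong_right) auto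
    also have "\<dots> \<le> (\<epsilon> * wn a (fc f))\<^sup>2"
    proof (rule N)
      show "ws a (fc f)" using H_synth(1)[OF f(1)] by (simp add: wsum_ws)
      show "G - F \<subseteq> {m. N < lev m}"
      proof
        fix m assume "m \<in> G - F"
        then have "m \<notin> sect N" using F(2) by blast
        then show "m \<in> {m. N < lev m}" by simp
      qed
    qed (use G in simp)
    also have "\<dots> \<le> (\<epsilon> * 1)\<^sup>2"
      using f assms by (intro power_mono mult_left_mono) (auto simp: norm_eq wnorm_wn)
    finally show "L2_set (\<lambda>n. cmod (crd (Lb f - trunc F (Lb f)) n)) G \<le> \<epsilon>"
      unfolding L2_set_def using assms by (intro real_le_lsqrt) (auto simp: sum_nonneg)
  qed
  then show ?thesis by blast
qed

lemma Lb_bounded: "\<exists>B\<ge>0. \<forall>f\<in>H. hnorm cip (Lb f) \<le> B * hnorm cip f"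
proof -
  have "(0 :: real) < 1" by simp
  from Lb_iterates[OF this] obtain B where B: "B \<ge> 0" "\<And>n f. f \<in> H \<Longrightarrow> hnorm cip ((Lb ^^ n) f) \<le> B * 1 ^ n * hnorm cip f"
    by blast
  show ?thesis using B(1) B(2)[of _ 1] by (intro exI[of _ B]) simp
qed

lemma compact_Lb: "compact_op H cip Lb"
proof -
  obtain B where B: "B \<ge> 0" "\<And>f. f \<in> H \<Longrightarrow> hnorm cip (Lb f) \<le> B * hnorm cip f" using Lb_bounded by blast
  show ?thesis
  proof (rule compact_opI[OF linear_Lb B(2,1)])
    fix \<epsilon> :: real assume "\<epsilon> > 0"
    then obtain N where "\<And>F f. finite F \<Longrightarrow> sect N \<subseteq> F \<Longrightarrow> f \<in> H \<Longrightarrow> hnorm cip f \<le> 1 \<Longrightarrow> hnorm cip (Lb f - trunc F (Lb f)) \<le> \<epsilon>"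
      using Lb_tail by blast
    then show "\<exists>F. finite F \<and> (\<forall>f\<in>H. hnorm cip f \<le> 1 \<longrightarrow> hnorm cip (Lb f - trunc F (Lb f)) \<le> \<epsilon>)"
      using finite_lev[of N] by blast
  qed assumption
qed

lemma Lb_radius: "op_spectral_radius H cip Lb = 0"
proof (rule op_spectral_radius_eq_0[OF linear_Lb Lb_iterates mode_in[of 0]])
  show "fourier_mode 0 \<noteq> 0"
  proof
    assume "fourier_mode 0 = 0"
    then have "crd (fourier_mode 0) 0 = 0" by (simp only: crd_zero)
    then show False using a_pos[OF adm, of "lev 0"] by (simp add: crd_def fc_mode)
  qed
  \<comment> \<open>The constant mode has the lowest level and so is mapped to 0 by the part that
    strictly decreases levels.\<close>
  have "lower (\<lambda>n. if n = 0 then 1 else 0) m = (\<Sum>\<^sub>\<infinity>n\<in>{n. lev m < lev n}. 0)" for m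
    unfolding lower_def by (intro infsum_cong) (auto simp: lev_zero)
  then have "lower (fc (fourier_mode 0)) = (\<lambda>m. 0)" by (simp add: fc_mode[abs_def] fun_eq_iff)
  then show "Lb (fourier_mode 0) = 0" by (simp add: Lb_def synth_def[abs_def] zero_fun_def)
qed

text \<open>The nuclearity criterion wants a single bound \<gamma> that decays faster than every
  power, while \<open>upper_rapid\<close> gives one bound for each power; the infimum combines
  them.\<close>

definition rapid_bound :: "(nat \<Rightarrow> real) \<Rightarrow> int \<Rightarrow> real" where
  "rapid_bound C m = (INF K. C K / brk m ^ K)"

lemma Lc_rapid:
  "\<exists>\<gamma>. (\<forall>f m. f \<in> H \<longrightarrow> cmod (crd (Lc f) m) \<le> \<gamma> m * hnorm cip f) \<and> (\<forall>k::nat. \<exists>C. \<forall>m. \<gamma> m \<le> C / brk m ^ k)"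
proof -
  have "\<forall>K. \<exists>C\<ge>0. \<forall>m x. ws a x \<longrightarrow> a (lev m) * cmod (upper x m) \<le> C / brk m ^ K * wn a x"
    using upper_rapid[OF adm] by blast
  then obtain C where C: "\<And>K. C K \<ge> 0" "\<And>K m x. ws a x \<Longrightarrow> a (lev m) * cmod (upper x m) \<le> C K / brk m ^ K * wn a x"
    by metis
  have bdd: "bdd_below (range (\<lambda>K. C K / brk m ^ K))" for m
    using C(1) by (intro bdd_belowI2[of _ 0]) simp
  have le: "cmod (crd (Lc f) m) \<le> C K / brk m ^ K * hnorm cip f" if f: "f \<in> H" for f m K
    using C(2)[of "fc f" m K] H_synth(1)[OF f] a_pos[OF adm, of "lev m"] f
    by (simp add: crd_def[of "Lc f"] fc_Lc norm_mult norm_eq wnorm_wn wsum_ws)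
  have "cmod (crd (Lc f) m) \<le> rapid_bound C m * hnorm cip f" if f: "f \<in> H" for f m
  proof (cases "hnorm cip f = 0")
    case True
    then show ?thesis using le[OF f, of m 0] by simp
  next
    case False
    then have pos: "hnorm cip f > 0" using hnorm_nonneg[OF f] by simp
    have "cmod (crd (Lc f) m) / hnorm cip f \<le> rapid_bound C m"
      unfolding rapid_bound_def by (rule cINF_greatest) (use le[OF f, of m] pos in \<open>simp_all add: pos_divide_le_eq\<close>)
    then show ?thesis using pos by (simp add: pos_divide_le_eq)
  qed
  moreover have "rapid_bound C m \<le> C k / brk m ^ k" for k m
    unfolding rapid_bound_def by (rule cINF_lower[OF bdd]) simp
  ultimately show ?thesis by blast
qed

lemma Lc_nuclear: "nuclear_order_0 H cip Lc" and Lc_bounded: "\<exists>B\<ge>0. \<forall>f\<in>H. hnorm cip (Lc f) \<le> B * hnorm cip f"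
  and Lc_tail: "\<epsilon> > 0 \<Longrightarrow> \<exists>N. \<forall>F f. finite F \<longrightarrow> {- int N..int N} \<subseteq> F \<longrightarrow> f \<in> H \<longrightarrow> hnorm cip f \<le> 1 \<longrightarrow>
    hnorm cip (Lc f - trunc F (Lc f)) \<le> \<epsilon>"
proof -
  obtain \<gamma> where \<gamma>: "\<And>f m. f \<in> H \<Longrightarrow> cmod (crd (Lc f) m) \<le> \<gamma> m * hnorm cip f"
    "\<And>k::nat. \<exists>C. \<forall>m. \<gamma> m \<le> C / brk m ^ k" using Lc_rapid by blast
  show "nuclear_order_0 H cip Lc" by (rule rapid_nuclear[OF linear_Lc \<gamma>])
  show "\<exists>B\<ge>0. \<forall>f\<in>H. hnorm cip (Lc f) \<le> B * hnorm cip f" by (rule rapid_bounded[OF linear_Lc \<gamma>])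
  assume \<epsilon>: "\<epsilon> > 0"
  obtain C where C: "C > 0" "\<And>N f g. f \<in> H \<Longrightarrow> g \<in> H \<Longrightarrow> (\<forall>m. \<bar>m\<bar> \<le> int N \<longrightarrow> crd g m = 0) \<Longrightarrow>
      (\<forall>m. cmod (crd g m) \<le> \<gamma> m * hnorm cip f) \<Longrightarrow> hnorm cip g \<le> C / (1 + real N) ^ 1 * hnorm cip f"
    using rapid_tail[OF linear_Lc \<gamma>, of 1] by blast
  obtain N :: nat where N: "C / \<epsilon> \<le> real N" using real_arch_simple by blast
  have CN: "C / (1 + real N) \<le> \<epsilon>" using N \<epsilon> C(1) by (simp add: field_simps add_increasing2)
  show "\<exists>N. \<forall>F f. finite F \<longrightarrow> {- int N..int N} \<subseteq> F \<longrightarrow> f \<in> H \<longrightarrow> hnorm cip f \<le> 1 \<longrightarrow> hnorm cip (Lc f - trunc F (Lc f)) \<le> \<epsilon>"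
  proof (intro exI[of _ N] allI impI)
    fix F f assume F: "finite F" "{- int N..int N} \<subseteq> F" and f: "f \<in> H" "hnorm cip f \<le> 1"
    note L = Lc_in[OF f(1)]
    have c: "crd (Lc f - trunc F (Lc f)) m = (if m \<in> F then 0 else crd (Lc f) m)" for m
      by (simp add: crd_diff[OF L trunc(1)] trunc(2)[OF F(1)])
    have "hnorm cip (Lc f - trunc F (Lc f)) \<le> C / (1 + real N) ^ 1 * hnorm cip f"
    proof (rule C(2)[OF f(1) diffH[OF L trunc(1)]])
      show "\<forall>m. \<bar>m\<bar> \<le> int N \<longrightarrow> crd (Lc f - trunc F (Lc f)) m = 0" unfolding c using F(2) by (auto simp: abs_le_iff subset_iff)
      show "\<forall>m. cmod (crd (Lc f - trunc F (Lc f)) m) \<le> \<gamma> m * hnorm cip f"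
        unfolding c using \<gamma>(1)[OF f(1)] order_trans[OF norm_ge_zero \<gamma>(1)[OF f(1)]] by simp
    qed
    also have "\<dots> \<le> C / (1 + real N) ^ 1 * 1" using f C(1) by (intro mult_left_mono) auto
    finally show "hnorm cip (Lc f - trunc F (Lc f)) \<le> \<epsilon>" using CN by simp
  qed
qed

text \<open>On \<open>H\<close> the operator acts through the Fourier matrix, and each row splits
  into the columns of higher level and the others. The exchange of the sums over rows and columns is
  the only analytic point.\<close>

lemma transfer_split:
  assumes f: "\<phi> \<in> H"
  shows "transfer T \<phi> = Lb \<phi> + Lc \<phi>"
proof
  fix p
  define x where "x = fc \<phi>"
  have x: "wsum x" "synth x = \<phi>" using H_synth[OF f] by (simp_all add: x_def)
  have "((\<lambda>n. x n * transfer T (fourier_mode n) p) has_sum transfer T \<phi> p) UNIV"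
  proof (cases "finite {y. T y = p}")
    case True
    have "((\<lambda>n. \<Sum>y | T y = p. complex_of_real (1 / \<bar>circle_deriv T y\<bar>) * (x n * fourier_mode n y)) has_sum
        (\<Sum>y | T y = p. complex_of_real (1 / \<bar>circle_deriv T y\<bar>) * synth x y)) UNIV"
      by (intro has_sum_sum True has_sum_cmult_right synth_has_sum x(1))
    then show ?thesis by (simp add: transfer_def x(2) sum_distrib_left mult_ac)
  next
    case False
    \<comment> \<open>A sum over an infinite set is 0 by convention, so both sides vanish.\<close>
    then show ?thesis by (simp add: transfer_def)
  qed
  then have "transfer T \<phi> p = (\<Sum>\<^sub>\<infinity>n. x n * transfer T (fourier_mode n) p)" by (simp only: infsumI)
  also have "\<dots> = (\<Sum>\<^sub>\<infinity>n. \<Sum>\<^sub>\<infinity>m. x n * (entry 1 m n * fourier_mode m p))"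
  proof (rule infsum_cong)
    fix n
    show "x n * transfer T (fourier_mode n) p = (\<Sum>\<^sub>\<infinity>m. x n * (entry 1 m n * fourier_mode m p))"
      using infsumI[OF has_sum_cmult_right[OF transfer_mode[of n p], of "x n"]] by (rule sym)
  qed
  also have "\<dots> = (\<Sum>\<^sub>\<infinity>m. \<Sum>\<^sub>\<infinity>n. x n * (entry 1 m n * fourier_mode m p))"
  \<comment> \<open>The square growth in n allowed by \<open>column_bound\<close> is outweighed by
    the decay of the coefficients of a function in \<open>H\<close>, leaving inverse squares in both
    indices.\<close>
  proof (rule infsum_swap_banach, rule abs_summable_summable)
    obtain D where D: "D \<ge> 0" "\<And>m n. cmod (entry 1 m n) \<le> D * (brk n)\<^sup>2 * (1 / (brk m)\<^sup>2)"
      using column_bound by blast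
    obtain C where C0: "C \<ge> 0" and C: "\<And>n. (brk n)\<^sup>2 * cmod (x n) \<le> C * wnorm x * (1 / (brk n)\<^sup>2)"
      using coef_decay[of 2] x(1) by blast
    let ?s = "\<lambda>n::int. 1 / (brk n)\<^sup>2"
    have nm: "cmod (fourier_mode m p) = 1" for m
    proof -
      obtain t where "p = to_circle t" using to_circle_rep by metis
      then show ?thesis by (simp add: fourier_mode_to_circle)
    qed
    have nn: "norm ((C * wnorm x * ?s n) * (D * ?s m)) = (C * wnorm x * ?s n) * (D * ?s m)" for n m
      using C0 D(1) wnorm_nonneg[of x] by simp
    have "(\<lambda>nm. case nm of (n, m) \<Rightarrow> (C * wnorm x * ?s n) * (D * ?s m)) abs_summable_on (SIGMA n:UNIV. UNIV)"
      unfolding Infinite_Sum.abs_summable_on_Sigma_iff prod.case nn infsum_cmult_right'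
    proof (intro conjI ballI)
      show "(\<lambda>m. (C * wnorm x * ?s n) * (D * ?s m)) summable_on UNIV" for n
        by (rule summable_on_cmult_right[OF inverse_square_summable])
      show "(\<lambda>n. norm ((C * wnorm x * ?s n) * (D * infsum ?s UNIV))) summable_on UNIV"
      proof -
        have "infsum ?s UNIV \<ge> 0" by (rule infsum_nonneg) simp
        then have "norm ((C * wnorm x * ?s n) * (D * infsum ?s UNIV)) = (C * wnorm x * ?s n) * (D * infsum ?s UNIV)" for n
          using C0 D(1) wnorm_nonneg[of x] by simp
        then show ?thesis by (simp only: summable_on_cmult_left[OF inverse_square_summable])
      qed
    qed
    then have "(\<lambda>(n, m). (C * wnorm x * ?s n) * (D * ?s m)) summable_on UNIV \<times> UNIV"
      by (rule abs_summable_summable)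
    then show "(\<lambda>(n, m). x n * (entry 1 m n * fourier_mode m p)) abs_summable_on UNIV \<times> UNIV"
    proof (rule Infinite_Sum.abs_summable_on_comparison_test')
      fix nm :: "int \<times> int"
      obtain n m where nm': "nm = (n, m)" by (cases nm)
      have "cmod (x n) * cmod (entry 1 m n) \<le> cmod (x n) * (D * (brk n)\<^sup>2 * ?s m)"
        by (intro mult_left_mono D) simp
      also have "\<dots> = ((brk n)\<^sup>2 * cmod (x n)) * (D * ?s m)" by (simp only: mult_ac)
      also have "\<dots> \<le> (C * wnorm x * ?s n) * (D * ?s m)" using D(1) by (intro mult_right_mono C) simp
      finally show "norm (case nm of (n, m) \<Rightarrow> x n * (entry 1 m n * fourier_mode m p)) \<le>
          (case nm of (n, m) \<Rightarrow> (C * wnorm x * ?s n) * (D * ?s m))"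
        by (simp only: nm' prod.case norm_mult nm mult_1_right)
    qed
  qed
  also have "\<dots> = (\<Sum>\<^sub>\<infinity>m. (lower x m + upper x m) * fourier_mode m p)"
  proof (rule infsum_cong)
    fix m
    obtain B where B: "\<And>n. cmod (x n) \<le> B" using wsum_bounded[OF x(1)] by blast
    have "(\<Sum>\<^sub>\<infinity>n. entry 1 m n * x n) = (\<Sum>\<^sub>\<infinity>n\<in>{n. lev m < lev n} \<union> {n. lev n \<le> lev m}. entry 1 m n * x n)"
      by (rule infsum_cong_neutral) auto
    also have "\<dots> = lower x m + (\<Sum>\<^sub>\<infinity>n\<in>{n. lev n \<le> lev m}. entry 1 m n * x n)"
      unfolding lower_def by (intro infsum_Un_disjoint abs_summable_summable[OF row_summable[OF B]]) auto
    also have "(\<Sum>\<^sub>\<infinity>n\<in>{n. lev n \<le> lev m}. entry 1 m n * x n) = upper x m"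
      unfolding upper_def by (rule infsum_finite) (rule finite_lev)
    finally have "(\<Sum>\<^sub>\<infinity>n. entry 1 m n * x n) = lower x m + upper x m" .
    moreover have "(\<Sum>\<^sub>\<infinity>n. x n * (entry 1 m n * fourier_mode m p)) = (\<Sum>\<^sub>\<infinity>n. entry 1 m n * x n) * fourier_mode m p"
      unfolding infsum_cmult_left'[symmetric] by (simp only: mult_ac)
    ultimately show "(\<Sum>\<^sub>\<infinity>n. x n * (entry 1 m n * fourier_mode m p)) = (lower x m + upper x m) * fourier_mode m p" by (simp only:)
  qed
  also have "\<dots> = synth (\<lambda>m. lower x m + upper x m) p" by (simp only: synth_def)
  also have "\<dots> = (Lb \<phi> + Lc \<phi>) p"
  proof -
    have "wsum (lower x)" using lower_ws x(1) by blast
    from synth_add[OF this upper_ws[OF x(1)]] show ?thesis by (simp add: Lb_def Lc_def x_def)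
  qed
  finally show "transfer T \<phi> p = (Lb \<phi> + Lc \<phi>) p" .
qed

lemma trunc_add: "f \<in> H \<Longrightarrow> g \<in> H \<Longrightarrow> trunc X (f + g) = trunc X f + trunc X g"
  unfolding trunc_def by (simp only: crd_add cfun.scale_left_distrib sum.distrib)

lemma compact_transfer: "compact_op H cip (transfer T)"
proof -
  have lin: "linear_op H (transfer T)"
    unfolding linear_op_def
  proof (intro conjI ballI allI)
    show "transfer T ` H \<subseteq> H"
    proof (rule image_subsetI)
      fix f assume f: "f \<in> H"
      show "transfer T f \<in> H" unfolding transfer_split[OF f] by (rule addH[OF Lb_in[OF f] Lc_in[OF f]])
    qed
    fix f assume f: "f \<in> H"
    show "transfer T (f + g) = transfer T f + transfer T g" if g: "g \<in> H" for g
    proof -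
      have "Lb (f + g) = Lb f + Lb g" "Lc (f + g) = Lc f + Lc g"
        using linear_Lb linear_Lc f g by (auto simp: linear_op_def)
      then show ?thesis by (simp only: transfer_split[OF f] transfer_split[OF g] transfer_split[OF addH[OF f g]] add_ac)
    qed
    show "transfer T (cscale k f) = cscale k (transfer T f)" for k
    proof -
      have "Lb (cscale k f) = cscale k (Lb f)" "Lc (cscale k f) = cscale k (Lc f)"
        using linear_Lb linear_Lc f by (auto simp: linear_op_def)
      then show ?thesis by (simp only: transfer_split[OF f] transfer_split[OF scaleH[OF f]] cfun.scale_right_distrib)
    qed
  qed
  obtain B where B: "B \<ge> 0" "\<And>f. f \<in> H \<Longrightarrow> hnorm cip (Lb f) \<le> B * hnorm cip f" using Lb_bounded by blast
  obtain B' where B': "B' \<ge> 0" "\<And>f. f \<in> H \<Longrightarrow> hnorm cip (Lc f) \<le> B' * hnorm cip f" using Lc_bounded by blast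
  show ?thesis
  proof (rule compact_opI[OF lin])
    show "0 \<le> B + B'" using B(1) B'(1) by simp
    show "hnorm cip (transfer T f) \<le> (B + B') * hnorm cip f" if f: "f \<in> H" for f
      using order_trans[OF hnorm_triangle[OF Lb_in[OF f] Lc_in[OF f]] add_mono[OF B(2)[OF f] B'(2)[OF f]]]
      by (simp add: transfer_split[OF f] distrib_right)
    fix \<epsilon> :: real assume "\<epsilon> > 0"
    then have e: "\<epsilon> / 2 > 0" by simp
    obtain N where N: "\<And>F f. finite F \<Longrightarrow> sect N \<subseteq> F \<Longrightarrow> f \<in> H \<Longrightarrow> hnorm cip f \<le> 1 \<Longrightarrow> hnorm cip (Lb f - trunc F (Lb f)) \<le> \<epsilon> / 2"
      using Lb_tail[OF e] by blast
    obtain N' where N': "\<And>F f. finite F \<Longrightarrow> {- int N'..int N'} \<subseteq> F \<Longrightarrow> f \<in> H \<Longrightarrow> hnorm cip f \<le> 1 \<Longrightarrow> hnorm cip (Lc f - trunc F (Lc f)) \<le> \<epsilon> / 2"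
      using Lc_tail[OF e] by blast
    define F where "F = sect N \<union> {- int N'..int N'}"
    have F: "finite F" "sect N \<subseteq> F" "{- int N'..int N'} \<subseteq> F" using finite_lev by (auto simp: F_def)
    have "hnorm cip (transfer T f - trunc F (transfer T f)) \<le> \<epsilon>" if f: "f \<in> H" "hnorm cip f \<le> 1" for f
    proof -
      note Lbf = Lb_in[OF f(1)] and Lcf = Lc_in[OF f(1)]
      have "transfer T f - trunc F (transfer T f) = (Lb f - trunc F (Lb f)) + (Lc f - trunc F (Lc f))"
        by (simp add: transfer_split[OF f(1)] trunc_add[OF Lbf Lcf])
      then show ?thesis
        using hnorm_triangle[OF diffH[OF Lbf trunc(1)[of F "Lb f"]] diffH[OF Lcf trunc(1)[of F "Lc f"]]] N[OF F(1,2) f] N'[OF F(1,3) f] by fastforce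
    qed
    then show "\<exists>F. finite F \<and> (\<forall>f\<in>H. hnorm cip f \<le> 1 \<longrightarrow> hnorm cip (transfer T f - trunc F (transfer T f)) \<le> \<epsilon>)"
      using F(1) by blast
  qed
qed

text \<open>The operator is a sum of rank one operators: the functional is a coordinate of
  \<open>Lc\<close>, represented by \<open>v k\<close>, and the vector is -z times the resolvent of
  \<open>Lb\<close> applied to \<open>bas k\<close>. Then \<open>cip (u k) (v l)\<close> is the
  matrix \<open>fmat z\<close> conjugated by the weights, which has the same minors.\<close>

theorem fredholm_fdet:
  "fredholm_det H cip (\<lambda>\<phi>. - cscale z (inv_into H (\<lambda>\<psi>. \<psi> - cscale z (Lb \<psi>)) (Lc \<phi>))) = fdet z"
proof -
  define \<epsilon> where "\<epsilon> = 1 / (2 * (cmod z + 1))"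
  have p: "cmod z + 1 > 0" by (simp add: add_nonneg_pos)
  have \<epsilon>: "\<epsilon> > 0" using p by (simp add: \<epsilon>_def)
  have q: "cmod z * \<epsilon> < 1" using p by (simp add: \<epsilon>_def field_simps add_nonneg_pos)
  obtain B where B: "B \<ge> 0" "\<And>n f. f \<in> H \<Longrightarrow> hnorm cip ((Lb ^^ n) f) \<le> B * \<epsilon> ^ n * hnorm cip f"
    using Lb_iterates[OF \<epsilon>] by blast
  define R where "R = inv_into H (\<lambda>\<psi>. \<psi> - cscale z (Lb \<psi>))"
  note inv = neumann_inv[OF linear_Lb B(2,1) less_imp_le[OF \<epsilon>] q, folded R_def]
  define V where "V = (\<Sum>n. B * (cmod z * \<epsilon>) ^ n)"
  have RH: "R g \<in> H" if "g \<in> H" for g by (rule inv(1)[OF _ that])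
  have Rinv: "R (f - cscale z (Lb f)) = f" if "f \<in> H" for f by (rule inv(3)[OF _ that])
  have Rb: "bounded_op H cip R" by (rule inv(4))
  have Rn: "hnorm cip (R g) \<le> V * hnorm cip g" if "g \<in> H" for g unfolding V_def by (rule inv(5)[OF _ that])
  have V: "V \<ge> 0"
    using order_trans[OF hnorm_nonneg[OF RH[OF bas(1)[of 0]]] Rn[OF bas(1)[of 0]]] by (simp add: hnorm_bas)
  obtain C where C: "C \<ge> 0" "\<And>m x. ws a x \<Longrightarrow> a (lev m) * cmod (upper x m) \<le> C / brk m ^ 3 * wn a x"
    using upper_rapid[OF adm, of 3] by blast
  define u where "u k = - cscale z (R (bas k))" for k
  have uH: "u k \<in> H" for k unfolding u_def by (intro uminusH scaleH RH bas)
  \<comment> \<open>The bound for the norm of h inherits the decay of \<open>upper\<close>: one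
    power for the factor \<open>brk\<close> in \<open>fredholm_det_nuclear\<close> and two for
    summability.\<close>
  have "\<exists>h\<in>H. hnorm cip h \<le> C / brk k ^ 3 \<and> (\<forall>f\<in>H. crd (Lc f) k = cip f h)" for k
  proof (rule riesz)
    show "crd (Lc (f + g)) k = crd (Lc f) k + crd (Lc g) k" if "f \<in> H" "g \<in> H" for f g
      using that linear_Lc by (simp add: linear_op_def crd_add Lc_in)
    show "crd (Lc (cscale b f)) k = b * crd (Lc f) k" if "f \<in> H" for b f
      using that linear_Lc by (simp add: linear_op_def crd_scale Lc_in)
    show "cmod (crd (Lc f) k) \<le> C / brk k ^ 3 * hnorm cip f" if f: "f \<in> H" for f
      using C(2)[of "fc f" k] H_synth(1)[OF f] a_pos[OF adm, of "lev k"] f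
      by (simp add: crd_def[of "Lc f"] fc_Lc norm_mult norm_eq wnorm_wn wsum_ws)
    show "0 \<le> C / brk k ^ 3" using C(1) by simp
  qed
  then obtain v where v: "\<And>k. v k \<in> H" "\<And>k. hnorm cip (v k) \<le> C / brk k ^ 3"
    "\<And>k f. f \<in> H \<Longrightarrow> crd (Lc f) k = cip f (v k)" by metis
  have "fredholm_det H cip (\<lambda>\<phi>. - cscale z (R (Lc \<phi>))) = (\<Sum>\<^sub>\<infinity>K\<in>fin_subsets UNIV. pminor (\<lambda>k l. cip (u k) (v l)) K)"
  proof (rule fredholm_det_nuclear[OF orthonormal_bas uH v(1)])
    fix f g assume f: "f \<in> H" and g: "g \<in> H"
    \<comment> \<open>Moving the resolvent to the other side of the inner product leaves the
      coordinate expansion of \<open>cip (Lc f) h\<close>, so no series has to be passed through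
      \<open>R\<close>.\<close>
    obtain h where h: "h \<in> H" "\<And>f. f \<in> H \<Longrightarrow> cip (R f) g = cip f h" using adjoint_ex[OF Rb g] by blast
    have m: "cip (- cscale z (R y)) g = - z * cip y h" if y: "y \<in> H" for y
    proof -
      have "- cscale z (R y) = cscale (- z) (R y)" by (simp add: cscale_def fun_eq_iff)
      then show ?thesis using ip_scale[OF RH[OF y] g, of "- z"] h(2)[OF y] by simp
    qed
    have "((\<lambda>k. - z * (crd (Lc f) k * cnj (crd h k))) has_sum - z * cip (Lc f) h) UNIV"
      unfolding cip_def by (intro has_sum_cmult_right has_sum_infsum crd_prod Lc_in f h(1))
    moreover have "- z * (crd (Lc f) k * cnj (crd h k)) = cip f (v k) * cip (u k) g" for k
      unfolding u_def m[OF bas(1)] cip_bas_left[OF h(1)] v(3)[OF f] by (simp only: mult_ac)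
    ultimately show "((\<lambda>k. cip f (v k) * cip (u k) g) has_sum cip (- cscale z (R (Lc f))) g) UNIV"
      by (simp only: m[OF Lc_in[OF f]])
  next
    have un: "hnorm cip (u k) \<le> cmod z * V" for k
    proof -
      have e: "u k = cscale (- z) (R (bas k))" by (simp add: u_def cscale_def fun_eq_iff)
      have "hnorm cip (u k) = cmod z * hnorm cip (R (bas k))"
        by (simp only: e hnorm_scale[OF RH[OF bas(1)]] norm_minus_cancel)
      also have "\<dots> \<le> cmod z * V" using Rn[OF bas(1)[of k]] by (intro mult_left_mono) (simp_all add: hnorm_bas)
      finally show ?thesis .
    qed
    have "norm (brk k * (hnorm cip (u k) * hnorm cip (v k))) \<le> (cmod z * V * C) * (1 / (brk k)\<^sup>2)" for k
    proof -
      define t where "t = 1 + \<bar>real_of_int k\<bar>"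
      have t: "t > 0" by (simp add: t_def)
      have "hnorm cip (u k) * hnorm cip (v k) \<le> (cmod z * V) * (C / t ^ 3)"
        using un v(2) hnorm_nonneg[OF uH] hnorm_nonneg[OF v(1)] V unfolding t_def by (intro mult_mono) auto
      then have "t * (hnorm cip (u k) * hnorm cip (v k)) \<le> t * ((cmod z * V) * (C / t ^ 3))"
        using t by (intro mult_left_mono) auto
      also have "\<dots> = (cmod z * V * C) * (1 / t\<^sup>2)" using t by (simp add: power3_eq_cube power2_eq_square)
      finally show ?thesis
        using t hnorm_nonneg[OF uH[of k]] hnorm_nonneg[OF v(1)[of k]] unfolding t_def[symmetric] by simp
    qed
    from Infinite_Sum.abs_summable_on_comparison_test'[OF inverse_square_summable this]
    show "(\<lambda>k. brk k * (hnorm cip (u k) * hnorm cip (v k))) summable_on UNIV"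
      by (rule abs_summable_summable)
  qed
  also have "\<dots> = (\<Sum>\<^sub>\<infinity>K\<in>fin_subsets UNIV. pminor (fmat z) K)"
  proof (rule infsum_cong)
    fix K :: "int set"
    have "cip (u k) (v l) = fmat z k l * of_real (a (lev l)) / of_real (a (lev k))" for k l
    proof -
      let ?b = "inverse (of_real (a (lev k))) :: complex"
      \<comment> \<open>The finite Neumann sum \<open>resolv\<close>, divided by the weight of index
        k because \<open>bas k\<close> is the mode k divided by this weight. It solves the resolvent
        equation exactly, and injectivity identifies it with \<open>R (bas k)\<close>.\<close>
      define y where "y n = ?b * resolv z k n" for n
      have y: "wsum y"
      proof -
        have "y n = 0" if "n \<notin> sect (lev k)" for n using that resolv_support[of z k n] by (auto simp: y_def)
        then have "(\<lambda>n. (a (lev n) * cmod (y n))\<^sup>2) summable_on UNIV \<longleftrightarrow> (\<lambda>n. (a (lev n) * cmod (y n))\<^sup>2) summable_on sect (lev k)"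
          by (intro summable_on_cong_neutral) auto
        then show ?thesis by (simp add: wsum_def finite_lev)
      qed
      have s: "synth y \<in> H" "fc (synth y) = y" by (simp_all add: synth_in fc_synth y)
      have "R (bas k) = synth y"
      proof -
        have d: "synth y - cscale z (Lb (synth y)) \<in> H" by (intro diffH s scaleH Lb_in)
        have "(synth y - cscale z (Lb (synth y))) - bas k = 0"
        proof (rule crd_inj[OF diffH[OF d bas(1)]])
          fix n
          have "lower y n = ?b * lower (resolv z k) n" unfolding y_def[abs_def] by (rule lower_scale)
          then have "y n - z * lower y n = ?b * (resolv z k n - z * lower (resolv z k) n)" by (simp add: y_def algebra_simps)
          also have "\<dots> = ?b * (if n = k then 1 else 0)" by (simp only: resolv_eq)
          finally have e: "y n - z * lower y n = ?b * (if n = k then 1 else 0)" .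
          have "crd (synth y - cscale z (Lb (synth y))) n = of_real (a (lev n)) * (y n - z * lower y n)"
            by (simp add: crd_diff[OF s(1) scaleH[OF Lb_in[OF s(1)]]] crd_scale[OF Lb_in[OF s(1)]]
                crd_def[of "synth y"] crd_def[of "Lb (synth y)"] fc_Lb[OF s(1)] s(2) algebra_simps)
          also have "\<dots> = (if n = k then 1 else 0)" unfolding e using a_pos[OF adm, of "lev k"] by simp
          finally show "crd (synth y - cscale z (Lb (synth y)) - bas k) n = 0"
            by (simp add: crd_diff[OF d bas(1)] bas)
        qed
        then have "synth y - cscale z (Lb (synth y)) = bas k" by simp
        then show ?thesis using Rinv[OF s(1)] by simp
      qed
      then have "u k = cscale (- z) (synth y)" by (simp add: u_def cscale_def fun_eq_iff)
      then have fu: "fc (u k) = (\<lambda>n. (- z * ?b) * resolv z k n)"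
        using H_scale[OF s(1), of "- z"] by (simp add: s(2) y_def mult.assoc)
      have "cip (u k) (v l) = crd (Lc (u k)) l" by (rule v(3)[OF uH, symmetric])
      also have "\<dots> = of_real (a (lev l)) * upper (fc (u k)) l" by (simp add: crd_def fc_Lc[OF uH])
      also have "\<dots> = of_real (a (lev l)) * ((- z * ?b) * upper (resolv z k) l)" unfolding fu upper_scale ..
      also have "\<dots> = fmat z k l * of_real (a (lev l)) / of_real (a (lev k))" unfolding fmat_def by (simp only: divide_inverse mult_ac)
      finally show ?thesis .
    qed
    then have "pminor (\<lambda>k l. cip (u k) (v l)) K = pminor (\<lambda>k l. fmat z k l * of_real (a (lev l)) / of_real (a (lev k))) K"
      by (simp only:)
    also have "\<dots> = pminor (fmat z) K"
    proof (rule pminor_conj)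
      fix n
      show "complex_of_real (a (lev n)) \<noteq> 0" using a_pos[OF adm, of "lev n"] by simp
    qed
    finally show "pminor (\<lambda>k l. cip (u k) (v l)) K = pminor (fmat z) K" .
  qed
  finally show ?thesis unfolding R_def fdet_def .
qed

end

theorem theorem2:
  fixes T :: "circle \<Rightarrow> circle"
  assumes "smooth_circle_map T" and "expanding T"
  shows "\<exists>(H :: (circle \<Rightarrow> complex) set) ip Lc Lb.
    hilbert_function_space H ip \<and>
    H \<subseteq> Cinf \<and> continuous_map (htop H ip) Cinf_topology (\<lambda>\<phi>. \<phi>) \<and>
    trig_polys \<subseteq> H \<and> htop H ip closure_of trig_polys = H \<and>
    compact_op H ip (transfer T) \<and> compact_op H ip Lc \<and> compact_op H ip Lb \<and>
    nuclear_order_0 H ip Lc \<and>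
    op_spectral_radius H ip Lb = 0 \<and>
    (\<forall>\<phi>\<in>H. transfer T \<phi> = Lb \<phi> + Lc \<phi>) \<and>
    (\<exists>d. d holomorphic_on UNIV \<and>
         (\<exists>r>0. \<forall>z. cmod z < r \<longrightarrow> summable (dyn_det_term T z) \<and> d z = dyn_det T z) \<and>
         (\<forall>z. d z = fredholm_det H ip
                (\<lambda>\<phi>. - cscale z (inv_into H (\<lambda>\<psi>. \<psi> - cscale z (Lb \<psi>)) (Lc \<phi>)))))"
proof -
  obtain F q c where "circle_lift T F q c" using circle_lift_ex[OF assms] by blast
  then interpret circle_lift T F q c .
  obtain a where "admissible a" using admissible_ex by blast
  then interpret circle_space T F q c a by unfold_locales
  \<comment> \<open>The extension is \<open>fdet\<close>: it is entire as a locally uniform limit of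
    polynomials, agrees with the exponential of the flat trace series near 0, and equals the
    Fredholm determinant for every z.\<close>
  have "\<exists>d. d holomorphic_on UNIV \<and>
         (\<exists>r>0. \<forall>z. cmod z < r \<longrightarrow> summable (dyn_det_term T z) \<and> d z = dyn_det T z) \<and>
         (\<forall>z. d z = fredholm_det H cip
                (\<lambda>\<phi>. - cscale z (inv_into H (\<lambda>\<psi>. \<psi> - cscale z (Lb \<psi>)) (Lc \<phi>))))"
    by (intro exI[of _ fdet] conjI fdet_holomorphic fdet_dyn_det allI fredholm_fdet[symmetric])
  moreover have "compact_op H cip Lc" using Lc_nuclear by (simp add: nuclear_order_0_def)
  moreover have "hilbert_function_space H cip" by unfold_locales
  moreover have "\<forall>\<phi>\<in>H. transfer T \<phi> = Lb \<phi> + Lc \<phi>" using transfer_split by blast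
  ultimately show ?thesis
    using H_Cinf identity_continuous trig_polys_dense compact_transfer compact_Lb Lc_nuclear Lb_radius
    by (intro exI[of _ H] exI[of _ cip] exI[of _ Lc] exI[of _ Lb] conjI)
qed

end
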